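(* Let $n\ge1$. The Painlev\'e system $P_{(n+1,n+1)}$ is invariant under the actions of the birational canonical transformations $r_0,\ldots,r_{2n+1}$ and $\pi$ defined in the context. Furthermore, the group of symmetries $\langle r_0,\ldots,r_{2n+1},\pi\rangle$ is isomorphic to the extended affine Weyl group $\widetilde W(A^{(1)}_{2n+1})$.
   Context: The extended affine Weyl group $\widetilde W(A^{(1)}_{2n+1})$ is the group generated by $r_0,\ldots,r_{2n+1},\pi$ with the fundamental relations $r_i^2=1$, $(r_ir_j)^{2-a_{i,j}}=1$ $(i\ne j)$, $\pi^{2n+2}=1$, $\pi r_i=r_{i+1}\pi$ $(i=0,\ldots,2n)$, $\pi r_{2n+1}=r_0\pi$, where $a_{i,i}=2$, $a_{i,i+1}=a_{i+1,i}=-1$ $(i=0,\ldots,2n)$, $a_{2n+1,0}=a_{0,2n+1}=-1$, and $a_{i,j}=0$ otherwise. The Painlev\'e system $P_{(n+1,n+1)}$ with parameters $\alpha_0,\ldots,\alpha_{2n+1},\eta$, $\sum_{i=0}^{2n+1}\alpha_i=1$, is the Hamiltonian system $\frac{dq_i}{dt}=\frac{\partial H}{\partial p_i}$, $\frac{dp_i}{dt}=-\frac{\partial H}{\partial q_i}$ $(i=1,\ldots,n)$ with $$t(t-1)H=\sum_{i=1}^nH_{\rm VI}\Big[\sum_{j=0}^n\alpha_{2j+1}-\alpha_{2i-1}-\eta,\ \sum_{j=0}^{i-1}\alpha_{2j},\ \sum_{j=i}^n\alpha_{2j},\ \alpha_{2i-1}\eta;\ q_i,p_i\Big]+\sum_{1\le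 i<j\le n}(q_i-1)(q_j-t)\{(q_ip_i+\alpha_{2i-1})p_j+p_i(p_jq_j+\alpha_{2j-1})\},$$ $$H_{\rm VI}[\kappa_0,\kappa_1,\kappa_t,\kappa;q,p]=q(q-1)(q-t)p^2-\kappa_0(q-1)(q-t)p-\kappa_1q(q-t)p-(\kappa_t-1)q(q-1)p+\kappa q.$$ Conventions: $q_{n+1}=t$; the Poisson bracket is $\{p_i,q_j\}=\delta_{i,j}$, $\{p_i,p_j\}=\{q_i,q_j\}=0$, with $t,\alpha_i,\eta$ having zero bracket with everything. The transformations are regarded as automorphisms of the field of rational functions in $q_i,p_i$ $(1\le i\le n)$, $t$, $\eta$ and $\alpha_0,\ldots,\alpha_{2n+1}$ (subject to $\sum\alpha_i=1$). Let $D=d/dt$ be the derivation of this field defined by the system, with $D(t)=1$, $D(\alpha_i)=D(\eta)=0$. Invariance means that each transformation maps the system to itself: $r_i\circ D=D\circ r_i$, and $\pi\circ D=-t^2\,D\circ\pi$ (that is, $\pi(df/dt)=d\pi(f)/d\pi(t)$ with $\pi(t)=1/t$). Definition of the transformations, for $j=1,\ldots,n$: - $r_0(q_j)=q_j$, $r_0(p_j)=p_j+\frac{\alpha_0}{q_1-1}\{q_1-1,p_j\}$; - $r_{2i}(q_j)=q_j$, $r_{2i}(p_j)=p_j+\frac{\alpha_{2i}}{q_i-q_{i+1}}\{q_i-q_{i+1},p_j\}$ $(i=1,\ldots,n)$; - $r_{2i-1}(q_j)=q_j+\frac{\alpha_{2i-1}}{p_i}\{p_i,q_j\}$, $r_{2i-1}(p_j)=p_j$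 $(i=1,\ldots,n)$; - $r_{2n+1}(q_j)=q_j+\dfrac{\alpha_{2n+1}q_j}{\sum_{k=1}^nq_kp_k+\eta-\alpha_{2n+1}}$, $r_{2n+1}(p_j)=p_j-\dfrac{\alpha_{2n+1}p_j}{\sum_{k=1}^nq_kp_k+\eta}$; - $r_i(\alpha_j)=\alpha_j-a_{i,j}\alpha_i$, $r_i(\eta)=\eta+(-1)^i\alpha_i$, $r_i(t)=t$ $(i,j=0,\ldots,2n+1)$; - for $i=1,\ldots,n$, $$\pi(q_i)=\frac{\sum_{j=1}^i(q_j-1)p_j+\sum_{j=i+1}^n(q_j-t)p_j+\eta}{\sum_{j=1}^n(q_j-t)p_j+\eta},\qquad \pi(p_i)=\frac{(q_{i+1}-q_i)\{\sum_{j=1}^n(q_j-t)p_j+\eta\}}{t-1};$$ - $\pi(t)=1/t$, $\pi(\alpha_i)=\alpha_{i+1}$ $(i=0,\ldots,2n)$, $\pi(\alpha_{2n+1})=\alpha_0$, $\pi(\eta)=-\eta$. *)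

theory Defs
  imports
    "HOL-Library.Countable"
    "HOL-Library.Poly_Mapping"
    "HOL-Computational_Algebra.Fraction_Field"
    "HOL-Algebra.Bij"
    "HOL-Algebra.Generated_Groups"
    "HOL-Algebra.QuotRing"
begin

section \<open>Groups given by generators and relations\<close>

text \<open>
  A word is a list of letters \<open>(g, e)\<close>, which stand for \<open>g\<close> if \<open>e = True\<close> and for the formal
  inverse of \<open>g\<close> if \<open>e = False\<close>. A relation \<open>u = v\<close> is the pair of words \<open>(u, v)\<close>.
\<close>

type_synonym 'g word = "('g \<times> bool) list"

definition words :: "'g set \<Rightarrow> 'g word set" where
  "words S = lists (S \<times> UNIV)"

inductive pres_cong :: "'g set \<Rightarrow> ('g word \<times> 'g word) set \<Rightarrow> 'g word \<Rightarrow> 'g word \<Rightarrow> bool"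
  for S R where
  refl: "pres_cong S R u u"
| sym: "pres_cong S R u v \<Longrightarrow> pres_cong S R v u"
| trans: "pres_cong S R u v \<Longrightarrow> pres_cong S R v w \<Longrightarrow> pres_cong S R u w"
| cancel: "g \<in> S \<Longrightarrow> pres_cong S R (u @ [(g, e), (g, \<not> e)] @ v) (u @ v)"
| relation: "(a, b) \<in> R \<Longrightarrow> pres_cong S R (u @ a @ v) (u @ b @ v)"

definition pres_rel :: "'g set \<Rightarrow> ('g word \<times> 'g word) set \<Rightarrow> ('g word \<times> 'g word) set" where
  "pres_rel S R = {(u, v). u \<in> words S \<and> v \<in> words S \<and> pres_cong S R u v}"

definition presented_group :: "'g set \<Rightarrow> ('g word \<times> 'g word) set \<Rightarrow> 'g word set monoid" where
  "presented_group S R =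
     \<lparr>carrier = words S // pres_rel S R,
      mult = (\<lambda>A B. \<Union>u\<in>A. \<Union>v\<in>B. pres_rel S R `` {u @ v}),
      one = pres_rel S R `` {[]}\<rparr>"


section \<open>The extended affine Weyl group of type $A^{(1)}_{2n+1}$\<close>

text \<open>Only used for \<open>i, j \<le> 2n+1\<close> with \<open>n \<ge> 1\<close>.\<close>

definition cartan :: "nat \<Rightarrow> nat \<Rightarrow> nat \<Rightarrow> int" where
  "cartan n i j =
     (if i = j then 2
      else if j = i + 1 \<or> i = j + 1 \<or> (i = 2*n+1 \<and> j = 0) \<or> (i = 0 \<and> j = 2*n+1) then - 1
      else 0)"

datatype weyl_gen = Refl nat | Rot

abbreviation s_word :: "nat \<Rightarrow> weyl_gen word" where
  "s_word i \<equiv> [(Refl i, True)]"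

abbreviation pi_word :: "weyl_gen word" where
  "pi_word \<equiv> [(Rot, True)]"

definition weyl_gens :: "nat \<Rightarrow> weyl_gen set" where
  "weyl_gens n = insert Rot (Refl ` {0..2*n+1})"

definition weyl_rels :: "nat \<Rightarrow> (weyl_gen word \<times> weyl_gen word) set" where
  "weyl_rels n =
     {(s_word i @ s_word i, []) | i. i \<le> 2*n+1} \<union>
     {(concat (replicate (nat (2 - cartan n i j)) (s_word i @ s_word j)), []) | i j.
        i \<le> 2*n+1 \<and> j \<le> 2*n+1 \<and> i \<noteq> j} \<union>
     {(concat (replicate (2*n+2) pi_word), [])} \<union>
     {(pi_word @ s_word i, s_word (i+1) @ pi_word) | i. i \<le> 2*n} \<union>
     {(pi_word @ s_word (2*n+1), s_word 0 @ pi_word)}"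

definition ext_affine_weyl :: "nat \<Rightarrow> weyl_gen word set monoid" where
  "ext_affine_weyl n = presented_group (weyl_gens n) (weyl_rels n)"


section \<open>Rational functions\<close>

text \<open>
  \<open>VAlpha 0\<close> is never used: the relation $\sum_i \alpha_i = 1$ is imposed by eliminating
  $\alpha_0$, see \<open>al\<close> below.
\<close>

datatype pvar = VQ nat | VP nat | VT | VEta | VAlpha nat

instance pvar :: countable
  by countable_datatype

text \<open>
  An arbitrary linear order on the variables; its only purpose is to make the polynomial ring
  an instance of the class \<open>idom\<close>.
\<close>

instantiation pvar :: linorder
begin

definition less_eq_pvar :: "pvar \<Rightarrow> pvar \<Rightarrow> bool" where
  "less_eq_pvar x y \<longleftrightarrow> to_nat x \<le> to_nat y"

definition less_pvar :: "pvar \<Rightarrow> pvar \<Rightarrow> bool" where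
  "less_pvar x y \<longleftrightarrow> to_nat x < to_nat y"

instance
  by standard (auto simp: less_eq_pvar_def less_pvar_def)

end

type_synonym 'k mpoly = "(pvar \<Rightarrow>\<^sub>0 nat) \<Rightarrow>\<^sub>0 'k"
type_synonym 'k ratfun = "'k mpoly fract"

definition Const :: "'k \<Rightarrow> 'k::field_char_0 ratfun" where
  "Const c = Fract (Poly_Mapping.single 0 c) 1"

definition Var :: "pvar \<Rightarrow> 'k::field_char_0 ratfun" where
  "Var x = Fract (Poly_Mapping.single (Poly_Mapping.single x 1) 1) 1"

definition poly_vars :: "'k::field_char_0 mpoly \<Rightarrow> pvar set" where
  "poly_vars p = (\<Union>m\<in>Poly_Mapping.keys p. Poly_Mapping.keys m)"

definition vars :: "nat \<Rightarrow> pvar set" where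
  "vars n = VQ ` {1..n} \<union> VP ` {1..n} \<union> {VT, VEta} \<union> VAlpha ` {1..2*n+1}"

definition ratfield :: "nat \<Rightarrow> 'k::field_char_0 ratfun set" where
  "ratfield n = {Fract a b | a b. poly_vars a \<subseteq> vars n \<and> poly_vars b \<subseteq> vars n \<and> b \<noteq> 0}"

definition ratfield_ring :: "nat \<Rightarrow> 'k::field_char_0 ratfun ring" where
  "ratfield_ring n = \<lparr>carrier = ratfield n, mult = (*), one = 1, zero = 0, add = (+)\<rparr>"

text \<open>Numerator and denominator of some representation of an element of \<open>ratfield n\<close>.\<close>

definition num_den :: "nat \<Rightarrow> 'k::field_char_0 ratfun \<Rightarrow> 'k mpoly \<times> 'k mpoly" where
  "num_den n f = (SOME (a, b). poly_vars a \<subseteq> vars n \<and> poly_vars b \<subseteq> vars n \<and> b \<noteq> 0 \<and>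
     f = Fract a b)"

definition poly_eval :: "(pvar \<Rightarrow> 'k::field_char_0 ratfun) \<Rightarrow> 'k mpoly \<Rightarrow> 'k ratfun" where
  "poly_eval \<sigma> p = (\<Sum>m\<in>Poly_Mapping.keys p. Const (Poly_Mapping.lookup p m) *
     (\<Prod>x\<in>Poly_Mapping.keys m. \<sigma> x ^ Poly_Mapping.lookup m x))"

text \<open>
  The transformation $f \mapsto f(\sigma)$ of the field \<open>ratfield n\<close> determined by the images
  \<open>\<sigma> x\<close> of the variables. It does not depend on the representations picked by \<open>num_den\<close> as
  long as the images of the variables in \<open>vars n\<close> are algebraically independent.
\<close>

definition ratfun_subst :: "nat \<Rightarrow> (pvar \<Rightarrow> 'k::field_char_0 ratfun) \<Rightarrow> 'k ratfun \<Rightarrow> 'k ratfun" where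
  "ratfun_subst n \<sigma> = (\<lambda>f\<in>ratfield n. case num_den n f of (a, b) \<Rightarrow> poly_eval \<sigma> a / poly_eval \<sigma> b)"

text \<open>
  Partial derivatives of polynomials and, by the quotient rule, of rational functions.
\<close>

definition poly_partial :: "pvar \<Rightarrow> 'k::field_char_0 mpoly \<Rightarrow> 'k mpoly" where
  "poly_partial x p = (\<Sum>m\<in>Poly_Mapping.keys p. Poly_Mapping.single
     (m - Poly_Mapping.single x 1) (of_nat (Poly_Mapping.lookup m x) * Poly_Mapping.lookup p m))"

definition partial_deriv :: "nat \<Rightarrow> pvar \<Rightarrow> 'k::field_char_0 ratfun \<Rightarrow> 'k ratfun" where
  "partial_deriv n x f = (case num_den n f of (a, b) \<Rightarrow>
     Fract (poly_partial x a * b - a * poly_partial x b) (b * b))"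


section \<open>The Painleve system\<close>

abbreviation tv :: "'k::field_char_0 ratfun" where "tv \<equiv> Var VT"
abbreviation etav :: "'k::field_char_0 ratfun" where "etav \<equiv> Var VEta"
abbreviation pv :: "nat \<Rightarrow> 'k::field_char_0 ratfun" where "pv i \<equiv> Var (VP i)"

text \<open>The convention $q_{n+1} = t$ is built in.\<close>

definition qv :: "nat \<Rightarrow> nat \<Rightarrow> 'k::field_char_0 ratfun" where
  "qv n i = (if i = n + 1 then tv else Var (VQ i))"

definition al :: "nat \<Rightarrow> nat \<Rightarrow> 'k::field_char_0 ratfun" where
  "al n i = (if i = 0 then 1 - (\<Sum>k=1..2*n+1. Var (VAlpha k)) else Var (VAlpha i))"

text \<open>The sign convention is $\{p_i, q_j\} = \delta_{i,j}$.\<close>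

definition poisson :: "nat \<Rightarrow> 'k::field_char_0 ratfun \<Rightarrow> 'k ratfun \<Rightarrow> 'k ratfun" where
  "poisson n f g = (\<Sum>i=1..n.
     partial_deriv n (VP i) f * partial_deriv n (VQ i) g -
     partial_deriv n (VQ i) f * partial_deriv n (VP i) g)"

definition H_VI ::
    "'k::field_char_0 ratfun \<Rightarrow> 'k ratfun \<Rightarrow> 'k ratfun \<Rightarrow> 'k ratfun \<Rightarrow> 'k ratfun \<Rightarrow> 'k ratfun \<Rightarrow> 'k ratfun"
  where
  "H_VI \<kappa>0 \<kappa>1 \<kappa>t \<kappa> x y =
     x * (x - 1) * (x - tv) * y^2 - \<kappa>0 * (x - 1) * (x - tv) * y - \<kappa>1 * x * (x - tv) * y
     - (\<kappa>t - 1) * x * (x - 1) * y + \<kappa> * x"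

definition hamiltonian :: "nat \<Rightarrow> 'k::field_char_0 ratfun" where
  "hamiltonian n =
     ((\<Sum>i=1..n. H_VI ((\<Sum>j=0..n. al n (2*j+1)) - al n (2*i-1) - etav)
                       (\<Sum>j=0..i-1. al n (2*j))
                       (\<Sum>j=i..n. al n (2*j))
                       (al n (2*i-1) * etav)
                       (qv n i) (pv i))
      + (\<Sum>i=1..n. \<Sum>j=i+1..n. (qv n i - 1) * (qv n j - tv) *
           ((qv n i * pv i + al n (2*i-1)) * pv j + pv i * (pv j * qv n j + al n (2*j-1)))))
     / (tv * (tv - 1))"

text \<open>
  The derivation $D = d/dt$ of \<open>ratfield n\<close> given by
  $D(q_i) = \partial H/\partial p_i$, $D(p_i) = -\partial H/\partial q_i$, $D(t) = 1$,
  $D(\alpha_i) = D(\eta) = 0$.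
\<close>

definition ddt :: "nat \<Rightarrow> 'k::field_char_0 ratfun \<Rightarrow> 'k ratfun" where
  "ddt n f = partial_deriv n VT f + (\<Sum>i=1..n.
     partial_deriv n (VP i) (hamiltonian n) * partial_deriv n (VQ i) f -
     partial_deriv n (VQ i) (hamiltonian n) * partial_deriv n (VP i) f)"


section \<open>The transformations\<close>

text \<open>
  Images of the variables. An odd index below \<open>2n+1\<close> is written $2k-1$ with
  \<open>k = (i+1) div 2\<close>, a positive even one $2k$ with \<open>k = i div 2\<close>. The prescribed image of the
  eliminated $\alpha_0$ is the one forced by $\sum_i \alpha_i = 1$.
\<close>

definition refl_image :: "nat \<Rightarrow> nat \<Rightarrow> pvar \<Rightarrow> 'k::field_char_0 ratfun" where
  "refl_image n i x = (case x of
     VQ j \<Rightarrow>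
       if i = 2*n+1 then
         qv n j + al n i * qv n j / ((\<Sum>k=1..n. qv n k * pv k) + etav - al n i)
       else if odd i then
         (let \<phi> = pv ((i+1) div 2) in qv n j + al n i / \<phi> * poisson n \<phi> (qv n j))
       else qv n j
   | VP j \<Rightarrow>
       if i = 2*n+1 then
         pv j - al n i * pv j / ((\<Sum>k=1..n. qv n k * pv k) + etav)
       else if i = 0 then
         (let \<phi> = qv n 1 - 1 in pv j + al n i / \<phi> * poisson n \<phi> (pv j))
       else if even i then
         (let \<phi> = qv n (i div 2) - qv n (i div 2 + 1) in pv j + al n i / \<phi> * poisson n \<phi> (pv j))
       else pv j
   | VT \<Rightarrow> tv
   | VEta \<Rightarrow> etav + (- 1)^i * al n i
   | VAlpha j \<Rightarrow> al n j - of_int (cartan n i j) * al n i)"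

definition rot_image :: "nat \<Rightarrow> pvar \<Rightarrow> 'k::field_char_0 ratfun" where
  "rot_image n x =
     (let \<Phi> = (\<Sum>j=1..n. (qv n j - tv) * pv j) + etav in
      case x of
        VQ i \<Rightarrow> ((\<Sum>j=1..i. (qv n j - 1) * pv j) + (\<Sum>j=i+1..n. (qv n j - tv) * pv j) + etav) / \<Phi>
      | VP i \<Rightarrow> (qv n (i+1) - qv n i) * \<Phi> / (tv - 1)
      | VT \<Rightarrow> 1 / tv
      | VEta \<Rightarrow> - etav
      | VAlpha i \<Rightarrow> if i = 2*n+1 then al n 0 else al n (i+1))"

definition reflection :: "nat \<Rightarrow> nat \<Rightarrow> 'k::field_char_0 ratfun \<Rightarrow> 'k ratfun" where
  "reflection n i = ratfun_subst n (refl_image n i)"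

definition rotation :: "nat \<Rightarrow> 'k::field_char_0 ratfun \<Rightarrow> 'k ratfun" where
  "rotation n = ratfun_subst n (rot_image n)"

text \<open>Automorphisms of the field of rational functions that preserve the Poisson bracket.\<close>

definition birational_canonical :: "nat \<Rightarrow> ('k::field_char_0 ratfun \<Rightarrow> 'k ratfun) \<Rightarrow> bool" where
  "birational_canonical n \<phi> \<longleftrightarrow>
     \<phi> \<in> ring_iso (ratfield_ring n) (ratfield_ring n) \<and>
     (\<forall>f\<in>ratfield n. \<forall>g\<in>ratfield n. \<phi> (poisson n f g) = poisson n (\<phi> f) (\<phi> g))"

text \<open>The group operation is composition of automorphisms.\<close>

definition symmetry_group :: "nat \<Rightarrow> ('k::field_char_0 ratfun \<Rightarrow> 'k ratfun) monoid" where
  "symmetry_group n =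
     subgroup_generated (BijGroup (ratfield n)) (insert (rotation n) (reflection n ` {0..2*n+1}))"

end

theory Submission
  imports Defs
begin

text \<open>
  Put $q_0 = 1$, $q_{n+1} = t$ and
  $R_i = (\sum_j (q_j - t) p_j + \eta)/(t-1) + p_1 + \cdots + p_i$, and interleave these
  functions to a sequence $x_{2i-1} = q_i$, $x_{2i} = R_i$, extended to all integers by
  $x_{k+2n+2} = t^{\pm 1} x_k$ (\<open>+\<close> for odd \<open>k\<close>). Up to a gauge transformation
  $x_k \mapsto g^{\pm 1} x_k$, which is pinned down by $x_{-1} = 1$, the rotation $\pi$ becomes the
  shift $x_k \mapsto x_{k+1}$, and $r_i$ becomes
  $x_k \mapsto x_k + \alpha_k/(x_{k+1} - x_{k-1})$ for $k \equiv i$ modulo \<open>2n+2\<close>. In this form the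
  fundamental relations are identities between sequences, and all $r_i$ are conjugates of $r_0$
  by powers of $\pi$. Hence invariance and canonicity need only be checked for $r_0$ and $\pi$,
  using an expression of the vector field in the $x_k$ that is shift-invariant up to gauge.

  The group acts faithfully already on the parameters: on the partial sums of the $\alpha_k$ it acts
  through affine permutations of the integers. Removing descents brings any
  affine permutation to a shift, and the resulting words are unique modulo the relations, so that
  a word acting trivially is trivial in the presented group.
\<close>

section \<open>Polynomials and their evaluation\<close>

text \<open>The overview passes over one obstacle. \<open>ratfun_subst\<close> evaluates a chosen
  numerator and denominator, so it is a homomorphism only if the images of the variables satisfy no
  polynomial relation. This is proved, by a left inverse on the variables, for r_0 and pi. For the
  other indices the conjugates of r_0 by powers of pi are homomorphisms by construction, and an
  endomorphism with the prescribed images of the variables must be the substitution. Up to powers of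
  t, the differences x_{k+1} - x_{k-1} are the denominators in the definition of the reflections:
  p_i for odd k, q_{i+1} - q_i for even k, and -(sum q_j p_j + eta) for k = -1. The special shape of
  r_{2n+1} is a gauge correction: this reflection moves x_{-1}, which has to be rescaled to 1. In
  the vector field the gauge freedom is a term proportional to x_k with alternating sign. Its
  coefficient is fixed by D(x_{-1}) = 0, so comparing coefficients at k = -1 settles it for all k. A
  shift by 2n+2 moves every integer but fixes every parameter; this matches pi^{2n+2} = 1.\<close>

abbreviation cpoly :: "'k \<Rightarrow> 'k::field_char_0 mpoly" where
  "cpoly c \<equiv> Poly_Mapping.single 0 c"

abbreviation xpoly :: "pvar \<Rightarrow> 'k::field_char_0 mpoly" where
  "xpoly x \<equiv> Poly_Mapping.single (Poly_Mapping.single x 1) 1"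

text \<open>Serves on two levels: for polynomials as sums of monomials and, in
  \<open>poly_eval_Var\<close>, for exponents as sums of powers of single variables.\<close>

lemma poly_mapping_add_induct [case_names single add]:
  fixes p :: "'a \<Rightarrow>\<^sub>0 'b::comm_monoid_add"
  assumes "\<And>m c. P (Poly_Mapping.single m c)" and "\<And>p q. P p \<Longrightarrow> P q \<Longrightarrow> P (p + q)"
  shows "P p"
proof -
  have *: "P (\<Sum>m\<in>A. Poly_Mapping.single m (Poly_Mapping.lookup p m))" if "finite A" for A
    using that
  proof (induction A rule: finite_induct)
    case empty
    \<comment> \<open>The zero map is a monomial with coefficient 0, whatever its exponent.\<close>
    show ?case using assms(1)[of undefined 0] by simp
  next
    case (insert m A)
    then show ?case using assms by simp
  qed
  have "p = (\<Sum>m\<in>Poly_Mapping.keys p. Poly_Mapping.single m (Poly_Mapping.lookup p m))"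
    by (rule poly_mapping_eqI)
      (auto simp: lookup_sum lookup_single when_def in_keys_iff sum.delta')
  then show ?thesis using *[of "Poly_Mapping.keys p"] by simp
qed

definition monom_eval :: "(pvar \<Rightarrow> 'k::field_char_0 ratfun) \<Rightarrow> (pvar \<Rightarrow>\<^sub>0 nat) \<Rightarrow> 'k ratfun" where
  "monom_eval \<sigma> m = (\<Prod>x\<in>Poly_Mapping.keys m. \<sigma> x ^ Poly_Mapping.lookup m x)"

text \<open>Outside the support the exponent is 0 and the factor 1, so the products for different
  monomials can be taken over one common set of variables.\<close>

lemma monom_eval_superset:
  "finite A \<Longrightarrow> Poly_Mapping.keys m \<subseteq> A \<Longrightarrow>
    monom_eval \<sigma> m = (\<Prod>x\<in>A. \<sigma> x ^ Poly_Mapping.lookup m x)"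
  unfolding monom_eval_def by (rule prod.mono_neutral_left) (auto simp: in_keys_iff)

lemma monom_eval_0 [simp]: "monom_eval \<sigma> 0 = 1"
  by (simp add: monom_eval_def)

lemma monom_eval_single [simp]: "monom_eval \<sigma> (Poly_Mapping.single x k) = \<sigma> x ^ k"
  by (subst monom_eval_superset[of "{x}"]) auto

lemma monom_eval_add: "monom_eval \<sigma> (m + m') = monom_eval \<sigma> m * monom_eval \<sigma> m'"
proof -
  define A where "A = Poly_Mapping.keys m \<union> Poly_Mapping.keys m'"
  have "finite A" "Poly_Mapping.keys m \<subseteq> A" "Poly_Mapping.keys m' \<subseteq> A"
    "Poly_Mapping.keys (m + m') \<subseteq> A"
    using keys_add[of m m'] by (auto simp: A_def)
  then show ?thesis
    by (simp add: monom_eval_superset[of A] lookup_add power_add prod.distrib)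
qed

lemma Const_0 [simp]: "Const 0 = 0"
  by (simp add: Const_def Zero_fract_def)

lemma Const_1 [simp]: "Const 1 = 1"
  by (simp add: Const_def One_fract_def)

lemma Const_add: "Const (a + b) = Const a + Const b"
  by (simp add: Const_def single_add)

lemma Const_mult: "Const (a * b) = Const a * Const b"
  by (simp add: Const_def mult_single)

lemma Const_minus: "Const (- a) = - Const a"
  by (simp add: Const_def single_uminus)

lemma Const_of_int: "Const (of_int c) = of_int c"
proof -
  have "Const (of_nat m) = of_nat m" for m
    by (induction m) (simp_all add: Const_add)
  then show ?thesis
    by (cases c) (simp_all add: Const_minus Const_add del: of_nat_Suc)
qed

lemma Const_eq_0_iff: "Const a = 0 \<longleftrightarrow> a = 0"
proof
  assume "Const a = 0"
  then have "cpoly a = 0" by (simp add: Const_def Zero_fract_def eq_fract)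
  then show "a = 0" by (metis lookup_single_eq lookup_zero)
qed simp

lemma of_int_ratfun_eq_0_iff: "(of_int c :: 'k::field_char_0 ratfun) = 0 \<longleftrightarrow> c = 0"
  by (simp add: Const_of_int[symmetric] Const_eq_0_iff)

lemma poly_eval_alt: "poly_eval \<sigma> p =
    (\<Sum>m\<in>Poly_Mapping.keys p. Const (Poly_Mapping.lookup p m) * monom_eval \<sigma> m)"
  by (simp add: poly_eval_def monom_eval_def)

lemma poly_eval_single [simp]: "poly_eval \<sigma> (Poly_Mapping.single m c) = Const c * monom_eval \<sigma> m"
  by (simp add: poly_eval_alt)

lemma poly_eval_add: "poly_eval \<sigma> (p + q) = poly_eval \<sigma> p + poly_eval \<sigma> q"
  unfolding poly_eval_alt
  by (rule setsum_keys_plus_distrib) (simp_all add: Const_add distrib_right)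

lemma poly_eval_0 [simp]: "poly_eval \<sigma> 0 = 0"
  by (simp add: poly_eval_def)

lemma poly_eval_1 [simp]: "poly_eval \<sigma> 1 = 1"
  by (subst single_one[symmetric], subst poly_eval_single) simp

lemma poly_eval_mult: "poly_eval \<sigma> (p * q) = poly_eval \<sigma> p * poly_eval \<sigma> q"
proof (induction p rule: poly_mapping_add_induct)
  case (single m c)
  show ?case
    by (induction q rule: poly_mapping_add_induct)
      (simp_all add: mult_single monom_eval_add Const_mult poly_eval_add algebra_simps)
next
  case (add p p')
  then show ?case by (simp add: distrib_right poly_eval_add)
qed

lemma Fract_1_power: "Fract a 1 ^ k = Fract (a ^ k) (1::'a::idom)"
  by (induction k) (simp_all add: One_fract_def)

text \<open>Evaluation at the variables is the embedding of polynomials into fractions. Read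
  backwards, it presents a polynomial as an expression in the variables, to which closure and
  substitution arguments apply.\<close>

lemma poly_eval_Var: "poly_eval Var p = Fract p 1"
proof (induction p rule: poly_mapping_add_induct)
  case (single m c)
  have "monom_eval Var m = Fract (Poly_Mapping.single m 1) (1::'a mpoly)"
  proof (induction m rule: poly_mapping_add_induct)
    case (single x k)
    have "(xpoly x :: 'a mpoly) ^ k = Poly_Mapping.single (Poly_Mapping.single x k) 1"
      by (induction k) (simp_all add: mult_single single_add[symmetric])
    then show ?case by (simp add: Var_def Fract_1_power)
  next
    case (add m m')
    then show ?case by (simp add: monom_eval_add mult_single)
  qed
  then show ?case by (simp add: Const_def mult_single)
next
  case (add p q)
  then show ?case by (simp add: poly_eval_add)
qed

lemma poly_vars_0 [simp]: "poly_vars 0 = {}"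
  by (simp add: poly_vars_def)

lemma poly_vars_const [simp]: "poly_vars (cpoly c) = {}"
  by (simp add: poly_vars_def)

lemma poly_vars_1 [simp]: "poly_vars 1 = {}"
  using poly_vars_const[of 1] by simp

lemma poly_vars_var [simp]: "poly_vars (xpoly x) = {x}"
  by (simp add: poly_vars_def)

lemma poly_vars_add: "poly_vars (p + q) \<subseteq> poly_vars p \<union> poly_vars q"
  using keys_add[of p q] by (force simp: poly_vars_def)

lemma poly_vars_uminus [simp]: "poly_vars (- p) = poly_vars p"
  by (simp add: poly_vars_def in_keys_iff set_eq_iff)

lemma poly_vars_mult: "poly_vars (p * q) \<subseteq> poly_vars p \<union> poly_vars q"
proof
  fix x assume "x \<in> poly_vars (p * q)"
  then obtain m where "m \<in> Poly_Mapping.keys (p * q)" and x: "x \<in> Poly_Mapping.keys m"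
    by (auto simp: poly_vars_def)
  then obtain a b where "m = a + b" "a \<in> Poly_Mapping.keys p" "b \<in> Poly_Mapping.keys q"
    using keys_mult[of p q] by blast
  then show "x \<in> poly_vars p \<union> poly_vars q"
    using keys_add[of a b] x by (auto simp: poly_vars_def)
qed

section \<open>The field of rational functions\<close>

lemma ratfieldI:
  "poly_vars a \<subseteq> vars n \<Longrightarrow> poly_vars b \<subseteq> vars n \<Longrightarrow> b \<noteq> 0 \<Longrightarrow> Fract a b \<in> ratfield n"
  by (auto simp: ratfield_def)

lemma ratfieldE:
  assumes "f \<in> ratfield n"
  obtains a b where "poly_vars a \<subseteq> vars n" "poly_vars b \<subseteq> vars n" "b \<noteq> 0" "f = Fract a b"
  using assms by (auto simp: ratfield_def)

lemma Const_in [simp]: "Const c \<in> ratfield n"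
  by (simp add: Const_def ratfieldI)

lemma zero_in [simp]: "0 \<in> ratfield n"
  using Const_in[of 0] by simp

lemma one_in [simp]: "1 \<in> ratfield n"
  using Const_in[of 1] by simp

lemma Var_in: "x \<in> vars n \<Longrightarrow> Var x \<in> ratfield n"
  unfolding Var_def by (rule ratfieldI) (simp_all only: poly_vars_var, simp_all)

lemma add_in [simp]: "f \<in> ratfield n \<Longrightarrow> g \<in> ratfield n \<Longrightarrow> f + g \<in> ratfield n"
proof (elim ratfieldE)
  fix a b a' b' :: "'a mpoly"
  assume *: "poly_vars a \<subseteq> vars n" "poly_vars b \<subseteq> vars n" "b \<noteq> 0" "f = Fract a b"
    "poly_vars a' \<subseteq> vars n" "poly_vars b' \<subseteq> vars n" "b' \<noteq> 0" "g = Fract a' b'"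
  have "poly_vars (a * b' + a' * b) \<subseteq> vars n" "poly_vars (b * b') \<subseteq> vars n"
    using poly_vars_add[of "a * b'" "a' * b"] poly_vars_mult[of a b'] poly_vars_mult[of a' b]
      poly_vars_mult[of b b'] * by blast+
  then show ?thesis using * by (simp add: ratfieldI)
qed

lemma mult_in [simp]: "f \<in> ratfield n \<Longrightarrow> g \<in> ratfield n \<Longrightarrow> f * g \<in> ratfield n"
proof (elim ratfieldE)
  fix a b a' b' :: "'a mpoly"
  assume *: "poly_vars a \<subseteq> vars n" "poly_vars b \<subseteq> vars n" "b \<noteq> 0" "f = Fract a b"
    "poly_vars a' \<subseteq> vars n" "poly_vars b' \<subseteq> vars n" "b' \<noteq> 0" "g = Fract a' b'"
  have "poly_vars (a * a') \<subseteq> vars n" "poly_vars (b * b') \<subseteq> vars n"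
    using poly_vars_mult[of a a'] poly_vars_mult[of b b'] * by auto
  then show ?thesis using * by (simp add: ratfieldI)
qed

lemma uminus_in [simp]: "f \<in> ratfield n \<Longrightarrow> - f \<in> ratfield n"
  by (erule ratfieldE) (simp add: ratfieldI)

lemma diff_in [simp]: "f \<in> ratfield n \<Longrightarrow> g \<in> ratfield n \<Longrightarrow> f - g \<in> ratfield n"
  using add_in[of f n "- g"] by simp

lemma inverse_in [simp]: "f \<in> ratfield n \<Longrightarrow> inverse f \<in> ratfield n"
proof (erule ratfieldE)
  fix a b :: "'a mpoly"
  assume *: "poly_vars a \<subseteq> vars n" "poly_vars b \<subseteq> vars n" "b \<noteq> 0" "f = Fract a b"
  show ?thesis
  proof (cases "a = 0")
    case True
    then have "f = 0" using * by (simp add: Zero_fract_def eq_fract)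
    then show ?thesis by simp
  next
    case False
    then show ?thesis using * by (simp add: ratfieldI)
  qed
qed

lemma divide_in [simp]: "f \<in> ratfield n \<Longrightarrow> g \<in> ratfield n \<Longrightarrow> f / g \<in> ratfield n"
  by (simp add: divide_inverse)

lemma power_in [simp]: "f \<in> ratfield n \<Longrightarrow> f ^ k \<in> ratfield n"
  by (induction k) simp_all

lemma powi_in [simp]: "f \<in> ratfield n \<Longrightarrow> f powi k \<in> ratfield n"
  by (simp add: power_int_def)

lemma sum_in [simp]: "\<forall>i\<in>A. f i \<in> ratfield n \<Longrightarrow> sum f A \<in> ratfield n"
  by (induction A rule: infinite_finite_induct) simp_all

lemma of_int_in [simp]: "of_int c \<in> ratfield n"
  by (simp add: Const_of_int[symmetric])

text \<open>Closure principle for subrings that contain the constants. It gives membership of values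
  in \<open>ratfield n\<close> and the polynomial part of \<open>ratfield_induct\<close>.\<close>

lemma poly_eval_in_generated:
  assumes "\<And>c. P (Const c)" "\<And>f g. P f \<Longrightarrow> P g \<Longrightarrow> P (f + g)" "\<And>f g. P f \<Longrightarrow> P g \<Longrightarrow> P (f * g)"
    and "\<And>x. x \<in> poly_vars p \<Longrightarrow> P (\<sigma> x)"
  shows "P (poly_eval \<sigma> p)"
proof -
  have 0: "P 0" and 1: "P 1" using assms(1)[of 0] assms(1)[of 1] by simp_all
  have pow: "P (f ^ k)" if "P f" for f k
    using that 1 by (induction k) (simp_all add: assms)
  have prod: "P (\<Prod>x\<in>A. f x)" if "finite A" "\<And>x. x \<in> A \<Longrightarrow> P (f x)" for f :: "pvar \<Rightarrow> _" and A
    using that 1 by (induction A rule: finite_induct) (simp_all add: assms)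
  have sum: "P (\<Sum>x\<in>A. f x)" if "finite A" "\<And>x. x \<in> A \<Longrightarrow> P (f x)" for f :: "(pvar \<Rightarrow>\<^sub>0 nat) \<Rightarrow> _" and A
    using that 0 by (induction A rule: finite_induct) (simp_all add: assms)
  show ?thesis unfolding poly_eval_def
    by (intro sum assms(3) assms(1) prod pow assms(4)) (auto simp: poly_vars_def)
qed

text \<open>The field is generated by constants and variables. Through this rule, identities between
  endomorphisms or derivations are reduced to their values on the variables.\<close>

lemma ratfield_induct [consumes 1, case_names Const Var add mult inverse]:
  assumes f: "f \<in> ratfield n"
    and C: "\<And>c. P (Const c)" and V: "\<And>x. x \<in> vars n \<Longrightarrow> P (Var x)"
    and A: "\<And>f g. f \<in> ratfield n \<Longrightarrow> g \<in> ratfield n \<Longrightarrow> P f \<Longrightarrow> P g \<Longrightarrow> P (f + g)"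
    and M: "\<And>f g. f \<in> ratfield n \<Longrightarrow> g \<in> ratfield n \<Longrightarrow> P f \<Longrightarrow> P g \<Longrightarrow> P (f * g)"
    and I: "\<And>f. f \<in> ratfield n \<Longrightarrow> f \<noteq> 0 \<Longrightarrow> P f \<Longrightarrow> P (inverse f)"
  shows "P f"
proof -
  have poly: "Fract p 1 \<in> ratfield n \<and> P (Fract p 1)" if "poly_vars p \<subseteq> vars n" for p
    unfolding poly_eval_Var[symmetric]
    by (rule poly_eval_in_generated) (use that in \<open>auto intro: C V A M Var_in\<close>)
  obtain a b where ab: "poly_vars a \<subseteq> vars n" "poly_vars b \<subseteq> vars n" "b \<noteq> 0" "f = Fract a b"
    using f by (rule ratfieldE)
  then have "f = Fract a 1 * inverse (Fract b 1)" "Fract b 1 \<noteq> 0"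
    by (simp_all add: Zero_fract_def eq_fract)
  moreover have "P (Fract a 1 * inverse (Fract b 1))"
    using poly ab calculation by (intro M I inverse_in) auto
  ultimately show ?thesis by metis
qed

lemma num_den_spec:
  assumes "f \<in> ratfield n" "num_den n f = (a, b)"
  shows "poly_vars a \<subseteq> vars n" "poly_vars b \<subseteq> vars n" "b \<noteq> 0" "f = Fract a b"
proof -
  have "\<exists>x. case x of (a, b) \<Rightarrow> poly_vars a \<subseteq> vars n \<and> poly_vars b \<subseteq> vars n \<and> b \<noteq> 0 \<and> f = Fract a b"
    using assms(1) by (auto simp: ratfield_def)
  from someI_ex[OF this] assms(2)
  show "poly_vars a \<subseteq> vars n" "poly_vars b \<subseteq> vars n" "b \<noteq> 0" "f = Fract a b"
    unfolding num_den_def by auto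
qed

section \<open>Partial derivatives\<close>

lemma poly_partial_single: "poly_partial x (Poly_Mapping.single m c) =
    Poly_Mapping.single (m - Poly_Mapping.single x 1) (of_nat (Poly_Mapping.lookup m x) * c)"
  by (simp add: poly_partial_def)

lemma poly_partial_add: "poly_partial x (p + q) = poly_partial x p + poly_partial x q"
  unfolding poly_partial_def
  by (rule setsum_keys_plus_distrib) (simp_all add: single_add distrib_left)

text \<open>Subtraction of exponents is truncated, so it commutes with addition only if
  \<open>x\<close> occurs in \<open>m\<close>. If it does not occur, the coefficient in the
  derivative is 0 anyway.\<close>

lemma monom_diff_add:
  assumes "Poly_Mapping.lookup m x \<noteq> 0"
  shows "m - Poly_Mapping.single x 1 + m' = m + m' - Poly_Mapping.single x (1::nat)"
  by (rule poly_mapping_eqI)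
    (use assms in \<open>auto simp: lookup_add lookup_minus lookup_single when_def\<close>)

lemma poly_partial_mult: "poly_partial x (p * q) = poly_partial x p * q + p * poly_partial x q"
proof (induction p rule: poly_mapping_add_induct)
  case (single m c)
  show ?case
  proof (induction q rule: poly_mapping_add_induct)
    case (single m' c')
    define e where "e = Poly_Mapping.single x (1::nat)"
    have 1: "Poly_Mapping.single (m - e) (of_nat (Poly_Mapping.lookup m x) * c) *
        Poly_Mapping.single m' c' =
      Poly_Mapping.single (m + m' - e) (of_nat (Poly_Mapping.lookup m x) * c * c')"
      using monom_diff_add[of m x m']
      by (cases "Poly_Mapping.lookup m x = 0") (simp_all add: mult_single e_def)
    have 2: "Poly_Mapping.single m c * Poly_Mapping.single (m' - e)
        (of_nat (Poly_Mapping.lookup m' x) * c') =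
      Poly_Mapping.single (m + m' - e) (of_nat (Poly_Mapping.lookup m' x) * c * c')"
      using monom_diff_add[of m' x m]
      by (cases "Poly_Mapping.lookup m' x = 0")
        (simp_all add: mult_single e_def ac_simps)
    show ?case
      using 1 2 by (simp add: mult_single poly_partial_single lookup_add e_def single_add[symmetric]
          algebra_simps)
  next
    case (add q q')
    then show ?case by (simp add: poly_partial_add algebra_simps)
  qed
next
  case (add p p')
  then show ?case by (simp add: poly_partial_add algebra_simps)
qed

lemma poly_vars_partial: "poly_vars (poly_partial x p) \<subseteq> poly_vars p"
proof
  fix y assume "y \<in> poly_vars (poly_partial x p)"
  then obtain m where m: "m \<in> Poly_Mapping.keys (poly_partial x p)" "y \<in> Poly_Mapping.keys m"
    by (auto simp: poly_vars_def)
  have "m \<in> (\<Union>m\<in>Poly_Mapping.keys p. {m - Poly_Mapping.single x 1})"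
    using m(1) unfolding poly_partial_def
    by (auto dest!: subsetD[OF Poly_Mapping.keys_sum] split: if_splits)
  then obtain m' where m': "m' \<in> Poly_Mapping.keys p" "m = m' - Poly_Mapping.single x 1" by auto
  then have "y \<in> Poly_Mapping.keys m'"
    using m(2) by (auto simp: in_keys_iff lookup_minus)
  then show "y \<in> poly_vars p" using m' by (auto simp: poly_vars_def)
qed

text \<open>\<open>partial_deriv\<close> depends on the representation picked by
  \<open>num_den\<close>. Two representations are linked by the cross-multiplied equation
  \<open>eq\<close>; its derivative \<open>eq'\<close> shows that the quotient rule yields the same
  fraction for both.\<close>

lemma partial_deriv_Fract:
  assumes "poly_vars a \<subseteq> vars n" "poly_vars b \<subseteq> vars n" "b \<noteq> 0"
  shows "partial_deriv n x (Fract a b) = Fract (poly_partial x a * b - a * poly_partial x b) (b * b)"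
proof -
  obtain c d where cd: "num_den n (Fract a b) = (c, d)" by fastforce
  note spec = num_den_spec[OF ratfieldI[OF assms] cd]
  have eq: "a * d = c * b" using spec assms by (simp add: eq_fract)
  have eq': "poly_partial x a * d + a * poly_partial x d = poly_partial x c * b + c * poly_partial x b"
    using arg_cong[OF eq, of "poly_partial x"] by (simp add: poly_partial_mult)
  have "(c' * d - c * d') * (b * b) = (a' * b - a * b') * (d * d)"
    if "a * d = c * b" "a' * d + a * d' = c' * b + c * b'" for a' b' c' d' :: "'a mpoly"
  proof -
    have 1: "a' * d = c' * b + c * b' - a * d'"
      using that(2) by (simp add: eq_diff_eq)
    have "(a' * b - a * b') * (d * d) = (a' * d) * b * d - (a * d) * b' * d"
      by (simp add: algebra_simps)
    also have "\<dots> = c' * b * b * d + (c * b) * b' * d - (a * d) * d' * b - (a * d) * b' * d"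
      unfolding 1 by (simp add: algebra_simps)
    also have "\<dots> = (c' * d - c * d') * (b * b)"
      unfolding that(1) by (simp add: algebra_simps)
    finally show ?thesis by simp
  qed
  from this[OF eq eq'] have "(poly_partial x c * d - c * poly_partial x d) * (b * b) =
      (poly_partial x a * b - a * poly_partial x b) * (d * d)" .
  then show ?thesis
    using spec assms by (simp add: partial_deriv_def cd eq_fract)
qed

lemma partial_in [simp]: "f \<in> ratfield n \<Longrightarrow> partial_deriv n x f \<in> ratfield n"
proof (erule ratfieldE)
  fix a b :: "'a mpoly"
  assume *: "poly_vars a \<subseteq> vars n" "poly_vars b \<subseteq> vars n" "b \<noteq> 0" "f = Fract a b"
  have 1: "poly_vars (poly_partial x a * b) \<subseteq> vars n" "poly_vars (a * poly_partial x b) \<subseteq> vars n"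
    using poly_vars_mult[of "poly_partial x a" b] poly_vars_mult[of a "poly_partial x b"]
      poly_vars_partial[of x a] poly_vars_partial[of x b] * by blast+
  have "poly_vars (poly_partial x a * b - a * poly_partial x b) \<subseteq> vars n"
    using poly_vars_add[of "poly_partial x a * b" "- (a * poly_partial x b)"] 1
    by (simp del: Un_subset_iff) blast
  moreover have "poly_vars (b * b) \<subseteq> vars n"
    using poly_vars_mult[of b b] * by blast
  ultimately show ?thesis using * by (simp add: partial_deriv_Fract ratfieldI)
qed

text \<open>The rules are required on \<open>ratfield n\<close> alone, because
  \<open>num_den\<close> has a meaning only there.\<close>

definition derivation :: "nat \<Rightarrow> ('k::field_char_0 ratfun \<Rightarrow> 'k ratfun) \<Rightarrow> bool" where
  "derivation n d \<longleftrightarrow> (\<forall>f\<in>ratfield n. d f \<in> ratfield n) \<and> (\<forall>c. d (Const c) = 0) \<and>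
     (\<forall>f\<in>ratfield n. \<forall>g\<in>ratfield n. d (f + g) = d f + d g \<and> d (f * g) = d f * g + f * d g)"

lemma derivation_partial: "derivation n (partial_deriv n x :: 'k::field_char_0 ratfun \<Rightarrow> _)"
proof -
  have C: "partial_deriv n x (Const c :: 'k ratfun) = 0" for c
    unfolding Const_def using poly_partial_single[of x 0]
    by (simp add: partial_deriv_Fract poly_partial_single poly_partial_single[of x 0 1, simplified]
        Zero_fract_def)
  have "partial_deriv n x (f + g) = partial_deriv n x f + partial_deriv n x g \<and>
     partial_deriv n x (f * g) = partial_deriv n x f * g + f * partial_deriv n x g"
    if fg: "f \<in> ratfield n" "g \<in> ratfield n" for f g :: "'k ratfun"
  proof -
    obtain a b where ab: "poly_vars a \<subseteq> vars n" "poly_vars b \<subseteq> vars n" "b \<noteq> 0" "f = Fract a b"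
      using fg(1) by (rule ratfieldE)
    obtain c d where cd: "poly_vars c \<subseteq> vars n" "poly_vars d \<subseteq> vars n" "d \<noteq> 0" "g = Fract c d"
      using fg(2) by (rule ratfieldE)
    have *: "poly_vars (a * c) \<subseteq> vars n" "poly_vars (b * d) \<subseteq> vars n" "poly_vars (a * d + c * b) \<subseteq> vars n"
      using ab cd poly_vars_mult[of a c] poly_vars_mult[of b d] poly_vars_mult[of a d]
        poly_vars_mult[of c b] poly_vars_add[of "a * d" "c * b"] by blast+
    show ?thesis
      using ab cd * by (simp add: partial_deriv_Fract eq_fract poly_partial_add poly_partial_mult algebra_simps)
  qed
  then show ?thesis by (simp add: derivation_def C)
qed

lemma partial_Var: "x \<in> vars n \<Longrightarrow> partial_deriv n y (Var x) = (if x = y then 1 else 0)"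
proof -
  assume x: "x \<in> vars n"
  have "poly_vars (xpoly x :: 'a mpoly) \<subseteq> vars n" using x by (simp only: poly_vars_var) simp
  moreover have "poly_partial y (1 :: 'a mpoly) = 0"
    using poly_partial_single[of y 0 1] by simp
  ultimately show ?thesis
    unfolding Var_def by (subst partial_deriv_Fract)
      (auto simp: poly_partial_single One_fract_def Zero_fract_def lookup_single)
qed

context
  fixes n :: nat and d :: "'k::field_char_0 ratfun \<Rightarrow> 'k ratfun"
  assumes d: "derivation n d"
begin

lemma derivation_in: "f \<in> ratfield n \<Longrightarrow> d f \<in> ratfield n"
  using d by (simp add: derivation_def)

lemma derivation_Const: "d (Const c) = 0"
  using d by (simp add: derivation_def)

lemma derivation_of_int: "d (of_int c) = 0"
  using derivation_Const[of "of_int c"] by (simp add: Const_of_int)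

lemma derivation_0: "d 0 = 0" and derivation_1: "d 1 = 0" and derivation_numeral: "d (numeral v) = 0"
  using derivation_of_int[of 0] derivation_of_int[of 1] derivation_of_int[of "numeral v"] by simp_all

lemma derivation_add: "f \<in> ratfield n \<Longrightarrow> g \<in> ratfield n \<Longrightarrow> d (f + g) = d f + d g"
  and derivation_mult: "f \<in> ratfield n \<Longrightarrow> g \<in> ratfield n \<Longrightarrow> d (f * g) = d f * g + f * d g"
  using d by (simp_all add: derivation_def)

lemma derivation_uminus: "f \<in> ratfield n \<Longrightarrow> d (- f) = - d f"
  using derivation_add[of f "- f"] by (simp add: derivation_0 eq_neg_iff_add_eq_0 add.commute)

lemma derivation_diff: "f \<in> ratfield n \<Longrightarrow> g \<in> ratfield n \<Longrightarrow> d (f - g) = d f - d g"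
  using derivation_add[of f "- g"] by (simp add: derivation_uminus)

lemma derivation_inverse:
  assumes "f \<in> ratfield n" "f \<noteq> 0"
  shows "d (inverse f) = - d f / f ^ 2"
proof -
  have "d f * inverse f + f * d (inverse f) = 0"
    using derivation_mult[of f "inverse f"] assms by (simp add: derivation_1)
  then show ?thesis using assms(2) by (simp add: field_simps power2_eq_square add_eq_0_iff)
qed

lemma derivation_divide:
  "f \<in> ratfield n \<Longrightarrow> g \<in> ratfield n \<Longrightarrow> g \<noteq> 0 \<Longrightarrow> d (f / g) = (d f * g - f * d g) / g ^ 2"
  by (simp add: divide_inverse derivation_mult derivation_inverse)
    (simp add: field_simps power2_eq_square)

lemma derivation_sum: "\<forall>i\<in>A. f i \<in> ratfield n \<Longrightarrow> d (\<Sum>i\<in>A. f i) = (\<Sum>i\<in>A. d (f i))"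
  by (induction A rule: infinite_finite_induct) (simp_all add: derivation_0 derivation_add)

lemma derivation_power2: "f \<in> ratfield n \<Longrightarrow> d (f ^ 2) = 2 * f * d f"
  by (simp add: power2_eq_square derivation_mult)

lemmas derivation_simps = derivation_in derivation_Const derivation_0 derivation_1
  derivation_numeral derivation_add derivation_mult derivation_uminus derivation_diff
  derivation_divide derivation_sum derivation_power2

end

section \<open>Endomorphisms of the field of rational functions\<close>

text \<open>Endomorphisms over the ground field. The rules are again confined to
  \<open>ratfield n\<close>, outside of which \<open>ratfun_subst\<close> is
  \<open>undefined\<close>.\<close>

definition kend :: "nat \<Rightarrow> ('k::field_char_0 ratfun \<Rightarrow> 'k ratfun) \<Rightarrow> bool" where
  "kend n \<phi> \<longleftrightarrow> (\<forall>f\<in>ratfield n. \<phi> f \<in> ratfield n) \<and> (\<forall>c. \<phi> (Const c) = Const c) \<and>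
     (\<forall>f\<in>ratfield n. \<forall>g\<in>ratfield n. \<phi> (f + g) = \<phi> f + \<phi> g \<and> \<phi> (f * g) = \<phi> f * \<phi> g)"

context
  fixes n :: nat and \<phi> :: "'k::field_char_0 ratfun \<Rightarrow> 'k ratfun"
  assumes \<phi>: "kend n \<phi>"
begin

lemma kend_in: "f \<in> ratfield n \<Longrightarrow> \<phi> f \<in> ratfield n"
  using \<phi> by (simp add: kend_def)

lemma kend_Const: "\<phi> (Const c) = Const c"
  using \<phi> by (simp add: kend_def)

lemma kend_of_int: "\<phi> (of_int c) = of_int c"
  using kend_Const[of "of_int c"] by (simp add: Const_of_int)

lemma kend_0: "\<phi> 0 = 0" and kend_1: "\<phi> 1 = 1" and kend_numeral: "\<phi> (numeral v) = numeral v"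
  using kend_of_int[of 0] kend_of_int[of 1] kend_of_int[of "numeral v"] by simp_all

lemma kend_add: "f \<in> ratfield n \<Longrightarrow> g \<in> ratfield n \<Longrightarrow> \<phi> (f + g) = \<phi> f + \<phi> g"
  and kend_mult: "f \<in> ratfield n \<Longrightarrow> g \<in> ratfield n \<Longrightarrow> \<phi> (f * g) = \<phi> f * \<phi> g"
  using \<phi> by (simp_all add: kend_def)

lemma kend_uminus: "f \<in> ratfield n \<Longrightarrow> \<phi> (- f) = - \<phi> f"
  using kend_add[of f "- f"] by (simp add: kend_0 eq_neg_iff_add_eq_0 add.commute)

lemma kend_diff: "f \<in> ratfield n \<Longrightarrow> g \<in> ratfield n \<Longrightarrow> \<phi> (f - g) = \<phi> f - \<phi> g"
  using kend_add[of f "- g"] by (simp add: kend_uminus)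

lemma kend_inverse:
  assumes "f \<in> ratfield n"
  shows "\<phi> (inverse f) = inverse (\<phi> f)"
proof (cases "f = 0")
  case False
  then have "\<phi> f * \<phi> (inverse f) = 1"
    using kend_mult[of f "inverse f"] assms by (simp add: kend_1)
  then show ?thesis by (simp add: inverse_unique)
qed (simp add: kend_0)

lemma kend_divide: "f \<in> ratfield n \<Longrightarrow> g \<in> ratfield n \<Longrightarrow> \<phi> (f / g) = \<phi> f / \<phi> g"
  by (simp add: divide_inverse kend_mult kend_inverse)

lemma kend_sum: "\<forall>i\<in>A. f i \<in> ratfield n \<Longrightarrow> \<phi> (\<Sum>i\<in>A. f i) = (\<Sum>i\<in>A. \<phi> (f i))"
  by (induction A rule: infinite_finite_induct) (simp_all add: kend_0 kend_add)

lemma kend_power: "f \<in> ratfield n \<Longrightarrow> \<phi> (f ^ k) = \<phi> f ^ k"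
  by (induction k) (simp_all add: kend_1 kend_mult)

lemma kend_powi: "f \<in> ratfield n \<Longrightarrow> \<phi> (f powi k) = \<phi> f powi k"
  by (simp add: power_int_def kend_power kend_inverse)

lemma kend_eq_0_iff: "f \<in> ratfield n \<Longrightarrow> \<phi> f = 0 \<longleftrightarrow> f = 0"
proof
  assume "f \<in> ratfield n" "\<phi> f = 0"
  then have "\<phi> (f * inverse f) = 0" by (simp only: kend_mult inverse_in) simp
  then show "f = 0" using kend_1 by (cases "f = 0") auto
qed (simp add: kend_0)

lemma kend_inj: "f \<in> ratfield n \<Longrightarrow> g \<in> ratfield n \<Longrightarrow> \<phi> f = \<phi> g \<Longrightarrow> f = g"
  using kend_eq_0_iff[of "f - g"] by (simp add: kend_diff)

lemmas kend_simps = kend_in kend_Const kend_0 kend_1 kend_numeral kend_add kend_mult kend_uminus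
  kend_diff kend_inverse kend_divide kend_sum kend_power kend_powi kend_eq_0_iff

lemma kend_poly: "poly_vars p \<subseteq> vars n \<Longrightarrow> \<phi> (Fract p 1) = poly_eval (\<phi> \<circ> Var) p"
proof -
  assume p: "poly_vars p \<subseteq> vars n"
  have x: "x \<in> vars n" if "m \<in> Poly_Mapping.keys p" "x \<in> Poly_Mapping.keys m" for m x
    using p that by (auto simp: poly_vars_def)
  have mon: "(monom_eval Var m :: 'k ratfun) \<in> ratfield n \<and> \<phi> (monom_eval Var m) = monom_eval (\<phi> \<circ> Var) m"
    if "m \<in> Poly_Mapping.keys p" for m
  proof -
    have "(\<Prod>x\<in>A. Var x ^ Poly_Mapping.lookup m x :: 'k ratfun) \<in> ratfield n \<and>
      \<phi> (\<Prod>x\<in>A. Var x ^ Poly_Mapping.lookup m x) = (\<Prod>x\<in>A. \<phi> (Var x) ^ Poly_Mapping.lookup m x)"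
      if "finite A" "A \<subseteq> vars n" for A
      using that by (induction A rule: finite_induct)
        (simp_all add: kend_1 kend_mult kend_power Var_in)
    from this[of "Poly_Mapping.keys m"] show ?thesis using x[OF that]
      by (simp add: monom_eval_def subsetI)
  qed
  have "\<phi> (poly_eval Var p) = poly_eval (\<phi> \<circ> Var) p"
    unfolding poly_eval_alt using mon by (simp add: kend_simps cong: sum.cong)
  then show ?thesis by (simp add: poly_eval_Var)
qed

text \<open>The value of the endomorphism at \<open>f\<close> involves no choice of a
  representation, so it equals the quotient of the evaluations for whichever one
  \<open>num_den\<close> picks. All reflections are identified with conjugates of r_0 in this
  way.\<close>

lemma ratfun_subst_eq:
  assumes \<sigma>: "\<And>x. x \<in> vars n \<Longrightarrow> \<phi> (Var x) = \<sigma> x" and f: "f \<in> ratfield n"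
  shows "ratfun_subst n \<sigma> f = \<phi> f"
proof -
  obtain a b where ab: "num_den n f = (a, b)" by fastforce
  note spec = num_den_spec[OF f ab]
  have eq: "poly_eval \<sigma> p = \<phi> (Fract p 1)" if p: "poly_vars p \<subseteq> vars n" for p
  proof -
    have "monom_eval \<sigma> m = monom_eval (\<phi> \<circ> Var) m" if "m \<in> Poly_Mapping.keys p" for m
      unfolding monom_eval_def using p that by (intro prod.cong) (auto simp: \<sigma>[symmetric] poly_vars_def)
    then show ?thesis using p by (simp add: kend_poly poly_eval_alt)
  qed
  have "f = Fract a 1 / Fract b 1" using spec by simp
  moreover have "Fract a 1 \<in> ratfield n" "Fract b 1 \<in> ratfield n" using spec by (auto intro: ratfieldI)
  moreover have "ratfun_subst n \<sigma> f = poly_eval \<sigma> a / poly_eval \<sigma> b"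
    using f ab by (simp add: ratfun_subst_def)
  ultimately show ?thesis
    using spec by (simp only: eq kend_divide)
qed

end

lemma kend_eqI:
  assumes "kend n \<phi>" "kend n \<psi>" "\<And>x. x \<in> vars n \<Longrightarrow> \<phi> (Var x) = \<psi> (Var x)" "f \<in> ratfield n"
  shows "\<phi> f = \<psi> f"
  using assms(4)
  by (induction rule: ratfield_induct) (simp_all add: assms(1-3) kend_simps[OF assms(1)] kend_simps[OF assms(2)])

lemma kend_comp: "kend n \<phi> \<Longrightarrow> kend n \<psi> \<Longrightarrow> kend n (\<phi> \<circ> \<psi>)"
  by (simp add: kend_def)

lemma kend_id: "kend n id"
  by (simp add: kend_def)

lemma kend_funpow: "kend n \<phi> \<Longrightarrow> kend n (\<phi> ^^ k)"
  by (induction k) (simp_all add: kend_comp kend_id)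

text \<open>
  Unlike \<open>ratfun_subst\<close>, this makes sense without knowing that the images are algebraically
  independent; it is what the algebraic independence of the images is derived from.
\<close>

definition local_subst ::
    "(pvar \<Rightarrow> 'k::field_char_0 ratfun) \<Rightarrow> 'k ratfun \<Rightarrow> 'k ratfun \<Rightarrow> bool" where
  "local_subst \<sigma> f g \<longleftrightarrow>
     (\<exists>a b. f = Fract a b \<and> poly_eval \<sigma> b \<noteq> 0 \<and> g = poly_eval \<sigma> a / poly_eval \<sigma> b)"

lemma local_substI:
  "poly_eval \<sigma> b \<noteq> 0 \<Longrightarrow> g = poly_eval \<sigma> a / poly_eval \<sigma> b \<Longrightarrow> local_subst \<sigma> (Fract a b) g"
  by (auto simp: local_subst_def)

lemma local_substE:
  assumes "local_subst \<sigma> f g"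
  obtains a b where "f = Fract a b" "b \<noteq> 0" "poly_eval \<sigma> b \<noteq> 0" "g = poly_eval \<sigma> a / poly_eval \<sigma> b"
  using assms by (auto simp: local_subst_def) (metis poly_eval_0)

text \<open>A fraction equal to 0 has numerator 0. This much uniqueness suffices to refute a
  polynomial relation: if it held, every specialization defined at it would give 0.\<close>

lemma local_subst_0: "local_subst \<sigma> 0 g \<Longrightarrow> g = 0"
  by (erule local_substE) (simp, simp add: Zero_fract_def eq_fract)

lemma local_subst_Const: "local_subst \<sigma> (Const c) (Const c)"
  unfolding Const_def by (rule local_substI) (simp_all add: Const_def[symmetric])

lemma local_subst_1: "local_subst \<sigma> 1 1"
  using local_subst_Const[of \<sigma> 1] by simp

lemma local_subst_Var: "local_subst \<sigma> (Var x) (\<sigma> x)"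
  unfolding Var_def by (rule local_substI) simp_all

lemma local_subst_Var': "\<sigma> x = y \<Longrightarrow> local_subst \<sigma> (Var x) y"
  using local_subst_Var by blast

lemma local_subst_add:
  assumes "local_subst \<sigma> f g" "local_subst \<sigma> f' g'"
  shows "local_subst \<sigma> (f + f') (g + g')"
  using assms(1)
proof (rule local_substE)
  fix a b assume 1: "f = Fract a b" "b \<noteq> 0" "poly_eval \<sigma> b \<noteq> 0" "g = poly_eval \<sigma> a / poly_eval \<sigma> b"
  from assms(2) show ?thesis
  proof (rule local_substE)
    fix a' b' assume "f' = Fract a' b'" "b' \<noteq> 0" "poly_eval \<sigma> b' \<noteq> 0" "g' = poly_eval \<sigma> a' / poly_eval \<sigma> b'"
    with 1 show ?thesis
      by (auto intro!: local_substI simp: poly_eval_add poly_eval_mult field_simps)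
  qed
qed

lemma local_subst_mult:
  assumes "local_subst \<sigma> f g" "local_subst \<sigma> f' g'"
  shows "local_subst \<sigma> (f * f') (g * g')"
  using assms(1)
proof (rule local_substE)
  fix a b assume 1: "f = Fract a b" "b \<noteq> 0" "poly_eval \<sigma> b \<noteq> 0" "g = poly_eval \<sigma> a / poly_eval \<sigma> b"
  from assms(2) show ?thesis
  proof (rule local_substE)
    fix a' b' assume "f' = Fract a' b'" "b' \<noteq> 0" "poly_eval \<sigma> b' \<noteq> 0" "g' = poly_eval \<sigma> a' / poly_eval \<sigma> b'"
    with 1 show ?thesis
      by (auto intro!: local_substI simp: poly_eval_mult)
  qed
qed

lemma local_subst_inverse:
  assumes "local_subst \<sigma> f g" "g \<noteq> 0"
  shows "local_subst \<sigma> (inverse f) (inverse g)"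
  using assms(1)
proof (rule local_substE)
  fix a b assume 1: "f = Fract a b" "b \<noteq> 0" "poly_eval \<sigma> b \<noteq> 0" "g = poly_eval \<sigma> a / poly_eval \<sigma> b"
  with assms(2) show ?thesis
    by (auto intro!: local_substI simp: poly_eval_mult)
qed

lemma local_subst_uminus: "local_subst \<sigma> f g \<Longrightarrow> local_subst \<sigma> (- f) (- g)"
  using local_subst_mult[OF local_subst_Const[of \<sigma> "- 1"]] by (fastforce simp: Const_minus)

lemma local_subst_diff:
  "local_subst \<sigma> f g \<Longrightarrow> local_subst \<sigma> f' g' \<Longrightarrow> local_subst \<sigma> (f - f') (g - g')"
  using local_subst_add[OF _ local_subst_uminus, of \<sigma> f g f' g'] by simp

lemma local_subst_divide:
  "local_subst \<sigma> f g \<Longrightarrow> local_subst \<sigma> f' g' \<Longrightarrow> g' \<noteq> 0 \<Longrightarrow> local_subst \<sigma> (f / f') (g / g')"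
  using local_subst_mult[OF _ local_subst_inverse, of \<sigma> f g f' g'] by (simp add: divide_inverse)

lemma local_subst_sum:
  "(\<And>i. i \<in> A \<Longrightarrow> local_subst \<sigma> (f i) (g i)) \<Longrightarrow> local_subst \<sigma> (\<Sum>i\<in>A. f i) (\<Sum>i\<in>A. g i)"
  using local_subst_Const[of \<sigma> 0]
  by (induction A rule: infinite_finite_induct) (simp_all add: local_subst_add)

lemma local_subst_prod:
  "(\<And>i. i \<in> A \<Longrightarrow> local_subst \<sigma> (f i) (g i)) \<Longrightarrow> local_subst \<sigma> (\<Prod>i\<in>A. f i) (\<Prod>i\<in>A. g i)"
  by (induction A rule: infinite_finite_induct) (simp_all add: local_subst_mult local_subst_1)

lemma local_subst_power: "local_subst \<sigma> f g \<Longrightarrow> local_subst \<sigma> (f ^ k) (g ^ k)"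
  by (induction k) (simp_all add: local_subst_mult local_subst_1)

text \<open>The left inverse \<sigma> is itself known only as a partially defined substitution. It
  still shows that the images \<tau> are algebraically independent, so that no denominator is lost
  and the choice made by \<open>num_den\<close> does not matter.\<close>

lemma kend_ratfun_subst:
  fixes \<tau> :: "pvar \<Rightarrow> 'k::field_char_0 ratfun"
  assumes \<tau>: "\<And>x. x \<in> vars n \<Longrightarrow> \<tau> x \<in> ratfield n"
    and left_inv: "\<And>x. x \<in> vars n \<Longrightarrow> local_subst \<sigma> (\<tau> x) (Var x)"
  shows "kend n (ratfun_subst n \<tau>)" "\<And>x. x \<in> vars n \<Longrightarrow> ratfun_subst n \<tau> (Var x) = \<tau> x"
proof -
  \<comment> \<open>Substituting \<sigma> into the value of \<open>p\<close> at \<tau> gives back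
    \<open>p\<close>, so the value vanishes for \<open>p = 0\<close> only.\<close>
  have inj: "poly_eval \<tau> p \<noteq> 0" if p: "poly_vars p \<subseteq> vars n" "p \<noteq> 0" for p
  proof
    assume "poly_eval \<tau> p = 0"
    have "local_subst \<sigma> (poly_eval \<tau> p) (poly_eval Var p)"
      unfolding poly_eval_def
      by (intro local_subst_sum local_subst_mult local_subst_Const local_subst_prod
          local_subst_power left_inv) (use p in \<open>auto simp: poly_vars_def\<close>)
    then have "Fract p 1 = 0"
      using \<open>poly_eval \<tau> p = 0\<close> by (simp add: poly_eval_Var local_subst_0)
    then show False using p(2) by (simp add: Zero_fract_def eq_fract)
  qed
  have eval: "ratfun_subst n \<tau> (Fract a b) = poly_eval \<tau> a / poly_eval \<tau> b"
    if ab: "poly_vars a \<subseteq> vars n" "poly_vars b \<subseteq> vars n" "b \<noteq> 0" for a b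
  proof -
    obtain c d where cd: "num_den n (Fract a b) = (c, d)" by fastforce
    note spec = num_den_spec[OF ratfieldI[OF ab] cd]
    have "a * d = c * b" using spec ab by (simp add: eq_fract)
    then have "poly_eval \<tau> a * poly_eval \<tau> d = poly_eval \<tau> c * poly_eval \<tau> b"
      using poly_eval_mult by metis
    then have "poly_eval \<tau> c / poly_eval \<tau> d = poly_eval \<tau> a / poly_eval \<tau> b"
      using spec ab inj by (simp add: frac_eq_eq)
    moreover have "ratfun_subst n \<tau> (Fract a b) = poly_eval \<tau> c / poly_eval \<tau> d"
      using cd ratfieldI[OF ab] by (simp add: ratfun_subst_def)
    ultimately show ?thesis by simp
  qed
  have poly_in: "poly_eval \<tau> p \<in> ratfield n" if "poly_vars p \<subseteq> vars n" for p
    by (rule poly_eval_in_generated) (use that \<tau> in auto)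
  have C: "ratfun_subst n \<tau> (Const c) = Const c" for c
    using eval[of "cpoly c" 1] by (simp add: Const_def)
  have ops: "ratfun_subst n \<tau> (f + g) = ratfun_subst n \<tau> f + ratfun_subst n \<tau> g \<and>
      ratfun_subst n \<tau> (f * g) = ratfun_subst n \<tau> f * ratfun_subst n \<tau> g"
    if fg: "f \<in> ratfield n" "g \<in> ratfield n" for f g
  proof -
    obtain a b where ab: "poly_vars a \<subseteq> vars n" "poly_vars b \<subseteq> vars n" "b \<noteq> 0" "f = Fract a b"
      using fg(1) by (rule ratfieldE)
    obtain c d where cd: "poly_vars c \<subseteq> vars n" "poly_vars d \<subseteq> vars n" "d \<noteq> 0" "g = Fract c d"
      using fg(2) by (rule ratfieldE)
    have *: "poly_vars (a * c) \<subseteq> vars n" "poly_vars (b * d) \<subseteq> vars n" "poly_vars (a * d + c * b) \<subseteq> vars n"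
      using ab cd poly_vars_mult[of a c] poly_vars_mult[of b d] poly_vars_mult[of a d]
        poly_vars_mult[of c b] poly_vars_add[of "a * d" "c * b"] by blast+
    show ?thesis
      using ab cd * inj by (simp add: eval poly_eval_add poly_eval_mult field_simps)
  qed
  have cl: "ratfun_subst n \<tau> f \<in> ratfield n" if "f \<in> ratfield n" for f
    using that by (elim ratfieldE) (simp add: eval poly_in)
  show "kend n (ratfun_subst n \<tau>)" using C ops cl by (simp add: kend_def)
  show "ratfun_subst n \<tau> (Var x) = \<tau> x" if "x \<in> vars n" for x
    using eval[of "xpoly x" 1] that poly_vars_var[of x, where ?'a = 'k] by (simp add: Var_def)
qed

section \<open>Coordinates on the field\<close>

lemma tv_in [simp]: "tv \<in> ratfield n"
  and etav_in [simp]: "etav \<in> ratfield n"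
  and pv_in [simp]: "1 \<le> i \<Longrightarrow> i \<le> n \<Longrightarrow> pv i \<in> ratfield n"
  and VarQ_in [simp]: "1 \<le> i \<Longrightarrow> i \<le> n \<Longrightarrow> Var (VQ i) \<in> ratfield n"
  and VarAlpha_in [simp]: "1 \<le> j \<Longrightarrow> j \<le> 2*n+1 \<Longrightarrow> Var (VAlpha j) \<in> ratfield n"
  by (auto intro!: Var_in simp: vars_def)

lemma qv_in [simp]: "1 \<le> i \<Longrightarrow> i \<le> n + 1 \<Longrightarrow> qv n i \<in> ratfield n"
  by (auto simp: qv_def)

lemma al_in [simp]: "i \<le> 2*n+1 \<Longrightarrow> al n i \<in> ratfield n"
  by (auto simp: al_def simp del: sum.cl_ivl_Suc)

lemma qv_Var: "i \<le> n \<Longrightarrow> qv n i = Var (VQ i)"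
  by (simp add: qv_def)

lemma al_Var: "1 \<le> i \<Longrightarrow> al n i = Var (VAlpha i)"
  by (simp add: al_def)

lemma sum_al: "(\<Sum>k=0..2*n+1. al n k) = 1"
  by (simp add: sum.atLeast_Suc_atMost al_def del: sum.cl_ivl_Suc)

lemma vars_cases [consumes 1, case_names VQ VP VT VEta VAlpha]:
  assumes "x \<in> vars n"
  obtains j where "x = VQ j" "1 \<le> j" "j \<le> n" | j where "x = VP j" "1 \<le> j" "j \<le> n"
    | "x = VT" | "x = VEta" | j where "x = VAlpha j" "1 \<le> j" "j \<le> 2*n+1"
  using assms by (auto simp: vars_def)

lemma partial_coords [simp]:
  "1 \<le> i \<Longrightarrow> i \<le> n \<Longrightarrow> partial_deriv n y (pv i) = (if y = VP i then 1 else 0)"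
  "partial_deriv n y tv = (if y = VT then 1 else 0)"
  "partial_deriv n y etav = (if y = VEta then 1 else 0)"
  "1 \<le> i \<Longrightarrow> i \<le> n + 1 \<Longrightarrow>
    partial_deriv n y (qv n i) = (if i = n + 1 then if y = VT then 1 else 0 else if y = VQ i then 1 else 0)"
  "1 \<le> j \<Longrightarrow> j \<le> 2*n+1 \<Longrightarrow> partial_deriv n y (Var (VAlpha j)) = (if y = VAlpha j then 1 else 0)"
  by (auto simp: partial_Var vars_def qv_def)

lemma partial_al [simp]:
  assumes "i \<le> 2*n+1" "\<And>j. y \<noteq> VAlpha j"
  shows "partial_deriv n y (al n i) = 0"
  using assms
  by (auto simp: al_def derivation_simps[OF derivation_partial] simp del: sum.cl_ivl_Suc)

text \<open>A cheap criterion for denominators: one nonvanishing partial derivative, usually with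
  respect to eta, is enough.\<close>

lemma nonzero_by_partial:
  "partial_deriv n x f \<noteq> 0 \<Longrightarrow> f \<noteq> 0"
  using derivation_0[OF derivation_partial] by auto

lemma tv_nonzero [simp]: "tv \<noteq> 0"
  by (rule nonzero_by_partial[of 0 VT]) simp

lemma tv_neq_1 [simp]: "tv \<noteq> 1" "1 \<noteq> tv"
  using nonzero_by_partial[of 0 VT "tv - 1"]
  by (auto simp: derivation_simps[OF derivation_partial])

lemma tv_minus_1_neq_0 [simp]: "tv - 1 \<noteq> 0" "1 - tv \<noteq> 0"
  by (simp_all add: field_simps)

text \<open>The common denominator of the images of the q_i under the rotation; divided by t - 1 it
  is the lattice term R_0 = x_0.\<close>

definition Phi :: "nat \<Rightarrow> 'k::field_char_0 ratfun" where
  "Phi n = (\<Sum>j=1..n. (qv n j - tv) * pv j) + etav"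

lemma Phi_in [simp]: "Phi n \<in> ratfield n"
  by (simp add: Phi_def)

lemma Phi_nonzero [simp]: "Phi n \<noteq> 0"
  by (rule nonzero_by_partial[of n VEta])
    (simp add: Phi_def derivation_simps[OF derivation_partial])

section \<open>The lattice of coordinates\<close>

abbreviation per :: "nat \<Rightarrow> int" where
  "per n \<equiv> 2 * int n + 2"

text \<open>Multiplier of the sequence over one period. The value t at odd indices encodes q_{n+1} =
  t q_0 with q_0 = 1; even terms carry the inverse, as for a gauge factor.\<close>

definition qfac :: "int \<Rightarrow> 'k::field_char_0 ratfun" where
  "qfac k = (if odd k then tv else 1 / tv)"

text \<open>Used for $-1 \le r \le 2n$ only, one period of the sequence \<open>lat n\<close>.\<close>

definition lat_base :: "nat \<Rightarrow> int \<Rightarrow> 'k::field_char_0 ratfun" where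
  "lat_base n r =
     (if odd r then if r = - 1 then 1 else qv n (nat ((r + 1) div 2))
      else Phi n / (tv - 1) + (\<Sum>j=1..nat (r div 2). pv j))"

text \<open>The fundamental window starts at -1, which explains the shifts by 1 inside
  \<open>div\<close> and \<open>mod\<close>: it begins with the normalized term x_{-1} = q_0 =
  1.\<close>

definition lat :: "nat \<Rightarrow> int \<Rightarrow> 'k::field_char_0 ratfun" where
  "lat n k = qfac k powi ((k + 1) div per n) * lat_base n ((k + 1) mod per n - 1)"

definition par :: "nat \<Rightarrow> int \<Rightarrow> 'k::field_char_0 ratfun" where
  "par n k = al n (nat (k mod per n))"

definition qper :: "nat \<Rightarrow> (int \<Rightarrow> 'k::field_char_0 ratfun) \<Rightarrow> bool" where
  "qper n A \<longleftrightarrow> (\<forall>k. A (k + per n) = qfac k * A k)"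

lemma qfac_in [simp]: "qfac k \<in> ratfield n"
  by (simp add: qfac_def)

lemma qfac_nonzero [simp]: "qfac k \<noteq> 0"
  by (simp add: qfac_def)

lemma qfac_neq_1: "qfac k \<noteq> 1"
  by (simp add: qfac_def)

lemma qfac_shift [simp]: "qfac (k + per n) = qfac k" "qfac (k + 2) = qfac k"
    "qfac (k + 1) = 1 / qfac k" "qfac (k - 1) = 1 / qfac k"
  by (simp_all add: qfac_def)

lemma qfac_mod: "qfac (k + per n * q) = qfac k"
  by (simp add: qfac_def)

lemma qperD: "qper n A \<Longrightarrow> A (k + per n) = qfac k * A k"
  by (simp add: qper_def)

lemma qper_mult:
  assumes "qper n A"
  shows "A (k + per n * q) = qfac k powi q * A k"
proof (induction q rule: int_induct[where k = 0])
  case base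
  then show ?case by simp
next
  case (step1 i)
  have "A (k + per n * (i + 1)) = A (k + per n * i + per n)" by (simp add: algebra_simps)
  also have "\<dots> = qfac k * A (k + per n * i)" by (simp add: qperD[OF assms] qfac_mod)
  finally show ?case using step1 by (simp add: power_int_add)
next
  case (step2 i)
  have "A (k + per n * i) = A (k + per n * (i - 1) + per n)" by (simp add: algebra_simps)
  also have "\<dots> = qfac k * A (k + per n * (i - 1))" by (simp add: qperD[OF assms] qfac_mod)
  finally show ?case using step2 by (simp add: power_int_diff field_simps)
qed

lemma base_cases:
  assumes "- 1 \<le> r" "r \<le> 2 * int n"
  obtains i where "i \<le> n" "r = 2 * int i - 1" | i where "i \<le> n" "r = 2 * int i"
proof (cases "odd r")
  case True
  then have "r = 2 * int (nat ((r + 1) div 2)) - 1" using assms by (auto elim!: oddE)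
  then show ?thesis using assms by (intro that(1)[of "nat ((r + 1) div 2)"]) linarith+
next
  case False
  then have "r = 2 * int (nat (r div 2))" using assms by (auto elim!: evenE)
  then show ?thesis using assms by (intro that(2)[of "nat (r div 2)"]) linarith+
qed

lemma per_neq_0: "per n \<noteq> 0" by simp

lemma qper_lat: "qper n (lat n :: int \<Rightarrow> 'k::field_char_0 ratfun)"
proof -
  have "lat n (k + per n) = qfac k * (lat n k :: 'k ratfun)" for k
  proof -
    have "k + per n + 1 = k + 1 + per n" by simp
    then have "(k + per n + 1) div per n = (k + 1) div per n + 1"
      "(k + per n + 1) mod per n = (k + 1) mod per n"
      by (metis div_add_self2 zero_neq_one mod_add_self2 per_neq_0) (metis mod_add_self2 \<open>k + per n + 1 = k + 1 + per n\<close>)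
    then show ?thesis
      unfolding lat_def qfac_shift by (simp add: power_int_add)
  qed
  then show ?thesis by (simp add: qper_def)
qed

lemma lat_odd:
  assumes "i \<le> n + 1"
  shows "lat n (2 * int i - 1) = (if i = 0 then 1 else qv n i)"
proof (cases "i = n + 1")
  case True
  \<comment> \<open>Index 2n+1 lies one step beyond the window and is reached from -1 by one period;
    the multiplier t is the convention q_{n+1} = t.\<close>
  have "lat n (- 1 + per n) = (tv :: 'a ratfun)"
    by (subst qperD[OF qper_lat]) (simp add: lat_def lat_base_def qfac_def)
  then show ?thesis using True by (simp add: qv_def algebra_simps)
next
  case False
  then show ?thesis using assms by (simp add: lat_def lat_base_def)
qed

lemma lat_minus_1 [simp]: "lat n (- 1) = 1"
  using lat_odd[of 0 n] by simp

lemma lat_even: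
  assumes "i \<le> n"
  shows "lat n (2 * int i) = Phi n / (tv - 1) + (\<Sum>j=1..i. pv j)"
proof -
  have "(2 * int i + 1) div per n = 0" "(2 * int i + 1) mod per n = 2 * int i + 1"
    using assms by simp_all
  then show ?thesis by (simp add: lat_def lat_base_def)
qed

lemma lat_0: "lat n 0 = Phi n / (tv - 1)"
  using lat_even[of 0 n] by simp

lemma lat_diff:
  assumes "1 \<le> i" "i \<le> n"
  shows "lat n (2 * int i) - lat n (2 * int i - 2) = (pv i :: 'k::field_char_0 ratfun)"
proof -
  obtain m where "i = Suc m" using assms(1) by (cases i) auto
  then have "lat n (2 * int i - 2) = Phi n / (tv - 1) + (\<Sum>j=1..m. pv j :: 'k ratfun)"
    "lat n (2 * int i) = Phi n / (tv - 1) + (\<Sum>j=1..m. pv j) + (pv i :: 'k ratfun)"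
    using assms(2) lat_even[of i n, where ?'a = 'k] lat_even[of m n, where ?'a = 'k] by (simp_all add: add.assoc)
  then show ?thesis by simp
qed

lemma lat_base_in: "- 1 \<le> r \<Longrightarrow> r \<le> 2 * int n \<Longrightarrow> lat_base n r \<in> ratfield n"
  by (erule (1) base_cases) (auto simp: lat_base_def intro!: add_in sum_in)

lemma lat_in [simp]: "lat n k \<in> ratfield n"
proof -
  have "0 \<le> (k + 1) mod per n" "(k + 1) mod per n < per n" by auto
  then have "- 1 \<le> (k + 1) mod per n - 1" "(k + 1) mod per n - 1 \<le> 2 * int n" by linarith+
  then show ?thesis unfolding lat_def by (intro mult_in powi_in lat_base_in) simp_all
qed

lemma par_in [simp]: "par n k \<in> ratfield n"
proof -
  have "0 \<le> k mod per n" "k mod per n < per n" by simp_all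
  then have "nat (k mod per n) \<le> 2*n+1" by linarith
  then show ?thesis unfolding par_def by (rule al_in)
qed

lemma par_shift [simp]: "par n (k + per n) = par n k"
  by (simp add: par_def)

lemma par_mod: "par n (k + per n * q) = par n k"
  by (simp add: par_def)

lemma par_al: "i \<le> 2*n+1 \<Longrightarrow> par n (int i) = al n i"
  by (simp add: par_def nat_mod_as_int[symmetric] flip: of_nat_mod)

section \<open>Rotation\<close>

text \<open>Summation by parts: after exchanging the sums, p_k meets the differences of index at
  most k, and these telescope. It evaluates \<open>Phi n\<close> under the inverse rotation;
  \<open>abel_sum_lower\<close> does so under the rotation.\<close>

lemma abel_sum_upper:
  fixes p q :: "nat \<Rightarrow> 'a::comm_ring"
  shows "(\<Sum>j=1..n. (\<Sum>k=j..n. p k) * (q j - q (j - 1))) = (\<Sum>k=1..n. p k * (q k - q 0))"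
proof (induction n)
  case (Suc n)
  have tel: "(\<Sum>j=1..n. q j - q (j - 1)) = q n - q 0" for n
    by (induction n) simp_all
  have "(\<Sum>j=1..Suc n. (\<Sum>k=j..Suc n. p k) * (q j - q (j - 1))) =
      (\<Sum>j=1..n. ((\<Sum>k=j..n. p k) + p (Suc n)) * (q j - q (j - 1))) + p (Suc n) * (q (Suc n) - q n)"
  proof -
    have "(\<Sum>j=1..n. (\<Sum>k=j..Suc n. p k) * (q j - q (j - 1))) =
        (\<Sum>j=1..n. ((\<Sum>k=j..n. p k) + p (Suc n)) * (q j - q (j - 1)))"
      by (intro sum.cong) auto
    then show ?thesis by simp
  qed
  also have "\<dots> = (\<Sum>k=1..n. p k * (q k - q 0)) + p (Suc n) * (\<Sum>j=1..n. q j - q (j - 1))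
      + p (Suc n) * (q (Suc n) - q n)"
    using Suc by (simp add: distrib_right sum.distrib sum_distrib_left)
  also have "\<dots> = (\<Sum>k=1..Suc n. p k * (q k - q 0))"
    unfolding tel by (simp add: algebra_simps)
  finally show ?case .
qed simp

lemma abel_sum_lower:
  fixes p q :: "nat \<Rightarrow> 'a::comm_ring"
  shows "(\<Sum>j=1..n. (\<Sum>k=1..j. p k) * (q (j + 1) - q j)) = (\<Sum>k=1..n. p k * (q (n + 1) - q k))"
proof (induction n)
  case (Suc n)
  have "(\<Sum>k=1..Suc n. p k * (q (Suc n + 1) - q k)) =
      (\<Sum>k=1..n. p k * (q (n + 1) - q k)) + (\<Sum>k=1..Suc n. p k) * (q (Suc n + 1) - q (Suc n))"
  proof -
    have "(\<Sum>k=1..n. p k * (q (Suc n + 1) - q k)) =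
        (\<Sum>k=1..n. p k * (q (n + 1) - q k) + p k * (q (Suc n + 1) - q (Suc n)))"
      by (simp add: algebra_simps)
    then show ?thesis
      by (simp add: sum.distrib sum_distrib_right[symmetric] distrib_right)
  qed
  then show ?case using Suc by simp
qed simp

text \<open>The numerator differs from \<open>Phi n\<close> by having 1 instead of t in the first i
  terms. In this form the image is visibly the quotient of R_i by R_0.\<close>

lemma rot_image_VQ:
  assumes "i \<le> n"
  shows "rot_image n (VQ i) = 1 + (tv - 1) * (\<Sum>j=1..i. pv j) / (Phi n :: 'k::field_char_0 ratfun)"
proof -
  obtain m where n: "n = i + m" using assms le_Suc_ex by blast
  have "(\<Sum>j=1..n. (qv n j - tv) * pv j) = (\<Sum>j=1..i. (qv n j - tv) * pv j) +
      (\<Sum>j=i+1..n. (qv n j - tv) * (pv j :: 'k ratfun))"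
    unfolding n by (rule sum.ub_add_nat) simp
  moreover have "(\<Sum>j=1..i. (qv n j - 1) * pv j) =
      (\<Sum>j=1..i. (qv n j - tv) * pv j) + (tv - 1) * (\<Sum>j=1..i. pv j :: 'k ratfun)"
    by (simp add: sum_distrib_left algebra_simps flip: sum.distrib)
  ultimately have "(\<Sum>j=1..i. (qv n j - 1) * pv j) + (\<Sum>j=i+1..n. (qv n j - tv) * pv j) + etav =
      Phi n + (tv - 1) * (\<Sum>j=1..i. pv j :: 'k ratfun)"
    by (simp add: Phi_def)
  then show ?thesis
    using Phi_nonzero[of n, where ?'a = 'k]
    unfolding rot_image_def Let_def Phi_def[symmetric] by (simp add: add_divide_distrib)
qed

lemma rot_image_simps [simp]:
  "rot_image n (VP i) = (qv n (i + 1) - qv n i) * Phi n / (tv - 1)"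
  "rot_image n VT = 1 / tv"
  "rot_image n VEta = - etav"
  by (simp_all add: rot_image_def Let_def Phi_def)

lemma rot_image_VAlpha: "rot_image n (VAlpha i) = al n (if i = 2*n+1 then 0 else i + 1)"
  by (simp add: rot_image_def Let_def)

lemma rot_image_in: "x \<in> vars n \<Longrightarrow> rot_image n x \<in> ratfield n"
  by (erule vars_cases) (auto simp: rot_image_VQ rot_image_VAlpha)

definition q_ext :: "nat \<Rightarrow> nat \<Rightarrow> 'k::field_char_0 ratfun" where
  "q_ext n i = (if i = 0 then 1 else qv n i)"

text \<open>The value of \<open>Phi n\<close> under the inverse rotation, as computed in
  \<open>local_subst_rot_image\<close>; hence the denominator of the inverse formulas.\<close>

definition Psi :: "nat \<Rightarrow> 'k::field_char_0 ratfun" where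
  "Psi n = - (\<Sum>k=1..n. (qv n k - 1) * pv k) - etav"

lemma Psi_nonzero [simp]: "Psi n \<noteq> (0 :: 'k::field_char_0 ratfun)"
proof -
  have "partial_deriv n VEta (Psi n) = (- 1 :: 'k ratfun)"
    by (simp add: Psi_def derivation_simps[OF derivation_partial])
  then show ?thesis using nonzero_by_partial[of n VEta "Psi n :: 'k ratfun"] by simp
qed

text \<open>Found by solving the formulas of the rotation. Differences of consecutive images of the
  q_i isolate p_i, starting from q_0 = 1; the images of the p_i isolate q_{i+1} - q_i, which are
  summed downwards from q_{n+1} = t.\<close>

definition rot_inv_image :: "nat \<Rightarrow> pvar \<Rightarrow> 'k::field_char_0 ratfun" where
  "rot_inv_image n x = (case x of
     VQ i \<Rightarrow> 1 / tv - (1 / tv - 1) / Psi n * (\<Sum>k=i..n. pv k)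
   | VP i \<Rightarrow> (q_ext n i - q_ext n (i - 1)) * Psi n / (1 / tv - 1)
   | VT \<Rightarrow> 1 / tv
   | VEta \<Rightarrow> - etav
   | VAlpha i \<Rightarrow> al n (i - 1))"

lemma local_subst_rot_image:
  assumes "x \<in> vars n"
  shows "local_subst (rot_inv_image n) (rot_image n x) (Var x :: 'k::field_char_0 ratfun)"
proof -
  let ?\<sigma> = "rot_inv_image n :: pvar \<Rightarrow> 'k ratfun"
  have t: "local_subst ?\<sigma> tv (1 / tv)" and eta: "local_subst ?\<sigma> etav (- etav)"
    by (auto intro!: local_subst_Var' simp: rot_inv_image_def)
  have p: "local_subst ?\<sigma> (pv i) ((q_ext n i - q_ext n (i - 1)) * Psi n / (1 / tv - 1))" for i
    by (auto intro!: local_subst_Var' simp: rot_inv_image_def)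
  have q: "local_subst ?\<sigma> (qv n i) (1 / tv - (1 / tv - 1) / Psi n * (\<Sum>k=i..n. pv k))"
    if "i \<le> n + 1" for i
  proof (cases "i = n + 1")
    case True
    then show ?thesis using t by (simp add: qv_def)
  next
    case False
    then show ?thesis by (auto intro!: local_subst_Var' simp: qv_def rot_inv_image_def)
  qed
  have Phi: "local_subst ?\<sigma> (Phi n) (Psi n)"
  proof -
    have "local_subst ?\<sigma> (Phi n) ((\<Sum>j=1..n. (1 / tv - (1 / tv - 1) / Psi n * (\<Sum>k=j..n. pv k) - 1 / tv) *
        ((q_ext n j - q_ext n (j - 1)) * Psi n / (1 / tv - 1))) + - etav)"
      unfolding Phi_def by (intro local_subst_add local_subst_sum local_subst_mult local_subst_diff p q t eta) auto
    also have "(\<Sum>j=1..n. (1 / tv - (1 / tv - 1) / Psi n * (\<Sum>k=j..n. pv k) - 1 / tv) *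
        ((q_ext n j - q_ext n (j - 1)) * Psi n / (1 / tv - 1))) =
        - (\<Sum>j=1..n. (\<Sum>k=j..n. pv k) * (q_ext n j - q_ext n (j - 1) :: 'k ratfun))"
    proof -
      have "(a - b / c * s - a) * (d * c / b) = - (s * d)" if "b \<noteq> 0" "c \<noteq> 0" for a b c d s :: "'k ratfun"
        using that by (simp add: field_simps)
      from this[of "1 / tv - 1" "Psi n"] show ?thesis by (simp add: sum_negf)
    qed
    also have "(\<Sum>j=1..n. (\<Sum>k=j..n. pv k) * (q_ext n j - q_ext n (j - 1))) =
        (\<Sum>k=1..n. pv k * (q_ext n k - q_ext n 0 :: 'k ratfun))"
      by (rule abel_sum_upper)
    also have "\<dots> = (\<Sum>k=1..n. (qv n k - 1) * pv k)"
      by (intro sum.cong) (auto simp: q_ext_def)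
    finally show ?thesis by (simp add: Psi_def)
  qed
  \<comment> \<open>\<alpha>_0 is not a variable, so its image has to be computed from the images of
    the other parameters. These are \<alpha>_0, ..., \<alpha>_{2n}, and the relation leaves
    \<alpha>_{2n+1}.\<close>
  have al0: "local_subst ?\<sigma> (al n 0) (al n (2*n+1))"
  proof -
    have "local_subst ?\<sigma> (al n 0) (1 - (\<Sum>k=1..2*n+1. al n (k - 1)))"
      unfolding al_def[of n 0] if_P[OF HOL.refl]
      by (intro local_subst_diff local_subst_1 local_subst_sum local_subst_Var')
        (simp add: rot_inv_image_def)
    also have "(\<Sum>k=1..2*n+1. al n (k - 1)) = (\<Sum>k=0..2*n. al n k :: 'k ratfun)"
      using sum.shift_bounds_cl_Suc_ivl[of "\<lambda>k. al n (k - 1) :: 'k ratfun" 0 "2*n"] by simp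
    also have "\<dots> = 1 - al n (2*n+1)"
      using sum_al[of n, where ?'a = 'k] by (simp add: eq_diff_eq)
    finally show ?thesis by simp
  qed
  show ?thesis using assms
  proof (cases rule: vars_cases)
    case (VQ i)
    have "local_subst ?\<sigma> (rot_image n (VQ i)) (1 + (1 / tv - 1) * (\<Sum>j=1..i.
        (q_ext n j - q_ext n (j - 1)) * Psi n / (1 / tv - 1)) / Psi n)"
      unfolding rot_image_VQ[OF \<open>i \<le> n\<close>]
      by (intro local_subst_add local_subst_1 local_subst_divide local_subst_mult local_subst_sum
          local_subst_diff p t Phi Psi_nonzero)
    also have "(\<Sum>j=1..i. (q_ext n j - q_ext n (j - 1)) * Psi n / (1 / tv - 1)) =
        (\<Sum>j=1..i. q_ext n j - q_ext n (j - 1)) * (Psi n / (1 / tv - 1 :: 'k ratfun))"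
      by (simp only: sum_distrib_right times_divide_eq_right sum_divide_distrib)
    also have "(\<Sum>j=1..i. q_ext n j - q_ext n (j - 1)) = q_ext n i - (q_ext n 0 :: 'k ratfun)"
      by (induction i) simp_all
    also have "1 + (1 / tv - 1) * ((q_ext n i - q_ext n 0) * (Psi n / (1 / tv - 1))) / Psi n =
        (q_ext n i :: 'k ratfun)"
    proof -
      have "1 + b * ((d - 1) * (c / b)) / c = d" if "b \<noteq> 0" "c \<noteq> 0" for b c d :: "'k ratfun"
        using that by simp
      from this[of "1 / tv - 1" "Psi n"] show ?thesis by (simp add: q_ext_def)
    qed
    finally show ?thesis using VQ by (simp add: q_ext_def qv_def)
  next
    case (VP i)
    have "local_subst ?\<sigma> (rot_image n (VP i)) (((1 / tv - (1 / tv - 1) / Psi n * (\<Sum>k=i+1..n. pv k)) -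
        (1 / tv - (1 / tv - 1) / Psi n * (\<Sum>k=i..n. pv k))) * Psi n / (1 / tv - 1))"
      unfolding rot_image_simps using VP
      by (intro local_subst_1 local_subst_divide local_subst_mult
          local_subst_diff q t Phi) auto
    also have "(\<Sum>k=i..n. pv k) = pv i + (\<Sum>k=i+1..n. pv k :: 'k ratfun)"
      using VP by (simp add: sum.atLeast_Suc_atMost)
    also have "((1 / tv - (1 / tv - 1) / Psi n * (\<Sum>k=i+1..n. pv k)) -
        (1 / tv - (1 / tv - 1) / Psi n * (pv i + (\<Sum>k=i+1..n. pv k)))) * Psi n / (1 / tv - 1) = (pv i :: 'k ratfun)"
    proof -
      have "((a - b / c * s) - (a - b / c * (d + s))) * c / b = d" if "b \<noteq> 0" "c \<noteq> 0" for a b c d s :: "'k ratfun"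
        using that by (simp add: field_simps)
      from this[of "1 / tv - 1" "Psi n"] show ?thesis by simp
    qed
    finally show ?thesis using VP by simp
  next
    case VT
    have "local_subst ?\<sigma> (1 / tv) (1 / (1 / tv))"
      by (intro local_subst_divide local_subst_1 t) simp
    then show ?thesis using VT by simp
  next
    case VEta
    then show ?thesis using local_subst_uminus[OF eta] by simp
  next
    case (VAlpha j)
    then show ?thesis
      using al0 by (auto simp: rot_image_VAlpha al_Var[symmetric])
        (auto simp: al_def rot_inv_image_def intro!: local_subst_Var')
  qed
qed

lemma kend_rotation: "kend n (rotation n)"
  and rotation_Var: "x \<in> vars n \<Longrightarrow> rotation n (Var x) = rot_image n x"
  unfolding rotation_def
  using kend_ratfun_subst[of n "rot_image n" "rot_inv_image n"] rot_image_in local_subst_rot_image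
  by blast+

section \<open>The reflection of index zero\<close>

text \<open>The neighbours 1 and 2n+1 of node 0 are distinct because n is positive. The value makes
  the eliminated \<alpha>_0 go to its negative.\<close>

lemma sum_cartan_0:
  assumes "1 \<le> n"
  shows "(\<Sum>k=1..2*n+1. cartan n 0 k) = - 2"
proof -
  have "cartan n 0 k = (if k = 1 then - 1 else 0) + (if k = 2*n+1 then - 1 else 0)"
    if "k \<in> {1..2*n+1}" for k
    using that assms by (auto simp: cartan_def)
  then have "(\<Sum>k=1..2*n+1. cartan n 0 k) =
      (\<Sum>k=1..2*n+1. (if k = 1 then - 1 else 0) + (if k = 2*n+1 then - 1 else 0))"
    by (rule sum.cong[OF HOL.refl])
  then show ?thesis by (simp add: sum.distrib del: sum.cl_ivl_Suc)
qed

lemma refl_image_0: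
  fixes n :: nat
  defines "im \<equiv> (refl_image n 0 :: pvar \<Rightarrow> 'k::field_char_0 ratfun)"
  shows
  "1 \<le> j \<Longrightarrow> j \<le> n \<Longrightarrow> im (VQ j) = qv n j"
  "1 \<le> j \<Longrightarrow> j \<le> n \<Longrightarrow> im (VP j) = pv j - (if j = 1 then al n 0 / (qv n 1 - 1) else 0)"
  "im VT = tv"
  "im VEta = etav + al n 0"
  "im (VAlpha i) = al n i - of_int (cartan n 0 i) * al n 0"
proof -
  assume j: "1 \<le> j" "j \<le> n"
  show "im (VQ j) = qv n j" by (simp add: refl_image_def im_def)
  have "poisson n (qv n 1 - 1) (pv j) = (\<Sum>i=1..n. if i = 1 \<and> i = j then - 1 else 0 :: 'k ratfun)"
    unfolding poisson_def
    by (intro sum.cong HOL.refl)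
       (use j in \<open>auto simp: derivation_simps[OF derivation_partial]\<close>)
  also have "\<dots> = (if j = 1 then - 1 else 0)"
  proof (cases "j = 1")
    case False
    then have "(\<Sum>i=1..n. if i = 1 \<and> i = j then - 1 else 0) = (\<Sum>i=1..n. 0 :: 'k ratfun)"
      by (intro sum.cong) auto
    then show ?thesis using False by simp
  next
    case True
    then show ?thesis using j by (simp add: sum.delta)
  qed
  finally show "im (VP j) = pv j - (if j = 1 then al n 0 / (qv n 1 - 1) else 0)"
    by (simp add: refl_image_def im_def Let_def)
qed (simp_all add: refl_image_def im_def)

lemma refl_image_0_in:
  assumes "1 \<le> n" "x \<in> vars n"
  shows "refl_image n 0 x \<in> ratfield n"
  using assms(2,1) by (cases rule: vars_cases) (auto simp: refl_image_0)

lemma q1_neq_1: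
  assumes "1 \<le> n"
  shows "qv n 1 - 1 \<noteq> 0"
  by (rule nonzero_by_partial[of n "VQ 1"])
    (use assms in \<open>simp add: derivation_simps[OF derivation_partial]\<close>)

text \<open>r_0 is an involution, so its own images serve as the left inverse required by
  \<open>kend_ratfun_subst\<close>.\<close>

lemma local_subst_refl_image_0:
  assumes n: "1 \<le> n" and "x \<in> vars n"
  shows "local_subst (refl_image n 0) (refl_image n 0 x) (Var x :: 'k::field_char_0 ratfun)"
proof -
  let ?\<sigma> = "refl_image n 0 :: pvar \<Rightarrow> 'k ratfun"
  have q: "local_subst ?\<sigma> (qv n j) (qv n j)" if "1 \<le> j" "j \<le> n" for j
    using that local_subst_Var[of ?\<sigma> "VQ j"] by (simp add: refl_image_0 qv_def)
  have p: "local_subst ?\<sigma> (pv j) (pv j - (if j = 1 then al n 0 / (qv n 1 - 1) else 0))"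
    if "1 \<le> j" "j \<le> n" for j
    using that local_subst_Var[of ?\<sigma> "VP j"] by (simp add: refl_image_0)
  have al: "local_subst ?\<sigma> (al n j) (al n j - of_int (cartan n 0 j) * al n 0)" if "1 \<le> j" for j
    using that local_subst_Var[of ?\<sigma> "VAlpha j"] by (simp add: refl_image_0 al_Var)
  have al0: "local_subst ?\<sigma> (al n 0) (- al n 0)"
  proof -
    have "local_subst ?\<sigma> (al n 0) (1 - (\<Sum>k=1..2*n+1. al n k - of_int (cartan n 0 k) * al n 0))"
      unfolding al_def[of n 0] if_P[OF HOL.refl]
      by (intro local_subst_diff local_subst_1 local_subst_sum local_subst_Var')
        (simp add: refl_image_0 al_def)
    also have "(\<Sum>k=1..2*n+1. al n k - of_int (cartan n 0 k) * al n 0) =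
       (\<Sum>k=1..2*n+1. al n k) - of_int (\<Sum>k=1..2*n+1. cartan n 0 k) * (al n 0 :: 'k ratfun)"
      by (simp only: sum_subtractf sum_distrib_right of_int_sum)
    also have "(\<Sum>k=1..2*n+1. al n k) = 1 - (al n 0 :: 'k ratfun)"
      using sum_al[of n, where ?'a = 'k] by (simp add: sum.atLeast_Suc_atMost eq_diff_eq add.commute del: sum.cl_ivl_Suc)
    finally show ?thesis unfolding sum_cartan_0[OF n] by simp
  qed
  show ?thesis using assms(2)
  proof (cases rule: vars_cases)
    case (VQ j)
    then show ?thesis using q[of j] by (simp add: refl_image_0 qv_def)
  next
    case (VP j)
    show ?thesis
    proof (cases "j = 1")
      case True
      have "local_subst ?\<sigma> (pv j - al n 0 / (qv n 1 - 1))
          ((pv j - al n 0 / (qv n 1 - 1)) - - al n 0 / (qv n 1 - 1))"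
        using p[of j] VP True n
        by (intro local_subst_diff local_subst_divide al0 q local_subst_1 q1_neq_1) auto
      then show ?thesis using VP True by (simp add: refl_image_0)
    next
      case False
      then show ?thesis using p[of j] VP by (simp add: refl_image_0)
    qed
  next
    case VT
    then show ?thesis using local_subst_Var[of ?\<sigma> VT] by (simp add: refl_image_0)
  next
    case VEta
    then show ?thesis using local_subst_add[OF local_subst_Var[of ?\<sigma> VEta] al0] by (simp add: refl_image_0)
  next
    case (VAlpha j)
    have "local_subst ?\<sigma> (al n j - of_int (cartan n 0 j) * al n 0)
        ((al n j - of_int (cartan n 0 j) * al n 0) - of_int (cartan n 0 j) * - al n 0)"
      unfolding Const_of_int[symmetric]
      using VAlpha al[of j] by (intro local_subst_diff local_subst_mult local_subst_Const al0)
        (simp_all add: Const_of_int)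
    then show ?thesis using VAlpha by (simp add: refl_image_0 al_Var)
  qed
qed

lemma kend_reflection_0: "1 \<le> n \<Longrightarrow> kend n (reflection n 0)"
  and reflection_0_Var: "1 \<le> n \<Longrightarrow> x \<in> vars n \<Longrightarrow> reflection n 0 (Var x) = refl_image n 0 x"
  unfolding reflection_def
  using kend_ratfun_subst[of n "refl_image n 0" "refl_image n 0"] refl_image_0_in
    local_subst_refl_image_0
  by blast+

section \<open>Transformations of the lattice\<close>

definition gfac :: "'a::field \<Rightarrow> int \<Rightarrow> 'a" where
  "gfac g k = (if odd k then g else inverse g)"

text \<open>The factor has to lie in \<open>ratfield n\<close>, because composition applies a
  further endomorphism to it.\<close>

definition gauge :: "nat \<Rightarrow> (int \<Rightarrow> 'k::field_char_0 ratfun) \<Rightarrow> (int \<Rightarrow> 'k ratfun) \<Rightarrow> bool" where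
  "gauge n A B \<longleftrightarrow> (\<exists>g\<in>ratfield n. g \<noteq> 0 \<and> (\<forall>k. A k = gfac g k * B k))"

text \<open>The affine Cartan matrix as a function of the difference of two indices modulo
  \<open>N\<close>, extended to all integers; see \<open>coupling_cartan\<close>.\<close>

definition coupling :: "int \<Rightarrow> int \<Rightarrow> int" where
  "coupling N m = (if N dvd m then 2 else if N dvd m - 1 \<or> N dvd m + 1 then - 1 else 0)"

definition refl_par :: "int \<Rightarrow> int \<Rightarrow> (int \<Rightarrow> 'a) \<Rightarrow> int \<Rightarrow> 'a::field" where
  "refl_par N i c k = c k - of_int (coupling N (k - i)) * c i"

text \<open>Stated for arbitrary sequences, because in a composition of reflections the second
  formula is applied to sequences that are already transformed.\<close>

definition refl_seq :: "int \<Rightarrow> int \<Rightarrow> (int \<Rightarrow> 'a) \<Rightarrow> (int \<Rightarrow> 'a) \<Rightarrow> int \<Rightarrow> 'a::field" where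
  "refl_seq N i c A k = A k + (if N dvd k - i then c k / (A (k + 1) - A (k - 1)) else 0)"

definition acts :: "nat \<Rightarrow> ('k::field_char_0 ratfun \<Rightarrow> 'k ratfun) \<Rightarrow> (int \<Rightarrow> 'k ratfun) \<Rightarrow>
    (int \<Rightarrow> 'k ratfun) \<Rightarrow> bool" where
  "acts n \<phi> c A \<longleftrightarrow> (\<forall>k. \<phi> (par n k) = c k) \<and> gauge n (\<lambda>k. \<phi> (lat n k)) A"

lemma gfac_nonzero [simp]: "gfac g k = 0 \<longleftrightarrow> g = 0"
  by (simp add: gfac_def)

lemma gfac_in [simp]: "g \<in> ratfield n \<Longrightarrow> gfac g k \<in> ratfield n"
  by (simp add: gfac_def)

lemma gfac_shift [simp]: "gfac g (k + 1) = inverse (gfac g k)" "gfac g (k - 1) = inverse (gfac g k)"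
  by (simp_all add: gfac_def)

lemma gfac_mult: "gfac g k * gfac h k = gfac (g * h) k"
  by (simp add: gfac_def)

lemma gfac_inverse: "inverse (gfac g k) = gfac (inverse g) k"
  by (simp add: gfac_def)

lemma gfac_1 [simp]: "gfac 1 k = 1"
  by (simp add: gfac_def)

lemma kend_gfac: "kend n \<phi> \<Longrightarrow> g \<in> ratfield n \<Longrightarrow> \<phi> (gfac g k) = gfac (\<phi> g) k"
  by (simp add: gfac_def kend_inverse)

lemma gauge_refl: "gauge n A A"
  unfolding gauge_def by (rule bexI[of _ 1]) simp_all

lemma gauge_eq: "A = B \<Longrightarrow> gauge n A B"
  using gauge_refl by blast

lemma gaugeI: "g \<in> ratfield n \<Longrightarrow> g \<noteq> 0 \<Longrightarrow> (\<And>k. A k = gfac g k * B k) \<Longrightarrow> gauge n A B"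
  unfolding gauge_def by blast

lemma gauge_trans:
  assumes "gauge n A B" "gauge n B C"
  shows "gauge n A C"
proof -
  obtain g where "g \<in> ratfield n" "g \<noteq> 0" "\<And>k. A k = gfac g k * B k"
    using assms(1) unfolding gauge_def by blast
  moreover obtain h where "h \<in> ratfield n" "h \<noteq> 0" "\<And>k. B k = gfac h k * C k"
    using assms(2) unfolding gauge_def by blast
  ultimately show ?thesis
    by (intro gaugeI[of "g * h"]) (simp_all add: gfac_mult[symmetric])
qed

lemma gauge_sym:
  assumes "gauge n A B"
  shows "gauge n B A"
proof -
  obtain g where "g \<in> ratfield n" "g \<noteq> 0" "\<And>k. A k = gfac g k * B k"
    using assms(1) unfolding gauge_def by blast
  then show ?thesis
    by (intro gaugeI[of "inverse g"]) (simp_all add: gfac_inverse[symmetric])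
qed

text \<open>The neighbours of x_k carry the inverse factor, so the correction term scales exactly as
  x_k does. Reflections are therefore well defined on sequences up to gauge.\<close>

lemma refl_seq_gauge:
  assumes "g \<noteq> 0"
  shows "refl_seq N i c (\<lambda>k. gfac g k * A k) k = gfac g k * refl_seq N i c A k"
proof -
  have "c / (inverse h * x - inverse h * y) = h * (c / (x - y))" if "h \<noteq> 0" for c h x y :: 'a
  proof -
    have "inverse h * x - inverse h * y = inverse h * (x - y)" by (simp add: algebra_simps)
    then show ?thesis using that by (simp add: divide_inverse)
  qed
  then show ?thesis using assms by (simp add: refl_seq_def distrib_left)
qed

lemma actsI: "(\<And>k. \<phi> (par n k) = c k) \<Longrightarrow> gauge n (\<lambda>k. \<phi> (lat n k)) A \<Longrightarrow> acts n \<phi> c A"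
  by (simp add: acts_def)

lemma actsD: "acts n \<phi> c A \<Longrightarrow> \<phi> (par n k) = c k"
    "acts n \<phi> c A \<Longrightarrow> gauge n (\<lambda>k. \<phi> (lat n k)) A"
  by (simp_all add: acts_def)

lemma acts_gauge: "acts n \<phi> c A \<Longrightarrow> gauge n A B \<Longrightarrow> acts n \<phi> c B"
  unfolding acts_def using gauge_trans by blast

lemma acts_id: "acts n id (par n) (lat n)"
  by (simp add: acts_def gauge_refl)

text \<open>In a composite \<phi> \<circ> \<psi> the formula of the inner map \<psi> is evaluated on
  the sequences of \<phi>. The gauge of \<phi> enters inverted, since the shift changes
  parity.\<close>

lemma acts_comp_shift:
  assumes \<phi>: "kend n \<phi>" "acts n \<phi> c A"
    and \<psi>: "acts n \<psi> (\<lambda>k. par n (k + 1)) (\<lambda>k. lat n (k + 1))"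
  shows "acts n (\<phi> \<circ> \<psi>) (\<lambda>k. c (k + 1)) (\<lambda>k. A (k + 1))"
proof (rule actsI)
  show "(\<phi> \<circ> \<psi>) (par n k) = c (k + 1)" for k
    using actsD(1)[OF \<phi>(2)] actsD(1)[OF \<psi>] by simp
  obtain g where g: "g \<in> ratfield n" "g \<noteq> 0" "\<And>k. \<psi> (lat n k) = gfac g k * lat n (k + 1)"
    using actsD(2)[OF \<psi>] unfolding gauge_def by blast
  obtain h where h: "h \<in> ratfield n" "h \<noteq> 0" "\<And>k. \<phi> (lat n k) = gfac h k * A k"
    using actsD(2)[OF \<phi>(2)] unfolding gauge_def by blast
  have "\<phi> (\<psi> (lat n k)) = gfac (\<phi> g * inverse h) k * A (k + 1)" for k
    by (simp add: g h kend_mult[OF \<phi>(1)] kend_gfac[OF \<phi>(1)] gfac_mult[symmetric] gfac_inverse)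
  then show "gauge n (\<lambda>k. (\<phi> \<circ> \<psi>) (lat n k)) (\<lambda>k. A (k + 1))"
    using g h kend_in[OF \<phi>(1)] kend_eq_0_iff[OF \<phi>(1)]
    by (intro gaugeI[of "\<phi> g * inverse h"]) auto
qed

lemma acts_comp_refl:
  fixes \<phi> :: "'k::field_char_0 ratfun \<Rightarrow> 'k ratfun"
  assumes \<phi>: "kend n \<phi>" "acts n \<phi> c A"
    and \<psi>: "acts n \<psi> (refl_par (per n) i (par n)) (refl_seq (per n) i (par n) (lat n))"
  shows "acts n (\<phi> \<circ> \<psi>) (refl_par (per n) i c) (refl_seq (per n) i c A)"
proof (rule actsI)
  show "(\<phi> \<circ> \<psi>) (par n k) = refl_par (per n) i c k" for k
    using actsD(1)[OF \<phi>(2)] actsD(1)[OF \<psi>]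
    by (simp add: refl_par_def kend_simps[OF \<phi>(1)] kend_of_int[OF \<phi>(1)])
  obtain g where g: "g \<in> ratfield n" "g \<noteq> 0"
      "\<And>k. \<psi> (lat n k) = gfac g k * refl_seq (per n) i (par n) (lat n) k"
    using actsD(2)[OF \<psi>] unfolding gauge_def by blast
  obtain h where h: "h \<in> ratfield n" "h \<noteq> 0" "\<And>k. \<phi> (lat n k) = gfac h k * A k"
    using actsD(2)[OF \<phi>(2)] unfolding gauge_def by blast
  have R: "\<phi> (refl_seq (per n) i (par n) (lat n) k) = gfac h k * refl_seq (per n) i c A k" for k
  proof -
    have "\<phi> (refl_seq (per n) i (par n) (lat n) k) = refl_seq (per n) i c (\<lambda>k. \<phi> (lat n k)) k"
      using actsD(1)[OF \<phi>(2)] by (simp add: refl_seq_def kend_simps[OF \<phi>(1)])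
    then show ?thesis by (simp add: h refl_seq_gauge)
  qed
  have "refl_seq (per n) i (par n) (lat n) k \<in> (ratfield n :: 'k ratfun set)" for k
    by (simp add: refl_seq_def)
  then have "\<phi> (\<psi> (lat n k)) = gfac (\<phi> g * h) k * refl_seq (per n) i c A k" for k
    by (simp add: g R kend_mult[OF \<phi>(1)] kend_gfac[OF \<phi>(1)] gfac_mult[symmetric])
  then show "gauge n (\<lambda>k. (\<phi> \<circ> \<psi>) (lat n k)) (refl_seq (per n) i c A)"
    using g h kend_in[OF \<phi>(1)] kend_eq_0_iff[OF \<phi>(1)]
    by (intro gaugeI[of "\<phi> g * h"]) auto
qed

text \<open>The normalization \<open>lat n (- 1) = 1\<close> removes the gauge freedom.\<close>

lemma acts_eqI:
  assumes \<phi>: "kend n \<phi>" "acts n \<phi> c A" and \<psi>: "kend n \<psi>" "acts n \<psi> c A"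
    and t: "\<phi> tv = \<psi> tv" and f: "f \<in> ratfield n"
  shows "\<phi> f = (\<psi> f :: 'k::field_char_0 ratfun)"
proof -
  have "gauge n (\<lambda>k. \<phi> (lat n k)) (\<lambda>k. \<psi> (lat n k))"
    using gauge_trans[OF actsD(2)[OF \<phi>(2)] gauge_sym[OF actsD(2)[OF \<psi>(2)]]] .
  then obtain g where g: "g \<noteq> 0" "\<And>k. \<phi> (lat n k) = gfac g k * \<psi> (lat n k)"
    unfolding gauge_def by blast
  from g(2)[of "- 1"] have "g = 1"
    by (simp add: gfac_def kend_1[OF \<phi>(1)] kend_1[OF \<psi>(1)])
  then have lat: "\<phi> (lat n k) = \<psi> (lat n k)" for k using g(2) by simp
  have p: "\<phi> (pv j) = \<psi> (pv j)" if "1 \<le> j" "j \<le> n" for j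
    unfolding lat_diff[OF that, symmetric]
    by (simp add: lat kend_diff[OF \<phi>(1)] kend_diff[OF \<psi>(1)])
  have q: "\<phi> (qv n j) = \<psi> (qv n j)" if "1 \<le> j" "j \<le> n" for j
    using that lat[of "2 * int j - 1"] by (simp add: lat_odd)
  have al: "\<phi> (al n j) = \<psi> (al n j)" if "j \<le> 2*n+1" for j
    using that actsD(1)[OF \<phi>(2), of "int j"] actsD(1)[OF \<psi>(2), of "int j"] by (simp add: par_al)
  \<comment> \<open>Among the lattice terms eta is visible through \<open>Phi n\<close>, so x_0 is
    solved for it.\<close>
  have "etav = lat n 0 * (tv - 1) - (\<Sum>j=1..n. (qv n j - tv) * (pv j :: 'k ratfun))"
    by (simp add: lat_0 Phi_def)
  then have eta: "\<phi> etav = \<psi> etav"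
    by (simp add: kend_simps[OF \<phi>(1)] kend_simps[OF \<psi>(1)] lat t p q)
  show ?thesis
  proof (rule kend_eqI[OF \<phi>(1) \<psi>(1) _ f])
    fix x assume "x \<in> vars n"
    then show "\<phi> (Var x) = \<psi> (Var x)"
    proof (cases rule: vars_cases)
      case (VQ j)
      then show ?thesis using q[of j] by (simp add: qv_def)
    next
      case (VAlpha j)
      then show ?thesis using al[of j] by (simp add: al_def)
    qed (simp_all add: p t eta)
  qed
qed

section \<open>The generators acting on the lattice\<close>

lemma rotation_simps:
  "rotation n tv = 1 / tv"
  "rotation n etav = - etav"
  "1 \<le> i \<Longrightarrow> i \<le> n \<Longrightarrow> rotation n (pv i) = (qv n (i + 1) - qv n i) * Phi n / (tv - 1)"
  "1 \<le> i \<Longrightarrow> i \<le> n \<Longrightarrow> rotation n (Var (VQ i)) = 1 + (tv - 1) * (\<Sum>j=1..i. pv j) / Phi n"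
  "1 \<le> i \<Longrightarrow> i \<le> 2*n+1 \<Longrightarrow> rotation n (Var (VAlpha i)) = al n (if i = 2*n+1 then 0 else i + 1)"
  by (simp_all add: rotation_Var vars_def rot_image_VQ rot_image_VAlpha del: One_nat_def)

lemma nat_mod_per: "nat (k mod per n) \<le> 2*n+1"
proof -
  have "0 \<le> k mod per n" "k mod per n < per n" by simp_all
  then show ?thesis by linarith
qed

lemma rotation_par: "rotation n (par n k) = (par n (k + 1) :: 'k::field_char_0 ratfun)"
proof -
  define r where "r = nat (k mod per n)"
  have r: "k mod per n = int r" "r \<le> 2*n+1"
    by (simp_all only: r_def nat_mod_per) simp
  have par_k: "par n k = (al n r :: 'k ratfun)" by (simp add: par_def r)
  have "(k + 1) mod per n = (int r + 1) mod per n"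
    by (metis mod_add_left_eq r(1))
  also have "\<dots> = int (if r = 2*n+1 then 0 else r + 1)"
  proof (cases "r = 2*n+1")
    case True
    then have "int r + 1 = per n" by simp
    then show ?thesis using True by (simp only: mod_self) simp
  next
    case False
    then show ?thesis using r(2) by simp
  qed
  finally have par_k1: "par n (k + 1) = (al n (if r = 2*n+1 then 0 else r + 1) :: 'k ratfun)"
    by (simp add: par_def)
  \<comment> \<open>The images of \<alpha>_1, ..., \<alpha>_{2n+1} are all parameters except
    \<alpha>_1, which is what the relation leaves for the eliminated \<alpha>_0.\<close>
  have "rotation n (al n 0) = (al n 1 :: 'k ratfun)"
  proof -
    have "rotation n (al n 0) = 1 - (\<Sum>k=1..2*n+1. rotation n (Var (VAlpha k) :: 'k ratfun))"
      unfolding al_def[of n 0] if_P[OF HOL.refl]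
      by (simp add: kend_simps[OF kend_rotation] del: sum.cl_ivl_Suc)
    also have "(\<Sum>k=1..2*n+1. rotation n (Var (VAlpha k))) =
        (\<Sum>k=1..2*n+1. al n (if k = 2*n+1 then 0 else k + 1) :: 'k ratfun)"
      by (intro sum.cong rotation_simps) auto
    also have "\<dots> = (\<Sum>k=1..2*n. al n (Suc k)) + al n 0"
      by (simp cong: sum.cong_simp)
    also have "(\<Sum>k=1..2*n. al n (Suc k)) = (\<Sum>k=2..2*n+1. al n k :: 'k ratfun)"
      using sum.shift_bounds_cl_Suc_ivl[of "al n :: nat \<Rightarrow> 'k ratfun" 1 "2*n"] by (simp add: numeral_2_eq_2)
    also have "\<dots> = 1 - al n 0 - al n 1"
      using sum_al[of n, where ?'a = 'k]
      by (simp add: sum.atLeast_Suc_atMost eq_diff_eq numeral_2_eq_2 del: sum.cl_ivl_Suc) (simp add: algebra_simps)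
    finally show ?thesis by simp
  qed
  then show ?thesis
    using r(2) by (cases "r = 0") (auto simp: par_k par_k1 al_Var rotation_simps)
qed

text \<open>Nonzero multipliers carry an equality to the next period in both directions, so one
  window of indices suffices. Computations in coordinates are extended to the whole lattice in this
  way.\<close>

lemma quasi_periodic_eqI:
  fixes A B \<tau> :: "int \<Rightarrow> 'a::field"
  assumes "\<And>k. A (k + per n) = \<tau> k * A k" "\<And>k. B (k + per n) = \<tau> k * B k" "\<And>k. \<tau> k \<noteq> 0"
    and "\<And>r. - 1 \<le> r \<Longrightarrow> r \<le> 2 * int n \<Longrightarrow> A r = B r"
  shows "A k = B k"
proof -
  define r where "r = (k + 1) mod per n - 1"
  define q where "q = (k + 1) div per n"
  have k: "k = r + per n * q"
    using div_mult_mod_eq[of "k + 1" "per n"] by (simp add: r_def q_def algebra_simps)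
  have "0 \<le> (k + 1) mod per n" "(k + 1) mod per n < per n" by simp_all
  then have "- 1 \<le> r" "r \<le> 2 * int n" unfolding r_def by linarith+
  then have r: "A r = B r" by (rule assms(4))
  have "A (r + per n * q) = B (r + per n * q)"
  proof (induction q rule: int_induct[where k = 0])
    case base
    then show ?case using r by simp
  next
    case (step1 i)
    then show ?case using assms(1,2)[of "r + per n * i"] by (simp add: algebra_simps)
  next
    case (step2 i)
    have "r + per n * i = (r + per n * (i - 1)) + per n" by (simp add: algebra_simps)
    then have "\<tau> (r + per n * (i - 1)) * A (r + per n * (i - 1)) =
        \<tau> (r + per n * (i - 1)) * B (r + per n * (i - 1))"
      using assms(1,2)[of "r + per n * (i - 1)"] step2 by metis
    then show ?case using assms(3) by simp
  qed
  then show ?thesis by (simp add: k)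
qed

lemma lat_shift: "lat n (k + per n) = qfac k * lat n k"
  by (rule qperD[OF qper_lat])

lemma qfac_gfac: "qfac k = gfac tv k"
  by (simp add: qfac_def gfac_def inverse_eq_divide)

lemma rotation_qfac: "rotation n (qfac k) = 1 / qfac k"
  by (simp add: qfac_def kend_simps[OF kend_rotation] rotation_simps)

text \<open>In lattice terms this says that x_0 goes to x_0 x_1. Termwise cancellation leaves a
  telescoping sum and a sum by parts, and the latter equals eta - \<open>Phi n\<close>.\<close>

lemma rotation_Phi:
  assumes "1 \<le> n"
  shows "rotation n (Phi n) = - qv n 1 * Phi n / (tv :: 'k::field_char_0 ratfun)"
proof -
  let ?P = "\<lambda>j. \<Sum>k=1..j. pv k :: 'k ratfun"
  have "rotation n (Phi n) = (\<Sum>j=1..n. (1 + (tv - 1) * ?P j / Phi n - 1 / tv) *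
      ((qv n (j + 1) - qv n j) * Phi n / (tv - 1))) - (etav :: 'k ratfun)"
  proof -
    have "rotation n (Phi n) = (\<Sum>j=1..n. rotation n ((qv n j - tv) * pv j)) - (etav :: 'k ratfun)"
      by (simp add: Phi_def kend_simps[OF kend_rotation] rotation_simps)
    moreover have "rotation n ((qv n j - tv) * pv j) = (1 + (tv - 1) * ?P j / Phi n - 1 / tv) *
      ((qv n (j + 1) - qv n j) * Phi n / (tv - 1 :: 'k ratfun))" if "j \<in> {1..n}" for j
      using that by (simp add: kend_simps[OF kend_rotation] rotation_simps qv_Var[of j])
    ultimately show ?thesis by simp
  qed
  also have "(\<Sum>j=1..n. (1 + (tv - 1) * ?P j / Phi n - 1 / tv) *
      ((qv n (j + 1) - qv n j) * Phi n / (tv - 1))) =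
      (\<Sum>j=1..n. (qv n (j + 1) - qv n j) * (Phi n / tv) + ?P j * (qv n (j + 1) - qv n j))"
  proof -
    have "(1 + (t - 1) * P / f - 1 / t) * (d * f / (t - 1)) = d * (f / t) + P * d"
      if "t \<noteq> 0" "t - 1 \<noteq> 0" "f \<noteq> 0" for t P f d :: "'k ratfun"
    proof -
      have "(1 + (t - 1) * P / f - 1 / t) * (d * f / (t - 1)) =
          ((t - 1) / t + (t - 1) * P / f) * (d * f / (t - 1))"
        using that by (simp add: diff_divide_distrib)
      also have "\<dots> = d * (f / t) + P * d"
      proof -
        have "(s / t + s * P / f) * (d * f / s) = d * (f / t) + P * d" if "s \<noteq> 0" for s
          using that \<open>t \<noteq> 0\<close> \<open>f \<noteq> 0\<close> by (simp add: field_simps)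
        then show ?thesis using that by blast
      qed
      finally show ?thesis .
    qed
    from this[of tv "Phi n"] show ?thesis by simp
  qed
  also have "\<dots> = (\<Sum>j=1..n. qv n (j + 1) - qv n j) * (Phi n / tv) +
      (\<Sum>j=1..n. ?P j * (qv n (j + 1) - qv n j))"
    by (simp only: sum.distrib sum_distrib_right)
  also have "(\<Sum>j=1..n. ?P j * (qv n (j + 1) - qv n j)) = (\<Sum>k=1..n. pv k * (qv n (n + 1) - qv n k))"
    by (rule abel_sum_lower)
  also have "\<dots> = etav - Phi n"
    by (simp add: Phi_def qv_def[of n "Suc n"] algebra_simps flip: sum_negf)
  also have "(\<Sum>j=1..n. qv n (j + 1) - qv n j) = tv - (qv n 1 :: 'k ratfun)"
    using sum_Suc_diff[of 1 n "qv n :: nat \<Rightarrow> 'k ratfun"] assms by (simp add: qv_def[of n "Suc n"])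
  finally show ?thesis by (simp add: field_simps)
qed

text \<open>The gauge factor is forced by k = -1: the left side is 1 there, while the shifted term
  is x_0.\<close>

lemma rotation_lat:
  assumes "1 \<le> n"
  shows "rotation n (lat n k) = gfac (1 / lat n 0) k * (lat n (k + 1) :: 'k::field_char_0 ratfun)"
proof (rule quasi_periodic_eqI[where \<tau> = "\<lambda>k. 1 / qfac k" and n = n and k = k])
  note rot = kend_simps[OF kend_rotation]
  fix k :: int
  show "rotation n (lat n (k + per n)) = 1 / qfac k * rotation n (lat n k :: 'k ratfun)"
    by (simp add: lat_shift rot rotation_qfac)
  have "lat n (k + per n + 1) = 1 / qfac k * (lat n (k + 1) :: 'k ratfun)"
  proof -
    have "k + per n + 1 = k + 1 + per n" by simp
    then show ?thesis by (simp only: lat_shift qfac_shift)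
  qed
  moreover have "gfac g (k + per n) = gfac g k" for g :: "'k ratfun"
    by (simp add: gfac_def)
  ultimately show "gfac (1 / lat n 0) (k + per n) * lat n (k + per n + 1) =
      1 / qfac k * (gfac (1 / lat n 0) k * (lat n (k + 1) :: 'k ratfun))"
    by simp
  show "1 / qfac k \<noteq> (0 :: 'k ratfun)" by simp
next
  note rot = kend_simps[OF kend_rotation]
  fix r :: int
  assume "- 1 \<le> r" "r \<le> 2 * int n"
  then show "rotation n (lat n r) = gfac (1 / lat n 0) r * (lat n (r + 1) :: 'k ratfun)"
  proof (cases rule: base_cases)
    case (1 i)
    show ?thesis
    proof (cases "i = 0")
      case True
      then show ?thesis using 1 by (simp add: rot gfac_def lat_0)
    next
      case False
      have "1 + (t - 1) * P / f = (f / (t - 1) + P) / (f / (t - 1))" if "t - 1 \<noteq> 0" "f \<noteq> 0" for t P f :: "'k ratfun"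
        using that by (simp add: field_simps)
      from this[of tv "Phi n"] show ?thesis using 1 False
        by (simp add: lat_odd qv_Var rotation_simps gfac_def lat_even lat_0)
    qed
  next
    case (2 i)
    have i1: "2 * int i + 1 = 2 * int (i + 1) - 1" by simp
    have "rotation n (lat n r) = rotation n (Phi n) / (1 / tv - 1) +
       (\<Sum>j=1..i. rotation n (pv j :: 'k ratfun))"
      using 2 by (simp add: lat_even rot rotation_simps)
    also have "rotation n (Phi n) / (1 / tv - 1) = qv n 1 * (Phi n / (tv - 1 :: 'k ratfun))"
    proof -
      have "- q * f / t / (1 / t - 1) = q * (f / (t - 1))" if "t \<noteq> 0" "t - 1 \<noteq> 0" for q f t :: "'k ratfun"
      proof -
        have "1 / t - 1 = - (t - 1) / t" using that by (simp add: diff_divide_distrib)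
        moreover have "- q * f / t / (- s / t) = q * (f / s)" if "s \<noteq> 0" for s
          using that \<open>t \<noteq> 0\<close> by simp
        ultimately show ?thesis using that by metis
      qed
      then show ?thesis by (simp add: rotation_Phi[OF assms])
    qed
    also have "(\<Sum>j=1..i. rotation n (pv j)) = (\<Sum>j=1..i. (qv n (j + 1) - qv n j) * (Phi n / (tv - 1 :: 'k ratfun)))"
      using 2 by (intro sum.cong) (auto simp: rotation_simps)
    also have "\<dots> = (\<Sum>j=1..i. qv n (j + 1) - qv n j) * (Phi n / (tv - 1 :: 'k ratfun))"
      by (simp only: sum_distrib_right)
    also have "(\<Sum>j=1..i. qv n (j + 1) - qv n j) = qv n (i + 1) - (qv n 1 :: 'k ratfun)"
      using sum_Suc_diff[of 1 i "qv n :: nat \<Rightarrow> 'k ratfun"] by (cases i) simp_all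
    also have "qv n 1 * (Phi n / (tv - 1)) + (qv n (i + 1) - qv n 1) * (Phi n / (tv - 1)) =
        Phi n / (tv - 1) * (qv n (i + 1) :: 'k ratfun)"
      by (simp only: distrib_right[symmetric]) simp
    also have "\<dots> = gfac (1 / lat n 0) r * (lat n (r + 1) :: 'k ratfun)"
      unfolding \<open>r = 2 * int i\<close> i1 using 2 by (subst lat_odd) (simp_all add: gfac_def lat_0)
    finally show ?thesis .
  qed
qed

lemma lat_0_nonzero [simp]: "lat n 0 \<noteq> 0"
  by (simp add: lat_0)

lemma acts_rotation: "1 \<le> n \<Longrightarrow> acts n (rotation n) (\<lambda>k. par n (k + 1)) (\<lambda>k. lat n (k + 1))"
  by (rule actsI, rule rotation_par, rule gaugeI[of "1 / lat n 0"]) (simp_all add: rotation_lat)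

lemma acts_comp_rotation_funpow:
  assumes "1 \<le> n" "kend n \<phi>" "acts n \<phi> c A"
  shows "acts n (\<phi> \<circ> (rotation n ^^ j)) (\<lambda>k. c (k + int j)) (\<lambda>k. A (k + int j))"
proof (induction j)
  case 0
  then show ?case using assms(3) by (simp add: comp_def)
next
  case (Suc j)
  have "acts n (\<phi> \<circ> (rotation n ^^ j) \<circ> rotation n) (\<lambda>k. c (k + 1 + int j)) (\<lambda>k. A (k + 1 + int j))"
    by (rule acts_comp_shift[OF kend_comp[OF assms(2) kend_funpow[OF kend_rotation]] Suc acts_rotation[OF assms(1)]])
  moreover have "\<phi> \<circ> (rotation n ^^ Suc j) = \<phi> \<circ> (rotation n ^^ j) \<circ> rotation n"
    by (simp only: funpow_Suc_right comp_assoc)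
  moreover have "k + 1 + int j = k + int (Suc j)" for k by simp
  ultimately show ?case by (simp only:)
qed

lemma rotation_funpow_tv: "(rotation n ^^ (2 * m)) tv = tv"
  by (induction m) (simp_all add: rotation_simps kend_simps[OF kend_rotation])

text \<open>A shift by one full period multiplies the sequence by \<open>qfac\<close>, which is the
  gauge factor of t and hence invisible.\<close>

lemma rotation_order:
  assumes "1 \<le> n" "f \<in> ratfield n"
  shows "(rotation n ^^ (2*n+2)) f = f"
proof -
  have "acts n (id \<circ> (rotation n ^^ (2*n+2))) (\<lambda>k. par n (k + per n)) (\<lambda>k. lat n (k + per n))"
    using acts_comp_rotation_funpow[OF assms(1) kend_id acts_id, of "2*n+2"]
    by (simp add: add.commute)
  then have "acts n (rotation n ^^ (2*n+2)) (par n) (\<lambda>k. lat n (k + per n))"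
    by (simp add: comp_def id_def)
  moreover have "gauge n (\<lambda>k. lat n (k + per n)) (lat n)"
    by (rule gaugeI[of tv]) (simp_all add: lat_shift qfac_gfac)
  ultimately have "acts n (rotation n ^^ (2*n+2)) (par n) (lat n)"
    by (rule acts_gauge)
  from acts_eqI[OF kend_funpow[OF kend_rotation] this kend_id acts_id _ assms(2)]
  show ?thesis using rotation_funpow_tv[of "n + 1" n] by simp
qed

section \<open>The reflection of index zero acting on the lattice\<close>

lemma dvd_small:
  fixes N m :: int
  assumes "N dvd m" "- N < m" "m < N"
  shows "m = 0"
  using assms dvd_imp_le_int[of m N] by (cases "m = 0") auto

lemma dvd_small_cases:
  fixes N m :: int
  assumes "N dvd m" "- N \<le> m" "m \<le> N"
  shows "m = - N \<or> m = 0 \<or> m = N"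
proof (cases "m = - N \<or> m = N")
  case False
  then show ?thesis using dvd_small[of N m] assms by linarith
qed auto

lemma coupling_cartan:
  assumes "1 \<le> n" "i \<le> 2*n+1" "j \<le> 2*n+1"
  shows "coupling (per n) (int j - int i) = cartan n i j"
proof -
  have "per n dvd int j - int i \<longleftrightarrow> j = i"
    using dvd_small[of "per n" "int j - int i"] assms by auto
  moreover have "per n dvd int j - int i - 1 \<longleftrightarrow> j = i + 1 \<or> (i = 2*n+1 \<and> j = 0)"
  proof
    assume "per n dvd int j - int i - 1"
    from dvd_small_cases[OF this] assms show "j = i + 1 \<or> (i = 2*n+1 \<and> j = 0)" by auto
  next
    assume "j = i + 1 \<or> (i = 2*n+1 \<and> j = 0)"
    then have "int j - int i - 1 = 0 \<or> int j - int i - 1 = - per n" by auto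
    then show "per n dvd int j - int i - 1" by (metis dvd_0_right dvd_minus_iff dvd_refl)
  qed
  moreover have "per n dvd int j - int i + 1 \<longleftrightarrow> i = j + 1 \<or> (i = 0 \<and> j = 2*n+1)"
  proof
    assume "per n dvd int j - int i + 1"
    from dvd_small_cases[OF this] assms show "i = j + 1 \<or> (i = 0 \<and> j = 2*n+1)" by auto
  next
    assume "i = j + 1 \<or> (i = 0 \<and> j = 2*n+1)"
    then have "int j - int i + 1 = 0 \<or> int j - int i + 1 = per n" by auto
    then show "per n dvd int j - int i + 1" by (metis dvd_0_right dvd_refl)
  qed
  ultimately show ?thesis by (auto simp: coupling_def cartan_def)
qed

lemma coupling_mod: "coupling N (m mod N + k) = coupling N (m + k)"
proof -
  have "N dvd m mod N + k' \<longleftrightarrow> N dvd m + k'" for k'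
    by (metis dvd_eq_mod_eq_0 mod_add_left_eq)
  from this[of k] this[of "k - 1"] this[of "k + 1"] show ?thesis
    by (simp add: coupling_def algebra_simps)
qed

lemma reflection_0_simps:
  assumes "1 \<le> n"
  shows "reflection n 0 tv = (tv :: 'k::field_char_0 ratfun)"
    "reflection n 0 etav = etav + (al n 0 :: 'k ratfun)"
    "1 \<le> j \<Longrightarrow> j \<le> n \<Longrightarrow> reflection n 0 (pv j) = (pv j - (if j = 1 then al n 0 / (qv n 1 - 1) else 0) :: 'k ratfun)"
    "1 \<le> j \<Longrightarrow> j \<le> n + 1 \<Longrightarrow> reflection n 0 (qv n j) = (qv n j :: 'k ratfun)"
    "1 \<le> j \<Longrightarrow> j \<le> 2*n+1 \<Longrightarrow> reflection n 0 (Var (VAlpha j)) =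
       (al n j - of_int (cartan n 0 j) * al n 0 :: 'k ratfun)"
  using assms by (auto simp: reflection_0_Var refl_image_0 vars_def qv_def[of n j] simp del: One_nat_def)

lemma reflection_0_al:
  assumes "1 \<le> n" "j \<le> 2*n+1"
  shows "reflection n 0 (al n j) = (al n j - of_int (cartan n 0 j) * al n 0 :: 'k::field_char_0 ratfun)"
proof (cases "j = 0")
  case True
  note r0 = kend_simps[OF kend_reflection_0[OF assms(1)]]
  have "reflection n 0 (al n 0) = 1 - (\<Sum>k=1..2*n+1. reflection n 0 (Var (VAlpha k) :: 'k ratfun))"
    unfolding al_def[of n 0] if_P[OF HOL.refl] by (simp add: r0 del: sum.cl_ivl_Suc)
  also have "(\<Sum>k=1..2*n+1. reflection n 0 (Var (VAlpha k))) =
      (\<Sum>k=1..2*n+1. al n k - of_int (cartan n 0 k) * al n 0 :: 'k ratfun)"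
    by (intro sum.cong reflection_0_simps assms(1)) auto
  also have "\<dots> = (\<Sum>k=1..2*n+1. al n k) - of_int (\<Sum>k=1..2*n+1. cartan n 0 k) * (al n 0 :: 'k ratfun)"
    by (simp only: sum_subtractf sum_distrib_right of_int_sum)
  also have "(\<Sum>k=1..2*n+1. al n k) = 1 - (al n 0 :: 'k ratfun)"
    using sum_al[of n, where ?'a = 'k]
    by (simp add: sum.atLeast_Suc_atMost eq_diff_eq add.commute del: sum.cl_ivl_Suc)
  finally show ?thesis unfolding sum_cartan_0[OF assms(1)] using True by (simp add: cartan_def)
next
  case False
  then show ?thesis using assms reflection_0_simps(5)[of n j, where ?'k = 'k] by (simp add: al_Var)
qed

lemma reflection_0_par:
  assumes "1 \<le> n"
  shows "reflection n 0 (par n k) = (refl_par (per n) 0 (par n) k :: 'k::field_char_0 ratfun)"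
proof -
  have "int (nat (k mod per n)) = k mod per n" by simp
  then have "cartan n 0 (nat (k mod per n)) = coupling (per n) k"
    using coupling_cartan[OF assms, of 0 "nat (k mod per n)"] nat_mod_per[of k n] coupling_mod[of "per n" k 0]
    by simp
  moreover have "par n 0 = (al n 0 :: 'k ratfun)" by (simp add: par_def)
  ultimately show ?thesis
    using reflection_0_al[OF assms nat_mod_per[of k n]] by (simp add: par_def[of n k] refl_par_def)
qed

text \<open>With X = \<alpha>_0/(q_1 - 1), p_1 drops by X and eta grows by X (q_1 - 1). The total
  change is -(q_1 - t) X + (q_1 - 1) X = (t - 1) X.\<close>

lemma reflection_0_Phi:
  assumes "1 \<le> n"
  shows "reflection n 0 (Phi n) = (Phi n + (tv - 1) * (al n 0 / (qv n 1 - 1)) :: 'k::field_char_0 ratfun)"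
proof -
  note r0 = kend_simps[OF kend_reflection_0[OF assms]]
  define X where "X = (al n 0 / (qv n 1 - 1) :: 'k ratfun)"
  have al: "al n 0 = X * (qv n 1 - 1)" using q1_neq_1[OF assms, where ?'a = 'k] by (simp add: X_def)
  have "reflection n 0 (Phi n) = (\<Sum>j=1..n. reflection n 0 ((qv n j - tv) * pv j)) + (etav + al n 0 :: 'k ratfun)"
    using assms by (simp add: Phi_def r0 reflection_0_simps)
  also have "(\<Sum>j=1..n. reflection n 0 ((qv n j - tv) * pv j)) =
      (\<Sum>j=1..n. (qv n j - tv) * pv j - (if j = 1 then (qv n 1 - tv) * X else 0))"
    using assms by (intro sum.cong) (auto simp: r0 reflection_0_simps X_def right_diff_distrib)
  also have "\<dots> = (\<Sum>j=1..n. (qv n j - tv) * pv j) - (qv n 1 - tv) * X"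
    using assms by (simp add: sum_subtractf sum.delta')
  also have "(\<Sum>j=1..n. (qv n j - tv) * pv j) - (qv n 1 - tv) * X + (etav + al n 0) =
      Phi n + (tv - 1) * X"
    unfolding Phi_def al by (simp add: algebra_simps)
  finally show ?thesis by (simp only: X_def)
qed

lemma refl_seq_shift:
  assumes "\<And>k. A (k + per n) = qfac k * A k" "\<And>k. c (k + per n) = c k"
  shows "refl_seq (per n) i c A (k + per n) = qfac k * refl_seq (per n) i c A k"
proof -
  have "A (k + per n + 1) = A (k + 1) / qfac k" "A (k + per n - 1) = A (k - 1) / qfac k"
  proof -
    have "k + per n + 1 = k + 1 + per n" "k + per n - 1 = k - 1 + per n" by simp_all
    then show "A (k + per n + 1) = A (k + 1) / qfac k" "A (k + per n - 1) = A (k - 1) / qfac k"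
      by (simp_all only: assms(1) qfac_shift times_divide_eq_left mult_1_left)
  qed
  moreover have "per n dvd k + per n - i \<longleftrightarrow> per n dvd k - i"
    using dvd_add_left_iff[of "per n" "per n" "k - i"] by (simp add: algebra_simps)
  moreover have "c / (x / q - y / q) = q * (c / (x - y))" for c x y q :: "'a ratfun"
    by (simp flip: diff_divide_distrib)
  ultimately show ?thesis
    by (simp add: refl_seq_def assms distrib_left)
qed

text \<open>R_0 gains X and p_1 loses it, so R_1, ..., R_n are unchanged and only x_0 moves within
  the window. Since x_{-1} is fixed, the equality holds without a gauge factor.\<close>

lemma reflection_0_lat:
  assumes "1 \<le> n"
  shows "reflection n 0 (lat n k) = (refl_seq (per n) 0 (par n) (lat n) k :: 'k::field_char_0 ratfun)"
proof (rule quasi_periodic_eqI[where \<tau> = qfac and n = n and k = k])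
  note r0 = kend_simps[OF kend_reflection_0[OF assms]]
  fix k :: int
  have "reflection n 0 (qfac k) = (qfac k :: 'k ratfun)"
    using assms by (simp add: qfac_def r0 reflection_0_simps)
  then show "reflection n 0 (lat n (k + per n)) = qfac k * reflection n 0 (lat n k :: 'k ratfun)"
    by (simp add: lat_shift r0)
  show "refl_seq (per n) 0 (par n) (lat n) (k + per n) = qfac k * (refl_seq (per n) 0 (par n) (lat n) k :: 'k ratfun)"
    by (rule refl_seq_shift) (simp_all only: lat_shift par_shift)
  show "qfac k \<noteq> (0 :: 'k ratfun)" by simp
next
  note r0 = kend_simps[OF kend_reflection_0[OF assms]]
  fix r :: int
  assume "- 1 \<le> r" "r \<le> 2 * int n"
  then show "reflection n 0 (lat n r) = (refl_seq (per n) 0 (par n) (lat n) r :: 'k ratfun)"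
  proof (cases rule: base_cases)
    case (1 i)
    have "\<not> per n dvd r"
    proof
      assume "per n dvd r"
      then have "2 dvd r" by (rule dvd_trans[rotated]) simp
      then show False using 1 by simp
    qed
    then show ?thesis using 1 assms by (cases "i = 0") (simp_all add: refl_seq_def r0 lat_odd reflection_0_simps)
  next
    case (2 i)
    define X where "X = (al n 0 / (qv n 1 - 1) :: 'k ratfun)"
    have l1: "lat n 1 = (qv n 1 :: 'k ratfun)" using lat_odd[of 1 n, where ?'a = 'k] by simp
    have p0: "par n 0 = (al n 0 :: 'k ratfun)" by (simp add: par_def)
    have "reflection n 0 (lat n r) = (Phi n + (tv - 1) * X) / (tv - 1) + (\<Sum>j=1..i. reflection n 0 (pv j :: 'k ratfun))"
      using 2 assms by (simp add: lat_even r0 reflection_0_simps reflection_0_Phi X_def)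
    also have "(\<Sum>j=1..i. reflection n 0 (pv j :: 'k ratfun)) = (\<Sum>j=1..i. pv j - (if j = 1 then X else 0))"
      using 2 assms by (intro sum.cong) (auto simp: reflection_0_simps X_def)
    also have "\<dots> = (\<Sum>j=1..i. pv j) - (if i = 0 then 0 else X)"
      by (simp add: sum_subtractf sum.delta')
    also have "(Phi n + (tv - 1) * X) / (tv - 1) = Phi n / (tv - 1) + X"
      by (simp add: add_divide_distrib)
    finally have "reflection n 0 (lat n r) = lat n r + (if i = 0 then X else 0)"
      using 2 by (simp add: lat_even)
    moreover have "per n dvd r \<longleftrightarrow> i = 0"
      using dvd_small[of "per n" r] 2 by auto
    ultimately show ?thesis using 2 by (simp add: refl_seq_def l1 p0 X_def)
  qed
qed

lemma acts_reflection_0: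
  "1 \<le> n \<Longrightarrow> acts n (reflection n 0) (refl_par (per n) 0 (par n)) (refl_seq (per n) 0 (par n) (lat n))"
  by (rule actsI, erule reflection_0_par, rule gauge_eq) (simp add: reflection_0_lat)

section \<open>All reflections\<close>

text \<open>The exponent \<open>(2*n+1) * i\<close> stands for \<open>- i\<close>, as the rotation has order \<open>2*n+2\<close>.\<close>

definition conj_refl :: "nat \<Rightarrow> nat \<Rightarrow> 'k::field_char_0 ratfun \<Rightarrow> 'k ratfun" where
  "conj_refl n i = (rotation n ^^ i) \<circ> reflection n 0 \<circ> (rotation n ^^ ((2*n+1) * i))"

lemma kend_conj_refl: "1 \<le> n \<Longrightarrow> kend n (conj_refl n i)"
  unfolding conj_refl_def
  by (intro kend_comp kend_funpow kend_rotation kend_reflection_0)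

lemma lat_gauge_shift:
  "lat n (k + per n * int i) = gfac (tv ^ i) k * (lat n k :: 'k::field_char_0 ratfun)"
proof -
  have "qfac k ^ i = (gfac (tv ^ i) k :: 'k ratfun)" by (simp add: qfac_gfac gfac_def power_inverse)
  then show ?thesis using qper_mult[OF qper_lat[of n, where ?'k = 'k], of k "int i"] by simp
qed

lemma acts_conj_refl:
  assumes "1 \<le> n"
  shows "acts n (conj_refl n i :: 'k::field_char_0 ratfun \<Rightarrow> 'k ratfun)
    (refl_par (per n) (int i) (par n)) (refl_seq (per n) (int i) (par n) (lat n))"
proof -
  let ?M = "(2*n+1) * i"
  let ?R = "rotation n :: 'k ratfun \<Rightarrow> 'k ratfun"
  have 1: "acts n (?R ^^ i) (\<lambda>k. par n (k + int i)) (\<lambda>k. lat n (k + int i))"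
    using acts_comp_rotation_funpow[OF assms kend_id acts_id, of i] by (simp add: comp_def id_def)
  have 2: "acts n ((?R ^^ i) \<circ> reflection n 0) (refl_par (per n) 0 (\<lambda>k. par n (k + int i)))
     (refl_seq (per n) 0 (\<lambda>k. par n (k + int i)) (\<lambda>k. lat n (k + int i)))"
    by (rule acts_comp_refl[OF kend_funpow[OF kend_rotation] 1 acts_reflection_0[OF assms]])
  have 3: "acts n (conj_refl n i) (\<lambda>k. refl_par (per n) 0 (\<lambda>k. par n (k + int i)) (k + int ?M))
     (\<lambda>k. refl_seq (per n) 0 (\<lambda>k. par n (k + int i)) (\<lambda>k. lat n (k + int i)) (k + int ?M) :: 'k ratfun)"
    unfolding conj_refl_def
    by (rule acts_comp_rotation_funpow[OF assms kend_comp[OF kend_funpow[OF kend_rotation] kend_reflection_0[OF assms]] 2])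
  \<comment> \<open>Both powers of the rotation together shift by i full periods. The parameters do
    not see this, and the lattice sees it as the gauge factor of t^i.\<close>
  have M: "k + int ?M + int i = k + per n * int i" "k + int ?M = k - int i + per n * int i" for k
    by (simp_all add: algebra_simps)
  have M1: "k + int ?M + 1 + int i = k + 1 + per n * int i" "k + int ?M - 1 + int i = k - 1 + per n * int i" for k
    by (simp_all add: algebra_simps)
  have cp: "coupling (per n) (k + int ?M) = coupling (per n) (k - int i)" for k
    unfolding M(2) using coupling_mod[of "per n" "k - int i + per n * int i" 0] coupling_mod[of "per n" "k - int i" 0]
    by simp
  have dv: "per n dvd k + int ?M \<longleftrightarrow> per n dvd k - int i" for k
    unfolding M(2) by (simp add: dvd_add_left_iff)
  have e: "(\<lambda>k. refl_par (per n) 0 (\<lambda>k. par n (k + int i)) (k + int ?M)) =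
     (refl_par (per n) (int i) (par n) :: int \<Rightarrow> 'k ratfun)"
    unfolding refl_par_def by (simp only: M(1) par_mod diff_0_right cp add_0)
  have "refl_seq (per n) 0 (\<lambda>k. par n (k + int i)) (\<lambda>k. lat n (k + int i)) (k + int ?M) =
     (gfac (tv ^ i) k * refl_seq (per n) (int i) (par n) (lat n) k :: 'k ratfun)" for k
  proof -
    have "refl_seq (per n) 0 (\<lambda>k. par n (k + int i)) (\<lambda>k. lat n (k + int i)) (k + int ?M) =
      refl_seq (per n) (int i) (par n) (\<lambda>k. gfac (tv ^ i) k * lat n k) k"
      unfolding refl_seq_def by (simp only: M(1) M1 par_mod diff_0_right dv lat_gauge_shift)
    also have "\<dots> = gfac (tv ^ i) k * refl_seq (per n) (int i) (par n) (lat n) k"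
      by (rule refl_seq_gauge) simp
    finally show ?thesis .
  qed
  then have "gauge n (\<lambda>k. refl_seq (per n) 0 (\<lambda>k. par n (k + int i)) (\<lambda>k. lat n (k + int i)) (k + int ?M))
     (refl_seq (per n) (int i) (par n) (lat n) :: int \<Rightarrow> 'k ratfun)"
    by (intro gaugeI[of "tv ^ i"]) simp_all
  from acts_gauge[OF 3 this] show ?thesis unfolding e .
qed

text \<open>The exponents match because (2n+1)(i+1) + 1 exceeds (2n+1) i by exactly the order 2n+2
  of the rotation.\<close>

lemma conj_refl_rotation:
  assumes "1 \<le> n" "f \<in> ratfield n"
  shows "rotation n (conj_refl n i f) = conj_refl n (i + 1) (rotation n f)"
proof -
  let ?R = "rotation n"
  define d where "d = 2*n+2"
  have d: "(?R ^^ d) f = f" unfolding d_def by (rule rotation_order[OF assms])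
  have "Suc ((2*n+1) * (i + 1)) = (2*n+1) * i + d" by (simp add: d_def)
  then have "(?R ^^ Suc ((2*n+1) * (i + 1))) f = (?R ^^ ((2*n+1) * i + d)) f"
    by (simp only:)
  then have "(?R ^^ ((2*n+1) * (i + 1))) (?R f) = (?R ^^ ((2*n+1) * i)) f"
    by (simp only: funpow_add[of "(2*n+1) * i"] funpow_Suc_right comp_apply d)
  then show ?thesis
    unfolding conj_refl_def comp_apply by (simp only: Suc_eq_plus1[symmetric] funpow.simps comp_apply)
qed

lemma rotation_funpow_coords:
  "(rotation n ^^ j) tv = (if even j then tv else 1 / tv)"
  "(rotation n ^^ j) etav = (- 1) ^ j * etav"
  "(rotation n ^^ j) (par n k) = par n (k + int j)"
proof -
  note rot = kend_simps[OF kend_rotation]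
  show "(rotation n ^^ j) tv = (if even j then tv else 1 / tv)"
    by (induction j) (simp_all add: rot rotation_simps)
  show "(rotation n ^^ j) etav = (- 1) ^ j * etav"
    by (induction j) (simp_all add: rot rotation_simps)
  show "(rotation n ^^ j) (par n k) = par n (k + int j)"
    by (induction j) (simp_all add: rotation_par add_ac)
qed

lemma conj_refl_tv: "1 \<le> n \<Longrightarrow> conj_refl n i tv = tv"
  by (simp add: conj_refl_def rotation_funpow_coords reflection_0_simps
      kend_simps[OF kend_funpow[OF kend_rotation]] kend_simps[OF kend_reflection_0])

text \<open>Every rotation negates eta. The exponents i and (2n+1) i have the same parity, so two
  signs cancel on eta and one survives on \<alpha>_i.\<close>

lemma conj_refl_etav:
  assumes "1 \<le> n" "i \<le> 2*n+1"
  shows "conj_refl n i etav = etav + (- 1) ^ i * (al n i :: 'k::field_char_0 ratfun)"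
proof -
  have "(rotation n ^^ i) (al n 0) = (al n i :: 'k ratfun)"
    using rotation_funpow_coords(3)[of i n 0, where ?'c = 'k] assms(2) by (simp add: par_al) (simp add: par_def)
  then have "(rotation n ^^ i) (etav + al n 0) = ((- 1) ^ i * etav + al n i :: 'k ratfun)"
    by (simp add: kend_simps[OF kend_funpow[OF kend_rotation]] rotation_funpow_coords)
  moreover have "(- 1) ^ ((2*n+1) * i) = ((- 1) ^ i :: 'k ratfun)"
    by (simp add: minus_one_power_iff)
  moreover have "(rotation n ^^ i) ((- 1) ^ i * f) = (- 1) ^ i * (rotation n ^^ i) f"
    if "f \<in> ratfield n" for f :: "'k ratfun"
    using that by (simp add: minus_one_power_iff kend_simps[OF kend_funpow[OF kend_rotation]])
  moreover have "reflection n 0 ((- 1) ^ i * etav) = (- 1) ^ i * (etav + al n 0 :: 'k ratfun)"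
    using assms by (simp add: minus_one_power_iff reflection_0_simps kend_simps[OF kend_reflection_0])
  ultimately have "conj_refl n i etav = (- 1) ^ i * ((- 1) ^ i * etav + al n i :: 'k ratfun)"
    by (simp add: conj_refl_def rotation_funpow_coords)
  then show ?thesis by (simp add: minus_one_power_iff)
qed

lemma conj_refl_par:
  "1 \<le> n \<Longrightarrow> conj_refl n i (par n k) = refl_par (per n) (int i) (par n) k"
  using actsD(1)[OF acts_conj_refl] by blast

section \<open>Comparison of the conjugates with the prescribed images of the variables\<close>

lemma poisson_p_q:
  assumes "1 \<le> m" "m \<le> n" "1 \<le> j" "j \<le> n"
  shows "poisson n (pv m) (qv n j) = (if m = j then 1 else 0 :: 'k::field_char_0 ratfun)"
proof -
  have "poisson n (pv m) (qv n j) = (\<Sum>i=1..n. if i = m then if m = j then 1 else 0 else 0 :: 'k ratfun)"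
    unfolding poisson_def by (intro sum.cong) (use assms in auto)
  then show ?thesis using assms by (simp add: sum.delta)
qed

lemma poisson_q_p:
  assumes "1 \<le> m" "m \<le> n" "1 \<le> j" "j \<le> n"
  shows "poisson n (qv n m - qv n (m + 1)) (pv j) =
    ((if m + 1 = j then 1 else 0) - (if m = j then 1 else 0) :: 'k::field_char_0 ratfun)"
proof -
  have "poisson n (qv n m - qv n (m + 1)) (pv j) =
     (\<Sum>i=1..n. if i = j then (if m + 1 = j then 1 else 0) - (if m = j then 1 else 0) else 0 :: 'k ratfun)"
    unfolding poisson_def
    by (intro sum.cong) (use assms in \<open>auto simp: derivation_simps[OF derivation_partial]\<close>)
  then show ?thesis using assms by (simp add: sum.delta)
qed

lemma par_odd: "1 \<le> j \<Longrightarrow> j \<le> n \<Longrightarrow> par n (2 * int j - 1) = al n (2*j-1)"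
proof -
  assume "1 \<le> j" "j \<le> n"
  then have "2*j-1 \<le> 2*n+1" "int (2*j-1) = 2 * int j - 1" by linarith+
  then show ?thesis using par_al[of "2*j-1" n] by metis
qed

lemma par_even: "j \<le> n \<Longrightarrow> par n (2 * int j) = al n (2*j)"
  using par_al[of "2*j" n] by simp

lemma refl_seq_odd:
  assumes "i \<le> 2*n+1" "1 \<le> j" "j \<le> n"
  shows "refl_seq (per n) (int i) (par n) (lat n) (2 * int j - 1) =
    (qv n j + (if i = 2*j-1 then al n i / pv j else 0) :: 'k::field_char_0 ratfun)"
proof -
  have "per n dvd 2 * int j - 1 - int i \<longleftrightarrow> i = 2*j-1"
    using dvd_small[of "per n" "2 * int j - 1 - int i"] assms by auto
  then show ?thesis
    using assms lat_diff[of j n, where ?'k = 'k]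
    by (auto simp: refl_seq_def lat_odd par_odd)
qed

lemma refl_seq_even:
  assumes "i \<le> 2*n+1" "j \<le> n"
  shows "refl_seq (per n) (int i) (par n) (lat n) (2 * int j) =
    (lat n (2 * int j) + (if i = 2*j then al n i / (qv n (j+1) - (if j = 0 then 1 else qv n j)) else 0)
      :: 'k::field_char_0 ratfun)"
proof -
  have "per n dvd 2 * int j - int i \<longleftrightarrow> i = 2*j"
    using dvd_small_cases[of "per n" "2 * int j - int i"] assms by auto
  moreover have "lat n (2 * int j + 1) = (qv n (j + 1) :: 'k ratfun)"
  proof -
    have "2 * int j + 1 = 2 * int (j + 1) - 1" by simp
    then show ?thesis using assms by (simp only: lat_odd) simp
  qed
  ultimately show ?thesis
    using assms by (auto simp: refl_seq_def lat_odd par_even)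
qed

text \<open>The difference that enters the reflection at index -1, that is, of index 2n+1. As x_{-2}
  = t R_n, the multiples of t cancel and the denominator in the definition of r_{2n+1}
  appears.\<close>

lemma lat_minus_2:
  "lat n 0 - lat n (- 2) = - ((\<Sum>k=1..n. qv n k * pv k) + etav :: 'k::field_char_0 ratfun)"
proof -
  have "lat n (2 * int n) = (lat n (- 2 + per n) :: 'k ratfun)" by simp
  then have "lat n (- 2) = tv * (lat n (2 * int n) :: 'k ratfun)"
    unfolding lat_shift by (simp add: qfac_def)
  also have "lat n (2 * int n) = Phi n / (tv - 1) + (\<Sum>j=1..n. pv j :: 'k ratfun)"
    by (rule lat_even) simp
  finally have "lat n 0 - lat n (- 2) = Phi n / (tv - 1) - tv * (Phi n / (tv - 1) + (\<Sum>j=1..n. pv j :: 'k ratfun))"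
    by (simp only: lat_0)
  also have "\<dots> = Phi n / (tv - 1) * (1 - tv) - tv * (\<Sum>j=1..n. pv j)"
  proof -
    have "a - t * (a + s) = a * (1 - t) - t * s" for a s t :: "'k ratfun" by (simp add: algebra_simps)
    then show ?thesis .
  qed
  also have "Phi n / (tv - 1) * (1 - tv) = - (Phi n :: 'k ratfun)"
  proof -
    have "f / (t - 1) * (1 - t) = - f" if "t - 1 \<noteq> 0" for f t :: "'k ratfun"
      using that by (simp add: field_simps)
    then show ?thesis by simp
  qed
  also have "(Phi n :: 'k ratfun) = (\<Sum>k=1..n. qv n k * pv k) - tv * (\<Sum>j=1..n. pv j) + etav"
    by (simp add: Phi_def sum_distrib_left left_diff_distrib sum_subtractf)
  finally show ?thesis by simp
qed

text \<open>The lattice action gives all images up to one gauge factor \<open>g\<close>, which the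
  term x_{-1} = 1 determines. It is 1 unless i = 2n+1; in that case x_{-1} itself moves, and
  rescaling it to 1 multiplies every q_j by \<open>g\<close> and divides every p_j by
  \<open>g\<close>.\<close>

lemma conj_refl_Var:
  assumes n: "1 \<le> n" and i: "i \<le> 2*n+1" and x: "x \<in> vars n"
  shows "conj_refl n i (Var x) = (refl_image n i x :: 'k::field_char_0 ratfun)"
proof -
  let ?E = "conj_refl n i :: 'k ratfun \<Rightarrow> 'k ratfun"
  let ?T = "refl_seq (per n) (int i) (par n) (lat n) :: int \<Rightarrow> 'k ratfun"
  let ?S = "(\<Sum>k=1..n. qv n k * pv k) + etav :: 'k ratfun"
  note E = kend_simps[OF kend_conj_refl[OF n]]
  have "gauge n (\<lambda>k. ?E (lat n k)) ?T"
    by (rule actsD(2)[OF acts_conj_refl[OF n]])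
  then obtain g where g: "g \<noteq> 0" "\<And>k. ?E (lat n k) = gfac g k * ?T k"
    unfolding gauge_def by blast
  have dvd1: "per n dvd - 1 - int i \<longleftrightarrow> i = 2*n+1"
  proof
    assume "i = 2*n+1"
    then have "- 1 - int i = - per n" by simp
    then show "per n dvd - 1 - int i" by (metis dvd_minus_iff dvd_refl)
  qed (use dvd_small_cases[of "per n" "- 1 - int i"] i in auto)
  have T1: "?T (- 1) = (if i = 2*n+1 then 1 - al n i / ?S else 1)"
  proof (cases "i = 2*n+1")
    case True
    have "par n (- 1) = (par n (- 1 + per n) :: 'k ratfun)" by (simp only: par_shift)
    then have "par n (- 1) = (al n i :: 'k ratfun)" using True par_al[of i n] by simp
    then have "?T (- 1) = 1 + al n i / (lat n 0 - lat n (- 2))"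
      using dvd1 True by (simp add: refl_seq_def)
    then show ?thesis using True unfolding lat_minus_2 minus_divide_right[symmetric] by simp
  next
    case False
    then show ?thesis using dvd1 by (simp add: refl_seq_def)
  qed
  have gT: "g * ?T (- 1) = 1"
    using g(2)[of "- 1"] by (simp add: E gfac_def)
  have q: "?E (Var (VQ j)) = g * (qv n j + (if i = 2*j-1 then al n i / pv j else 0))"
    if "1 \<le> j" "j \<le> n" for j
    using that g(2)[of "2 * int j - 1"] i
    by (simp add: lat_odd qv_Var refl_seq_odd gfac_def)
  have p: "?E (pv j) = inverse g * (pv j + (if i = 2*j then al n i / (qv n (j+1) - qv n j) else 0)
      - (if i = 2*(j-1) then al n i / (qv n j - (if j = 1 then 1 else qv n (j-1))) else 0))"
    if j: "1 \<le> j" "j \<le> n" for j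
  proof -
    have j2: "2 * int j - 2 = 2 * int (j - 1)" using j by simp
    have "?E (pv j) = ?E (lat n (2 * int j)) - ?E (lat n (2 * int j - 2))"
      using lat_diff[OF j, where ?'k = 'k] by (metis E(9) lat_in)
    also have "\<dots> = inverse g * (?T (2 * int j) - ?T (2 * int j - 2))"
      by (simp add: g(2) gfac_def right_diff_distrib)
    also have "?T (2 * int j) - ?T (2 * int j - 2) = lat n (2 * int j) - lat n (2 * int j - 2) +
       (if i = 2*j then al n i / (qv n (j+1) - qv n j) else 0)
      - (if i = 2*(j-1) then al n i / (qv n j - (if j = 1 then 1 else qv n (j-1))) else 0)"
      unfolding j2 using j i refl_seq_even[of i n j, where ?'k = 'k] refl_seq_even[of i n "j - 1", where ?'k = 'k]
      by (simp add: algebra_simps)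
    finally show ?thesis by (simp add: lat_diff[OF j])
  qed
  show ?thesis using x
  proof (cases rule: vars_cases)
    case (VQ j)
    show ?thesis
    proof (cases "i = 2*n+1")
      case True
      have S: "?S - al n i \<noteq> 0"
        by (rule nonzero_by_partial[of n VEta])
          (use i in \<open>simp add: derivation_simps[OF derivation_partial]\<close>)
      have S0: "?S \<noteq> 0"
        by (rule nonzero_by_partial[of n VEta]) (simp add: derivation_simps[OF derivation_partial])
      \<comment> \<open>Inverting 1 - \<alpha>/S moves the denominator to S - \<alpha>. Hence the
        two different denominators in the prescribed images of the q_j and p_j.\<close>
      have "g = 1 + al n i / (?S - al n i)"
      proof -
        have "g = 1 + a / (s - a)" if "g * (1 - a / s) = 1" "s \<noteq> 0" "s - a \<noteq> 0" for s a :: "'k ratfun"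
        proof -
          have "g * (s - a) = s" using that by (simp add: field_simps)
          then show ?thesis using that by (simp add: field_simps)
        qed
        then show ?thesis using gT T1 True S S0 by simp
      qed
      moreover have "i \<noteq> 2*j-1" using True VQ by linarith
      ultimately show ?thesis using True VQ q[of j] by (simp add: refl_image_def distrib_right)
    next
      case False
      then have "g = 1" using gT T1 by simp
      show ?thesis
      proof (cases "odd i")
        case True
        define m where "m = (i + 1) div 2"
        have m: "m = j \<longleftrightarrow> i = 2*j-1" "1 \<le> m" "m \<le> n"
          using True False i VQ by (auto simp: m_def elim!: oddE)
        have "refl_image n i (VQ j) = (qv n j + al n i / pv m * (if m = j then 1 else 0) :: 'k ratfun)"
          using True False VQ m by (simp add: refl_image_def Let_def poisson_p_q m_def[symmetric] del: One_nat_def)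
        then show ?thesis
          using VQ q[of j] \<open>g = 1\<close> m(1) by (cases "m = j") auto
      next
        case e: False
        then have "i \<noteq> 2*j-1" using VQ by auto
        then show ?thesis using e False VQ q[of j] \<open>g = 1\<close> by (auto simp add: refl_image_def)
      qed
    qed
  next
    case (VP j)
    show ?thesis
    proof (cases "i = 2*n+1")
      case True
      then have "inverse g = 1 - al n i / ?S" using gT T1 by (simp add: inverse_unique)
      then show ?thesis using True VP p[of j] by (auto simp add: refl_image_def left_diff_distrib)
    next
      case False
      then have "g = 1" using gT T1 by simp
      consider "odd i" | "i = 0" | "even i" "i \<noteq> 0" by auto
      then show ?thesis
      proof cases
        case 1
        then show ?thesis using False VP p[of j] \<open>g = 1\<close> by (auto simp add: refl_image_def)
      next
        case 2
        then show ?thesis using VP p[of j] \<open>g = 1\<close> refl_image_0(2)[of j n, where ?'k = 'k] by auto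
      next
        case 3
        define m where "m = i div 2"
        have m: "i = 2*m" "1 \<le> m" "m \<le> n" using 3 i by (auto simp: m_def)
        have "refl_image n i (VP j) = (pv j + al n i / (qv n m - qv n (m + 1)) *
           ((if m + 1 = j then 1 else 0) - (if m = j then 1 else 0)) :: 'k ratfun)"
          using m VP by (simp add: refl_image_def Let_def poisson_q_p del: One_nat_def)
        moreover have "al n i / (qv n (m+1) - qv n m) = - (al n i / (qv n m - qv n (m + 1) :: 'k ratfun))"
          by (metis minus_diff_eq minus_divide_right)
        ultimately show ?thesis
          using p[of j] VP \<open>g = 1\<close> m by auto
      qed
    qed
  next
    case VT
    then show ?thesis by (simp add: conj_refl_tv[OF n] refl_image_def)
  next
    case VEta
    then show ?thesis by (simp add: conj_refl_etav[OF n i] refl_image_def)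
  next
    case (VAlpha j)
    then have "?E (par n (int j)) = refl_par (per n) (int i) (par n) (int j)"
      by (intro conj_refl_par n)
    then show ?thesis using VAlpha i coupling_cartan[OF n i, of j]
      by (simp add: refl_par_def par_al refl_image_def al_Var)
  qed
qed

text \<open>From here on every property of the conjugates is available for the reflections as they
  are defined.\<close>

lemma reflection_eq:
  assumes "1 \<le> n" "i \<le> 2*n+1" "f \<in> ratfield n"
  shows "reflection n i f = conj_refl n i f"
  unfolding reflection_def
  by (rule ratfun_subst_eq[OF kend_conj_refl[OF assms(1)] conj_refl_Var[OF assms(1,2)] assms(3)])

section \<open>The fundamental relations\<close>

lemma coupling_add: "coupling N (N * m + k) = coupling N k"
proof -
  have "N dvd N * m + k' \<longleftrightarrow> N dvd k'" for k'
    by (simp add: dvd_add_right_iff)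
  from this[of k] this[of "k - 1"] this[of "k + 1"] show ?thesis
    by (simp add: coupling_def algebra_simps)
qed

lemma coupling_small:
  assumes "3 \<le> N"
  shows "coupling N 0 = 2" "coupling N 1 = - 1" "coupling N (- 1) = - 1"
proof -
  have "\<not> N dvd 1" "\<not> N dvd - 1" using assms by (auto dest: zdvd_imp_le)
  then show "coupling N 0 = 2" "coupling N 1 = - 1" "coupling N (- 1) = - 1"
    by (simp_all add: coupling_def)
qed

lemma refl_par_twice: "3 \<le> N \<Longrightarrow> refl_par N i (refl_par N i c) = c"
  by (rule ext) (simp add: refl_par_def coupling_small algebra_simps)

lemma not_dvd_near:
  fixes N m :: int
  assumes "4 \<le> N"
  shows "\<not> N dvd N * m + 1" "\<not> N dvd N * m + 2" "\<not> N dvd N * m - 1" "\<not> N dvd N * m - 2"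
proof -
  have "\<not> N dvd 1" "\<not> N dvd 2" using assms by (auto dest: zdvd_imp_le)
  then show "\<not> N dvd N * m + 1" "\<not> N dvd N * m + 2" "\<not> N dvd N * m - 1" "\<not> N dvd N * m - 2"
    by (auto simp: dvd_add_right_iff dvd_diff_right_iff)
qed

text \<open>The neighbours of a moved term stay fixed, so both corrections have the same
  denominator, and the parameter has changed its sign in between.\<close>

lemma refl_seq_twice:
  assumes N: "4 \<le> N" and c: "\<And>k m. c (k + N * m) = c k"
  shows "refl_seq N i (refl_par N i c) (refl_seq N i c A) = A"
proof
  fix k
  show "refl_seq N i (refl_par N i c) (refl_seq N i c A) k = A k"
  proof (cases "N dvd k - i")
    case True
    then obtain m where "k - i = N * m" by blast
    then have k: "k = i + N * m" by simp
    have e: "k + 1 - i = N * m + 1" "k - 1 - i = N * m - 1" "k - i = N * m" by (simp_all add: k)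
    have "c k = c i" by (simp add: k c)
    moreover have "coupling N (k - i) = 2" by (simp add: coupling_def True)
    ultimately show ?thesis
      using not_dvd_near[OF N, of m] by (simp add: refl_seq_def refl_par_def e(1,2) True diff_divide_distrib)
  next
    case False
    then show ?thesis by (simp add: refl_seq_def)
  qed
qed

lemma refl_par_commute:
  assumes "coupling N (i - j) = 0" "coupling N (j - i) = 0"
  shows "refl_par N i (refl_par N j c) = refl_par N j (refl_par N i c)"
  by (rule ext) (simp add: refl_par_def assms)

lemma coupling_0_dvd:
  assumes "coupling N m = 0"
  shows "\<not> N dvd m" "\<not> N dvd m - 1" "\<not> N dvd m + 1"
  using assms by (auto simp: coupling_def split: if_splits)

text \<open>If i and j are neither congruent nor adjacent, the reflection of index j changes neither
  x_k, nor its neighbours, nor the parameter at k, for k congruent to i.\<close>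

lemma refl_seq_commute_aux:
  assumes "coupling N (i - j) = 0" and c: "\<And>k m. c (k + N * m) = c k" and k: "N dvd k - i"
  shows "refl_seq N j (refl_par N i c) (refl_seq N i c A) k = refl_seq N i (refl_par N j c) (refl_seq N j c A) k"
proof -
  obtain m where "k - i = N * m" using k by blast
  then have k': "k = i + N * m" by simp
  have e: "N dvd k - j \<longleftrightarrow> N dvd i - j" "N dvd k + 1 - j \<longleftrightarrow> N dvd i - j + 1" "N dvd k - 1 - j \<longleftrightarrow> N dvd i - j - 1"
    using dvd_add_left_iff[of N "N * m" "i - j"] dvd_add_left_iff[of N "N * m" "i - j + 1"]
      dvd_add_left_iff[of N "N * m" "i - j - 1"]
    by (simp_all add: k' algebra_simps)
  have "coupling N (k - j) = 0" using assms(1) coupling_add[of N m "i - j"]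
    by (simp add: k' algebra_simps)
  then show ?thesis
    using coupling_0_dvd[OF assms(1)] k by (simp add: refl_seq_def refl_par_def e)
qed

lemma refl_seq_commute:
  assumes "coupling N (i - j) = 0" "coupling N (j - i) = 0" and c: "\<And>k m. c (k + N * m) = c k"
  shows "refl_seq N j (refl_par N i c) (refl_seq N i c A) = refl_seq N i (refl_par N j c) (refl_seq N j c A)"
proof
  fix k
  consider "N dvd k - i" | "N dvd k - j" | "\<not> N dvd k - i" "\<not> N dvd k - j" by blast
  then show "refl_seq N j (refl_par N i c) (refl_seq N i c A) k = refl_seq N i (refl_par N j c) (refl_seq N j c A) k"
  proof cases
    case 1
    then show ?thesis by (rule refl_seq_commute_aux[OF assms(1) c])
  next
    case 2
    then show ?thesis by (rule refl_seq_commute_aux[OF assms(2) c, symmetric])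
  qed (simp add: refl_seq_def)
qed

lemma refl_par_braid:
  assumes "3 \<le> N"
  shows "refl_par N i (refl_par N (i + 1) (refl_par N i c)) = refl_par N (i + 1) (refl_par N i (refl_par N (i + 1) c))"
  by (rule ext) (simp add: refl_par_def coupling_small[OF assms] algebra_simps)

text \<open>The braid relation at one index, with f = x_{k+1} - x_{k-1} and g = x_{k+2} - x_k for k
  congruent to i. Everything is expressed by h = f g - \<alpha> and e = f g + \<beta>, whose
  difference is \<alpha> + \<beta>.\<close>

lemma braid_identity:
  fixes f g \<alpha> \<beta> :: "'a::field"
  assumes "f \<noteq> 0" "g \<noteq> 0" "g - \<alpha> / f \<noteq> 0" "f + \<beta> / g \<noteq> 0"
  shows "\<alpha> / f + \<beta> / (f + (\<alpha> + \<beta>) / (g - \<alpha> / f)) = (\<alpha> + \<beta>) / (f + \<beta> / g)"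
proof -
  define h where "h = f * g - \<alpha>"
  define e where "e = f * g + \<beta>"
  have h: "g - \<alpha> / f = h / f" "h \<noteq> 0" and e: "f + \<beta> / g = e / g" "e \<noteq> 0"
    using assms by (auto simp: h_def e_def field_simps)
  have "f + (\<alpha> + \<beta>) / (h / f) = f * (h + \<alpha> + \<beta>) / h"
    using h(2) by (simp add: field_simps)
  also have "h + \<alpha> + \<beta> = e" by (simp add: h_def e_def)
  finally have "f + (\<alpha> + \<beta>) / (h / f) = f * e / h" .
  then have "\<alpha> / f + \<beta> / (f + (\<alpha> + \<beta>) / (g - \<alpha> / f)) = (\<alpha> * e + \<beta> * h) / (f * e)"
    using assms e(2) h by (simp add: field_simps)
  also have "\<alpha> * e + \<beta> * h = f * ((\<alpha> + \<beta>) * g)" by (simp add: e_def h_def algebra_simps)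
  also have "f * ((\<alpha> + \<beta>) * g) / (f * e) = (\<alpha> + \<beta>) / (e / g)"
    using assms e(2) by simp
  finally show ?thesis by (simp add: e(1))
qed

text \<open>Only the terms at k and k+1 with k congruent to i move, and \<open>both\<close> treats
  them together. The last three hypotheses exclude zero denominators before any reflection and after
  the first one on either side.\<close>

lemma refl_seq_braid:
  assumes N: "4 \<le> N" and c: "\<And>k m. c (k + N * m) = c k"
    and "\<And>k. A (k + 1) - A (k - 1) \<noteq> 0"
    and "\<And>k. refl_seq N i c A (k + 1) - refl_seq N i c A (k - 1) \<noteq> 0"
    and "\<And>k. refl_seq N (i + 1) c A (k + 1) - refl_seq N (i + 1) c A (k - 1) \<noteq> 0"
  shows "refl_seq N i (refl_par N (i + 1) (refl_par N i c)) (refl_seq N (i + 1) (refl_par N i c) (refl_seq N i c A)) =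
    refl_seq N (i + 1) (refl_par N i (refl_par N (i + 1) c)) (refl_seq N i (refl_par N (i + 1) c) (refl_seq N (i + 1) c A))"
    (is "?L = ?R")
proof
  fix k
  define j where "j = i + 1"
  have both: "?L k = ?R k \<and> ?L (k + 1) = ?R (k + 1)" if ki: "N dvd k - i" for k
  proof -
    obtain m where "k - i = N * m" using ki by (auto elim: dvdE)
    then have k: "k = i + N * m" by simp
    define p s u where "p = k - 1" and "s = k + 1" and "u = k + 2"
    note psu = p_def s_def u_def
    have e: "p - i = N * m - 1" "p - j = N * m - 2" "k - j = N * m - 1" "s - i = N * m + 1"
      "u - i = N * m + 2" "u - j = N * m + 1"
      by (simp_all add: k psu j_def)
    have nd: "\<not> N dvd p - i" "\<not> N dvd p - j" "\<not> N dvd k - j" "\<not> N dvd s - i"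
      "\<not> N dvd u - i" "\<not> N dvd u - j"
      unfolding e by (rule not_dvd_near[OF N])+
    have d: "N dvd k - i" "N dvd s - j" by (simp_all add: k psu j_def)
    have seq: "refl_seq N i d B k = B k + d k / (B s - B p)" "refl_seq N j d B s = B s + d s / (B u - B k)"
      "refl_seq N i d B p = B p" "refl_seq N j d B p = B p" "refl_seq N j d B k = B k" "refl_seq N i d B s = B s"
      "refl_seq N i d B u = B u" "refl_seq N j d B u = B u" for d B :: "int \<Rightarrow> 'a"
      using nd d by (simp_all add: refl_seq_def) (simp_all add: psu add.commute)
    have cp: "coupling N (k - i) = 2" "coupling N (k - j) = - 1" "coupling N (s - i) = - 1" "coupling N (s - j) = 2"
      "coupling N 0 = 2" "coupling N (i - j) = - 1" "coupling N (j - i) = - 1"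
      using coupling_add[of N m 0] coupling_add[of N m 1] coupling_add[of N m "- 1"] coupling_small[of N] N
      by (simp_all add: k psu j_def)
    have par: "refl_par N i d k = d k - 2 * d i" "refl_par N j d k = d k + d j"
      "refl_par N i d s = d s + d i" "refl_par N j d s = d s - 2 * d j"
      "refl_par N i d i = - d i" "refl_par N j d i = d i + d j"
      "refl_par N i d j = d j + d i" "refl_par N j d j = - d j" for d :: "int \<Rightarrow> 'a"
      by (simp_all add: refl_par_def cp)
    have ck: "c k = c i" "c s = c j" using c[of i m] c[of j m] by (simp_all add: k psu j_def algebra_simps)
    define f where "f = A s - A p"
    define g where "g = A u - A k"
    have A: "A s = A p + f" "A u = A k + g" by (simp_all add: f_def g_def)
    have s1: "s - 1 = k" "s + 1 = u" "k - 1 = p" "k + 1 = s" by (simp_all add: psu)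
    have f: "f \<noteq> 0" and g: "g \<noteq> 0"
      using assms(3)[of k] assms(3)[of s] by (simp_all only: s1 f_def g_def not_False_eq_True)
    have h: "g - c i / f \<noteq> 0"
      using assms(4)[of s] unfolding s1 seq ck A by (simp add: algebra_simps)
    have h': "f + c j / g \<noteq> 0"
      using assms(5)[of k] unfolding s1 j_def[symmetric] seq ck A by (simp add: algebra_simps)
    have 1: "c i / f + c j / (f + (c i + c j) / (g - c i / f)) = (c i + c j) / (f + c j / g)"
      by (rule braid_identity[OF f g h h'])
    \<comment> \<open>The identity at k+1 is the one at k with f and g exchanged and both parameters
      negated.\<close>
    have 2: "(c i + c j) / (g - c i / f) = c j / g + c i / (g - (c i + c j) / (f + c j / g))"
    proof -
      have n: "- c j - c i = - (c i + c j)" by simp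
      have "- (c j / g) - c i / (g + (- c j - c i) / (f + c j / g)) = (- c j - c i) / (g - c i / f)"
        using braid_identity[of g f "- c j" "- c i"] f g h h' by simp
      then have "- (c j / g) - c i / (g - (c i + c j) / (f + c j / g)) = - ((c i + c j) / (g - c i / f))"
        unfolding n minus_divide_left[symmetric] add_uminus_conv_diff .
      moreover have "P = Q + R" if "- Q - R = - P" for P Q R :: 'a
        using arg_cong[OF that, of uminus] by (simp add: add.commute)
      ultimately show ?thesis by blast
    qed
    have "?L k = A k + (c i / f + c j / (f + (c i + c j) / (g - c i / f)))"
      unfolding j_def[symmetric] seq par ck A by (simp add: algebra_simps)
    moreover have "?R k = A k + (c i + c j) / (f + c j / g)"
      unfolding j_def[symmetric] seq par ck A by (simp add: algebra_simps)
    moreover have "?L s = A s + (c i + c j) / (g - c i / f)"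
      unfolding j_def[symmetric] seq par ck A by (simp add: algebra_simps)
    moreover have "?R s = A s + (c j / g + c i / (g - (c i + c j) / (f + c j / g)))"
      unfolding j_def[symmetric] seq par ck A by (simp add: algebra_simps)
    ultimately show ?thesis using 1 2 by (simp only: s1)
  qed
  consider (i) "N dvd k - i" | (j) "N dvd k - 1 - i" | (none) "\<not> N dvd k - i" "\<not> N dvd k - (i + 1)"
    by (metis diff_diff_eq add.commute)
  then show "?L k = ?R k"
  proof cases
    case i
    then show ?thesis using both by blast
  next
    case j
    from both[OF this] show ?thesis by simp
  qed (simp add: refl_seq_def)
qed

section \<open>Nonvanishing denominators and the relations between automorphisms\<close>

lemma lat_diff_nonzero:
  assumes "1 \<le> n"
  shows "lat n (k + 1) - lat n (k - 1) \<noteq> (0 :: 'k::field_char_0 ratfun)"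
proof -
  \<comment> \<open>An indicator of nonvanishing. The difference itself is only quasi-periodic, but
    its indicator has multiplier 1, so \<open>quasi_periodic_eqI\<close> applies to a statement
    about being nonzero.\<close>
  define D :: "int \<Rightarrow> 'k ratfun" where "D k = (if lat n (k + 1) - lat n (k - 1) = (0 :: 'k ratfun) then 0 else 1)" for k
  have "D k = 1"
  proof (rule quasi_periodic_eqI[where \<tau> = "\<lambda>_. 1" and n = n and B = "\<lambda>_. 1"])
    fix k :: int
    have "k + per n + 1 = k + 1 + per n" "k + per n - 1 = k - 1 + per n" by simp_all
    then have "lat n (k + per n + 1) - lat n (k + per n - 1) = (lat n (k + 1) - lat n (k - 1)) / (qfac k :: 'k ratfun)"
      by (simp only: lat_shift qfac_shift diff_divide_distrib) simp
    then show "D (k + per n) = 1 * D k" by (simp add: D_def)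
  next
    fix r :: int
    assume "- 1 \<le> r" "r \<le> 2 * int n"
    then have "lat n (r + 1) - lat n (r - 1) \<noteq> (0 :: 'k ratfun)"
    proof (cases rule: base_cases)
      case (1 i)
      show ?thesis
      proof (cases "i = 0")
        case True
        have "(\<Sum>k=1..n. qv n k * pv k) + etav \<noteq> (0 :: 'k ratfun)"
          by (rule nonzero_by_partial[of n VEta]) (simp add: derivation_simps[OF derivation_partial])
        then have "lat n 0 - lat n (- 2) \<noteq> (0 :: 'k ratfun)"
          unfolding lat_minus_2 neg_equal_0_iff_equal .
        then show ?thesis using 1 True by simp
      next
        case False
        have "pv i \<noteq> (0 :: 'k ratfun)"
          by (rule nonzero_by_partial[of n "VP i"]) (use 1 False in simp)
        then show ?thesis using 1 False lat_diff[of i n, where ?'k = 'k] by simp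
      qed
    next
      case (2 i)
      have "2 * int i + 1 = 2 * int (i + 1) - 1" by simp
      then have l: "lat n (2 * int i + 1) = (qv n (i + 1) :: 'k ratfun)"
        using 2 by (simp only: lat_odd) simp
      show ?thesis
      proof (cases "i = 0")
        case True
        then show ?thesis using 2 l q1_neq_1[OF assms, where ?'a = 'k] by simp
      next
        case False
        have "qv n (i + 1) - qv n i \<noteq> (0 :: 'k ratfun)"
          by (rule nonzero_by_partial[of n "VQ i"])
            (use 2 False in \<open>simp add: derivation_simps[OF derivation_partial]\<close>)
        then show ?thesis using 2 l False by (simp add: lat_odd)
      qed
    qed
    then show "D r = 1" by (simp add: D_def)
  qed simp_all
  then show ?thesis by (auto simp: D_def)
qed

text \<open>Field endomorphisms are injective, and indices of equal parity carry the same gauge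
  factor, so nonvanishing passes from the lattice to any sequence by which an endomorphism
  acts.\<close>

lemma acts_diff_nonzero:
  fixes \<phi> :: "'k::field_char_0 ratfun \<Rightarrow> 'k ratfun"
  assumes "1 \<le> n" "kend n \<phi>" "acts n \<phi> c A"
  shows "A (k + 1) - A (k - 1) \<noteq> 0"
proof
  assume "A (k + 1) - A (k - 1) = 0"
  then have eq: "A (k + 1) = A (k - 1)" by simp
  obtain g where "\<And>k. \<phi> (lat n k) = gfac g k * A k"
    using actsD(2)[OF assms(3)] unfolding gauge_def by blast
  then have "\<phi> (lat n (k + 1)) = \<phi> (lat n (k - 1))" by (simp add: eq)
  then have "lat n (k + 1) = (lat n (k - 1) :: 'k ratfun)" by (rule kend_inj[OF assms(2), rotated 2]) simp_all
  then show False using lat_diff_nonzero[OF assms(1), of k, where ?'k = 'k] by simp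
qed

context
  fixes n :: nat
  assumes n: "1 \<le> n"
begin

lemma conj_refl_twice:
  fixes f :: "'k::field_char_0 ratfun"
  assumes "f \<in> ratfield n"
  shows "conj_refl n i (conj_refl n i f) = f"
proof -
  note E = kend_conj_refl[OF n] and A = acts_conj_refl[OF n, where ?'k = 'k]
  have "acts n (conj_refl n i \<circ> conj_refl n i :: 'k ratfun \<Rightarrow> 'k ratfun) (par n) (lat n)"
  proof -
    have "refl_par (per n) (int i) (refl_par (per n) (int i) (par n)) = (par n :: int \<Rightarrow> 'k ratfun)"
      by (rule refl_par_twice) (use n in simp)
    moreover have "refl_seq (per n) (int i) (refl_par (per n) (int i) (par n)) (refl_seq (per n) (int i) (par n) (lat n)) =
        (lat n :: int \<Rightarrow> 'k ratfun)"
      by (rule refl_seq_twice) (use n in simp, rule par_mod)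
    ultimately show ?thesis using acts_comp_refl[OF E A A, of i i] by simp
  qed
  from acts_eqI[OF kend_comp[OF E E] this kend_id acts_id _ assms] show ?thesis
    by (simp add: conj_refl_tv[OF n])
qed

lemma conj_refl_commute:
  fixes f :: "'k::field_char_0 ratfun"
  assumes "coupling (per n) (int i - int j) = 0" "coupling (per n) (int j - int i) = 0" "f \<in> ratfield n"
  shows "conj_refl n i (conj_refl n j f) = conj_refl n j (conj_refl n i f)"
proof -
  note E = kend_conj_refl[OF n] and A = acts_conj_refl[OF n, where ?'k = 'k]
  have 1: "acts n (conj_refl n i \<circ> conj_refl n j :: 'k ratfun \<Rightarrow> 'k ratfun) (refl_par (per n) (int j) (refl_par (per n) (int i) (par n)))
     (refl_seq (per n) (int j) (refl_par (per n) (int i) (par n)) (refl_seq (per n) (int i) (par n) (lat n)))"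
    by (rule acts_comp_refl[OF E A A])
  have 2: "acts n (conj_refl n j \<circ> conj_refl n i :: 'k ratfun \<Rightarrow> 'k ratfun) (refl_par (per n) (int j) (refl_par (per n) (int i) (par n)))
     (refl_seq (per n) (int j) (refl_par (per n) (int i) (par n)) (refl_seq (per n) (int i) (par n) (lat n)))"
    unfolding refl_par_commute[OF assms(2,1)]
    by (subst refl_seq_commute[OF assms(1,2)]) (simp add: par_mod, rule acts_comp_refl[OF E A A])
  from acts_eqI[OF kend_comp[OF E E] 1 kend_comp[OF E E] 2 _ assms(3)]
  show ?thesis by (simp add: conj_refl_tv[OF n])
qed

lemma conj_refl_braid:
  fixes f :: "'k::field_char_0 ratfun"
  assumes "f \<in> ratfield n"
  shows "conj_refl n i (conj_refl n (i + 1) (conj_refl n i f)) =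
    conj_refl n (i + 1) (conj_refl n i (conj_refl n (i + 1) f))"
proof -
  note E = kend_conj_refl[OF n] and A = acts_conj_refl[OF n, where ?'k = 'k]
  let ?i = "int i" and ?j = "int i + 1"
  have A': "acts n (conj_refl n (i + 1) :: 'k ratfun \<Rightarrow> 'k ratfun) (refl_par (per n) ?j (par n)) (refl_seq (per n) ?j (par n) (lat n))"
    using A[of "i + 1"] by (simp add: add.commute)
  have 1: "acts n (conj_refl n i \<circ> conj_refl n (i + 1) \<circ> conj_refl n i :: 'k ratfun \<Rightarrow> 'k ratfun)
     (refl_par (per n) ?i (refl_par (per n) ?j (refl_par (per n) ?i (par n))))
     (refl_seq (per n) ?i (refl_par (per n) ?j (refl_par (per n) ?i (par n)))
       (refl_seq (per n) ?j (refl_par (per n) ?i (par n)) (refl_seq (per n) ?i (par n) (lat n))))"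
    by (rule acts_comp_refl[OF kend_comp[OF E E] acts_comp_refl[OF E A A'] A])
  have 2: "acts n (conj_refl n (i + 1) \<circ> conj_refl n i \<circ> conj_refl n (i + 1) :: 'k ratfun \<Rightarrow> 'k ratfun)
     (refl_par (per n) ?j (refl_par (per n) ?i (refl_par (per n) ?j (par n))))
     (refl_seq (per n) ?j (refl_par (per n) ?i (refl_par (per n) ?j (par n)))
       (refl_seq (per n) ?i (refl_par (per n) ?j (par n)) (refl_seq (per n) ?j (par n) (lat n))))"
    by (rule acts_comp_refl[OF kend_comp[OF E E] acts_comp_refl[OF E A' A] A'])
  have "refl_par (per n) ?i (refl_par (per n) ?j (refl_par (per n) ?i (par n))) =
      (refl_par (per n) ?j (refl_par (per n) ?i (refl_par (per n) ?j (par n))) :: int \<Rightarrow> 'k ratfun)"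
    by (rule refl_par_braid) (use n in simp)
  moreover have "refl_seq (per n) ?i (refl_par (per n) ?j (refl_par (per n) ?i (par n)))
       (refl_seq (per n) ?j (refl_par (per n) ?i (par n)) (refl_seq (per n) ?i (par n) (lat n))) =
     (refl_seq (per n) ?j (refl_par (per n) ?i (refl_par (per n) ?j (par n)))
       (refl_seq (per n) ?i (refl_par (per n) ?j (par n)) (refl_seq (per n) ?j (par n) (lat n))) :: int \<Rightarrow> 'k ratfun)"
  proof (rule refl_seq_braid)
    show "4 \<le> per n" using n by simp
  qed (rule par_mod lat_diff_nonzero[OF n] acts_diff_nonzero[OF n E A] acts_diff_nonzero[OF n E A'])+
  ultimately have "acts n (conj_refl n (i + 1) \<circ> conj_refl n i \<circ> conj_refl n (i + 1) :: 'k ratfun \<Rightarrow> 'k ratfun)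
     (refl_par (per n) ?i (refl_par (per n) ?j (refl_par (per n) ?i (par n))))
     (refl_seq (per n) ?i (refl_par (per n) ?j (refl_par (per n) ?i (par n)))
       (refl_seq (per n) ?j (refl_par (per n) ?i (par n)) (refl_seq (per n) ?i (par n) (lat n))))"
    using 2 by simp
  from acts_eqI[OF kend_comp[OF kend_comp[OF E E] E] 1 kend_comp[OF kend_comp[OF E E] E] this _ assms]
  show ?thesis by (simp add: conj_refl_tv[OF n])
qed

text \<open>Closes the cycle of indices: the relations between indices i and i+1 thereby cover the
  pair 2n+1, 0.\<close>

lemma conj_refl_period:
  fixes f :: "'k::field_char_0 ratfun"
  assumes "f \<in> ratfield n"
  shows "conj_refl n (2*n+2) f = conj_refl n 0 f"
proof -
  have "acts n (conj_refl n (2*n+2) :: 'k ratfun \<Rightarrow> 'k ratfun) (refl_par (per n) (per n) (par n)) (refl_seq (per n) (per n) (par n) (lat n))"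
    using acts_conj_refl[OF n, of "2*n+2"] by (simp add: add.commute)
  moreover have "refl_par (per n) (per n) (par n) = (refl_par (per n) (int 0) (par n) :: int \<Rightarrow> 'k ratfun)"
  proof
    fix k
    have "par n (per n) = (par n 0 :: 'k ratfun)" using par_shift[of n 0, where ?'a = 'k] by simp
    moreover have "coupling (per n) (k - per n) = coupling (per n) k"
      using coupling_mod[of "per n" k 0] coupling_mod[of "per n" "k - per n" 0] by simp
    ultimately show "refl_par (per n) (per n) (par n) k = (refl_par (per n) (int 0) (par n) k :: 'k ratfun)"
      by (simp add: refl_par_def)
  qed
  moreover have "per n dvd k - per n \<longleftrightarrow> per n dvd k" for k
    using dvd_diff_left_iff[of "per n" "per n" k] by simp
  then have "refl_seq (per n) (per n) (par n) (lat n) = (refl_seq (per n) (int 0) (par n) (lat n) :: int \<Rightarrow> 'k ratfun)"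
    by (intro ext) (simp add: refl_seq_def)
  ultimately have "acts n (conj_refl n (2*n+2) :: 'k ratfun \<Rightarrow> 'k ratfun) (refl_par (per n) (int 0) (par n)) (refl_seq (per n) (int 0) (par n) (lat n))"
    by simp
  from acts_eqI[OF kend_conj_refl[OF n] this kend_conj_refl[OF n] acts_conj_refl[OF n, where ?'k = 'k] _ assms]
  show ?thesis by (simp add: conj_refl_tv[OF n])
qed

end

section \<open>Presented groups\<close>

lemma pres_cong_context:
  "pres_cong S R u v \<Longrightarrow> pres_cong S R (x @ u @ y) (x @ v @ y)"
proof (induction rule: pres_cong.induct)
  case (refl u)
  show ?case by (rule pres_cong.refl)
next
  case (sym u v)
  show ?case by (rule pres_cong.sym) (rule sym.IH)
next
  case (trans u v w)
  then show ?case by (blast intro: pres_cong.trans)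
next
  case (cancel g u e v)
  then show ?case using pres_cong.cancel[of g S R "x @ u" e "v @ y"] by simp
next
  case (relation a b u v)
  then show ?case using pres_cong.relation[of a b R S "x @ u" "v @ y"] by simp
qed

lemma pres_cong_append:
  assumes "pres_cong S R u u'" "pres_cong S R v v'"
  shows "pres_cong S R (u @ v) (u' @ v')"
  using pres_cong.trans[of S R "u @ v" "u' @ v" "u' @ v'"]
    pres_cong_context[OF assms(1), of "[]" v] pres_cong_context[OF assms(2), of u' "[]"]
  by simp

lemma words_append [simp]: "u @ v \<in> words S \<longleftrightarrow> u \<in> words S \<and> v \<in> words S"
  by (auto simp: words_def)

lemma words_Nil [simp]: "[] \<in> words S"
  by (simp add: words_def)

lemma words_Cons [simp]: "(g, e) # w \<in> words S \<longleftrightarrow> g \<in> S \<and> w \<in> words S"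
  by (auto simp: words_def)

definition word_inv :: "'g word \<Rightarrow> 'g word" where
  "word_inv w = rev (map (\<lambda>(g, e). (g, \<not> e)) w)"

lemma word_inv_words: "w \<in> words S \<Longrightarrow> word_inv w \<in> words S"
  by (induction w) (auto simp: word_inv_def)

lemma word_inv_cancel: "w \<in> words S \<Longrightarrow> pres_cong S R (word_inv w @ w) []"
proof (induction w)
  case Nil
  show ?case by (simp add: word_inv_def pres_cong.refl)
next
  case (Cons l w)
  obtain g e where l: "l = (g, e)" by fastforce
  have "pres_cong S R (word_inv w @ [(g, \<not> e), (g, \<not> \<not> e)] @ w) (word_inv w @ w)"
    by (rule pres_cong.cancel) (use Cons l in simp)
  then have "pres_cong S R (word_inv (l # w) @ l # w) (word_inv w @ w)"
    by (simp add: word_inv_def l)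
  moreover have "pres_cong S R (word_inv w @ w) []" using Cons l by simp
  ultimately show ?case by (rule pres_cong.trans)
qed

definition word_eval :: "('a, 'b) monoid_scheme \<Rightarrow> ('g \<Rightarrow> 'a) \<Rightarrow> 'g word \<Rightarrow> 'a" where
  "word_eval G \<gamma> w = foldr (\<lambda>(g, e) a. (if e then \<gamma> g else inv\<^bsub>G\<^esub> \<gamma> g) \<otimes>\<^bsub>G\<^esub> a) w \<one>\<^bsub>G\<^esub>"

lemma word_eval_simps [simp]:
  "word_eval G \<gamma> [] = \<one>\<^bsub>G\<^esub>"
  "word_eval G \<gamma> ((g, e) # w) = (if e then \<gamma> g else inv\<^bsub>G\<^esub> \<gamma> g) \<otimes>\<^bsub>G\<^esub> word_eval G \<gamma> w"
  by (simp_all add: word_eval_def)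

context group
begin

lemma word_eval_closed:
  "\<gamma> ` S \<subseteq> carrier G \<Longrightarrow> w \<in> words S \<Longrightarrow> word_eval G \<gamma> w \<in> carrier G"
  by (induction w) (auto simp: image_subset_iff)

lemma word_eval_append:
  assumes "\<gamma> ` S \<subseteq> carrier G" "u \<in> words S" "v \<in> words S"
  shows "word_eval G \<gamma> (u @ v) = word_eval G \<gamma> u \<otimes> word_eval G \<gamma> v"
  using assms(2)
proof (induction u)
  case Nil
  then show ?case using word_eval_closed[OF assms(1,3)] by simp
next
  case (Cons l u)
  then show ?case using assms(1) word_eval_closed[OF assms(1,3)] word_eval_closed[OF assms(1), of u]
    by (cases l) (auto simp: m_assoc)
qed

text \<open>
  If the relators hold in \<open>G\<close> and every word evaluating to the identity is trivial in the
  presented group, then a congruence class is the set of all words with a given value.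
\<close>

lemma presented_group_iso:
  assumes \<gamma>: "\<gamma> ` S \<subseteq> carrier G"
    and R: "\<And>a b. (a, b) \<in> R \<Longrightarrow> a \<in> words S \<and> b \<in> words S \<and> word_eval G \<gamma> a = word_eval G \<gamma> b"
    and triv: "\<And>w. w \<in> words S \<Longrightarrow> word_eval G \<gamma> w = \<one> \<Longrightarrow> pres_cong S R w []"
  shows "subgroup_generated G (\<gamma> ` S) \<cong> presented_group S R"
proof -
  let ?ev = "word_eval G \<gamma>"
  note closed = word_eval_closed[OF \<gamma>] and app = word_eval_append[OF \<gamma>]
  \<comment> \<open>\<open>pres_cong\<close> also relates words with letters outside
    \<open>S\<close>, so the induction carries along that membership in \<open>words S\<close> is
    preserved.\<close>
  have sound: "(u \<in> words S \<longleftrightarrow> v \<in> words S) \<and> (u \<in> words S \<longrightarrow> ?ev u = ?ev v)"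
    if "pres_cong S R u v" for u v
    using that
  proof (induction rule: pres_cong.induct)
    case (cancel g u e v)
    then have 1: "?ev [(g, e), (g, \<not> e)] = \<one>" using \<gamma> by auto
    have m: "[(g, e), (g, \<not> e)] \<in> words S" using cancel by simp
    have "?ev (u @ [(g, e), (g, \<not> e)] @ v) = ?ev (u @ v)" if "u \<in> words S" "v \<in> words S"
      using that m closed[OF that(2)] by (simp only: app words_append 1 l_one)
    then show ?case using m by auto
  next
    case (relation a b u v)
    then show ?case using R closed by (auto simp: app)
  qed auto
  \<comment> \<open>The word u v^{-1} has value 1 and is therefore trivial; multiplying by v gives
    the congruence.\<close>
  have complete: "pres_cong S R u v" if uv: "u \<in> words S" "v \<in> words S" "?ev u = ?ev v" for u v
  proof -
    note iv = word_inv_words[OF uv(2)]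
    have "?ev (word_inv v) \<otimes> ?ev v = \<one>"
      using sound[OF word_inv_cancel[OF uv(2)]] iv uv by (simp add: app)
    then have "?ev v \<otimes> ?ev (word_inv v) = \<one>"
      using closed[OF iv] closed[OF uv(2)] inv_comm by blast
    then have "?ev (u @ word_inv v) = \<one>" using iv uv by (simp add: app)
    then have "pres_cong S R (u @ word_inv v) []" using iv uv by (intro triv) simp_all
    then have 1: "pres_cong S R ((u @ word_inv v) @ v) ([] @ v)"
      by (rule pres_cong_append[OF _ pres_cong.refl])
    have "pres_cong S R (u @ (word_inv v @ v)) (u @ [])"
      by (rule pres_cong_append[OF pres_cong.refl word_inv_cancel[OF uv(2)]])
    then have "pres_cong S R (u @ word_inv v @ v) u" by simp
    moreover have "pres_cong S R (u @ word_inv v @ v) v" using 1 by simp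
    ultimately show ?thesis by (rule pres_cong.trans[OF pres_cong.sym])
  qed
  \<comment> \<open>The isomorphism sends a group element to the set of all words with that value.
    Going in this direction avoids choosing a word for each element.\<close>
  define cl where "cl f = {w \<in> words S. ?ev w = f}" for f
  have cls: "pres_rel S R `` {w} = cl (?ev w)" if "w \<in> words S" for w
  proof (rule Set.set_eqI)
    fix v
    show "v \<in> pres_rel S R `` {w} \<longleftrightarrow> v \<in> cl (?ev w)"
      unfolding pres_rel_def cl_def using that sound[of w v] complete[of w v] by auto
  qed
  have gen: "\<exists>w\<in>words S. ?ev w = f" if "f \<in> generate G (\<gamma> ` S)" for f
    using that
  proof (induction rule: generate.induct)
    case one
    show ?case by (rule bexI[of _ "[]"]) simp_all
  next
    case (incl h)
    then obtain g where "g \<in> S" "h = \<gamma> g" by blast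
    moreover from this have "\<gamma> g \<in> carrier G" using \<gamma> by blast
    ultimately show ?case by (intro bexI[of _ "[(g, True)]"]) simp_all
  next
    case (inv h)
    then obtain g where "g \<in> S" "h = \<gamma> g" by blast
    moreover from this have "\<gamma> g \<in> carrier G" using \<gamma> by blast
    ultimately show ?case by (intro bexI[of _ "[(g, False)]"]) simp_all
  next
    case (eng h1 h2)
    then obtain u v where "u \<in> words S" "v \<in> words S" "?ev u = h1" "?ev v = h2" by blast
    then show ?case by (intro bexI[of _ "u @ v"]) (simp_all add: app)
  qed
  have gen': "?ev w \<in> generate G (\<gamma> ` S)" if "w \<in> words S" for w
    using that
  proof (induction w)
    case Nil
    show ?case by (simp add: generate.one)
  next
    case (Cons l w)
    then show ?case by (cases l) (auto intro: generate.eng generate.incl generate.inv)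
  qed
  have carrier: "carrier (subgroup_generated G (\<gamma> ` S)) = generate G (\<gamma> ` S)"
    unfolding carrier_subgroup_generated
    using \<gamma> by (metis image_subsetI inf.absorb2)
  have "cl \<in> hom (subgroup_generated G (\<gamma> ` S)) (presented_group S R)"
  proof (rule homI)
    fix f assume "f \<in> carrier (subgroup_generated G (\<gamma> ` S))"
    then obtain w where w: "w \<in> words S" "?ev w = f" using gen carrier by blast
    then have "cl f = pres_rel S R `` {w}" by (simp add: cls)
    then show "cl f \<in> carrier (presented_group S R)"
      using w by (simp add: presented_group_def quotientI)
  next
    fix f f' assume "f \<in> carrier (subgroup_generated G (\<gamma> ` S))" "f' \<in> carrier (subgroup_generated G (\<gamma> ` S))"
    then obtain w w' where w: "w \<in> words S" "?ev w = f" "w' \<in> words S" "?ev w' = f'"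
      using gen carrier by metis
    have "pres_rel S R `` {u @ v} = cl (f \<otimes> f')" if "u \<in> cl f" "v \<in> cl f'" for u v
      using that by (auto simp: cl_def cls app)
    moreover have "w \<in> cl f" "w' \<in> cl f'" using w by (simp_all add: cl_def)
    ultimately have "(\<Union>u\<in>cl f. \<Union>v\<in>cl f'. pres_rel S R `` {u @ v}) = cl (f \<otimes> f')" by auto
    then show "cl (f \<otimes>\<^bsub>subgroup_generated G (\<gamma> ` S)\<^esub> f') = cl f \<otimes>\<^bsub>presented_group S R\<^esub> cl f'"
      by (simp add: presented_group_def)
  qed
  moreover have "bij_betw cl (generate G (\<gamma> ` S)) (words S // pres_rel S R)"
  proof (rule bij_betw_imageI)
    show "inj_on cl (generate G (\<gamma> ` S))"
    proof (rule inj_onI)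
      fix f f' assume "f \<in> generate G (\<gamma> ` S)" and eq: "cl f = cl f'"
      then obtain w where "w \<in> words S" "?ev w = f" using gen by blast
      then have "w \<in> cl f" by (simp add: cl_def)
      then show "f = f'" using eq by (auto simp: cl_def)
    qed
    show "cl ` generate G (\<gamma> ` S) = words S // pres_rel S R"
    proof
      show "cl ` generate G (\<gamma> ` S) \<subseteq> words S // pres_rel S R"
        using gen cls by (fastforce simp: quotient_def)
      show "words S // pres_rel S R \<subseteq> cl ` generate G (\<gamma> ` S)"
        using gen' cls by (auto simp: quotient_def)
    qed
  qed
  ultimately have "cl \<in> iso (subgroup_generated G (\<gamma> ` S)) (presented_group S R)"
    unfolding iso_def carrier by (simp add: presented_group_def)
  then show ?thesis by (auto simp: is_iso_def)
qed

end

section \<open>Affine permutations\<close>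

definition swap_at :: "int \<Rightarrow> int \<Rightarrow> int \<Rightarrow> int" where
  "swap_at N i k = (if N dvd k - i then k + 1 else if N dvd k - (i + 1) then k - 1 else k)"

text \<open>The sum of the values over a window is not normalized, so shifts are included. This is
  what the rotation needs: the extended affine symmetric group.\<close>

definition affine_perm :: "int \<Rightarrow> (int \<Rightarrow> int) \<Rightarrow> bool" where
  "affine_perm N \<sigma> \<longleftrightarrow> bij \<sigma> \<and> (\<forall>k. \<sigma> (k + N) = \<sigma> k + N)"

context
  fixes N :: int
  assumes N: "4 \<le> N"
begin

lemma affine_perm_mult: "affine_perm N \<sigma> \<Longrightarrow> \<sigma> (k + N * m) = \<sigma> k + N * m"
proof (induction m rule: int_induct[where k = 0])
  case (step1 m)
  then show ?case using step1(2)[OF step1.prems] step1.prems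
    unfolding affine_perm_def by (metis (no_types, opaque_lifting) add.assoc distrib_left mult.right_neutral)
next
  case (step2 m)
  have "\<sigma> (k + N * (m - 1) + N) = \<sigma> (k + N * (m - 1)) + N"
    using step2.prems by (simp add: affine_perm_def)
  then show ?case using step2(2)[OF step2.prems] by (simp add: algebra_simps)
qed simp

lemma not_dvd_small: "\<not> N dvd 1" "\<not> N dvd 2" "\<not> N dvd - 1" "\<not> N dvd - 2"
  using N by (auto dest: zdvd_imp_le)

lemma dvd_shift: "N dvd k - i \<Longrightarrow> N dvd k + m - i \<longleftrightarrow> N dvd m"
proof -
  assume "N dvd k - i"
  moreover have "k + m - i = (k - i) + m" by simp
  ultimately show ?thesis by (simp only: dvd_add_right_iff)
qed

lemma swap_at_cases:
  obtains (here) "N dvd k - i" "swap_at N i k = k + 1" "\<not> N dvd k - (i + 1)"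
  | (next') "N dvd k - (i + 1)" "swap_at N i k = k - 1" "\<not> N dvd k - i"
  | (other) "\<not> N dvd k - i" "\<not> N dvd k - (i + 1)" "swap_at N i k = k"
proof -
  have "\<not> (N dvd k - i \<and> N dvd k - (i + 1))"
  proof
    assume "N dvd k - i \<and> N dvd k - (i + 1)"
    then have "N dvd (k - i) - (k - (i + 1))" by (meson dvd_diff)
    then show False using not_dvd_small by simp
  qed
  then show ?thesis using that
    by (cases "N dvd k - i"; cases "N dvd k - (i + 1)") (simp_all add: swap_at_def)
qed

lemma swap_at_self: "swap_at N i i = i + 1" "swap_at N i (i + 1) = i"
  using not_dvd_small by (simp_all add: swap_at_def)

lemma swap_at_swap_at [simp]: "swap_at N i (swap_at N i k) = k"
proof (cases rule: swap_at_cases[of k i])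
  case here
  have "k + 1 - i = (k - (i + 1)) + 2" "k + 1 - (i + 1) = k - i" by simp_all
  moreover have "\<not> N dvd k + 1 - i" using here(1) not_dvd_small by (simp add: dvd_shift)
  ultimately show ?thesis using here by (simp add: swap_at_def)
next
  case next'
  then show ?thesis by (simp add: swap_at_def diff_diff_eq add.commute)
next
  case other
  then show ?thesis by simp
qed

lemma affine_perm_swap_at: "affine_perm N (swap_at N i)"
proof -
  have "bij (swap_at N i)" by (rule involuntory_imp_bij) simp
  moreover have "N dvd k + N - j \<longleftrightarrow> N dvd k - j" for k j
    using dvd_add_left_iff[of N N "k - j"] by (simp add: algebra_simps)
  ultimately show ?thesis by (simp add: affine_perm_def swap_at_def)
qed

lemma affine_perm_comp: "affine_perm N \<sigma> \<Longrightarrow> affine_perm N \<tau> \<Longrightarrow> affine_perm N (\<sigma> \<circ> \<tau>)"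
  by (auto simp: affine_perm_def bij_comp)

lemma affine_perm_shift: "affine_perm N (\<lambda>k. k + c)"
proof -
  have "bij (\<lambda>k. k + c)" by (rule bij_betw_byWitness[where f' = "\<lambda>k. k - c"]) auto
  then show ?thesis by (simp add: affine_perm_def)
qed

lemma swap_at_cong: "N dvd i - j \<Longrightarrow> swap_at N i = swap_at N j"
proof -
  assume d: "N dvd i - j"
  have "N dvd k - (i + m) \<longleftrightarrow> N dvd k - (j + m)" for k m
  proof -
    have "k - (j + m) = (k - (i + m)) + (i - j)" by simp
    then show ?thesis using d by (simp only: dvd_add_left_iff)
  qed
  from this[of _ 0] this[of _ 1] show ?thesis by (simp add: swap_at_def fun_eq_iff)
qed

lemma swap_at_commute:
  assumes "\<not> N dvd i - j" "\<not> N dvd i - j - 1" "\<not> N dvd i - j + 1"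
  shows "swap_at N i \<circ> swap_at N j = swap_at N j \<circ> swap_at N i"
proof -
  have *: "swap_at N i (swap_at N j k) = swap_at N j (swap_at N i k)"
    if "N dvd k - i \<or> N dvd k - (i + 1)" "\<not> N dvd i - j" "\<not> N dvd i - j - 1" "\<not> N dvd i - j + 1" for i j k
  proof -
    have e: "\<not> N dvd k - j" "\<not> N dvd k - (j + 1)"
      "\<not> N dvd swap_at N i k - j" "\<not> N dvd swap_at N i k - (j + 1)"
      if "N dvd k - i"
    proof -
      have "k - j = (k - i) + (i - j)" "k - (j + 1) = (k - i) + (i - j - 1)" "k + 1 - j = (k - i) + (i - j + 1)"
        "k + 1 - (j + 1) = (k - i) + (i - j)" by simp_all
      then show "\<not> N dvd k - j" "\<not> N dvd k - (j + 1)"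
        "\<not> N dvd swap_at N i k - j" "\<not> N dvd swap_at N i k - (j + 1)"
        using that \<open>\<not> N dvd i - j\<close> \<open>\<not> N dvd i - j - 1\<close> \<open>\<not> N dvd i - j + 1\<close>
        by (simp_all only: swap_at_def if_True dvd_add_right_iff not_False_eq_True)
    qed
    have e': "\<not> N dvd k - j" "\<not> N dvd k - (j + 1)"
      "\<not> N dvd swap_at N i k - j" "\<not> N dvd swap_at N i k - (j + 1)"
      if d: "N dvd k - (i + 1)"
    proof -
      have s: "swap_at N i k = k - 1" using d by (cases rule: swap_at_cases[of k i]) auto
      have "k - j = (k - (i + 1)) + (i - j + 1)" "k - (j + 1) = (k - (i + 1)) + (i - j)" "k - 1 - j = (k - (i + 1)) + (i - j)"
        "k - 1 - (j + 1) = (k - (i + 1)) + (i - j - 1)" by simp_all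
      then show "\<not> N dvd k - j" "\<not> N dvd k - (j + 1)"
        "\<not> N dvd swap_at N i k - j" "\<not> N dvd swap_at N i k - (j + 1)"
        unfolding s
        using d \<open>\<not> N dvd i - j\<close> \<open>\<not> N dvd i - j - 1\<close> \<open>\<not> N dvd i - j + 1\<close>
        by (simp_all only: dvd_add_right_iff not_False_eq_True)
    qed
    show ?thesis using that(1) e e' by (auto simp: swap_at_def[of N j])
  qed
  show ?thesis
  proof
    fix k
    have "N dvd j - i \<longleftrightarrow> N dvd i - j" "N dvd j - i - 1 \<longleftrightarrow> N dvd i - j + 1" "N dvd j - i + 1 \<longleftrightarrow> N dvd i - j - 1"
      using dvd_minus_iff[of N "i - j"] dvd_minus_iff[of N "i - j + 1"] dvd_minus_iff[of N "i - j - 1"]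
      by (simp_all add: algebra_simps)
    then have ji: "\<not> N dvd j - i" "\<not> N dvd j - i - 1" "\<not> N dvd j - i + 1"
      using assms by simp_all
    consider "N dvd k - i \<or> N dvd k - (i + 1)" | "N dvd k - j \<or> N dvd k - (j + 1)"
      | "\<not> N dvd k - i" "\<not> N dvd k - (i + 1)" "\<not> N dvd k - j" "\<not> N dvd k - (j + 1)" by blast
    then show "(swap_at N i \<circ> swap_at N j) k = (swap_at N j \<circ> swap_at N i) k"
    proof cases
      case 1
      then show ?thesis using *[OF _ assms] by simp
    next
      case 2
      then show ?thesis using *[OF _ ji] by simp
    next
      case 3
      then show ?thesis by (simp add: swap_at_def[of N i k] swap_at_def[of N j k])
    qed
  qed
qed

text \<open>The action of two adjacent generators on three consecutive positions. The braid relation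
  and the descents in \<open>reduced_unique\<close> are read off from this table.\<close>

lemma swap_at_near:
  assumes p: "N dvd p - i"
  shows "swap_at N i p = p + 1" "swap_at N i (p + 1) = p" "swap_at N i (p + 2) = p + 2"
     "swap_at N (i + 1) p = p" "swap_at N (i + 1) (p + 1) = p + 2" "swap_at N (i + 1) (p + 2) = p + 1"
proof -
  note nd = not_dvd_small
  have "p + 1 - (i + 1) = p + 0 - i" "p - (i + 1) = p + - 1 - i" "p + 2 - (i + 1) = p + 1 - i"
    "p - (i + 1 + 1) = p + - 2 - i" "p + 1 - (i + 1 + 1) = p + - 1 - i" "p + 2 - (i + 1 + 1) = p + 0 - i" by simp_all
  then show "swap_at N i p = p + 1" "swap_at N i (p + 1) = p" "swap_at N i (p + 2) = p + 2"
     "swap_at N (i + 1) p = p" "swap_at N (i + 1) (p + 1) = p + 2" "swap_at N (i + 1) (p + 2) = p + 1"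
    unfolding swap_at_def
    using nd by (simp_all only: dvd_shift[OF p] p) simp_all
qed

lemma swap_at_braid:
  "swap_at N i \<circ> swap_at N (i + 1) \<circ> swap_at N i = swap_at N (i + 1) \<circ> swap_at N i \<circ> swap_at N (i + 1)"
proof
  fix k

  consider p where "k = p" "N dvd p - i" | p where "k = p + 1" "N dvd p - i" | p where "k = p + 2" "N dvd p - i"
    | "\<not> N dvd k - i" "\<not> N dvd k - (i + 1)" "\<not> N dvd k - (i + 1 + 1)"
  proof (cases "N dvd k - i \<or> N dvd k - (i + 1) \<or> N dvd k - (i + 1 + 1)")
    case True
    then show ?thesis
      using that(1)[of k] that(2)[of "k - 1"] that(3)[of "k - 2"] by (auto simp: algebra_simps)
  next
    case False
    then show ?thesis using that(4) by blast
  qed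
  then show "(swap_at N i \<circ> swap_at N (i + 1) \<circ> swap_at N i) k = (swap_at N (i + 1) \<circ> swap_at N i \<circ> swap_at N (i + 1)) k"
  proof cases
    case 4
    then show ?thesis by (simp add: swap_at_def)
  qed (simp_all only: comp_apply swap_at_near)
qed

lemma swap_at_rotate: "swap_at N (i + 1) (k + 1) = swap_at N i k + 1"
proof -
  have "k + 1 - (i + 1) = k - i" "k + 1 - (i + 1 + 1) = k - (i + 1)" by simp_all
  then show ?thesis unfolding swap_at_def by (simp only:) simp
qed

text \<open>The summands are periodic in k, so any window gives the same value. It serves as the
  induction measure in place of a count of inversions.\<close>

definition displacement :: "(int \<Rightarrow> int) \<Rightarrow> nat" where
  "displacement \<sigma> = nat (\<Sum>k\<in>{0..<N}. (\<sigma> k - k)^2)"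

lemma sum_window:
  fixes f :: "int \<Rightarrow> int"
  assumes f: "\<And>k. f (k + N) = f k"
  shows "(\<Sum>k\<in>{a..<a + N}. f k) = (\<Sum>k\<in>{0..<N}. f k)"
proof -
  have step: "(\<Sum>k\<in>{a + 1..<a + 1 + N}. f k) = (\<Sum>k\<in>{a..<a + N}. f k)" for a
  proof -
    have "{a..<a + N} = insert a {a + 1..<a + N}" "{a + 1..<a + 1 + N} = insert (a + N) {a + 1..<a + N}"
      using N by auto
    then show ?thesis using f[of a] by simp
  qed
  show ?thesis
  proof (induction a rule: int_induct[where k = 0])
    case (step1 a)
    then show ?case using step[of a] by simp
  next
    case (step2 a)
    then show ?case using step[of "a - 1"] by simp
  qed simp
qed

text \<open>In a window starting at i only two summands change. Exchanging values a > b at positions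
  i and i+1 lowers the sum of squares by 2 (a - b).\<close>

lemma displacement_swap:
  assumes \<sigma>: "affine_perm N \<sigma>" and desc: "\<sigma> (i + 1) < \<sigma> i"
  shows "displacement (\<sigma> \<circ> swap_at N i) < displacement \<sigma>"
proof -
  have per: "(\<tau> (k + N) - (k + N))^2 = (\<tau> k - k)^2" if "affine_perm N \<tau>" for \<tau> k
    using that by (simp add: affine_perm_def)
  define d where "d \<tau> = (\<Sum>k\<in>{0..<N}. (\<tau> k - k)^2)" for \<tau> :: "int \<Rightarrow> int"
  have dw: "d \<tau> = (\<tau> i - i)^2 + (\<tau> (i + 1) - (i + 1))^2 + (\<Sum>k\<in>{i + 2..<i + N}. (\<tau> k - k)^2)"
    if "affine_perm N \<tau>" for \<tau>
  proof -
    have "{i..<i + N} = insert i (insert (i + 1) {i + 2..<i + N})" using N by auto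
    then show ?thesis
      unfolding d_def sum_window[of "\<lambda>k. (\<tau> k - k)^2" i, OF per[OF that], symmetric] by simp
  qed
  have fix': "swap_at N i k = k" if "k \<in> {i + 2..<i + N}" for k
  proof -
    have "\<not> N dvd k - i" "\<not> N dvd k - (i + 1)"
      using that zdvd_not_zless[of "k - i" N] zdvd_not_zless[of "k - (i + 1)" N] by auto
    then show ?thesis by (simp add: swap_at_def)
  qed
  have "d (\<sigma> \<circ> swap_at N i) = (\<sigma> (i + 1) - i)^2 + (\<sigma> i - (i + 1))^2 + (\<Sum>k\<in>{i + 2..<i + N}. (\<sigma> k - k)^2)"
    unfolding dw[OF affine_perm_comp[OF \<sigma> affine_perm_swap_at]] using fix' by (simp add: swap_at_self)
  moreover have "(\<sigma> (i + 1) - i)^2 + (\<sigma> i - (i + 1))^2 < (\<sigma> i - i)^2 + (\<sigma> (i + 1) - (i + 1))^2"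
  proof -
    have "(b - i)^2 + (a - (i + 1))^2 = (a - i)^2 + (b - (i + 1))^2 - 2 * (a - b)" for a b :: int
      by (simp add: power2_eq_square algebra_simps)
    moreover have "x < y" if "x = y - 2 * z" "0 < z" for x y z :: int
      using that by simp
    ultimately show ?thesis using desc by (metis diff_gt_0_iff_gt)
  qed
  ultimately have "d (\<sigma> \<circ> swap_at N i) < d \<sigma>" unfolding dw[OF \<sigma>] by simp
  moreover have "0 \<le> d (\<sigma> \<circ> swap_at N i)" by (simp add: d_def sum_nonneg)
  moreover have "displacement \<tau> = nat (d \<tau>)" for \<tau> by (simp add: displacement_def d_def)
  ultimately show ?thesis by (simp only: nat_less_eq_zless)
qed

text \<open>Without descents the map is strictly increasing, and by surjectivity it has no gaps, so
  consecutive values differ by 1.\<close>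

lemma no_descent_shift:
  assumes \<sigma>: "affine_perm N \<sigma>" and asc: "\<And>i. \<not> \<sigma> (i + 1) < \<sigma> i"
  shows "\<sigma> = (\<lambda>k. k + \<sigma> 0)"
proof -
  have inj: "inj \<sigma>" and surj: "surj \<sigma>" using \<sigma> by (auto simp: affine_perm_def bij_def)
  have lt: "\<sigma> i < \<sigma> (i + 1)" for i
    using asc[of i] injD[OF inj, of i "i + 1"] by force
  have mono: "\<sigma> i < \<sigma> (i + 1 + int m)" for i m
  proof (induction m)
    case 0
    then show ?case using lt by simp
  next
    case (Suc m)
    then show ?case using lt[of "i + 1 + int m"] by (simp add: algebra_simps)
  qed
  have mono': "\<sigma> i < \<sigma> j" if "i < j" for i j
    using mono[of i "nat (j - i - 1)"] that by simp
  have step: "\<sigma> (i + 1) = \<sigma> i + 1" for i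
  proof (rule ccontr)
    assume "\<sigma> (i + 1) \<noteq> \<sigma> i + 1"
    then have gt: "\<sigma> i + 1 < \<sigma> (i + 1)" using lt[of i] by simp
    obtain j where j: "\<sigma> j = \<sigma> i + 1" using surj by (metis surjD)
    show False
    proof (cases "j \<le> i")
      case True
      then show ?thesis using mono'[of j i] j by (cases "j = i") auto
    next
      case False
      then show ?thesis using mono'[of "i + 1" j] j gt by (cases "j = i + 1") auto
    qed
  qed
  have "\<sigma> k = k + \<sigma> 0" for k
  proof (induction k rule: int_induct[where k = 0])
    case (step1 i)
    then show ?case using step[of i] by simp
  next
    case (step2 i)
    then show ?case using step[of "i - 1"] by simp
  qed simp
  then show ?thesis by blast
qed

end

section \<open>Words of the extended affine Weyl group\<close>

abbreviation wcong :: "nat \<Rightarrow> weyl_gen word \<Rightarrow> weyl_gen word \<Rightarrow> bool" where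
  "wcong n \<equiv> pres_cong (weyl_gens n) (weyl_rels n)"

abbreviation rot_letter :: "weyl_gen \<times> bool" where
  "rot_letter \<equiv> (Rot, True)"

definition s_letter :: "nat \<Rightarrow> int \<Rightarrow> weyl_gen \<times> bool" where
  "s_letter n i = (Refl (nat (i mod per n)), True)"

text \<open>The formal inverse of a reflection acts like the reflection, because
  \<open>swap_at\<close> is an involution.\<close>

fun letter_perm :: "nat \<Rightarrow> weyl_gen \<times> bool \<Rightarrow> int \<Rightarrow> int" where
  "letter_perm n (Refl i, e) = swap_at (per n) (int i)"
| "letter_perm n (Rot, e) = (\<lambda>k. if e then k + 1 else k - 1)"

definition word_perm :: "nat \<Rightarrow> weyl_gen word \<Rightarrow> int \<Rightarrow> int" where
  "word_perm n w = foldr (\<lambda>l \<sigma>. letter_perm n l \<circ> \<sigma>) w id"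

lemma word_perm_simps [simp]:
  "word_perm n [] = id"
  "word_perm n (l # w) = letter_perm n l \<circ> word_perm n w"
  "word_perm n (u @ v) = word_perm n u \<circ> word_perm n v"
proof -
  show "word_perm n (u @ v) = word_perm n u \<circ> word_perm n v"
    by (induction u) (simp_all add: word_perm_def comp_assoc)
qed (simp_all add: word_perm_def)

lemma s_letter_cong: "per n dvd i - j \<Longrightarrow> s_letter n i = s_letter n j"
  unfolding s_letter_def by (simp only: mod_eq_dvd_iff[symmetric])

lemma wcong_relation: "(a, b) \<in> weyl_rels n \<Longrightarrow> wcong n a b"
  using pres_cong.relation[of a b "weyl_rels n" "weyl_gens n" "[]" "[]"] by simp

lemma wcong_left: "wcong n u v \<Longrightarrow> wcong n (x @ u) (x @ v)"
  by (rule pres_cong_append[OF pres_cong.refl])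

lemma wcong_right: "wcong n u v \<Longrightarrow> wcong n (u @ y) (v @ y)"
  by (rule pres_cong_append[OF _ pres_cong.refl])

lemma wcong_square: "wcong n [s_letter n i, s_letter n i] []"
proof (rule wcong_relation)
  show "([s_letter n i, s_letter n i], []) \<in> weyl_rels n"
    using nat_mod_per[of i n] unfolding weyl_rels_def s_letter_def by auto
qed

lemma wcong_coxeter:
  assumes "1 \<le> n" "\<not> per n dvd i - j"
  shows "wcong n (concat (replicate (nat (2 - coupling (per n) (j - i))) [s_letter n i, s_letter n j])) []"
proof (rule wcong_relation)
  have ne: "nat (i mod per n) \<noteq> nat (j mod per n)"
  proof
    assume "nat (i mod per n) = nat (j mod per n)"
    then have "i mod per n = j mod per n" by (simp add: eq_nat_nat_iff)
    then show False using assms(2) by (simp add: mod_eq_dvd_iff)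
  qed
  have "j mod per n - i mod per n = per n * (i div per n - j div per n) + (j - i)"
    by (simp add: algebra_simps minus_mult_div_eq_mod[symmetric])
  then have "coupling (per n) (j mod per n - i mod per n) = coupling (per n) (j - i)"
    by (simp only: coupling_add)
  moreover have "int (nat (i mod per n)) = i mod per n" "int (nat (j mod per n)) = j mod per n" by simp_all
  ultimately have "coupling (per n) (j - i) = cartan n (nat (i mod per n)) (nat (j mod per n))"
    using coupling_cartan[OF assms(1) nat_mod_per[of i n] nat_mod_per[of j n]] by simp
  then show "(concat (replicate (nat (2 - coupling (per n) (j - i))) [s_letter n i, s_letter n j]), []) \<in> weyl_rels n"
    using ne nat_mod_per[of i n] nat_mod_per[of j n] unfolding weyl_rels_def s_letter_def by auto
qed

text \<open>Moves an involutive letter to the other side. Repeated use turns the relators (s_i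
  s_j)^m into commutation and braid relations.\<close>

lemma wcong_cancel_right:
  assumes "wcong n (u @ [s_letter n i]) v"
  shows "wcong n u (v @ [s_letter n i])"
proof -
  have "wcong n (u @ [s_letter n i, s_letter n i]) (u @ [])" by (rule wcong_left[OF wcong_square])
  then have "wcong n u (u @ [s_letter n i, s_letter n i])" using pres_cong.sym by fastforce
  moreover have "wcong n (u @ [s_letter n i, s_letter n i]) (v @ [s_letter n i])"
    using wcong_right[OF assms, of "[s_letter n i]"] by simp
  ultimately show ?thesis by (rule pres_cong.trans)
qed

lemma wcong_commute:
  assumes "1 \<le> n" "coupling (per n) (j - i) = 0"
  shows "wcong n [s_letter n i, s_letter n j] [s_letter n j, s_letter n i]"
proof -
  have "\<not> per n dvd j - i" by (rule coupling_0_dvd[OF assms(2)])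
  then have "\<not> per n dvd i - j" using dvd_minus_iff[of "per n" "i - j"] by simp
  from wcong_coxeter[OF assms(1) this]
  have "wcong n [s_letter n i, s_letter n j, s_letter n i, s_letter n j] []"
    by (simp add: assms(2) numeral_2_eq_2)
  then have "wcong n ([s_letter n i, s_letter n j, s_letter n i] @ [s_letter n j]) []" by simp
  from wcong_cancel_right[OF this] have "wcong n ([s_letter n i, s_letter n j] @ [s_letter n i]) [s_letter n j]" by simp
  from wcong_cancel_right[OF this] show ?thesis by simp
qed

lemma wcong_braid:
  assumes "1 \<le> n"
  shows "wcong n [s_letter n i, s_letter n (i + 1), s_letter n i] [s_letter n (i + 1), s_letter n i, s_letter n (i + 1)]"
proof -
  let ?a = "s_letter n i" and ?b = "s_letter n (i + 1)"
  have c: "coupling (per n) (i + 1 - i) = - 1" using coupling_small[of "per n"] assms by simp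
  have "\<not> per n dvd i - (i + 1)" using assms not_dvd_small[of "per n"] by simp
  from wcong_coxeter[OF assms this]
  have "wcong n [?a, ?b, ?a, ?b, ?a, ?b] []" unfolding c by (simp add: numeral_3_eq_3)
  then have "wcong n ([?a, ?b, ?a, ?b, ?a] @ [?b]) []" by simp
  from wcong_cancel_right[OF this] have "wcong n ([?a, ?b, ?a, ?b] @ [?a]) [?b]" by simp
  from wcong_cancel_right[OF this] have "wcong n ([?a, ?b, ?a] @ [?b]) [?b, ?a]" by simp
  from wcong_cancel_right[OF this] show ?thesis by simp
qed

lemma wcong_rot: "wcong n [rot_letter, s_letter n i] [s_letter n (i + 1), rot_letter]"
proof (rule wcong_relation)
  define r where "r = nat (i mod per n)"
  have r: "i mod per n = int r" "r \<le> 2*n+1" by (simp_all only: r_def nat_mod_per) simp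
  have "(i + 1) mod per n = (int r + 1) mod per n" by (metis mod_add_left_eq r(1))
  also have "\<dots> = int (if r = 2*n+1 then 0 else r + 1)"
  proof (cases "r = 2*n+1")
    case True
    then have "int r + 1 = per n" by simp
    then show ?thesis using True by (simp only: mod_self) simp
  next
    case False
    then show ?thesis using r(2) by simp
  qed
  finally have "s_letter n (i + 1) = (Refl (if r = 2*n+1 then 0 else r + 1), True)"
    by (simp add: s_letter_def)
  then show "([rot_letter, s_letter n i], [s_letter n (i + 1), rot_letter]) \<in> weyl_rels n"
    using r unfolding weyl_rels_def s_letter_def by auto
qed

lemma wcong_rot_order: "wcong n (replicate (2*n+2) rot_letter) []"
proof (rule wcong_relation)
  have "concat (replicate m [rot_letter]) = replicate m rot_letter" for m by (induction m) simp_all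
  then show "(replicate (2*n+2) rot_letter, []) \<in> weyl_rels n"
    unfolding weyl_rels_def by (simp del: replicate.simps)
qed

text \<open>
  Words for an affine permutation obtained by removing descents, in any order, until a shift
  remains. Each removal decreases the displacement.
\<close>

inductive reduced :: "nat \<Rightarrow> (int \<Rightarrow> int) \<Rightarrow> weyl_gen word \<Rightarrow> bool" for n where
  shift: "reduced n (\<lambda>k. k + c) (replicate (nat (c mod per n)) rot_letter)"
| descent: "\<sigma> (i + 1) < \<sigma> i \<Longrightarrow> reduced n (\<sigma> \<circ> swap_at (per n) i) w \<Longrightarrow> reduced n \<sigma> (w @ [s_letter n i])"

context
  fixes n :: nat
  assumes n: "1 \<le> n"
begin

abbreviation "sw \<equiv> swap_at (per n)"
abbreviation "aff \<equiv> affine_perm (per n)"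
abbreviation "sl \<equiv> s_letter n"

lemma per4: "4 \<le> per n"
  using n by simp

lemmas aff_sw = affine_perm_comp[OF per4 _ affine_perm_swap_at[OF per4]]

lemma sw_sw [simp]: "\<sigma> \<circ> sw i \<circ> sw i = \<sigma>"
  by (simp add: fun_eq_iff swap_at_swap_at[OF per4])

section \<open>Uniqueness of reduced words modulo the relations\<close>

lemma reduced_exists: "aff \<sigma> \<Longrightarrow> \<exists>w. reduced n \<sigma> w"
proof (induction "displacement (per n) \<sigma>" arbitrary: \<sigma> rule: less_induct)
  case less
  show ?case
  proof (cases "\<exists>i. \<sigma> (i + 1) < \<sigma> i")
    case True
    then obtain i where i: "\<sigma> (i + 1) < \<sigma> i" by blast
    obtain w where "reduced n (\<sigma> \<circ> sw i) w"
      using less.hyps[OF displacement_swap[OF per4 less.prems i] aff_sw[OF less.prems]] by blast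
    then show ?thesis using reduced.descent[OF i] by blast
  next
    case False
    then have "\<sigma> = (\<lambda>k. k + \<sigma> 0)" by (intro no_descent_shift[OF per4 less.prems]) blast
    then show ?thesis using reduced.shift by metis
  qed
qed

text \<open>A diamond argument by induction on the displacement. If two words start by removing
  different descents, both removals are continued to a common permutation. The two continuations
  differ by a commutation or braid relation, and the induction hypothesis identifies each of them
  with the given word.\<close>

lemma reduced_unique:
  "aff \<sigma> \<Longrightarrow> reduced n \<sigma> w \<Longrightarrow> reduced n \<sigma> w' \<Longrightarrow> wcong n w w'"
proof (induction "displacement (per n) \<sigma>" arbitrary: \<sigma> w w' rule: less_induct)
  case less
  note [trans] = pres_cong.trans
  note aff = less.prems(1)
  have IH: "wcong n u v" if "\<sigma> (i + 1) < \<sigma> i" "reduced n (\<sigma> \<circ> sw i) u" "reduced n (\<sigma> \<circ> sw i) v" for i u v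
    using less.hyps[OF displacement_swap[OF per4 aff that(1)] aff_sw[OF aff] that(2,3)] .
  have commuting: "wcong n (w0 @ [sl i]) (w0' @ [sl j])"
    if i: "\<sigma> (i + 1) < \<sigma> i" "reduced n (\<sigma> \<circ> sw i) w0"
      and j: "\<sigma> (j + 1) < \<sigma> j" "reduced n (\<sigma> \<circ> sw j) w0'"
      and c: "coupling (per n) (i - j) = 0" "coupling (per n) (j - i) = 0" for i j w0 w0'
  proof -
    note nd = coupling_0_dvd[OF c(1)] coupling_0_dvd[OF c(2)]
    have far: "sw i j = j" "sw i (j + 1) = j + 1" "sw j i = i" "sw j (i + 1) = i + 1"
      using nd unfolding swap_at_def by (simp_all add: algebra_simps)
    \<comment> \<open>The word of the common lower corner of the diamond.\<close>
    obtain x where x: "reduced n (\<sigma> \<circ> sw i \<circ> sw j) x"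
      using reduced_exists[OF aff_sw[OF aff_sw[OF aff]]] by blast
    have comm: "\<sigma> \<circ> sw i \<circ> sw j = \<sigma> \<circ> sw j \<circ> sw i"
      using swap_at_commute[OF per4 nd(1-3)] by (simp add: comp_assoc)
    have "reduced n (\<sigma> \<circ> sw i) (x @ [sl j])"
      by (rule reduced.descent[OF _ x]) (use far j in simp)
    from IH[OF i this] have "wcong n (w0 @ [sl i]) ((x @ [sl j]) @ [sl i])" by (rule wcong_right)
    also have "wcong n ((x @ [sl j]) @ [sl i]) ((x @ [sl i]) @ [sl j])"
      using wcong_left[OF wcong_commute[OF n c(1)], of x] by simp
    also have "reduced n (\<sigma> \<circ> sw j) (x @ [sl i])"
      by (rule reduced.descent[OF _ x[unfolded comm]]) (use far i in simp)
    from IH[OF j(1) this j(2)] have "wcong n ((x @ [sl i]) @ [sl j]) (w0' @ [sl j])" by (rule wcong_right)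
    finally show ?thesis .
  qed
  have braid: "wcong n (w0 @ [sl i]) (w0' @ [sl (i + 1)])"
    if i: "\<sigma> (i + 1) < \<sigma> i" "reduced n (\<sigma> \<circ> sw i) w0"
      and j: "\<sigma> (i + 2) < \<sigma> (i + 1)" "reduced n (\<sigma> \<circ> sw (i + 1)) w0'" for i w0 w0'
  proof -
    have j': "\<sigma> (i + 1 + 1) < \<sigma> (i + 1)" using j(1) by (simp add: add.assoc)
    have ii: "per n dvd i - i" by simp
    note near = swap_at_near[OF per4 ii]
    have e: "i + 1 + 1 = i + 2" by simp
    obtain x where x: "reduced n (\<sigma> \<circ> sw i \<circ> sw (i + 1) \<circ> sw i) x"
      using reduced_exists[OF aff_sw[OF aff_sw[OF aff_sw[OF aff]]]] by blast
    have br: "\<sigma> \<circ> sw i \<circ> sw (i + 1) \<circ> sw i = \<sigma> \<circ> sw (i + 1) \<circ> sw i \<circ> sw (i + 1)"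
      using swap_at_braid[OF per4, of i] by (simp add: comp_assoc)
    \<comment> \<open>The values at i, i+1, i+2 decrease, so each of the three removals on either
      path undoes a descent.\<close>
    have "reduced n (\<sigma> \<circ> sw i \<circ> sw (i + 1)) (x @ [sl i])"
      by (rule reduced.descent[OF _ x]) (simp only: comp_apply e near j(1))
    then have "reduced n (\<sigma> \<circ> sw i) ((x @ [sl i]) @ [sl (i + 1)])"
      by (rule reduced.descent[rotated]) (use i j in \<open>simp only: comp_apply e near\<close>)
    from IH[OF i this] have "wcong n (w0 @ [sl i]) (((x @ [sl i]) @ [sl (i + 1)]) @ [sl i])" by (rule wcong_right)
    also have "wcong n (((x @ [sl i]) @ [sl (i + 1)]) @ [sl i]) (((x @ [sl (i + 1)]) @ [sl i]) @ [sl (i + 1)])"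
      using wcong_left[OF wcong_braid[OF n], of x] by simp
    also have "reduced n (\<sigma> \<circ> sw (i + 1) \<circ> sw i) (x @ [sl (i + 1)])"
      by (rule reduced.descent[OF _ x[unfolded br]]) (simp only: comp_apply e near i(1))
    then have "reduced n (\<sigma> \<circ> sw (i + 1)) ((x @ [sl (i + 1)]) @ [sl i])"
      by (rule reduced.descent[rotated]) (use i j in \<open>simp only: comp_apply e near\<close>)
    from IH[OF j' this j(2)] have "wcong n (((x @ [sl (i + 1)]) @ [sl i]) @ [sl (i + 1)]) (w0' @ [sl (i + 1)])"
      by (rule wcong_right)
    finally show ?thesis .
  qed
  have braid': "wcong n (w0 @ [sl i]) (w0' @ [sl j])"
    if i: "\<sigma> (i + 1) < \<sigma> i" "reduced n (\<sigma> \<circ> sw i) w0"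
      and j: "\<sigma> (j + 1) < \<sigma> j" "reduced n (\<sigma> \<circ> sw j) w0'"
      and d: "per n dvd j - (i + 1)" for i j w0 w0'
  proof -
    \<comment> \<open>Descents are periodic, so j may be replaced by the congruent index
      i+1.\<close>
    obtain m where m: "j = i + 1 + per n * m" using d by (auto elim!: dvdE simp: algebra_simps)
    have "\<sigma> j = \<sigma> (i + 1) + per n * m" unfolding m by (rule affine_perm_mult[OF per4 aff])
    moreover have "j + 1 = i + 2 + per n * m" by (simp add: m)
    then have "\<sigma> (j + 1) = \<sigma> (i + 2) + per n * m" by (simp only: affine_perm_mult[OF per4 aff])
    ultimately have "\<sigma> (i + 2) < \<sigma> (i + 1)" using j(1) by simp
    then show ?thesis
      using braid[OF i, of w0'] j(2) swap_at_cong[OF per4 d] s_letter_cong[OF d] by simp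
  qed
  show ?case using less.prems(2)
  proof cases
    case (shift c)
    show ?thesis using less.prems(3)
    proof cases
      case (shift c')
      have "c = c'" using fun_cong[OF HOL.trans[OF \<open>\<sigma> = (\<lambda>k. k + c)\<close>[symmetric] shift(1)], of 0] by simp
      then show ?thesis using \<open>w = _\<close> shift by (simp add: pres_cong.refl)
    next
      case (descent i w0)
      then show ?thesis using shift by simp
    qed
  next
    case i: (descent i w0)
    show ?thesis using less.prems(3)
    proof cases
      case (shift c)
      then show ?thesis using i by simp
    next
      case j: (descent j w0')
      consider "per n dvd j - i" | "per n dvd j - (i + 1)" | "per n dvd i - (j + 1)"
        | "coupling (per n) (i - j) = 0" "coupling (per n) (j - i) = 0"
      proof -
        have "per n dvd i - j \<longleftrightarrow> per n dvd j - i" "per n dvd i - j - 1 \<longleftrightarrow> per n dvd j - i + 1"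
          "per n dvd i - j + 1 \<longleftrightarrow> per n dvd j - i - 1"
          using dvd_minus_iff[of "per n" "i - j"] dvd_minus_iff[of "per n" "i - j - 1"]
            dvd_minus_iff[of "per n" "i - j + 1"] by (simp_all add: algebra_simps)
        then show ?thesis using that unfolding coupling_def
          by (cases "per n dvd j - i"; cases "per n dvd j - i - 1"; cases "per n dvd j - i + 1")
            (simp_all add: diff_diff_eq[symmetric])
      qed
      then show ?thesis
      proof cases
        case 1
        have "wcong n w0 w0'" using IH[OF i(2,3)] j(3) swap_at_cong[OF per4 1] by simp
        then show ?thesis unfolding i(1) j(1) s_letter_cong[OF 1] by (rule wcong_right)
      next
        case 2
        then show ?thesis unfolding i(1) j(1) using braid'[OF i(2,3) j(2,3)] by blast
      next
        case 3
        then show ?thesis unfolding i(1) j(1) using pres_cong.sym[OF braid'[OF j(2,3) i(2,3)]] by blast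
      next
        case 4
        then show ?thesis unfolding i(1) j(1) by (rule commuting[OF i(2,3) j(2,3)])
      qed
    qed
  qed
qed

text \<open>Either i is a descent of \<sigma>, or it is one after the swap. In both cases one of the
  two words extends the other by a removal, and uniqueness applies.\<close>

lemma reduced_swap:
  assumes aff: "aff \<sigma>" and w: "reduced n \<sigma> w" and v: "reduced n (\<sigma> \<circ> sw i) v"
  shows "wcong n v (w @ [sl i])"
proof (cases "\<sigma> (i + 1) < \<sigma> i")
  case True
  have "wcong n (v @ [sl i]) w" by (rule reduced_unique[OF aff reduced.descent[OF True v] w])
  then show ?thesis by (rule wcong_cancel_right)
next
  case False
  have "\<sigma> i \<noteq> \<sigma> (i + 1)"
    using aff by (auto simp: affine_perm_def bij_def dest: injD)
  then have "(\<sigma> \<circ> sw i) (i + 1) < (\<sigma> \<circ> sw i) i"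
    using False by (simp add: swap_at_self[OF per4])
  then have "reduced n (\<sigma> \<circ> sw i) (w @ [sl i])"
    by (rule reduced.descent) (simp only: sw_sw w)
  then show ?thesis by (rule reduced_unique[OF aff_sw[OF aff] v])
qed

text \<open>By induction over the removals, the new rotation letter is moved to the right end past
  the reflections. In the base case the exponent may wrap around, which is absorbed by the order of
  the rotation.\<close>

lemma reduced_rot:
  assumes "reduced n \<sigma> w" "aff \<sigma>" "reduced n (\<sigma> \<circ> (\<lambda>k. k + 1)) v"
  shows "wcong n v (w @ [rot_letter])"
  using assms
proof (induction arbitrary: v rule: reduced.induct)
  case (shift c)
  have "(\<lambda>k. k + c) \<circ> (\<lambda>k. k + 1) = (\<lambda>k. k + (c + 1))" by (simp add: fun_eq_iff)
  then have "wcong n v (replicate (nat ((c + 1) mod per n)) rot_letter)"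
    using shift reduced.shift[of n "c + 1"] affine_perm_shift[OF per4, of "c + 1"]
    by (intro reduced_unique[of "\<lambda>k. k + (c + 1)"]) simp_all
  moreover have "wcong n (replicate (nat ((c + 1) mod per n)) rot_letter)
    (replicate (nat (c mod per n)) rot_letter @ [rot_letter])"
  proof -
    define r where "r = nat (c mod per n)"
    have r: "c mod per n = int r" "r \<le> 2*n+1" by (simp_all only: r_def nat_mod_per) simp
    have c1: "(c + 1) mod per n = (int r + 1) mod per n" by (metis mod_add_left_eq r(1))
    have app: "replicate r rot_letter @ [rot_letter] = replicate (r + 1) rot_letter"
      by (simp add: replicate_append_same)
    show ?thesis
    proof (cases "r = 2*n+1")
      case True
      then have "int r + 1 = per n" "r + 1 = 2*n+2" by simp_all
      then have "(c + 1) mod per n = 0" by (simp only: c1 mod_self)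
      then show ?thesis
        unfolding r_def[symmetric] app \<open>r + 1 = 2*n+2\<close> using pres_cong.sym[OF wcong_rot_order] by simp
    next
      case False
      then have "(c + 1) mod per n = int (r + 1)" using r(2) by (simp add: c1)
      then show ?thesis unfolding r_def[symmetric] app by (simp only: nat_int pres_cong.refl)
    qed
  qed
  ultimately show ?case by (rule pres_cong.trans)
next
  case (descent \<sigma> i w)
  note [trans] = pres_cong.trans
  let ?\<tau> = "\<lambda>k::int. k + 1"
  have affr: "aff (\<sigma> \<circ> ?\<tau>)" by (rule affine_perm_comp[OF per4 descent.prems(1) affine_perm_shift[OF per4]])
  \<comment> \<open>Precomposition with the shift turns a removal at i into one at i-1.\<close>
  have eq: "\<sigma> \<circ> sw i \<circ> ?\<tau> = \<sigma> \<circ> ?\<tau> \<circ> sw (i - 1)"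
    using swap_at_rotate[OF per4, of "i - 1"] by (simp add: fun_eq_iff)
  obtain x where x: "reduced n (\<sigma> \<circ> sw i \<circ> ?\<tau>) x"
    using reduced_exists[OF affine_perm_comp[OF per4 aff_sw[OF descent.prems(1)] affine_perm_shift[OF per4]]] by blast
  have "reduced n (\<sigma> \<circ> ?\<tau>) (x @ [sl (i - 1)])"
    by (rule reduced.descent[OF _ x[unfolded eq]]) (use descent in simp)
  with affr descent.prems(2) have "wcong n v (x @ [sl (i - 1)])" by (rule reduced_unique)
  also have "wcong n (x @ [sl (i - 1)]) ((w @ [rot_letter]) @ [sl (i - 1)])"
    by (rule wcong_right[OF descent.IH[OF aff_sw[OF descent.prems(1)] x]])
  also have "wcong n ((w @ [rot_letter]) @ [sl (i - 1)]) ((w @ [sl i]) @ [rot_letter])"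
    using wcong_left[OF wcong_rot[of n "i - 1"], of w] by simp
  finally show ?case .
qed

lemma aff_word_perm: "aff (word_perm n w)"
proof (induction w)
  case Nil
  show ?case using affine_perm_shift[OF per4, of 0] by (simp add: id_def)
next
  case (Cons l w)
  have "aff (letter_perm n l)"
    using affine_perm_shift[OF per4, of 1] affine_perm_shift[OF per4, of "- 1"] affine_perm_swap_at[OF per4]
    by (cases l; cases "fst l"; cases "snd l") auto
  then show ?case using affine_perm_comp[OF per4 _ Cons] by (simp only: word_perm_simps)
qed

text \<open>Letters are appended on the right, where \<open>reduced_swap\<close> and
  \<open>reduced_rot\<close> describe the effect on reduced words. Thus every word is congruent to
  any reduced word of its permutation.\<close>

lemma reduced_word_perm:
  assumes "w \<in> words (weyl_gens n)" "reduced n (word_perm n w) v"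
  shows "wcong n v w"
  using assms
proof (induction w arbitrary: v rule: rev_induct)
  case Nil
  have "reduced n id []" using reduced.shift[of n 0] by (simp add: id_def)
  moreover have "aff id" using aff_word_perm[of "[]"] by simp
  moreover have "reduced n id v" using Nil(2) by (simp only: word_perm_simps)
  ultimately show ?case using reduced_unique by blast
next
  case (snoc l w)
  note [trans] = pres_cong.trans
  obtain u where u: "reduced n (word_perm n w) u" using reduced_exists[OF aff_word_perm] by blast
  have uw: "wcong n u w" using snoc.IH[OF _ u] snoc.prems(1) by simp
  have v: "reduced n (word_perm n w \<circ> letter_perm n l) v"
    using snoc.prems(2) by (simp only: word_perm_simps comp_id)
  obtain g e where l: "l = (g, e)" by fastforce
  have g: "g \<in> weyl_gens n" using snoc.prems(1) l by simp
  have "wcong n v (u @ [l])"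
  proof (cases g)
    case (Refl i)
    have "i \<le> 2*n+1" using g Refl by (auto simp: weyl_gens_def)
    then have Si: "sl (int i) = (g, True)" using Refl by (simp add: s_letter_def flip: of_nat_mod)
    have 1: "wcong n v (u @ [(g, True)])"
      using reduced_swap[OF aff_word_perm u, of "int i" v] v l Refl Si by simp
    show ?thesis
    proof (cases e)
      case True
      then show ?thesis using 1 l by simp
    next
      case False
      \<comment> \<open>A reflection letter is congruent to its formal inverse: insert the
        cancelling pair and use that the square is trivial.\<close>
      have "wcong n ([(g, True)] @ [(g, True), (g, \<not> True)] @ []) ([(g, True)] @ [])"
        by (rule pres_cong.cancel[OF g])
      then have "wcong n [(g, True)] [(g, True), (g, True), (g, False)]" using pres_cong.sym by fastforce
      also have "wcong n ([(g, True), (g, True)] @ [(g, False)]) ([] @ [(g, False)])"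
        using wcong_square[of n "int i"] unfolding Si by (rule wcong_right)
      then have "wcong n [(g, True), (g, True), (g, False)] [(g, False)]" by simp
      finally have "wcong n [(g, True)] [(g, False)]" .
      then show ?thesis using pres_cong.trans[OF 1 wcong_left] l False by simp
    qed
  next
    case Rot
    show ?thesis
    proof (cases e)
      case True
      then show ?thesis using reduced_rot[OF u aff_word_perm, of v] v l Rot by simp
    next
      case False
      \<comment> \<open>For an inverse rotation the roles are exchanged: a positive rotation is
        appended to \<open>v\<close>, which leads back to \<open>w\<close>.\<close>
      have "word_perm n w \<circ> letter_perm n l \<circ> (\<lambda>k. k + 1) = word_perm n w"
        using l Rot False by (simp add: fun_eq_iff)
      then have "wcong n u (v @ [rot_letter])"
        using reduced_rot[OF v, of u] u aff_word_perm[of "w @ [l]"] by simp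
      then have "wcong n (u @ [l]) ((v @ [rot_letter]) @ [l])" by (rule wcong_right)
      also have "wcong n (v @ [(Rot, True), (Rot, \<not> True)] @ []) (v @ [])"
        by (rule pres_cong.cancel) (simp add: weyl_gens_def)
      then have "wcong n ((v @ [rot_letter]) @ [l]) v" using l Rot False by simp
      finally show ?thesis by (rule pres_cong.sym)
    qed
  qed
  also have "wcong n (u @ [l]) (w @ [l])" by (rule wcong_right[OF uw])
  finally show ?case .
qed

text \<open>\<open>reduced\<close> records the exponent of the rotation modulo the period, so such a
  shift has the empty reduced word.\<close>

lemma word_perm_trivial:
  assumes "w \<in> words (weyl_gens n)" "word_perm n w = (\<lambda>k. k + c)" "per n dvd c"
  shows "wcong n w []"
proof -
  have "reduced n (word_perm n w) []" using reduced.shift[of n c] assms(2,3) by simp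
  from pres_cong.sym[OF reduced_word_perm[OF assms(1) this]] show ?thesis .
qed

end

section \<open>The Hamiltonian vector field\<close>

lemma H_VI_in [simp]:
  "\<kappa>0 \<in> ratfield n \<Longrightarrow> \<kappa>1 \<in> ratfield n \<Longrightarrow> \<kappa>t \<in> ratfield n \<Longrightarrow> \<kappa> \<in> ratfield n \<Longrightarrow>
    x \<in> ratfield n \<Longrightarrow> y \<in> ratfield n \<Longrightarrow> H_VI \<kappa>0 \<kappa>1 \<kappa>t \<kappa> x y \<in> ratfield n"
  by (simp add: H_VI_def)

definition ham_kappa0 :: "nat \<Rightarrow> nat \<Rightarrow> 'k::field_char_0 ratfun" where
  "ham_kappa0 n i = (\<Sum>j=0..n. al n (2*j+1)) - al n (2*i-1) - etav"

text \<open>This is t(t-1)H. The factor t(t-1) has zero partial derivatives in all q_i and p_i, so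
  Hamilton's equations can be computed from this polynomial.\<close>

definition ham_numerator :: "nat \<Rightarrow> 'k::field_char_0 ratfun" where
  "ham_numerator n =
     (\<Sum>i=1..n. H_VI (ham_kappa0 n i) (\<Sum>j=0..i-1. al n (2*j)) (\<Sum>j=i..n. al n (2*j))
        (al n (2*i-1) * etav) (qv n i) (pv i))
      + (\<Sum>i=1..n. \<Sum>j=i+1..n. (qv n i - 1) * (qv n j - tv) *
           ((qv n i * pv i + al n (2*i-1)) * pv j + pv i * (pv j * qv n j + al n (2*j-1))))"

lemma hamiltonian_eq: "hamiltonian n = ham_numerator n / (tv * (tv - 1))"
  by (simp only: hamiltonian_def ham_numerator_def ham_kappa0_def)

lemma odd_index_in [simp]: "j \<le> n \<Longrightarrow> al n (2*j-1) \<in> ratfield n"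
  and odd_index_in' [simp]: "j \<le> n \<Longrightarrow> al n (2*j - Suc 0) \<in> ratfield n"
  and even_index_in [simp]: "j \<le> n \<Longrightarrow> al n (2*j) \<in> ratfield n"
  and odd_index_in'' [simp]: "j \<le> n \<Longrightarrow> al n (Suc (2*j)) \<in> ratfield n"
  by (rule al_in, simp)+

lemma ham_kappa_in [simp]:
  "i \<le> n \<Longrightarrow> ham_kappa0 n i \<in> ratfield n"
  "i \<le> n \<Longrightarrow> (\<Sum>j=0..i-1. al n (2*j)) \<in> ratfield n"
  "i \<le> n \<Longrightarrow> (\<Sum>j=0..i - Suc 0. al n (2*j)) \<in> ratfield n"
  "(\<Sum>j=i..n. al n (2*j)) \<in> ratfield n"
  by (auto simp: ham_kappa0_def)

lemma ham_term_in [simp]: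
  "i \<le> n \<Longrightarrow> 1 \<le> i \<Longrightarrow> j \<le> n \<Longrightarrow> 1 \<le> j \<Longrightarrow> (qv n i - 1) * (qv n j - tv) *
    ((qv n i * pv i + al n (2*i-1)) * pv j + pv i * (pv j * qv n j + al n (2*j-1))) \<in> ratfield n"
  by (intro mult_in add_in diff_in) simp_all

lemma ham_numerator_in [simp]: "ham_numerator n \<in> ratfield n"
  unfolding ham_numerator_def
  by (intro add_in sum_in ballI H_VI_in ham_term_in ham_kappa_in mult_in) auto

lemma hamiltonian_in [simp]: "hamiltonian n \<in> ratfield n"
  by (simp add: hamiltonian_eq)

section \<open>Derivations that annihilate t, eta and the parameters, for the partial derivatives in
  p_m and q_m\<close>

context
  fixes n :: nat and d :: "'k::field_char_0 ratfun \<Rightarrow> 'k ratfun"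
  assumes d: "derivation n d" and t: "d tv = 0" and eta: "d etav = 0"
    and al: "\<forall>j\<le>2*n+1. d (al n j) = 0"
begin

lemmas ds = derivation_simps[OF d]

lemma d_al [simp]: "j \<le> n \<Longrightarrow> d (al n (2*j)) = 0" "j \<le> n \<Longrightarrow> d (al n (2*j-1)) = 0"
  "j \<le> n \<Longrightarrow> d (al n (2*j - Suc 0)) = 0" "j \<le> n \<Longrightarrow> d (al n (2*j+1)) = 0" "j \<le> n \<Longrightarrow> d (al n (Suc (2*j))) = 0"
  by (rule al[rule_format], simp)+

lemma d_kappa: "i \<le> n \<Longrightarrow> d (ham_kappa0 n i) = 0" "i \<le> n \<Longrightarrow> d (\<Sum>j=0..i-1. al n (2*j)) = 0"
  "i \<le> n \<Longrightarrow> d (\<Sum>j=0..i - Suc 0. al n (2*j)) = 0" "d (\<Sum>j=i..n. al n (2*j)) = 0"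
  by (auto simp: ham_kappa0_def ds eta)

lemma d_H_VI:
  assumes "\<kappa>0 \<in> ratfield n" "\<kappa>1 \<in> ratfield n" "\<kappa>t \<in> ratfield n" "\<kappa> \<in> ratfield n" "x \<in> ratfield n" "y \<in> ratfield n"
    "d \<kappa>0 = 0" "d \<kappa>1 = 0" "d \<kappa>t = 0" "d \<kappa> = 0"
  shows "d (H_VI \<kappa>0 \<kappa>1 \<kappa>t \<kappa> x y) =
    (2*x*(x-1)*(x-tv)*y - \<kappa>0*(x-1)*(x-tv) - \<kappa>1*x*(x-tv) - (\<kappa>t-1)*x*(x-1)) * d y +
    (((x-1)*(x-tv) + x*(x-tv) + x*(x-1))*y^2 - \<kappa>0*(2*x-1-tv)*y - \<kappa>1*(2*x-tv)*y - (\<kappa>t-1)*(2*x-1)*y + \<kappa>) * d x"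
  using assms by (simp add: H_VI_def ds t algebra_simps power2_eq_square)

lemma d_ham_term:
  assumes "1 \<le> i" "i \<le> n" "1 \<le> j" "j \<le> n"
  shows "d ((qv n i - 1) * (qv n j - tv) *
           ((qv n i * pv i + al n (2*i-1)) * pv j + pv i * (pv j * qv n j + al n (2*j-1)))) =
     (qv n i - 1) * (qv n j - tv) * ((qv n i * pv j + (pv j * qv n j + al n (2*j-1))) * d (pv i) +
        ((qv n i * pv i + al n (2*i-1)) + pv i * qv n j) * d (pv j)) +
     ((qv n j - tv) * ((qv n i * pv i + al n (2*i-1)) * pv j + pv i * (pv j * qv n j + al n (2*j-1))) +
        (qv n i - 1) * (qv n j - tv) * (pv i * pv j)) * d (qv n i) +
     ((qv n i - 1) * ((qv n i * pv i + al n (2*i-1)) * pv j + pv i * (pv j * qv n j + al n (2*j-1))) +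
        (qv n i - 1) * (qv n j - tv) * (pv i * pv j)) * d (qv n j)"
proof -
  define ai aj :: "'k ratfun" where "ai = al n (2*i-1)" and "aj = al n (2*j-1)"
  have "ai \<in> ratfield n" "aj \<in> ratfield n" "d ai = 0" "d aj = 0"
    using assms by (simp_all add: ai_def aj_def)
  then show ?thesis unfolding ai_def[symmetric] aj_def[symmetric]
    using assms by (simp add: ds t algebra_simps)
qed

end

text \<open>Of the interaction terms, only pairs containing m survive differentiation in q_m or p_m,
  with m as the smaller or as the larger index.\<close>

lemma sum_upper_triangle:
  fixes a b :: "nat \<Rightarrow> 'a::comm_monoid_add"
  assumes "1 \<le> m" "m \<le> n"
  shows "(\<Sum>i=1..n. \<Sum>j=i+1..n. (if i = m then a j else 0) + (if j = m then b i else 0)) =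
    (\<Sum>j=m+1..n. a j) + (\<Sum>i=1..m-1. b i)"
proof -
  have "(\<Sum>i=1..n. \<Sum>j=i+1..n. (if i = m then a j else 0)) = (\<Sum>i=1..n. if i = m then \<Sum>j=m+1..n. a j else 0)"
    by (intro sum.cong) auto
  also have "\<dots> = (\<Sum>j=m+1..n. a j)" using assms by (simp add: sum.delta)
  finally have 1: "(\<Sum>i=1..n. \<Sum>j=i+1..n. (if i = m then a j else 0)) = (\<Sum>j=m+1..n. a j)" .
  have "(\<Sum>i=1..n. \<Sum>j=i+1..n. (if j = m then b i else 0)) = (\<Sum>i=1..n. if i < m then b i else 0)"
    using assms by (intro sum.cong HOL.refl) (auto simp: sum.delta)
  also have "\<dots> = (\<Sum>i\<in>{i \<in> {1..n}. i < m}. b i)" by (rule sum.inter_filter[symmetric]) simp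
  also have "{i \<in> {1..n}. i < m} = {1..m-1}" using assms by auto
  finally show ?thesis unfolding sum.distrib 1 by simp
qed

lemma ham_partial_p:
  fixes n m :: nat
  assumes m: "1 \<le> m" "m \<le> n"
  defines "q \<equiv> qv n m :: 'k::field_char_0 ratfun" and "p \<equiv> pv m :: 'k ratfun"
  shows "partial_deriv n (VP m) (ham_numerator n) =
    2*q*(q-1)*(q-tv)*p - ham_kappa0 n m*(q-1)*(q-tv) - (\<Sum>j=0..m-1. al n (2*j))*q*(q-tv)
      - ((\<Sum>j=m..n. al n (2*j))-1)*q*(q-1)
     + (\<Sum>j=m+1..n. (q-1) * (qv n j - tv) * (q * pv j + (pv j * qv n j + al n (2*j-1))))
     + (\<Sum>i=1..m-1. (qv n i - 1) * (q - tv) * ((qv n i * pv i + al n (2*i-1)) + pv i * q))"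
proof -
  let ?d = "partial_deriv n (VP m) :: 'k ratfun \<Rightarrow> _"
  have d: "derivation n ?d" "?d tv = 0" "?d etav = 0" and al: "\<forall>j\<le>2*n+1. ?d (al n j) = 0"
    by (simp_all add: derivation_partial)
  note DH = d_H_VI[OF d al] and DT = d_ham_term[OF d al] and ds = derivation_simps[OF d(1)]
  have dp: "?d (pv i) = (if i = m then 1 else 0)" "?d (qv n i) = 0" if "i \<in> {1..n}" for i
    using that by auto
  have "?d (ham_numerator n) =
     (\<Sum>i=1..n. ?d (H_VI (ham_kappa0 n i) (\<Sum>j=0..i-1. al n (2*j)) (\<Sum>j=i..n. al n (2*j))
        (al n (2*i-1) * etav) (qv n i) (pv i)))
      + (\<Sum>i=1..n. \<Sum>j=i+1..n. ?d ((qv n i - 1) * (qv n j - tv) *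
           ((qv n i * pv i + al n (2*i-1)) * pv j + pv i * (pv j * qv n j + al n (2*j-1)))))"
    unfolding ham_numerator_def
    by (subst derivation_add[OF d(1)], (intro sum_in ballI H_VI_in ham_term_in ham_kappa_in mult_in; simp),
        (intro sum_in ballI ham_term_in; simp), subst derivation_sum[OF d(1)],
        (intro sum_in ballI H_VI_in ham_term_in ham_kappa_in mult_in; simp), subst derivation_sum[OF d(1)],
        (intro sum_in ballI ham_term_in; simp), intro arg_cong2[where f = "(+)"] HOL.refl sum.cong derivation_sum[OF d(1)] ballI ham_term_in)
      auto
  also have "(\<Sum>i=1..n. ?d (H_VI (ham_kappa0 n i) (\<Sum>j=0..i-1. al n (2*j)) (\<Sum>j=i..n. al n (2*j))
        (al n (2*i-1) * etav) (qv n i) (pv i))) =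
     (\<Sum>i=1..n. if i = m then 2*q*(q-1)*(q-tv)*p - ham_kappa0 n m*(q-1)*(q-tv) - (\<Sum>j=0..m-1. al n (2*j))*q*(q-tv)
      - ((\<Sum>j=m..n. al n (2*j))-1)*q*(q-1) else 0)"
  proof (intro sum.cong HOL.refl)
    fix i assume i: "i \<in> {1..n}"
    have "?d (al n (2*i-1) * etav) = 0"
      using i by (simp add: ds d_al[OF d al])
    then show "?d (H_VI (ham_kappa0 n i) (\<Sum>j=0..i-1. al n (2*j)) (\<Sum>j=i..n. al n (2*j))
        (al n (2*i-1) * etav) (qv n i) (pv i)) = (if i = m then 2*q*(q-1)*(q-tv)*p - ham_kappa0 n m*(q-1)*(q-tv) - (\<Sum>j=0..m-1. al n (2*j))*q*(q-tv)
      - ((\<Sum>j=m..n. al n (2*j))-1)*q*(q-1) else 0)"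
      using i by (subst DH) (simp_all add: d_kappa[OF d al] dp[OF i] q_def p_def)
  qed
  also have "\<dots> = 2*q*(q-1)*(q-tv)*p - ham_kappa0 n m*(q-1)*(q-tv) - (\<Sum>j=0..m-1. al n (2*j))*q*(q-tv)
      - ((\<Sum>j=m..n. al n (2*j))-1)*q*(q-1)"
    using m by (simp add: sum.delta)
  also have "(\<Sum>i=1..n. \<Sum>j=i+1..n. ?d ((qv n i - 1) * (qv n j - tv) *
           ((qv n i * pv i + al n (2*i-1)) * pv j + pv i * (pv j * qv n j + al n (2*j-1))))) =
     (\<Sum>i=1..n. \<Sum>j=i+1..n. (if i = m then (q-1) * (qv n j - tv) * (q * pv j + (pv j * qv n j + al n (2*j-1))) else 0)
       + (if j = m then (qv n i - 1) * (q - tv) * ((qv n i * pv i + al n (2*i-1)) + pv i * q) else 0))"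
  proof (intro sum.cong HOL.refl)
    fix i j assume "i \<in> {1..n}" "j \<in> {i+1..n}"
    then have ij: "1 \<le> i" "i \<le> n" "1 \<le> j" "j \<le> n" "i \<noteq> j" "i \<in> {1..n}" "j \<in> {1..n}" by auto
    show "?d ((qv n i - 1) * (qv n j - tv) *
           ((qv n i * pv i + al n (2*i-1)) * pv j + pv i * (pv j * qv n j + al n (2*j-1)))) =
      (if i = m then (q-1) * (qv n j - tv) * (q * pv j + (pv j * qv n j + al n (2*j-1))) else 0)
       + (if j = m then (qv n i - 1) * (q - tv) * ((qv n i * pv i + al n (2*i-1)) + pv i * q) else 0)"
      unfolding DT[OF ij(1-4)] dp[OF ij(6)] dp[OF ij(7)] using ij(5) by (auto simp: q_def p_def)
  qed
  also have "\<dots> = (\<Sum>j=m+1..n. (q-1) * (qv n j - tv) * (q * pv j + (pv j * qv n j + al n (2*j-1))))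
     + (\<Sum>i=1..m-1. (qv n i - 1) * (q - tv) * ((qv n i * pv i + al n (2*i-1)) + pv i * q))"
    by (rule sum_upper_triangle[OF m])
  finally show ?thesis by (simp only: add.assoc)
qed

lemma ham_partial_q:
  fixes n m :: nat
  assumes m: "1 \<le> m" "m \<le> n"
  defines "q \<equiv> qv n m :: 'k::field_char_0 ratfun" and "p \<equiv> pv m :: 'k ratfun" and "a \<equiv> al n (2*m-1) :: 'k ratfun"
  shows "partial_deriv n (VQ m) (ham_numerator n) =
    ((q-1)*(q-tv) + q*(q-tv) + q*(q-1))*p^2 - ham_kappa0 n m*(2*q-1-tv)*p - (\<Sum>j=0..m-1. al n (2*j))*(2*q-tv)*p
      - ((\<Sum>j=m..n. al n (2*j))-1)*(2*q-1)*p + a * etav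
     + (\<Sum>j=m+1..n. (qv n j - tv) * ((q * p + a) * pv j + p * (pv j * qv n j + al n (2*j-1))) +
        (q - 1) * (qv n j - tv) * (p * pv j))
     + (\<Sum>i=1..m-1. (qv n i - 1) * ((qv n i * pv i + al n (2*i-1)) * p + pv i * (p * q + a)) +
        (qv n i - 1) * (q - tv) * (pv i * p))"
proof -
  let ?d = "partial_deriv n (VQ m) :: 'k ratfun \<Rightarrow> _"
  have d: "derivation n ?d" "?d tv = 0" "?d etav = 0" and al: "\<forall>j\<le>2*n+1. ?d (al n j) = 0"
    by (simp_all add: derivation_partial)
  note DH = d_H_VI[OF d al] and DT = d_ham_term[OF d al] and ds = derivation_simps[OF d(1)]
  have dq: "?d (pv i) = 0" "?d (qv n i) = (if i = m then 1 else 0)" if "i \<in> {1..n}" for i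
    using that by auto
  have "?d (ham_numerator n) =
     (\<Sum>i=1..n. ?d (H_VI (ham_kappa0 n i) (\<Sum>j=0..i-1. al n (2*j)) (\<Sum>j=i..n. al n (2*j))
        (al n (2*i-1) * etav) (qv n i) (pv i)))
      + (\<Sum>i=1..n. \<Sum>j=i+1..n. ?d ((qv n i - 1) * (qv n j - tv) *
           ((qv n i * pv i + al n (2*i-1)) * pv j + pv i * (pv j * qv n j + al n (2*j-1)))))"
    unfolding ham_numerator_def
    by (subst derivation_add[OF d(1)], (intro sum_in ballI H_VI_in ham_term_in ham_kappa_in mult_in; simp),
        (intro sum_in ballI ham_term_in; simp), subst derivation_sum[OF d(1)],
        (intro sum_in ballI H_VI_in ham_term_in ham_kappa_in mult_in; simp), subst derivation_sum[OF d(1)],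
        (intro sum_in ballI ham_term_in; simp), intro arg_cong2[where f = "(+)"] HOL.refl sum.cong derivation_sum[OF d(1)] ballI ham_term_in)
      auto
  also have "(\<Sum>i=1..n. ?d (H_VI (ham_kappa0 n i) (\<Sum>j=0..i-1. al n (2*j)) (\<Sum>j=i..n. al n (2*j))
        (al n (2*i-1) * etav) (qv n i) (pv i))) =
     (\<Sum>i=1..n. if i = m then ((q-1)*(q-tv) + q*(q-tv) + q*(q-1))*p^2 - ham_kappa0 n m*(2*q-1-tv)*p - (\<Sum>j=0..m-1. al n (2*j))*(2*q-tv)*p
      - ((\<Sum>j=m..n. al n (2*j))-1)*(2*q-1)*p + a * etav else 0)"
  proof (intro sum.cong HOL.refl)
    fix i assume i: "i \<in> {1..n}"
    have "?d (al n (2*i-1) * etav) = 0"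
      using i by (simp add: ds d_al[OF d al])
    then show "?d (H_VI (ham_kappa0 n i) (\<Sum>j=0..i-1. al n (2*j)) (\<Sum>j=i..n. al n (2*j))
        (al n (2*i-1) * etav) (qv n i) (pv i)) = (if i = m then ((q-1)*(q-tv) + q*(q-tv) + q*(q-1))*p^2 - ham_kappa0 n m*(2*q-1-tv)*p - (\<Sum>j=0..m-1. al n (2*j))*(2*q-tv)*p
      - ((\<Sum>j=m..n. al n (2*j))-1)*(2*q-1)*p + a * etav else 0)"
      using i by (subst DH) (simp_all add: d_kappa[OF d al] dq[OF i] q_def p_def a_def)
  qed
  also have "\<dots> = ((q-1)*(q-tv) + q*(q-tv) + q*(q-1))*p^2 - ham_kappa0 n m*(2*q-1-tv)*p - (\<Sum>j=0..m-1. al n (2*j))*(2*q-tv)*p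
      - ((\<Sum>j=m..n. al n (2*j))-1)*(2*q-1)*p + a * etav"
    using m by (simp add: sum.delta)
  also have "(\<Sum>i=1..n. \<Sum>j=i+1..n. ?d ((qv n i - 1) * (qv n j - tv) *
           ((qv n i * pv i + al n (2*i-1)) * pv j + pv i * (pv j * qv n j + al n (2*j-1))))) =
     (\<Sum>i=1..n. \<Sum>j=i+1..n. (if i = m then (qv n j - tv) * ((q * p + a) * pv j + p * (pv j * qv n j + al n (2*j-1))) +
        (q - 1) * (qv n j - tv) * (p * pv j) else 0)
       + (if j = m then (qv n i - 1) * ((qv n i * pv i + al n (2*i-1)) * p + pv i * (p * q + a)) +
        (qv n i - 1) * (q - tv) * (pv i * p) else 0))"
  proof (intro sum.cong HOL.refl)
    fix i j assume "i \<in> {1..n}" "j \<in> {i+1..n}"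
    then have ij: "1 \<le> i" "i \<le> n" "1 \<le> j" "j \<le> n" "i \<noteq> j" "i \<in> {1..n}" "j \<in> {1..n}" by auto
    show "?d ((qv n i - 1) * (qv n j - tv) *
           ((qv n i * pv i + al n (2*i-1)) * pv j + pv i * (pv j * qv n j + al n (2*j-1)))) =
      (if i = m then (qv n j - tv) * ((q * p + a) * pv j + p * (pv j * qv n j + al n (2*j-1))) +
        (q - 1) * (qv n j - tv) * (p * pv j) else 0)
       + (if j = m then (qv n i - 1) * ((qv n i * pv i + al n (2*i-1)) * p + pv i * (p * q + a)) +
        (qv n i - 1) * (q - tv) * (pv i * p) else 0)"
      unfolding DT[OF ij(1-4)] dq[OF ij(6)] dq[OF ij(7)] using ij(5) by (auto simp: q_def p_def a_def)
  qed
  also have "\<dots> = (\<Sum>j=m+1..n. (qv n j - tv) * ((q * p + a) * pv j + p * (pv j * qv n j + al n (2*j-1))) +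
        (q - 1) * (qv n j - tv) * (p * pv j))
     + (\<Sum>i=1..m-1. (qv n i - 1) * ((qv n i * pv i + al n (2*i-1)) * p + pv i * (p * q + a)) +
        (qv n i - 1) * (q - tv) * (pv i * p))"
    by (rule sum_upper_triangle[OF m])
  finally show ?thesis by (simp only: add.assoc)
qed

lemma derivation_ddt: "derivation n (ddt n)"
proof -
  have "derivation n (\<lambda>f. partial_deriv n VT f + (\<Sum>i=1..n. c i * partial_deriv n (VQ i) f - e i * partial_deriv n (VP i) f))"
    if "\<And>i. i \<in> {1..n} \<Longrightarrow> c i \<in> ratfield n" "\<And>i. i \<in> {1..n} \<Longrightarrow> e i \<in> ratfield n" for c e :: "nat \<Rightarrow> 'a ratfun"
    unfolding derivation_def using that
    by (auto simp: derivation_add[OF derivation_partial] derivation_mult[OF derivation_partial]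
        derivation_Const[OF derivation_partial] algebra_simps sum_distrib_left sum.distrib sum_subtractf
        intro!: add_in sum_in diff_in mult_in)
  then show ?thesis unfolding ddt_def[abs_def] by simp
qed

lemma ddt_simps:
  "ddt n tv = 1" "ddt n etav = 0" "j \<le> 2*n+1 \<Longrightarrow> ddt n (al n j) = 0"
  "1 \<le> m \<Longrightarrow> m \<le> n \<Longrightarrow> ddt n (qv n m) = partial_deriv n (VP m) (hamiltonian n)"
  "1 \<le> m \<Longrightarrow> m \<le> n \<Longrightarrow> ddt n (pv m) = - partial_deriv n (VQ m) (hamiltonian n)"
proof -
  show "ddt n (qv n m) = partial_deriv n (VP m) (hamiltonian n)" if "1 \<le> m" "m \<le> n"
  proof -
    have "(\<Sum>i=1..n. partial_deriv n (VP i) (hamiltonian n) * partial_deriv n (VQ i) (qv n m) -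
       partial_deriv n (VQ i) (hamiltonian n) * partial_deriv n (VP i) (qv n m)) =
       (\<Sum>i=1..n. if i = m then partial_deriv n (VP m) (hamiltonian n) else 0)"
      using that by (intro sum.cong) auto
    then show ?thesis using that by (simp add: ddt_def sum.delta)
  qed
  show "ddt n (pv m) = - partial_deriv n (VQ m) (hamiltonian n)" if "1 \<le> m" "m \<le> n"
  proof -
    have "(\<Sum>i=1..n. partial_deriv n (VP i) (hamiltonian n) * partial_deriv n (VQ i) (pv m) -
       partial_deriv n (VQ i) (hamiltonian n) * partial_deriv n (VP i) (pv m)) =
       (\<Sum>i=1..n. if i = m then - partial_deriv n (VQ m) (hamiltonian n) else 0)"
      using that by (intro sum.cong) auto
    then show ?thesis using that by (simp add: ddt_def sum.delta)
  qed
qed (simp_all add: ddt_def)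

lemma partial_hamiltonian:
  assumes "y = VQ m \<or> y = VP m"
  shows "tv * (tv - 1) * partial_deriv n y (hamiltonian n) = (partial_deriv n y (ham_numerator n) :: 'k::field_char_0 ratfun)"
proof -
  note ds = derivation_simps[OF derivation_partial]
  have "partial_deriv n y (tv * (tv - 1)) = (0 :: 'k ratfun)" using assms by (auto simp: ds)
  moreover have nz: "tv * (tv - 1) \<noteq> (0 :: 'k ratfun)" by simp
  ultimately have "partial_deriv n y (hamiltonian n) =
     partial_deriv n y (ham_numerator n) * (tv * (tv - 1)) / (tv * (tv - 1) :: 'k ratfun)^2"
    unfolding hamiltonian_eq by (subst derivation_divide[OF derivation_partial]) (simp_all del: mult_eq_0_iff)
  then show ?thesis using nz by (simp add: power2_eq_square)
qed

section \<open>The flow on the lattice\<close>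

definition lat_src :: "nat \<Rightarrow> int \<Rightarrow> 'k::field_char_0 ratfun" where
  "lat_src n k = lat n k ^ 2 * (lat n (k + 1) - lat n (k - 1)) + par n k * lat n k"

text \<open>The antiderivative Y of \<open>lat_src\<close> with step 2, Y(k+2) - Y(k) =
  \<open>lat_src n k\<close>. The multiplier over one period fixes the additive constant: the sum
  over a period must equal (\<open>qfac k\<close> - 1) Y(k), whence the division.\<close>

definition lat_src_sum :: "nat \<Rightarrow> int \<Rightarrow> 'k::field_char_0 ratfun" where
  "lat_src_sum n k = (\<Sum>j=0..n. lat_src n (k + 2 * int j)) / (qfac k - 1)"

text \<open>The antiderivative of the parameters that vanishes at 0; as the parameters sum to 1, it
  grows by 1 in each period. It enters the flow and also carries the faithful action.\<close>

definition cumul :: "nat \<Rightarrow> int \<Rightarrow> 'k::field_char_0 ratfun" where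
  "cumul n k = (if 0 \<le> k then \<Sum>l\<in>{0..<k}. par n l else - (\<Sum>l\<in>{k..<0}. par n l))"

text \<open>Chosen so that the flow of the normalized term x_{-1} = 1 vanishes.\<close>

definition lat_gauge :: "nat \<Rightarrow> 'k::field_char_0 ratfun" where
  "lat_gauge n = lat_src_sum n 1 - lat n 0"

definition alt :: "int \<Rightarrow> 'a::ring_1" where
  "alt k = (if odd k then 1 else - 1)"

text \<open>The expression for t dx_k/dt, see \<open>ddt_lat\<close>. Apart from its last term, an
  infinitesimal gauge transformation, each summand scales as x_k does. The alternating sign matches
  the rotation: it shifts k by 1 and turns t d/dt into -t d/dt.\<close>

definition lat_flow :: "nat \<Rightarrow> int \<Rightarrow> 'k::field_char_0 ratfun" where
  "lat_flow n k = alt k * (- lat_src_sum n k + lat n k ^ 2 * lat n (k - 1) + lat n k * cumul n k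
     + lat_gauge n * lat n k)"

lemma cumul_step: "cumul n (k + 1) = cumul n k + par n k"
proof -
  consider "0 \<le> k" | "k = - 1" | "k < - 1" by linarith
  then show ?thesis
  proof cases
    case 1
    then have "{0..<k + 1} = insert k {0..<k}" by auto
    then show ?thesis using 1 by (simp add: cumul_def)
  next
    case 2
    then have "{k..<0} = {k}" by auto
    then show ?thesis using 2 by (simp add: cumul_def)
  next
    case 3
    then have "{k..<0} = insert k {k + 1..<0}" by auto
    then show ?thesis using 3 by (simp add: cumul_def)
  qed
qed

lemma cumul_0 [simp]: "cumul n 0 = 0"
  by (simp add: cumul_def)

lemma cumul_1: "cumul n 1 = par n 0"
  using cumul_step[of n 0] by simp

lemma cumul_in [simp]: "cumul n k \<in> ratfield n"
  by (simp add: cumul_def)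

lemma lat_src_in [simp]: "lat_src n k \<in> ratfield n"
  by (simp add: lat_src_def)

lemma lat_src_sum_in [simp]: "lat_src_sum n k \<in> ratfield n"
  by (simp add: lat_src_sum_def)

lemma lat_gauge_in [simp]: "lat_gauge n \<in> ratfield n"
  by (simp add: lat_gauge_def)

lemma lat_near_shift:
  "lat n (k + per n + 1) = lat n (k + 1) / qfac k" "lat n (k + per n - 1) = lat n (k - 1) / qfac k"
proof -
  have "k + per n + 1 = k + 1 + per n" "k + per n - 1 = k - 1 + per n" by simp_all
  then show "lat n (k + per n + 1) = lat n (k + 1) / qfac k" "lat n (k + per n - 1) = lat n (k - 1) / qfac k"
    by (simp_all only: lat_shift qfac_shift) simp_all
qed

lemma lat_src_shift: "lat_src n (k + per n) = qfac k * lat_src n k"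
proof -
  have "(q * x)^2 * (y / q - z / q) + a * (q * x) = q * (x^2 * (y - z) + a * x)" if "q \<noteq> 0" for q x y z a :: "'a ratfun"
    using that by (simp add: power_mult_distrib power2_eq_square distrib_left flip: diff_divide_distrib)
  from this[OF qfac_nonzero] show ?thesis
    unfolding lat_src_def lat_shift lat_near_shift par_shift .
qed

text \<open>Advancing by 2 exchanges the first summand for its translate by one period, which is
  \<open>qfac k\<close> times as large; the factor \<open>qfac k\<close> - 1 cancels.\<close>

lemma lat_src_sum_step: "lat_src_sum n (k + 2) = lat_src_sum n k + (lat_src n k :: 'k::field_char_0 ratfun)"
proof -
  have "(\<Sum>j=0..n. lat_src n (k + 2 + 2 * int j)) + lat_src n k =
    (\<Sum>j=0..n. lat_src n (k + 2 * int j)) + (lat_src n (k + per n) :: 'k ratfun)"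
  proof -
    have "(\<Sum>j=0..n. lat_src n (k + 2 + 2 * int j)) = (\<Sum>j=Suc 0..Suc n. lat_src n (k + 2 * int j) :: 'k ratfun)"
      unfolding sum.shift_bounds_cl_Suc_ivl by (simp add: algebra_simps)
    also have "lat_src n k + \<dots> = (\<Sum>j=0..Suc n. lat_src n (k + 2 * int j))"
      by (simp add: sum.atLeast_Suc_atMost[of 0 "Suc n"] del: sum.cl_ivl_Suc)
    also have "\<dots> = (\<Sum>j=0..n. lat_src n (k + 2 * int j)) + lat_src n (k + per n)"
      by (simp add: algebra_simps)
    finally show ?thesis by (simp add: add.commute)
  qed
  then have "(\<Sum>j=0..n. lat_src n (k + 2 + 2 * int j)) =
      (\<Sum>j=0..n. lat_src n (k + 2 * int j)) + (qfac k - 1) * (lat_src n k :: 'k ratfun)"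
  proof -
    have "a = b + (q - 1) * s" if "a + s = b + q * s" for a b q s :: "'k ratfun"
      using that by (simp add: left_diff_distrib eq_diff_eq add_diff_eq)
    then show ?thesis using \<open>_ = _ + lat_src n (k + per n)\<close> unfolding lat_src_shift by blast
  qed
  then show ?thesis
    using qfac_neq_1[of k, where ?'a = 'k] by (simp add: lat_src_sum_def add_divide_distrib)
qed

lemma lat_src_sum_shift: "lat_src_sum n (k + per n) = qfac k * (lat_src_sum n k :: 'k::field_char_0 ratfun)"
proof -
  have "lat_src n (k + per n + 2 * int j) = qfac k * (lat_src n (k + 2 * int j) :: 'k ratfun)" for j
  proof -
    have "k + per n + 2 * int j = k + 2 * int j + per n" by simp
    moreover have "qfac (k + 2 * int j) = (qfac k :: 'k ratfun)" by (simp add: qfac_def)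
    ultimately show ?thesis by (simp only: lat_src_shift)
  qed
  then show ?thesis unfolding lat_src_sum_def by (simp add: sum_distrib_left)
qed

lemma cumul_nat: "cumul n (int m) = (\<Sum>l<m. par n (int l))"
  by (induction m) (simp_all add: cumul_step add.commute[of 1])

lemma cumul_per: "cumul n (per n) = 1"
proof -
  have "per n = int (2*n+2)" by simp
  then have "cumul n (per n) = (\<Sum>l<2*n+2. par n (int l))" by (simp only: cumul_nat)
  also have "\<dots> = (\<Sum>l=0..2*n+1. al n l)"
    by (intro sum.cong) (auto simp: par_al)
  finally show ?thesis by (simp only: sum_al)
qed

lemma cumul_shift: "cumul n (k + per n) = (cumul n k + 1 :: 'k::field_char_0 ratfun)"
proof (induction k rule: int_induct[where k = 0])
  case base
  then show ?case using cumul_per by simp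
next
  case (step1 i)
  have "i + 1 + per n = i + per n + 1" by simp
  then show ?case using step1 by (simp only: cumul_step par_shift) simp
next
  case (step2 i)
  have "i + per n = i - 1 + per n + 1" by simp
  then have "cumul n (i + per n) = cumul n (i - 1 + per n) + (par n (i - 1) :: 'k ratfun)" by (simp only: cumul_step par_shift)
  moreover have "cumul n i = cumul n (i - 1) + (par n (i - 1) :: 'k ratfun)" using cumul_step[of n "i - 1"] by simp
  moreover have "B = D + 1" if "A = B + p" "C = D + p" "A = C + 1" for A B C D p :: "'k ratfun"
    using that by (simp add: add_ac)
  ultimately show ?case using step2.IH by blast
qed

lemma cumul_odd:
  assumes "1 \<le> m" "m \<le> n + 1"
  shows "cumul n (2 * int m - 1) = (\<Sum>j=0..m-1. al n (2*j)) + (\<Sum>j=1..m-1. al n (2*j-1) :: 'k::field_char_0 ratfun)"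
  using assms
proof (induction m rule: nat_induct_at_least)
  case base
  then show ?case by (simp add: cumul_1 par_def)
next
  case (Suc m)
  have "2 * int (Suc m) - 1 = 2 * int m - 1 + 1 + 1" by simp
  then have "cumul n (2 * int (Suc m) - 1) = cumul n (2 * int m - 1) + par n (2 * int m - 1) + (par n (2 * int m - 1 + 1) :: 'k ratfun)"
    by (simp only: cumul_step)
  also have "par n (2 * int m - 1) = (al n (2*m-1) :: 'k ratfun)" using Suc by (intro par_odd) auto
  also have "par n (2 * int m - 1 + 1) = (al n (2*m) :: 'k ratfun)" using Suc par_even[of m n] by simp
  finally show ?case using Suc by (cases m) (simp_all add: add_ac)
qed

lemma lat_src_odd:
  assumes "1 \<le> j" "j \<le> n"
  shows "lat_src n (2 * int j - 1) = qv n j ^ 2 * pv j + (al n (2*j-1) * qv n j :: 'k::field_char_0 ratfun)"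
  using assms lat_diff[of j n, where ?'k = 'k]
  by (simp add: lat_src_def lat_odd par_odd)

lemma lat_src_sum_odd:
  assumes "1 \<le> m" "m \<le> n + 1"
  shows "lat_src_sum n (2 * int m - 1) = lat_src_sum n 1 +
    (\<Sum>j=1..m-1. qv n j ^ 2 * pv j + (al n (2*j-1) * qv n j) :: 'k::field_char_0 ratfun)"
  using assms
proof (induction m rule: nat_induct_at_least)
  case base
  then show ?case by simp
next
  case (Suc m)
  have "2 * int (Suc m) - 1 = 2 * int m - 1 + 2" by simp
  then have "lat_src_sum n (2 * int (Suc m) - 1) = lat_src_sum n (2 * int m - 1) + (lat_src n (2 * int m - 1) :: 'k ratfun)"
    by (simp only: lat_src_sum_step)
  then show ?case using Suc lat_src_odd[of m n, where ?'k = 'k] by (cases m) (simp_all add: add_ac)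
qed

lemma lat_src_sum_1:
  "(tv - 1) * lat_src_sum n 1 = (\<Sum>j=1..n. qv n j ^ 2 * pv j + al n (2*j-1) * qv n j)
     - tv * ((\<Sum>k=1..n. qv n k * pv k) + etav) + al n (2*n+1) * (tv :: 'k::field_char_0 ratfun)"
proof -
  have "(tv - 1) * lat_src_sum n 1 = (\<Sum>j=0..n. lat_src n (1 + 2 * int j) :: 'k ratfun)"
    by (simp add: lat_src_sum_def qfac_def)
  also have "\<dots> = (\<Sum>j=1..Suc n. lat_src n (2 * int j - 1))"
    using sum.shift_bounds_cl_Suc_ivl[of "\<lambda>j. lat_src n (2 * int j - 1) :: 'k ratfun" 0 n] by (simp add: algebra_simps del: sum.cl_ivl_Suc)
  \<comment> \<open>The last summand, of index 2n+1, is reached from index -1 by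
    quasi-periodicity.\<close>
  also have "\<dots> = (\<Sum>j=1..n. lat_src n (2 * int j - 1)) + lat_src n (- 1 + per n)"
    by (simp add: algebra_simps)
  also have "lat_src n (- 1 + per n) = tv * (lat n 0 - lat n (- 2) + par n (- 1) :: 'k ratfun)"
    unfolding lat_src_shift by (simp add: lat_src_def qfac_def)
  also have "par n (- 1) = (par n (- 1 + per n) :: 'k ratfun)" by (simp only: par_shift)
  also have "\<dots> = al n (2*n+1)" using par_al[of "2*n+1" n, where ?'a = 'k] by simp
  also have "(\<Sum>j=1..n. lat_src n (2 * int j - 1)) = (\<Sum>j=1..n. qv n j ^ 2 * pv j + al n (2*j-1) * (qv n j :: 'k ratfun))"
    by (intro sum.cong) (auto simp: lat_src_odd)
  finally show ?thesis unfolding lat_minus_2 by (simp add: algebra_simps)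
qed

text \<open>All sums are split at m and treated as independent symbols, with suffix L for indices
  below m and U above: L, U for \<open>lat_src\<close>, S for q_j p_j, P for p_j, a and b for odd
  and even parameters. Y and R are known through their products with t - 1, so the equation is
  multiplied by t - 1; the last assumption is the relation between the parameters.\<close>

lemma flow_q_identity:
  fixes t :: "'a::comm_ring_1"
  assumes Y: "(t - 1) * Y = (L + (q^2*p + a*q) + U) - t * ((SL + q*p + SU) + e) + a1 * t"
    and R: "(t - 1) * R = (SL + q*p + SU) - t * (PL + p + PU) + e"
    and b: "bU = 1 - (bL + aL + a + aU + a1)"
  shows "2*q*(q-1)*(q-t)*p - (aL + aU + a1 - e)*(q-1)*(q-t) - bL*q*(q-t) - (bU-1)*q*(q-1)
      + (q-1)*(q*SU + U - t*q*PU - t*SU - t*aU) + (q-t)*(L - SL - aL + q*SL - q*PL)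
    = (t - 1) * (- (Y + L) + q^2*(R + PL) + q*(bL + aL) + (Y - R)*q)"
proof -
  have "(t - 1) * (- (Y + L) + q^2*(R + PL) + q*(bL + aL) + (Y - R)*q) =
     ((t - 1) * Y) * (q - 1) - (t - 1) * L + ((t - 1) * R) * (q^2 - q) + (t - 1) * (q^2 * PL + q*(bL + aL))"
    by (simp add: algebra_simps)
  then show ?thesis unfolding Y R b by (simp add: algebra_simps power2_eq_square)
qed

lemma flow_p_identity:
  fixes t :: "'a::comm_ring_1"
  assumes Y: "(t - 1) * Y = (L + (q^2*p + a*q) + U) - t * ((SL + q*p + SU) + e) + a1 * t"
    and R: "(t - 1) * R = (SL + q*p + SU) - t * (PL + p + PU) + e"
    and b: "bU = 1 - (bL + aL + a + aU + a1)"
  shows "((q-1)*(q-t) + q*(q-t) + q*(q-1))*p^2 - (aL + aU + a1 - e)*(2*q-1-t)*p - bL*(2*q-t)*p - (bU-1)*(2*q-1)*p + a*e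
     + ((q*p + a)*(SU - t*PU) + p*(U - t*SU - t*aU) + (q-1)*p*(SU - t*PU))
     + (p*(L - SL - aL) + (p*q + a)*(SL - PL) + (q-t)*p*(SL - PL))
    = (t - 1) * (p*q*((R + PL + p) + (R + PL)) + p*(bL + aL) + a*(R + PL + p) + (Y - R)*p)"
proof -
  have "(t - 1) * (p*q*((R + PL + p) + (R + PL)) + p*(bL + aL) + a*(R + PL + p) + (Y - R)*p) =
     ((t - 1) * Y) * p + ((t - 1) * R) * (2*p*q + a - p) + (t - 1) * (p*q*(2*PL+p) + p*(bL + aL) + a*(PL + p))"
    by (simp add: algebra_simps)
  then show ?thesis unfolding Y R b by (simp add: algebra_simps power2_eq_square)
qed

lemma sum_telescope:
  fixes g :: "nat \<Rightarrow> 'a::ab_group_add"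
  shows "(\<Sum>j=1..n. g j - g (j - 1)) = g n - g 0"
  by (induction n) simp_all

lemma sum_split_at:
  fixes f :: "nat \<Rightarrow> 'a::comm_monoid_add"
  assumes "1 \<le> m" "m \<le> n"
  shows "(\<Sum>j=1..n. f j) = (\<Sum>j=1..m-1. f j) + f m + (\<Sum>j=m+1..n. f j)"
proof -
  obtain l where m: "m = Suc l" using assms(1) by (cases m) auto
  obtain p where n: "n = m + p" using assms(2) le_Suc_ex by blast
  have "(\<Sum>j=1..m + p. f j) = (\<Sum>j=1..m. f j) + (\<Sum>j=m+1..m + p. f j)"
    by (rule sum.ub_add_nat) simp
  then show ?thesis unfolding n by (simp add: m)
qed

lemma sum_odd_even:
  fixes f :: "nat \<Rightarrow> 'a::comm_monoid_add"
  shows "(\<Sum>l=0..2*n+1. f l) = (\<Sum>j=0..n. f (2*j)) + (\<Sum>j=0..n. f (2*j+1))"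
  by (induction n) (simp_all add: add_ac)

text \<open>Hamilton's equations in lattice form. The q-equation is already the flow at an odd
  index; the p-equation is brought into that form in \<open>ddt_p_flow\<close>.\<close>

lemma ddt_qp:
  fixes n m :: nat
  assumes m: "1 \<le> m" "m \<le> n"
  shows "tv * ddt n (qv n m) = (lat_flow n (2 * int m - 1) :: 'k::field_char_0 ratfun)" (is ?Q)
    and "tv * ddt n (pv m) = - (pv m * qv n m * (lat n (2 * int m) + lat n (2 * int m - 2))
      + pv m * cumul n (2 * int m - 1) + al n (2*m-1) * lat n (2 * int m) + lat_gauge n * (pv m :: 'k ratfun))" (is ?P)
proof -
  define q p a e t :: "'k ratfun" where "q = qv n m" and "p = pv m" and "a = al n (2*m-1)" and "e = etav" and "t = tv"
  define Y R a1 :: "'k ratfun" where "Y = lat_src_sum n 1" and "R = lat n 0" and "a1 = al n (2*n+1)"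
  define L U SL SU PL PU aL aU bL bU :: "'k ratfun" where
    "L = (\<Sum>j=1..m-1. qv n j ^ 2 * pv j + al n (2*j-1) * qv n j)" and
    "U = (\<Sum>j=m+1..n. qv n j ^ 2 * pv j + al n (2*j-1) * qv n j)" and
    "SL = (\<Sum>j=1..m-1. qv n j * pv j)" and "SU = (\<Sum>j=m+1..n. qv n j * pv j)" and
    "PL = (\<Sum>j=1..m-1. pv j)" and "PU = (\<Sum>j=m+1..n. pv j)" and
    "aL = (\<Sum>j=1..m-1. al n (2*j-1))" and "aU = (\<Sum>j=m+1..n. al n (2*j-1))" and
    "bL = (\<Sum>j=0..m-1. al n (2*j))" and "bU = (\<Sum>j=m..n. al n (2*j))"
  note defs = q_def p_def a_def e_def t_def Y_def R_def a1_def L_def U_def SL_def SU_def PL_def PU_def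
    aL_def aU_def bL_def bU_def
  note split = sum_split_at[OF m]
  have Y: "(t - 1) * Y = (L + (q^2*p + a*q) + U) - t * ((SL + q*p + SU) + e) + a1 * t"
    unfolding defs lat_src_sum_1 split ..
  have Phi: "Phi n = (SL + q*p + SU) - t * (PL + p + PU) + e"
  proof -
    have "Phi n = (\<Sum>j=1..n. qv n j * pv j) - tv * (\<Sum>j=1..n. pv j) + (etav :: 'k ratfun)"
      by (simp add: Phi_def sum_distrib_left left_diff_distrib sum_subtractf)
    then show ?thesis unfolding defs split .
  qed
  have R: "(t - 1) * R = (SL + q*p + SU) - t * (PL + p + PU) + e"
    unfolding Phi[symmetric] by (simp add: R_def t_def lat_0)
  have odd_sum: "(\<Sum>j=0..n. al n (2*j+1)) = aL + a + aU + a1"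
  proof -
    have "(\<Sum>j=0..n. al n (2*j+1)) = (\<Sum>j=1..Suc n. al n (2*j-1) :: 'k ratfun)"
      using sum.shift_bounds_cl_Suc_ivl[of "\<lambda>j. al n (2*j-1) :: 'k ratfun" 0 n] by (simp del: sum.cl_ivl_Suc)
    also have "\<dots> = (\<Sum>j=1..n. al n (2*j-1)) + a1" by (simp add: a1_def)
    finally show ?thesis unfolding split by (simp only: defs)
  qed
  have even_sum: "(\<Sum>j=0..n. al n (2*j)) = bL + bU"
  proof -
    obtain l where l: "m = Suc l" using m(1) by (cases m) auto
    obtain r where r: "n = l + r" using m(2) l by (metis Suc_leD le_Suc_ex)
    have "(\<Sum>j=0..l + r. al n (2*j)) = (\<Sum>j=0..l. al n (2*j)) + (\<Sum>j=l+1..l + r. al n (2*j) :: 'k ratfun)"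
      by (rule sum.ub_add_nat) simp
    then show ?thesis by (simp add: bL_def bU_def l r)
  qed
  have b: "bU = 1 - (bL + aL + a + aU + a1)"
    using sum_al[of n, where ?'a = 'k] unfolding sum_odd_even odd_sum even_sum by (simp add: algebra_simps)
  have k0: "ham_kappa0 n m = aL + aU + a1 - e"
    unfolding ham_kappa0_def odd_sum by (simp add: a_def e_def)
  have lo: "lat n (2 * int m - 1) = q" using m by (simp add: lat_odd q_def)
  have le: "lat n (2 * int m - 2) = R + PL"
  proof -
    have "2 * int m - 2 = 2 * int (m - 1)" using m by simp
    then have "lat n (2 * int m - 2) = (lat n (2 * int (m - 1)) :: 'k ratfun)" by (simp only:)
    also have "\<dots> = Phi n / (tv - 1) + (\<Sum>j=1..m-1. pv j)" by (rule lat_even) (use m in simp)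
    finally show ?thesis by (simp only: lat_0 R_def PL_def)
  qed
  have le': "lat n (2 * int m) = R + PL + p"
    using lat_diff[OF m, where ?'k = 'k] le by (simp add: p_def algebra_simps)
  have ys: "lat_src_sum n (2 * int m - 1) = Y + L"
    using lat_src_sum_odd[of m n, where ?'k = 'k] m by (simp add: Y_def L_def)
  have cu: "cumul n (2 * int m - 1) = bL + aL"
    using cumul_odd[of m n, where ?'k = 'k] m by (simp add: bL_def aL_def)
  have ga: "lat_gauge n = Y - R" by (simp add: lat_gauge_def Y_def R_def)
  have t1: "t - 1 \<noteq> 0" by (simp add: t_def)
  have fl: "lat_flow n (2 * int m - 1) = - (Y + L) + q^2*(R + PL) + q*(bL + aL) + (Y - R)*q"
  proof -
    have "2 * int m - 1 - 1 = 2 * int m - 2" by simp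
    then show ?thesis unfolding lat_flow_def by (simp only: lo le ys cu ga) (simp add: alt_def)
  qed
  have "(t - 1) * (t * ddt n q) = partial_deriv n (VP m) (ham_numerator n)"
    using partial_hamiltonian[of "VP m" m n, where ?'k = 'k] m by (simp add: q_def t_def ddt_simps mult_ac)
  also have "\<dots> = 2*q*(q-1)*(q-t)*p - (aL + aU + a1 - e)*(q-1)*(q-t) - bL*q*(q-t) - (bU-1)*q*(q-1)
      + (q-1)*(q*SU + U - t*q*PU - t*SU - t*aU) + (q-t)*(L - SL - aL + q*SL - q*PL)"
  proof -
    have "(\<Sum>j=m+1..n. (q-1) * (qv n j - t) * (q * pv j + (pv j * qv n j + al n (2*j-1)))) =
        (\<Sum>j=m+1..n. (q-1) * (q * (qv n j * pv j) + (qv n j ^ 2 * pv j + al n (2*j-1) * qv n j) - t * q * pv j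
          - t * (qv n j * pv j) - t * al n (2*j-1)))"
      by (intro sum.cong HOL.refl) (simp add: algebra_simps power2_eq_square)
    also have "\<dots> = (q-1)*(q*SU + U - t*q*PU - t*SU - t*aU)"
      by (simp only: sum_distrib_left[symmetric] sum.distrib sum_subtractf SU_def U_def PU_def aU_def)
    finally have 1: "(\<Sum>j=m+1..n. (q-1) * (qv n j - t) * (q * pv j + (pv j * qv n j + al n (2*j-1)))) =
      (q-1)*(q*SU + U - t*q*PU - t*SU - t*aU)" .
    have "(\<Sum>i=1..m-1. (qv n i - 1) * (q - t) * ((qv n i * pv i + al n (2*i-1)) + pv i * q)) =
        (\<Sum>j=1..m-1. (q-t) * ((qv n j ^ 2 * pv j + al n (2*j-1) * qv n j) - qv n j * pv j - al n (2*j-1)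
          + q * (qv n j * pv j) - q * pv j))"
      by (intro sum.cong HOL.refl) (simp add: algebra_simps power2_eq_square)
    also have "\<dots> = (q-t)*(L - SL - aL + q*SL - q*PL)"
      by (simp only: sum_distrib_left[symmetric] sum.distrib sum_subtractf SL_def L_def PL_def aL_def)
    finally have 2: "(\<Sum>i=1..m-1. (qv n i - 1) * (q - t) * ((qv n i * pv i + al n (2*i-1)) + pv i * q)) =
      (q-t)*(L - SL - aL + q*SL - q*PL)" .
    show ?thesis
      unfolding ham_partial_p[OF m] k0 bL_def[symmetric] bU_def[symmetric]
      unfolding q_def[symmetric] p_def[symmetric] t_def[symmetric] 1 2 ..
  qed
  also have "\<dots> = (t - 1) * lat_flow n (2 * int m - 1)"
    unfolding fl by (rule flow_q_identity[OF Y R b])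
  finally show ?Q using t1 by (simp add: q_def t_def)
  have "(t - 1) * - (t * ddt n p) = partial_deriv n (VQ m) (ham_numerator n)"
    using partial_hamiltonian[of "VQ m" m n, where ?'k = 'k] m by (simp add: p_def t_def ddt_simps mult_ac)
  also have "\<dots> = ((q-1)*(q-t) + q*(q-t) + q*(q-1))*p^2 - (aL + aU + a1 - e)*(2*q-1-t)*p - bL*(2*q-t)*p - (bU-1)*(2*q-1)*p + a*e
     + ((q*p + a)*(SU - t*PU) + p*(U - t*SU - t*aU) + (q-1)*p*(SU - t*PU))
     + (p*(L - SL - aL) + (p*q + a)*(SL - PL) + (q-t)*p*(SL - PL))"
  proof -
    have "(\<Sum>j=m+1..n. (qv n j - t) * ((q * p + a) * pv j + p * (pv j * qv n j + al n (2*j-1))) +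
        (q - 1) * (qv n j - t) * (p * pv j)) =
        (\<Sum>j=m+1..n. (q*p + a) * (qv n j * pv j - t * pv j) + p * ((qv n j ^ 2 * pv j + al n (2*j-1) * qv n j)
          - t * (qv n j * pv j) - t * al n (2*j-1)) + (q-1) * p * (qv n j * pv j - t * pv j))"
      by (intro sum.cong HOL.refl) (simp add: algebra_simps power2_eq_square)
    also have "\<dots> = (q*p + a)*(SU - t*PU) + p*(U - t*SU - t*aU) + (q-1)*p*(SU - t*PU)"
      by (simp only: sum_distrib_left[symmetric] sum.distrib sum_subtractf SU_def U_def PU_def aU_def)
    finally have 1: "(\<Sum>j=m+1..n. (qv n j - t) * ((q * p + a) * pv j + p * (pv j * qv n j + al n (2*j-1))) +
        (q - 1) * (qv n j - t) * (p * pv j)) = (q*p + a)*(SU - t*PU) + p*(U - t*SU - t*aU) + (q-1)*p*(SU - t*PU)" .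
    have "(\<Sum>i=1..m-1. (qv n i - 1) * ((qv n i * pv i + al n (2*i-1)) * p + pv i * (p * q + a)) +
        (qv n i - 1) * (q - t) * (pv i * p)) =
        (\<Sum>j=1..m-1. p * ((qv n j ^ 2 * pv j + al n (2*j-1) * qv n j) - qv n j * pv j - al n (2*j-1))
          + (p*q + a) * (qv n j * pv j - pv j) + (q-t) * p * (qv n j * pv j - pv j))"
      by (intro sum.cong HOL.refl) (simp add: algebra_simps power2_eq_square)
    also have "\<dots> = p*(L - SL - aL) + (p*q + a)*(SL - PL) + (q-t)*p*(SL - PL)"
      by (simp only: sum_distrib_left[symmetric] sum.distrib sum_subtractf SL_def L_def PL_def aL_def)
    finally have 2: "(\<Sum>i=1..m-1. (qv n i - 1) * ((qv n i * pv i + al n (2*i-1)) * p + pv i * (p * q + a)) +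
        (qv n i - 1) * (q - t) * (pv i * p)) = p*(L - SL - aL) + (p*q + a)*(SL - PL) + (q-t)*p*(SL - PL)" .
    show ?thesis
      unfolding ham_partial_q[OF m] k0 bL_def[symmetric] bU_def[symmetric]
      unfolding q_def[symmetric] p_def[symmetric] a_def[symmetric] e_def[symmetric] t_def[symmetric] 1 2 ..
  qed
  also have "\<dots> = (t - 1) * (p*q*((R + PL + p) + (R + PL)) + p*(bL + aL) + a*(R + PL + p) + (Y - R)*p)"
    by (rule flow_p_identity[OF Y R b])
  finally have "- (t * ddt n p) = p*q*((R + PL + p) + (R + PL)) + p*(bL + aL) + a*(R + PL + p) + (Y - R)*p"
    by (simp only: mult_left_cancel[OF t1])
  then have "t * ddt n p = - (p*q*((R + PL + p) + (R + PL)) + p*(bL + aL) + a*(R + PL + p) + (Y - R)*p)"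
    by (metis add.inverse_inverse)
  then show ?P
    unfolding le le' cu ga by (simp only: p_def q_def t_def a_def)
qed

text \<open>The terms containing x_{2m-3} cancel between the two flows, which leaves the quantities
  occurring in \<open>ddt_qp\<close>.\<close>

lemma ddt_p_flow:
  assumes m: "1 \<le> m" "m \<le> n"
  shows "tv * ddt n (pv m) = (lat_flow n (2 * int m) - lat_flow n (2 * int m - 2) :: 'k::field_char_0 ratfun)"
proof -
  define r s q q' p a b e Y g :: "'k ratfun" where "r = lat n (2 * int m)" and "s = lat n (2 * int m - 2)"
    and "q = lat n (2 * int m - 1)" and "q' = lat n (2 * int m - 3)" and "p = pv m" and "a = par n (2 * int m - 1)"
    and "b = par n (2 * int m - 2)" and "e = cumul n (2 * int m - 2)" and "Y = lat_src_sum n (2 * int m - 2)"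
    and "g = lat_gauge n"
  have k: "2 * int m = 2 * int m - 2 + 2" "2 * int m - 1 = 2 * int m - 2 + 1" "2 * int m = 2 * int m - 1 + 1" by simp_all
  have Y': "lat_src_sum n (2 * int m) = Y + (s^2 * (q - q') + b * s)"
  proof -
    have "lat_src_sum n (2 * int m) = Y + lat_src n (2 * int m - 2)"
      unfolding Y_def by (subst k(1)) (rule lat_src_sum_step)
    moreover have "2 * int m - 2 + 1 = 2 * int m - 1" "2 * int m - 2 - 1 = 2 * int m - 3" by simp_all
    ultimately show ?thesis by (simp only: lat_src_def s_def q_def q'_def b_def)
  qed
  have e1: "cumul n (2 * int m - 1) = e + b"
    unfolding e_def b_def by (subst k(2)) (rule cumul_step)
  have e2: "cumul n (2 * int m) = e + b + a"
    unfolding a_def e1[symmetric] by (subst k(3)) (rule cumul_step)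
  have r: "r = s + p" using lat_diff[OF m, where ?'k = 'k] by (simp add: r_def s_def p_def algebra_simps)
  have q: "qv n m = q" using m by (simp add: q_def lat_odd)
  have a: "al n (2*m-1) = a" using m by (simp add: a_def par_odd)
  have f1: "lat_flow n (2 * int m) = Y + (s^2 * (q - q') + b * s) - r^2 * q - r * (e + b + a) - g * r"
    unfolding lat_flow_def Y' e2 by (simp add: alt_def r_def q_def g_def)
  have f2: "lat_flow n (2 * int m - 2) = Y - s^2 * q' - s * e - g * s"
  proof -
    have "2 * int m - 2 - 1 = 2 * int m - 3" by simp
    then show ?thesis unfolding lat_flow_def by (simp add: alt_def s_def q'_def e_def Y_def g_def)
  qed
  show ?thesis
    unfolding ddt_qp(2)[OF m] e1 q a f1 f2
    unfolding r_def[symmetric] s_def[symmetric] p_def[symmetric] g_def[symmetric] r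
    by (simp add: algebra_simps power2_eq_square)
qed

text \<open>R_0 is not one of the canonical coordinates. Its derivative is obtained by
  differentiating eta = (t - 1) R_0 - sum (q_j - t) p_j and using D(eta) = 0.\<close>

lemma ddt_lat_0: "tv * ddt n (lat n 0) = (lat_flow n 0 :: 'k::field_char_0 ratfun)"
proof -
  note ds = derivation_simps[OF derivation_ddt]
  let ?F = "lat_flow n :: int \<Rightarrow> 'k ratfun"
  define t R0 Rn qn Y0 Y1 Yn e b a :: "'k ratfun" where "t = tv" and "R0 = lat n 0" and "Rn = lat n (2 * int n)"
    and "qn = lat n (2 * int n - 1)" and "Y0 = lat_src_sum n 0" and "Y1 = lat_src_sum n 1"
    and "Yn = lat_src_sum n (2 * int n)" and "e = cumul n (2 * int n)" and "b = par n (2 * int n)" and "a = par n (- 1)"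
  have t: "t \<noteq> 0" "t - 1 \<noteq> 0" by (simp_all add: t_def)
  have F0: "?F 0 = Y0 - R0 * Y1"
    by (simp add: lat_flow_def alt_def R0_def Y0_def Y1_def lat_gauge_def algebra_simps power2_eq_square)
  have Fn: "?F (2 * int n) = Yn - Rn^2 * qn - Rn * e - (Y1 - R0) * Rn"
    by (simp add: lat_flow_def alt_def R0_def Rn_def qn_def Yn_def e_def Y1_def lat_gauge_def algebra_simps)
  have Y0: "Y0 = t * (Yn + (Rn^2 * (t - qn) + b * Rn))"
  proof -
    have "lat_src_sum n (2 * int n + 2) = Yn + lat_src n (2 * int n)" unfolding Yn_def by (rule lat_src_sum_step)
    moreover have "lat n (2 * int n + 1) = t"
      using lat_odd[of "n + 1" n, where ?'a = 'k] by (simp add: qv_def t_def algebra_simps)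
    moreover have "lat_src_sum n (0 + per n) = qfac 0 * Y0" unfolding Y0_def by (rule lat_src_sum_shift)
    ultimately have "Y0 / t = Yn + (Rn^2 * (t - qn) + b * Rn)"
      by (simp add: qfac_def t_def lat_src_def Rn_def qn_def b_def)
    then show ?thesis using t(1) by (simp add: field_simps)
  qed
  have lm2: "lat n (- 2) = t * Rn"
  proof -
    have "lat n (- 2 + per n) = qfac (- 2) * (lat n (- 2) :: 'k ratfun)" by (rule lat_shift)
    then show ?thesis by (simp add: qfac_def t_def Rn_def)
  qed
  have Y1': "lat_src_sum n (2 * int n + 1) = t * (Y1 - (R0 - t * Rn + a))"
  proof -
    have "lat_src_sum n (- 1 + 2) = lat_src_sum n (- 1) + (lat_src n (- 1) :: 'k ratfun)" by (rule lat_src_sum_step)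
    moreover have "lat_src n (- 1) = R0 - t * Rn + a" by (simp add: lat_src_def lm2 R0_def a_def)
    ultimately have 1: "lat_src_sum n (- 1) = Y1 - (R0 - t * Rn + a)" by (simp add: Y1_def)
    have "2 * int n + 1 = - 1 + per n" by simp
    then show ?thesis by (simp only: lat_src_sum_shift 1) (simp add: qfac_def t_def)
  qed
  have b: "b = 1 - e - a"
  proof -
    have "per n = 2 * int n + 1 + 1" by simp
    then have "cumul n (per n) = e + b + par n (2 * int n + 1)" unfolding e_def b_def by (simp only: cumul_step)
    moreover have "a = par n (- 1 + per n)" unfolding a_def by (simp only: par_shift)
    then have "a = par n (2 * int n + 1)" by (simp add: algebra_simps)
    ultimately show ?thesis unfolding cumul_per by (simp add: algebra_simps)
  qed
  \<comment> \<open>The flow of the product q_j p_j is a difference of consecutive values of -x_{2j}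
    Y(2j+1), where Y is \<open>lat_src_sum n\<close>, so the sum over j telescopes.\<close>
  have tm: "?F (2 * int j - 1) * pv j + qv n j * (?F (2 * int j) - ?F (2 * int j - 2)) =
      - (lat n (2 * int j) * lat_src_sum n (2 * int j + 1) - lat n (2 * int (j - 1)) * lat_src_sum n (2 * int (j - 1) + 1))"
    if j: "1 \<le> j" "j \<le> n" for j
  proof -
    have i1: "2 * int (j - 1) = 2 * int j - 2" "2 * int j - 2 + 1 = 2 * int j - 1" "2 * int j - 1 - 1 = 2 * int j - 2"
      "2 * int j + 1 = 2 * int j - 1 + 2" using j by simp_all
    have "lat n (2 * int j) = lat n (2 * int j - 2) + (pv j :: 'k ratfun)"
      using lat_diff[OF j, where ?'k = 'k] by (simp add: algebra_simps)
    moreover have "lat_src_sum n (2 * int j + 1) = lat_src_sum n (2 * int j - 1) + (qv n j ^ 2 * pv j + al n (2*j-1) * qv n j :: 'k ratfun)"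
      unfolding i1(4) lat_src_sum_step lat_src_odd[OF j] ..
    moreover have "lat n (2 * int j - 1) = (qv n j :: 'k ratfun)" using j by (simp add: lat_odd)
    moreover have "alt (2 * int j - 1) = (1 :: 'k ratfun)" by (simp add: alt_def)
    ultimately show ?thesis
      unfolding ddt_p_flow[OF j, symmetric] ddt_qp(2)[OF j] i1(1,2) lat_flow_def[of n "2 * int j - 1"] i1(3)
      by (simp add: algebra_simps power2_eq_square)
  qed
  have "etav = lat n 0 * (tv - 1) - (\<Sum>j=1..n. (qv n j - tv) * (pv j :: 'k ratfun))"
    by (simp add: lat_0 Phi_def)
  then have "ddt n etav = ddt n (lat n 0 * (tv - 1) - (\<Sum>j=1..n. (qv n j - tv) * (pv j :: 'k ratfun)))"
    by (rule arg_cong)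
  also have "\<dots> = ddt n (lat n 0) * (tv - 1) + lat n 0 - (\<Sum>j=1..n. (ddt n (qv n j) - 1) * pv j + (qv n j - tv) * ddt n (pv j))"
    by (simp add: ds ddt_simps)
  finally have "ddt n (lat n 0) * (tv - 1) = (\<Sum>j=1..n. (ddt n (qv n j) - 1) * pv j + (qv n j - tv) * ddt n (pv j)) - (lat n 0 :: 'k ratfun)"
    by (simp add: ddt_simps algebra_simps)
  then have "(t - 1) * (t * ddt n (lat n 0)) =
     t * (\<Sum>j=1..n. (ddt n (qv n j) - 1) * pv j + (qv n j - tv) * ddt n (pv j)) - t * R0"
  proof -
    have "(t - 1) * (t * A) = t * S - t * R0" if "A * (t - 1) = S - R0" for A S
    proof -
      have "(t - 1) * (t * A) = t * (A * (t - 1))" by (simp only: mult_ac)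
      then show ?thesis unfolding that by (simp only: right_diff_distrib)
    qed
    then show ?thesis using \<open>ddt n (lat n 0) * (tv - 1) = _\<close> unfolding t_def R0_def by blast
  qed
  also have "t * (\<Sum>j=1..n. (ddt n (qv n j) - 1) * pv j + (qv n j - tv) * ddt n (pv j)) =
     (\<Sum>j=1..n. (?F (2 * int j - 1) * pv j + qv n j * (?F (2 * int j) - ?F (2 * int j - 2)))
       - t * pv j - t * (?F (2 * int j) - ?F (2 * int j - 2)))"
    unfolding sum_distrib_left
  proof (intro sum.cong HOL.refl)
    fix j assume "j \<in> {1..n}"
    then have j: "1 \<le> j" "j \<le> n" by auto
    show "t * ((ddt n (qv n j) - 1) * pv j + (qv n j - tv) * ddt n (pv j)) =
      (?F (2 * int j - 1) * pv j + qv n j * (?F (2 * int j) - ?F (2 * int j - 2)))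
       - t * pv j - t * (?F (2 * int j) - ?F (2 * int j - 2))"
      unfolding ddt_qp(1)[OF j, symmetric] ddt_p_flow[OF j, symmetric] by (simp add: t_def algebra_simps)
  qed
  also have "\<dots> = (\<Sum>j=1..n. ?F (2 * int j - 1) * pv j + qv n j * (?F (2 * int j) - ?F (2 * int j - 2)))
       - t * (\<Sum>j=1..n. pv j) - t * (\<Sum>j=1..n. ?F (2 * int j) - ?F (2 * int j - 2))"
    by (simp only: sum_subtractf[symmetric] sum_distrib_left)
  also have "(\<Sum>j=1..n. ?F (2 * int j - 1) * pv j + qv n j * (?F (2 * int j) - ?F (2 * int j - 2))) =
     - (\<Sum>j=1..n. lat n (2 * int j) * lat_src_sum n (2 * int j + 1) - lat n (2 * int (j - 1)) * lat_src_sum n (2 * int (j - 1) + 1))"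
    unfolding sum_negf[symmetric] by (intro sum.cong tm) auto
  also have "(\<Sum>j=1..n. lat n (2 * int j) * lat_src_sum n (2 * int j + 1) - lat n (2 * int (j - 1)) * lat_src_sum n (2 * int (j - 1) + 1)) =
     Rn * lat_src_sum n (2 * int n + 1) - R0 * Y1"
    using sum_telescope[of "\<lambda>j. lat n (2 * int j) * lat_src_sum n (2 * int j + 1) :: 'k ratfun" n]
    by (simp add: Rn_def R0_def Y1_def)
  also have "(\<Sum>j=1..n. pv j) = Rn - R0"
    by (simp add: Rn_def R0_def lat_even lat_0)
  also have "(\<Sum>j=1..n. ?F (2 * int j) - ?F (2 * int j - 2)) = ?F (2 * int n) - ?F 0"
  proof -
    have "(\<Sum>j=1..n. ?F (2 * int j) - ?F (2 * int j - 2)) = (\<Sum>j=1..n. ?F (2 * int j) - ?F (2 * int (j - 1)))"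
      by (intro sum.cong HOL.refl) (auto simp: of_nat_diff algebra_simps)
    then show ?thesis using sum_telescope[of "\<lambda>j. ?F (2 * int j)" n] by simp
  qed
  also have "- (Rn * lat_src_sum n (2 * int n + 1) - R0 * Y1) - t * (Rn - R0) - t * (?F (2 * int n) - ?F 0) - t * R0 = (t - 1) * ?F 0"
    unfolding Y1' F0 Fn Y0 b by (simp add: algebra_simps power2_eq_square)
  finally show ?thesis using t(2) by (simp add: t_def)
qed

lemma ddt_qfac: "tv * ddt n (qfac k) = alt k * qfac k"
  by (simp add: qfac_def alt_def ddt_simps derivation_simps[OF derivation_ddt] power2_eq_square)

text \<open>The extra term comes from the growth of \<open>cumul\<close> by 1 per period. It is
  exactly the derivative of the multiplier, see \<open>ddt_qfac\<close>.\<close>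

lemma lat_flow_shift:
  "lat_flow n (k + per n) = qfac k * (lat_flow n k + alt k * (lat n k :: 'k::field_char_0 ratfun))"
proof -
  have "alt (k + per n) = (alt k :: 'k ratfun)" by (simp add: alt_def)
  moreover have "a * (- (q * Y) + (q * x)^2 * (y / q) + (q * x) * (e + 1) + g * (q * x)) =
     q * (a * (- Y + x^2 * y + x * e + g * x) + a * x)" if "q \<noteq> 0" for a q Y x y e g :: "'k ratfun"
    using that by (simp add: power2_eq_square algebra_simps)
  ultimately show ?thesis
    unfolding lat_flow_def lat_src_sum_shift lat_shift lat_near_shift cumul_shift by simp
qed

text \<open>The extra terms from the multiplier cancel in the defect between both sides, which is
  therefore quasi-periodic. It vanishes on the window, where the equations of motion are
  known.\<close>

lemma ddt_lat: "tv * ddt n (lat n k) = (lat_flow n k :: 'k::field_char_0 ratfun)"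
proof -
  note ds = derivation_simps[OF derivation_ddt]
  have "tv * ddt n (lat n k) - lat_flow n k = (0 :: 'k ratfun)"
  proof (rule quasi_periodic_eqI[where \<tau> = qfac and n = n and B = "\<lambda>_. 0"])
    fix k
    have "tv * ddt n (lat n (k + per n)) = tv * ddt n (qfac k) * lat n k + qfac k * (tv * ddt n (lat n k :: 'k ratfun))"
      unfolding lat_shift by (simp add: ds algebra_simps)
    then show "tv * ddt n (lat n (k + per n)) - lat_flow n (k + per n) = qfac k * (tv * ddt n (lat n k) - lat_flow n k :: 'k ratfun)"
      unfolding ddt_qfac lat_flow_shift by (simp add: algebra_simps)
  next
    fix r :: int
    assume "- 1 \<le> r" "r \<le> 2 * int n"
    then show "tv * ddt n (lat n r) - lat_flow n r = (0 :: 'k ratfun)"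
    proof (cases rule: base_cases)
      case (1 i)
      show ?thesis
      proof (cases "i = 0")
        case True
        have "lat_src_sum n (- 1 + 2) = lat_src_sum n (- 1) + (lat_src n (- 1) :: 'k ratfun)" by (rule lat_src_sum_step)
        moreover have "cumul n (- 1 + 1) = cumul n (- 1) + (par n (- 1) :: 'k ratfun)" by (rule cumul_step)
        ultimately have "lat_flow n (- 1) = (0 :: 'k ratfun)"
          by (simp add: lat_flow_def alt_def lat_gauge_def lat_src_def eq_neg_iff_add_eq_0 algebra_simps)
        then show ?thesis using 1 True by (simp add: ds)
      next
        case False
        then show ?thesis using 1 ddt_qp(1)[of i n, where ?'k = 'k] by (simp add: lat_odd)
      qed
    next
      case (2 i)
      have "lat n r = lat n 0 + (\<Sum>j=1..i. pv j :: 'k ratfun)" using 2 by (simp add: lat_even lat_0)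
      then have "tv * ddt n (lat n r) = tv * ddt n (lat n 0) + (\<Sum>j=1..i. tv * ddt n (pv j :: 'k ratfun))"
        using 2 by (simp add: ds distrib_left sum_distrib_left)
      also have "(\<Sum>j=1..i. tv * ddt n (pv j)) = (\<Sum>j=1..i. lat_flow n (2 * int j) - lat_flow n (2 * int (j - 1)) :: 'k ratfun)"
      proof (intro sum.cong HOL.refl)
        fix j assume "j \<in> {1..i}"
        then have j: "1 \<le> j" "j \<le> n" "2 * int (j - 1) = 2 * int j - 2" using 2 by auto
        show "tv * ddt n (pv j) = (lat_flow n (2 * int j) - lat_flow n (2 * int (j - 1)) :: 'k ratfun)"
          unfolding j(3) by (rule ddt_p_flow[OF j(1,2)])
      qed
      also have "\<dots> = lat_flow n (2 * int i) - lat_flow n 0"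
        using sum_telescope[of "\<lambda>j. lat_flow n (2 * int j) :: 'k ratfun" i] by simp
      finally show ?thesis using 2 by (simp add: ddt_lat_0)
    qed
  qed simp_all
  then show ?thesis by simp
qed

section \<open>Invariance of the vector field\<close>

lemma ddt_in [simp]: "f \<in> ratfield n \<Longrightarrow> ddt n f \<in> ratfield n"
  by (rule derivation_in[OF derivation_ddt])

text \<open>The coordinates p_j are differences of lattice terms and the q_j are lattice terms, so
  the window together with t, eta and the parameters is enough. The factor \<open>c\<close> is 1 for
  r_0 and -t^2 for the rotation.\<close>

lemma commutes_ddt:
  fixes \<phi> :: "'k::field_char_0 ratfun \<Rightarrow> 'k ratfun"
  assumes \<phi>: "kend n \<phi>"
    and lat: "\<And>k. - 1 \<le> k \<Longrightarrow> k \<le> 2 * int n \<Longrightarrow> \<phi> (ddt n (lat n k)) = c * ddt n (\<phi> (lat n k))"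
    and t: "c * ddt n (\<phi> tv) = 1" and eta: "ddt n (\<phi> etav) = 0"
    and al: "\<And>j. 1 \<le> j \<Longrightarrow> j \<le> 2*n+1 \<Longrightarrow> ddt n (\<phi> (al n j)) = 0"
    and f: "f \<in> ratfield n"
  shows "\<phi> (ddt n f) = c * ddt n (\<phi> f)"
  using f
proof (induction rule: ratfield_induct)
  note ph = kend_simps[OF \<phi>] and ds = derivation_simps[OF derivation_ddt]
  case (Const a)
  show ?case by (simp add: ph ds)
next
  note ph = kend_simps[OF \<phi>] and ds = derivation_simps[OF derivation_ddt]
  case (Var x)
  then show ?case
  proof (cases rule: vars_cases)
    case (VQ j)
    then show ?thesis using lat[of "2 * int j - 1"] by (simp add: lat_odd qv_Var)
  next
    case (VP j)
    have "Var x = lat n (2 * int j) - (lat n (2 * int j - 2) :: 'k ratfun)" using VP by (simp add: lat_diff)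
    then show ?thesis using VP lat[of "2 * int j"] lat[of "2 * int j - 2"] by (simp add: ph ds right_diff_distrib)
  next
    case VT
    then show ?thesis by (simp add: ddt_simps ph t)
  next
    case VEta
    then show ?thesis by (simp add: ddt_simps ph eta)
  next
    case (VAlpha j)
    have "ddt n (al n j) = (0 :: 'k ratfun)" using VAlpha by (intro ddt_simps) simp
    then show ?thesis using VAlpha al[of j] by (simp add: ph al_Var)
  qed
next
  note ph = kend_simps[OF \<phi>] and ds = derivation_simps[OF derivation_ddt]
  case (add f g)
  then show ?case by (simp add: ph ds distrib_left)
next
  note ph = kend_simps[OF \<phi>] and ds = derivation_simps[OF derivation_ddt]
  case (mult f g)
  then show ?case by (simp add: ph ds distrib_left mult_ac)
next
  note ph = kend_simps[OF \<phi>] and ds = derivation_simps[OF derivation_ddt]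
  case (inverse f)
  moreover have "\<phi> f \<noteq> 0" using inverse by (simp add: ph)
  ultimately show ?case
    by (simp add: derivation_inverse[OF derivation_ddt] ph)
qed

text \<open>The partial sums are shifted; subtracting \<alpha>_0 restores the normalization at
  0.\<close>

lemma rotation_cumul: "rotation n (cumul n k) = cumul n (k + 1) - (par n 0 :: 'k::field_char_0 ratfun)"
proof (induction k rule: int_induct[where k = 0])
  case base
  then show ?case by (simp add: kend_0[OF kend_rotation] cumul_1)
next
  case (step1 i)
  have "i + 1 + 1 = (i + 1) + 1" by simp
  have "rotation n (cumul n (i + 1)) = rotation n (cumul n i) + (par n (i + 1) :: 'k ratfun)"
    unfolding cumul_step by (simp add: kend_add[OF kend_rotation] rotation_par)
  then show ?case using step1 cumul_step[of n "i + 1", where ?'a = 'k] by simp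
next
  case (step2 i)
  have "cumul n i = cumul n (i - 1) + (par n (i - 1) :: 'k ratfun)" using cumul_step[of n "i - 1", where ?'a = 'k] by simp
  then have "rotation n (cumul n i) = rotation n (cumul n (i - 1)) + (par n i :: 'k ratfun)"
    by (simp add: kend_add[OF kend_rotation] rotation_par)
  moreover have "cumul n (i - 1 + 1 + 1) = cumul n (i - 1 + 1) + (par n i :: 'k ratfun)"
    using cumul_step[of n i, where ?'a = 'k] by simp
  ultimately show ?case using step2 by (simp add: algebra_simps)
qed

text \<open>The square of x_k meets a difference of neighbours with the inverse factor, so the
  source term scales under gauge just as x_k does.\<close>

lemma rotation_lat_src:
  assumes "1 \<le> n"
  shows "rotation n (lat_src n k) = gfac (1 / lat n 0) k * (lat_src n (k + 1) :: 'k::field_char_0 ratfun)"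
proof -
  note rot = kend_simps[OF kend_rotation]
  define h where "h = gfac (1 / lat n 0 :: 'k ratfun) k"
  have h: "h \<noteq> 0" by (simp add: h_def)
  have "rotation n (lat_src n k) = (h * lat n (k + 1))^2 * (inverse h * lat n (k + 1 + 1) - inverse h * lat n (k - 1 + 1))
     + par n (k + 1) * (h * lat n (k + 1))"
    by (simp add: lat_src_def rot rotation_lat[OF assms] rotation_par h_def del: diff_add_cancel)
  also have "\<dots> = h * (lat n (k + 1)^2 * (lat n (k + 1 + 1) - lat n (k + 1 - 1)) + par n (k + 1) * lat n (k + 1))"
  proof -
    have "inverse h * y - inverse h * z = inverse h * (y - z)" for y z by (simp only: right_diff_distrib)
    moreover have "(h * x)^2 * (inverse h * w) + a * (h * x) = h * (x^2 * w + a * x)" for x w a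
      using h by (simp add: power2_eq_square distrib_left)
    ultimately show ?thesis by simp
  qed
  finally show ?thesis unfolding lat_src_def[of n "k + 1"] by (simp only: h_def)
qed

lemma rotation_lat_src_sum:
  assumes "1 \<le> n"
  shows "rotation n (lat_src_sum n k) = gfac (1 / lat n 0) k * (lat_src_sum n (k + 1) :: 'k::field_char_0 ratfun)"
proof -
  note rot = kend_simps[OF kend_rotation]
  have g: "gfac g (k + 2 * int j) = gfac g k" for g :: "'k ratfun" and j by (simp add: gfac_def)
  have e: "k + 2 * int j + 1 = k + 1 + 2 * int j" for j by simp
  have "rotation n (lat_src_sum n k) = (\<Sum>j=0..n. rotation n (lat_src n (k + 2 * int j))) / (1 / qfac k - 1 :: 'k ratfun)"
    by (simp add: lat_src_sum_def rot rotation_qfac)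
  then have "rotation n (lat_src_sum n k) = (\<Sum>j=0..n. gfac (1 / lat n 0) k * lat_src n (k + 1 + 2 * int j)) / (1 / qfac k - 1 :: 'k ratfun)"
    by (simp only: rotation_lat_src[OF assms] g e)
  then show ?thesis by (simp add: lat_src_sum_def sum_distrib_left)
qed

lemma ddt_gfac:
  assumes "h \<in> ratfield n" "h \<noteq> 0"
  shows "ddt n (gfac h k) = alt k * gfac h k * (ddt n h / h)"
  using assms by (simp add: gfac_def alt_def derivation_inverse[OF derivation_ddt])
    (simp add: power2_eq_square field_simps)

lemma alt_in [simp]: "alt k \<in> ratfield n"
  by (simp add: alt_def)

text \<open>Both sides agree up to a multiple of the alternating gauge term, with a coefficient
  \<open>C\<close> that does not depend on k. It collects the gauge functions, the renormalization
  of \<open>cumul\<close> and the logarithmic derivative of the gauge factor. Since x_{-1} = 1 has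
  derivative 0, the index -1 gives C = 0.\<close>

lemma rotation_ddt_lat:
  assumes n: "1 \<le> n"
  shows "rotation n (ddt n (lat n k)) = - (tv ^ 2) * ddt n (rotation n (lat n k) :: 'k::field_char_0 ratfun)"
proof -
  note rot = kend_simps[OF kend_rotation] and ds = derivation_simps[OF derivation_ddt]
  define h :: "'k ratfun" where "h = 1 / lat n 0"
  have h: "h \<in> ratfield n" "h \<noteq> 0" by (simp_all add: h_def)
  note rl = rotation_lat[OF n, where ?'k = 'k, folded h_def]
  define g g' :: "'k ratfun" where "g = lat_gauge n" and "g' = rotation n (lat_gauge n)"
  define C where "C = tv * (g' - par n 0) - tv * g + tv ^ 2 * (ddt n h / h)"
  have main: "rotation n (ddt n (lat n k)) + tv ^ 2 * ddt n (rotation n (lat n k)) =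
      gfac h k * alt k * lat n (k + 1) * C" for k
  proof -
    define G X Y Z e a :: "'k ratfun" where "G = gfac h k" and "X = lat n (k + 1)" and "Y = lat_src_sum n (k + 1)"
      and "Z = lat n k" and "e = cumul n (k + 1)" and "a = alt k"
    have G: "G \<noteq> 0" using h by (simp add: G_def)
    have "rotation n (tv * ddt n (lat n k)) = rotation n (lat_flow n k)" by (simp add: ddt_lat)
    then have "1 / tv * rotation n (ddt n (lat n k)) = rotation n (lat_flow n k)"
      by (simp add: rot rotation_simps)
    then have 1: "rotation n (ddt n (lat n k)) = tv * rotation n (lat_flow n k)"
      by (simp add: field_simps)
    have "rotation n (alt k) = (alt k :: 'k ratfun)" by (simp add: alt_def rot)
    moreover have "rotation n (lat n (k - 1)) = inverse G * Z"
      using rl[of "k - 1"] by (simp add: G_def Z_def)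
    ultimately have "rotation n (lat_flow n k) = a * (- (G * Y) + (G * X)^2 * (inverse G * Z) + G * X * (e - par n 0) + g' * (G * X))"
      unfolding lat_flow_def
      by (simp add: rot rl rotation_lat_src_sum[OF n, where ?'k = 'k, folded h_def] rotation_cumul G_def X_def Y_def e_def a_def g'_def)
    also have "\<dots> = G * (a * (- Y + X^2 * Z + X * e) + a * (g' - par n 0) * X)"
      using G by (simp add: power2_eq_square algebra_simps)
    finally have 2: "rotation n (lat_flow n k) = G * (a * (- Y + X^2 * Z + X * e) + a * (g' - par n 0) * X)" .
    have "ddt n (rotation n (lat n k)) = a * G * (ddt n h / h) * X + G * ddt n X"
      unfolding rl using h by (simp add: ds ddt_gfac a_def G_def X_def)
    then have "tv ^ 2 * ddt n (rotation n (lat n k)) = tv ^ 2 * (a * G * (ddt n h / h) * X) + tv * G * (tv * ddt n X)"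
      by (simp add: power2_eq_square algebra_simps)
    also have "tv * ddt n X = - a * (- Y + X^2 * Z + X * e + g * X)"
    proof -
      have "alt (k + 1) = - a" by (simp add: alt_def a_def)
      then show ?thesis unfolding X_def ddt_lat lat_flow_def[of n "k + 1"] by (simp add: X_def Y_def Z_def e_def g_def)
    qed
    finally show ?thesis
      unfolding 1 2 C_def G_def[symmetric] a_def[symmetric] X_def[symmetric]
      by (simp add: algebra_simps)
  qed
  have "C = 0"
    using main[of "- 1"] h by (simp add: gfac_def alt_def rot ds h_def)
  then have "rotation n (ddt n (lat n k)) + tv ^ 2 * ddt n (rotation n (lat n k) :: 'k ratfun) = 0"
    using main[of k] by simp
  then show ?thesis by (simp add: eq_neg_iff_add_eq_0)
qed

lemma rotation_ddt:
  assumes "1 \<le> n" "f \<in> ratfield n"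
  shows "rotation n (ddt n f) = - (tv ^ 2) * ddt n (rotation n f)"
proof (rule commutes_ddt[OF kend_rotation rotation_ddt_lat[OF assms(1)] _ _ _ assms(2)])
  note ds = derivation_simps[OF derivation_ddt]
  show "- (tv ^ 2) * ddt n (rotation n tv) = (1 :: 'a ratfun)"
    by (simp add: rotation_simps ds ddt_simps)
  show "ddt n (rotation n etav) = (0 :: 'a ratfun)"
    by (simp add: rotation_simps ds ddt_simps)
  show "ddt n (rotation n (al n j)) = (0 :: 'a ratfun)" if "1 \<le> j" "j \<le> 2*n+1" for j
    using that by (simp add: al_Var rotation_simps ddt_simps)
qed

section \<open>Invariance under the reflection of index zero\<close>

lemma reflection_0_fixed:
  assumes n: "1 \<le> n" and k: "- 2 \<le> k" "k \<le> 2 * int n + 1" "k \<noteq> 0"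
  shows "reflection n 0 (lat n k) = (lat n k :: 'k::field_char_0 ratfun)"
proof -
  have "\<not> per n dvd k"
    using dvd_small_cases[of "per n" k] k n by auto
  then show ?thesis using reflection_0_lat[OF n, of k, where ?'k = 'k] by (simp add: refl_seq_def)
qed

lemma reflection_0_lat_0:
  assumes n: "1 \<le> n"
  shows "reflection n 0 (lat n 0) = (lat n 0 + par n 0 / (qv n 1 - 1) :: 'k::field_char_0 ratfun)"
  using reflection_0_lat[OF n, of 0, where ?'k = 'k] lat_odd[of 1 n, where ?'a = 'k] n
  by (simp add: refl_seq_def)

text \<open>At multiples of the period the source term is f x (x + \<alpha>/f) with f = x_{k+1} -
  x_{k-1}; r_0 fixes f and exchanges the factors x and x + \<alpha>/f. At other even indices none of
  the ingredients moves.\<close>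

lemma reflection_0_lat_src_even:
  assumes n: "1 \<le> n" and "even k"
  shows "reflection n 0 (lat_src n k) = (lat_src n k :: 'k::field_char_0 ratfun)"
proof -
  note r0 = kend_simps[OF kend_reflection_0[OF n]]
  have odd: "\<not> per n dvd k + 1" "\<not> per n dvd k - 1" "\<not> per n dvd 1 + k"
  proof -
    have "2 dvd per n" by simp
    moreover have "\<not> 2 dvd k + 1" "\<not> 2 dvd k - 1" "\<not> 2 dvd 1 + k" using assms(2) by simp_all
    ultimately show "\<not> per n dvd k + 1" "\<not> per n dvd k - 1" "\<not> per n dvd 1 + k"
      using dvd_trans[of 2 "per n"] by blast+
  qed
  have eq: "reflection n 0 (lat_src n k) = refl_seq (per n) 0 (par n) (lat n) k ^ 2 * (lat n (k + 1) - lat n (k - 1)) +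
      refl_par (per n) 0 (par n) k * (refl_seq (per n) 0 (par n) (lat n) k :: 'k ratfun)"
    using odd by (simp add: lat_src_def r0 reflection_0_lat[OF n] reflection_0_par[OF n])
      (simp add: refl_seq_def)
  show ?thesis
  proof (cases "per n dvd k")
    case True
    then have "par n k = (par n 0 :: 'k ratfun)" by (simp add: par_def)
    moreover have "coupling (per n) k = 2" using True by (simp add: coupling_def)
    ultimately have "refl_par (per n) 0 (par n) k = - (par n k :: 'k ratfun)" by (simp add: refl_par_def)
    moreover define f where "f = lat n (k + 1) - (lat n (k - 1) :: 'k ratfun)"
    moreover have "f \<noteq> 0" unfolding f_def by (rule lat_diff_nonzero[OF n])
    moreover have "(x + a / f)^2 * f + - a * (x + a / f) = x^2 * f + a * x" if "f \<noteq> 0" for x a f :: "'k ratfun"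
      using that by (simp add: field_simps power2_eq_square)
    ultimately show ?thesis using True unfolding eq by (simp add: refl_seq_def lat_src_def)
  next
    case False
    have "coupling (per n) k = 0" using False odd by (simp add: coupling_def)
    then show ?thesis using False unfolding eq by (simp add: refl_seq_def refl_par_def lat_src_def)
  qed
qed

lemma reflection_0_lat_src_sum_even:
  assumes n: "1 \<le> n" and "even k"
  shows "reflection n 0 (lat_src_sum n k) = (lat_src_sum n k :: 'k::field_char_0 ratfun)"
proof -
  note r0 = kend_simps[OF kend_reflection_0[OF n]]
  have "reflection n 0 (qfac k) = (qfac k :: 'k ratfun)"
    using n by (simp add: qfac_def r0 reflection_0_simps)
  then show ?thesis using assms by (simp add: lat_src_sum_def r0 reflection_0_lat_src_even)
qed

lemma reflection_0_par_small:
  assumes n: "1 \<le> n"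
  shows "reflection n 0 (par n 0) = (- par n 0 :: 'k::field_char_0 ratfun)"
    "reflection n 0 (par n 1) = (par n 1 + par n 0 :: 'k ratfun)"
    "reflection n 0 (par n (- 1)) = (par n (- 1) + par n 0 :: 'k ratfun)"
    "2 \<le> k \<Longrightarrow> k \<le> 2 * int n \<Longrightarrow> reflection n 0 (par n k) = (par n k :: 'k ratfun)"
proof -
  have N: "3 \<le> per n" using n by simp
  note c = coupling_small[OF N]
  show "reflection n 0 (par n 0) = (- par n 0 :: 'k ratfun)"
    "reflection n 0 (par n 1) = (par n 1 + par n 0 :: 'k ratfun)"
    "reflection n 0 (par n (- 1)) = (par n (- 1) + par n 0 :: 'k ratfun)"
    using c by (simp_all add: reflection_0_par[OF n] refl_par_def)
  assume k: "2 \<le> k" "k \<le> 2 * int n"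
  have "\<not> per n dvd k" "\<not> per n dvd k - 1" "\<not> per n dvd k + 1"
    using dvd_small[of "per n" k] dvd_small[of "per n" "k - 1"] dvd_small[of "per n" "k + 1"] k by auto
  then have "coupling (per n) k = 0" by (simp add: coupling_def)
  then show "reflection n 0 (par n k) = (par n k :: 'k ratfun)"
    by (simp add: reflection_0_par[OF n] refl_par_def)
qed

text \<open>Up to an additive constant r_0 exchanges the partial sums at 0 and 1. The normalization
  at 0 makes this constant -\<alpha>_0.\<close>

lemma reflection_0_cumul:
  assumes n: "1 \<le> n" and k: "- 1 \<le> k" "k \<le> 2 * int n + 1"
  shows "reflection n 0 (cumul n k) =
    (cumul n k - (if k = 0 then 0 else if k = 1 then 2 * par n 0 else par n 0) :: 'k::field_char_0 ratfun)"
proof -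
  note r0 = kend_simps[OF kend_reflection_0[OF n]]
  note ps = reflection_0_par_small[OF n]
  have m: "reflection n 0 (cumul n (int (m + 2))) = (cumul n (int (m + 2)) - par n 0 :: 'k ratfun)"
    if "m + 2 \<le> 2*n+1" for m
    using that
  proof (induction m)
    case 0
    have "cumul n (int (0 + 2)) = (par n 0 + par n 1 :: 'k ratfun)"
      using cumul_step[of n 1, where ?'a = 'k] by (simp add: cumul_1)
    then show ?case by (simp add: r0 ps)
  next
    case (Suc m)
    have e: "int (Suc m + 2) = int (m + 2) + 1" by simp
    have "reflection n 0 (par n (int (m + 2))) = (par n (int (m + 2)) :: 'k ratfun)"
      using Suc by (intro ps(4)) auto
    then show ?case using Suc unfolding e cumul_step by (simp add: r0 del: of_nat_add)
  qed
  have m1: "cumul n (- 1) = (- par n (- 1) :: 'k ratfun)"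
    using cumul_step[of n "- 1", where ?'a = 'k] by (simp add: eq_neg_iff_add_eq_0)
  consider "k = - 1" | "k = 0" | "k = 1" | "2 \<le> k" using k(1) by linarith
  then show ?thesis
  proof cases
    case 1
    then show ?thesis by (simp add: m1 r0 ps)
  next
    case 2
    then show ?thesis by (simp add: r0)
  next
    case 3
    then show ?thesis by (simp add: cumul_1 r0 ps)
  next
    case 4
    define j where "j = nat (k - 2)"
    have kj: "int (j + 2) = k" "j + 2 \<le> 2*n+1" using 4 k by (auto simp: j_def)
    have "k \<noteq> 0" "k \<noteq> 1" using 4 by auto
    then show ?thesis using m[OF kj(2)] unfolding kj(1) by simp
  qed
qed

text \<open>Among the odd indices of a period only -1 and 1 are adjacent to 0. Their source terms
  change by opposite amounts A and -A, so the sums differ from a common defect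
  \<open>U (- 1)\<close> at k = 1 alone.\<close>

lemma reflection_0_lat_src_sum_odd:
  assumes n: "1 \<le> n" and k: "odd k" "- 1 \<le> k" "k \<le> 2 * int n + 1"
  shows "reflection n 0 (lat_src_sum n k) = (lat_src_sum n k +
    (if k = 1 then par n 0 * qv n 1 / (qv n 1 - 1) else 0) :: 'k::field_char_0 ratfun)"
proof -
  note r0 = kend_simps[OF kend_reflection_0[OF n]]
  note ps = reflection_0_par_small[OF n, where ?'k = 'k] and fx = reflection_0_fixed[OF n]
  define q A :: "'k ratfun" where "q = qv n 1" and "A = par n 0 * q / (q - 1)"
  have q: "q - 1 \<noteq> 0" unfolding q_def by (rule q1_neq_1[OF n])
  have l0': "reflection n 0 (lat n 0) = lat n 0 + par n 0 / (q - 1)"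
    unfolding q_def by (rule reflection_0_lat_0[OF n])
  have l1: "lat n 1 = q" using lat_odd[of 1 n, where ?'a = 'k] n by (simp add: q_def)
  have s1: "reflection n 0 (lat_src n 1) = lat_src n 1 - A"
  proof -
    have "lat_src n 1 = q^2 * (lat n 2 - lat n 0) + par n 1 * q" by (simp add: lat_src_def l1)
    moreover have "reflection n 0 q = q" "reflection n 0 (lat n 2) = (lat n 2 :: 'k ratfun)"
      using fx[of 1, where ?'k = 'k] fx[of 2, where ?'k = 'k] n by (simp_all add: l1)
    moreover have "q^2 * (x - (z + a / (q - 1))) + (b + a) * q = q^2 * (x - z) + b * q - a * q / (q - 1)" for x z a b
      using q by (simp add: field_simps power2_eq_square)
    moreover have "q \<in> ratfield n" using n by (simp add: q_def)
    ultimately show ?thesis using l0' by (simp add: r0 ps A_def)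
  qed
  have sm: "reflection n 0 (lat_src n (- 1)) = lat_src n (- 1) + A"
  proof -
    have "lat_src n (- 1) = lat n 0 - lat n (- 2) + (par n (- 1) :: 'k ratfun)" by (simp add: lat_src_def)
    moreover have "reflection n 0 (lat n (- 2)) = (lat n (- 2) :: 'k ratfun)" by (rule fx) auto
    moreover have "a / (q - 1) + a = a * q / (q - 1)" for a using q by (simp add: field_simps)
    ultimately show ?thesis using l0' by (simp add: r0 ps A_def)
  qed
  have sk: "reflection n 0 (lat_src n k) = (lat_src n k :: 'k ratfun)" if "3 \<le> k" "k \<le> 2 * int n - 1" for k
    using that fx[of k, where ?'k = 'k] fx[of "k + 1", where ?'k = 'k] fx[of "k - 1", where ?'k = 'k] ps(4)[of k]
    by (simp add: lat_src_def r0)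
  define U where "U k = reflection n 0 (lat_src_sum n k) - (lat_src_sum n k :: 'k ratfun)" for k
  have step: "U (k + 2) = U k + (reflection n 0 (lat_src n k) - lat_src n k)" for k
    unfolding U_def lat_src_sum_step by (simp add: r0)
  have U1: "U 1 = U (- 1) + A" using step[of "- 1"] by (simp add: sm)
  have Ui: "U (2 * int i + 3) = U (- 1)" if "i + 1 \<le> n" for i
    using that
  proof (induction i)
    case 0
    show ?case using step[of 1] by (simp add: s1 U1)
  next
    case (Suc i)
    have "2 * int (Suc i) + 3 = 2 * int i + 3 + 2" by simp
    then have "U (2 * int (Suc i) + 3) = U (2 * int i + 3 + 2)" by (simp only:)
    also have "\<dots> = U (- 1)" using Suc step[of "2 * int i + 3"] sk[of "2 * int i + 3"] by simp
    finally show ?case .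
  qed
  \<comment> \<open>One period multiplies the common defect by t, but passing through the indices
    leaves it unchanged; hence it is 0.\<close>
  have "U (- 1 + per n) = tv * U (- 1)"
    unfolding U_def lat_src_sum_shift using n by (simp add: qfac_def r0 reflection_0_simps right_diff_distrib)
  moreover have "- 1 + per n = 2 * int (n - 1) + 3" using n by simp
  then have "U (- 1 + per n) = U (- 1)" using Ui[of "n - 1"] n by (simp only: le_add_diff_inverse2 order_refl)
  ultimately have "(tv - 1) * U (- 1) = 0" by (simp add: left_diff_distrib)
  then have Um: "U (- 1) = 0" by simp
  have "U k = (if k = 1 then A else 0)"
  proof -
    consider "k = - 1" | "k = 1" | "3 \<le> k" using k by (auto elim!: oddE) linarith
    then show ?thesis
    proof cases
      case 3
      have "k = 2 * int (nat ((k - 3) div 2)) + 3" using k(1) 3 by (auto elim!: oddE)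
      moreover have "nat ((k - 3) div 2) + 1 \<le> n" using k 3 by linarith
      ultimately have "U k = U (- 1)" using Ui by metis
      then show ?thesis using 3 Um by simp
    qed (simp_all add: Um U1)
  qed
  then have "reflection n 0 (lat_src_sum n k) = lat_src_sum n k + (if k = 1 then A else 0)"
    unfolding U_def by (simp add: diff_eq_eq add.commute)
  then show ?thesis by (simp only: A_def q_def)
qed

text \<open>Away from 0 and 1 the flow could change only by an alternating gauge term, and its
  vanishing at -1 shows that the gauge function grows by \<alpha>_0. The indices 0 and 1, where r_0
  moves x_0 or its use as a neighbour, are computed directly.\<close>

lemma reflection_0_ddt_lat:
  assumes n: "1 \<le> n" and k: "- 1 \<le> k" "k \<le> 2 * int n"
  shows "reflection n 0 (ddt n (lat n k)) = (ddt n (reflection n 0 (lat n k)) :: 'k::field_char_0 ratfun)"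
proof -
  note r0 = kend_simps[OF kend_reflection_0[OF n]] and ds = derivation_simps[OF derivation_ddt]
  note fx = reflection_0_fixed[OF n] and l0 = reflection_0_lat_0[OF n]
  define g g' :: "'k ratfun" where "g = lat_gauge n" and "g' = reflection n 0 (lat_gauge n)"
  have r_alt: "reflection n 0 (alt k) = (alt k :: 'k ratfun)" for k by (simp add: alt_def r0)
  have r_ddt: "tv * reflection n 0 (ddt n (lat n k)) = (reflection n 0 (lat_flow n k) :: 'k ratfun)" for k
    unfolding ddt_lat[symmetric] using n by (simp add: r0 reflection_0_simps)
  have gen: "reflection n 0 (lat_flow n k) = lat_flow n k + alt k * (g' - g - par n 0) * lat n k"
    if k: "- 1 \<le> k" "k \<le> 2 * int n" "k \<noteq> 0" "k \<noteq> 1" for k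
  proof -
    have "reflection n 0 (lat_src_sum n k) = (lat_src_sum n k :: 'k ratfun)"
      using k reflection_0_lat_src_sum_even[OF n, of k, where ?'k = 'k]
        reflection_0_lat_src_sum_odd[OF n, of k, where ?'k = 'k] by (cases "even k") simp_all
    moreover have "reflection n 0 (lat n k) = (lat n k :: 'k ratfun)" "reflection n 0 (lat n (k - 1)) = (lat n (k - 1) :: 'k ratfun)"
      using k by (auto intro!: fx)
    moreover have "reflection n 0 (cumul n k) = cumul n k - (par n 0 :: 'k ratfun)"
      using k reflection_0_cumul[OF n, of k, where ?'k = 'k] by simp
    ultimately have "reflection n 0 (lat_flow n k) = alt k * (- lat_src_sum n k + lat n k ^ 2 * lat n (k - 1)
        + lat n k * (cumul n k - par n 0) + g' * lat n k)"
      by (simp add: lat_flow_def r0 r_alt g'_def)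
    then show ?thesis unfolding lat_flow_def g_def[symmetric] by (simp add: algebra_simps)
  qed
  have "reflection n 0 (lat_flow n (- 1)) = (0 :: 'k ratfun)" "lat_flow n (- 1) = (0 :: 'k ratfun)"
    unfolding ddt_lat[symmetric] by (simp_all add: r0 ds)
  note zero = this
  have g': "g' = g + par n 0"
  proof -
    have "g' - g - par n 0 = 0" using gen[of "- 1"] zero by (simp add: alt_def)
    then show ?thesis by (simp only: diff_diff_eq right_minus_eq)
  qed
  define q X L a :: "'k ratfun" where "q = qv n 1" and "X = par n 0 / (q - 1)" and "L = lat n 0" and "a = par n 0"
  have q: "q - 1 \<noteq> 0" unfolding q_def by (rule q1_neq_1[OF n])
  have aX: "a = X * (q - 1)" using q by (simp add: X_def a_def)
  have l1: "lat n 1 = q" using lat_odd[of 1 n, where ?'a = 'k] n by (simp add: q_def)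
  have rq: "reflection n 0 q = q" using fx[of 1, where ?'k = 'k] n by (simp add: l1)
  have q_in: "q \<in> ratfield n" using n by (simp add: q_def)
  have rL: "reflection n 0 L = L + X" using l0[where ?'k = 'k] by (simp add: L_def X_def q_def)
  have F1: "lat_flow n 1 = - lat_src_sum n 1 + q^2 * L + q * a + g * q"
    by (simp add: lat_flow_def alt_def l1 L_def cumul_1 a_def g_def)
  have Y1: "lat_src_sum n 1 = g + L" by (simp add: g_def lat_gauge_def L_def)
  have rY1: "reflection n 0 (lat_src_sum n 1) = lat_src_sum n 1 + a * q / (q - 1)"
    unfolding a_def q_def by (subst reflection_0_lat_src_sum_odd[OF n]) simp_all
  consider "k = 0" | "k = 1" | "k \<noteq> 0" "k \<noteq> 1" by blast
  then have "tv * reflection n 0 (ddt n (lat n k)) = tv * (ddt n (reflection n 0 (lat n k)) :: 'k ratfun)"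
  proof cases
    case 1
    have F0: "lat_flow n 0 = lat_src_sum n 0 - L^2 - g * L"
      by (simp add: lat_flow_def alt_def L_def g_def)
    have "tv * reflection n 0 (ddt n (lat n k)) = (reflection n 0 (lat_flow n 0) :: 'k ratfun)"
      unfolding 1 by (rule r_ddt)
    also have "\<dots> = lat_src_sum n 0 - (L + X)^2 - (g + a) * (L + X)"
      using reflection_0_lat_src_sum_even[OF n, of 0, where ?'k = 'k] rL g'
      unfolding F0 by (simp add: r0 g_def g'_def L_def a_def)
    also have "\<dots> = lat_flow n 0 - X * lat_flow n 1 / (q - 1)"
    proof -
      \<comment> \<open>X times the flow of q_1 is divisible by q_1 - 1, because \<alpha>_0 = X (q_1
        - 1). This clears the second denominator brought in by the derivative of X.\<close>
      have "X * (- (g + L) + q^2 * L + q * a + g * q) = (q - 1) * (X * ((q + 1) * L + g + X * q))"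
        unfolding aX by (simp add: algebra_simps power2_eq_square)
      from this[folded Y1, folded F1] have "X * lat_flow n 1 / (q - 1) = X * ((q + 1) * L + g + X * q)"
        by (simp only: nonzero_mult_div_cancel_left[OF q])
      then show ?thesis unfolding F0 aX by (simp add: algebra_simps power2_eq_square)
    qed
    also have "\<dots> = tv * ddt n (L + X)"
    proof -
      have "par n 0 = (al n 0 :: 'k ratfun)" by (simp add: par_def)
      then have "ddt n (par n 0) = (0 :: 'k ratfun)" by (simp add: ddt_simps)
      then have "ddt n X = - (X * ddt n q / (q - 1))"
        unfolding X_def using q q_in by (simp add: ds power2_eq_square)
      moreover have "tv * ddt n q = lat_flow n 1" unfolding l1[symmetric] by (rule ddt_lat)
      then have "tv * (X * ddt n q / (q - 1)) = X * lat_flow n 1 / (q - 1)" by (simp add: mult.left_commute)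
      moreover have "X \<in> ratfield n" using q_in by (simp add: X_def)
      then have "tv * ddt n (L + X) = lat_flow n 0 + tv * ddt n X"
        by (simp add: ds L_def distrib_left ddt_lat)
      ultimately show ?thesis by (simp only: mult_minus_right add_uminus_conv_diff)
    qed
    finally show ?thesis unfolding 1 L_def[symmetric] rL .
  next
    case 2
    have "tv * reflection n 0 (ddt n (lat n k)) = (reflection n 0 (lat_flow n 1) :: 'k ratfun)"
      unfolding 2 by (rule r_ddt)
    also have "\<dots> = - (lat_src_sum n 1 + a * q / (q - 1)) + q^2 * (L + X) + q * - a + (g + a) * q"
      using rY1 rL rq g' q_in n reflection_0_par_small(1)[OF n, where ?'k = 'k]
      unfolding F1 by (simp add: r0 g_def g'_def L_def a_def)
    also have "\<dots> = lat_flow n 1"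
    proof -
      have "a * q / (q - 1) = X * q" by (simp add: X_def a_def)
      then show ?thesis unfolding F1 aX by (simp add: algebra_simps power2_eq_square)
    qed
    also have "\<dots> = tv * ddt n (reflection n 0 (lat n k))"
      unfolding 2 l1 rq by (simp add: ddt_lat flip: l1)
    finally show ?thesis .
  next
    case 3
    have "reflection n 0 (lat n k) = (lat n k :: 'k ratfun)" using k 3 by (intro fx) auto
    then show ?thesis unfolding r_ddt using gen[OF k 3] by (simp add: ddt_lat g')
  qed
  then show ?thesis by simp
qed

lemma reflection_0_ddt:
  assumes "1 \<le> n" "f \<in> ratfield n"
  shows "reflection n 0 (ddt n f) = (ddt n (reflection n 0 f) :: 'k::field_char_0 ratfun)"
proof -
  note ds = derivation_simps[OF derivation_ddt]
  have "reflection n 0 (ddt n f) = 1 * ddt n (reflection n 0 f)"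
  proof (rule commutes_ddt[OF kend_reflection_0[OF assms(1)] _ _ _ _ assms(2)])
    show "reflection n 0 (ddt n (lat n k)) = 1 * (ddt n (reflection n 0 (lat n k)) :: 'k ratfun)"
      if "- 1 \<le> k" "k \<le> 2 * int n" for k
      using reflection_0_ddt_lat[OF assms(1) that, where ?'k = 'k] by simp
    show "1 * ddt n (reflection n 0 tv) = (1 :: 'k ratfun)"
      using assms(1) by (simp add: reflection_0_simps ddt_simps)
    show "ddt n (reflection n 0 etav) = (0 :: 'k ratfun)"
      using assms(1) by (simp add: reflection_0_simps ddt_simps ds)
    show "ddt n (reflection n 0 (al n j)) = (0 :: 'k ratfun)" if "1 \<le> j" "j \<le> 2*n+1" for j
    proof -
      have "ddt n (of_int c) = (0 :: 'k ratfun)" for c by (rule derivation_of_int[OF derivation_ddt])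
      then show ?thesis using assms(1) that by (simp add: reflection_0_al ddt_simps ds)
    qed
  qed
  then show ?thesis by simp
qed

section \<open>Poisson brackets\<close>

lemma poisson_antisym: "poisson n f g = - poisson n g f"
  by (simp add: poisson_def sum_negf[symmetric] mult.commute)

lemma derivation_poisson:
  fixes f :: "'k::field_char_0 ratfun"
  assumes "f \<in> ratfield n"
  shows "derivation n (poisson n f)"
proof -
  note pd = derivation_simps[OF derivation_partial]
  have "poisson n f (g + h) = poisson n f g + poisson n f h" if "g \<in> ratfield n" "h \<in> ratfield n" for g h
    using that by (simp add: poisson_def pd algebra_simps sum.distrib sum_subtractf)
  moreover have "poisson n f (g * h) = poisson n f g * h + g * poisson n f h" if "g \<in> ratfield n" "h \<in> ratfield n" for g h
    using that by (simp add: poisson_def pd algebra_simps sum.distrib sum_subtractf sum_distrib_left)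
  moreover have "poisson n f g \<in> ratfield n" if "g \<in> ratfield n" for g
    using that assms by (simp add: poisson_def)
  moreover have "poisson n f (Const c) = 0" for c
    by (simp add: poisson_def pd)
  ultimately show ?thesis by (simp add: derivation_def)
qed

lemma derivation_poisson_left:
  fixes g :: "'k::field_char_0 ratfun"
  assumes "g \<in> ratfield n"
  shows "derivation n (\<lambda>f. poisson n f g)"
  using derivation_poisson[OF assms] unfolding derivation_def
  by (simp add: poisson_antisym[of n _ g])

lemma poisson_in [simp]: "f \<in> ratfield n \<Longrightarrow> g \<in> ratfield n \<Longrightarrow> poisson n f g \<in> ratfield n"
  by (rule derivation_in[OF derivation_poisson])

lemma poisson_coords [simp]:
  "1 \<le> i \<Longrightarrow> i \<le> n \<Longrightarrow> 1 \<le> j \<Longrightarrow> j \<le> n \<Longrightarrow> poisson n (pv i) (pv j) = (0 :: 'k::field_char_0 ratfun)"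
  "1 \<le> i \<Longrightarrow> i \<le> n + 1 \<Longrightarrow> 1 \<le> j \<Longrightarrow> j \<le> n + 1 \<Longrightarrow> poisson n (qv n i) (qv n j) = (0 :: 'k ratfun)"
  "1 \<le> i \<Longrightarrow> i \<le> n \<Longrightarrow> 1 \<le> j \<Longrightarrow> j \<le> n + 1 \<Longrightarrow> poisson n (pv i) (qv n j) = (if i = j then 1 else 0 :: 'k ratfun)"
  "1 \<le> i \<Longrightarrow> i \<le> n \<Longrightarrow> 1 \<le> j \<Longrightarrow> j \<le> n + 1 \<Longrightarrow> poisson n (qv n j) (pv i) = (if i = j then - 1 else 0 :: 'k ratfun)"
proof -
  show "1 \<le> i \<Longrightarrow> i \<le> n \<Longrightarrow> 1 \<le> j \<Longrightarrow> j \<le> n \<Longrightarrow> poisson n (pv i) (pv j) = (0 :: 'k ratfun)"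
    unfolding poisson_def by (intro sum.neutral) auto
  show "1 \<le> i \<Longrightarrow> i \<le> n + 1 \<Longrightarrow> 1 \<le> j \<Longrightarrow> j \<le> n + 1 \<Longrightarrow> poisson n (qv n i) (qv n j) = (0 :: 'k ratfun)"
    unfolding poisson_def by (intro sum.neutral) auto
  show pq: "poisson n (pv i) (qv n j) = (if i = j then 1 else 0 :: 'k ratfun)"
    if ij: "1 \<le> i" "i \<le> n" "1 \<le> j" "j \<le> n + 1" for i j
  proof -
    have "poisson n (pv i) (qv n j) = (\<Sum>l=1..n. if l = i then if i = j then 1 else 0 else 0 :: 'k ratfun)"
      unfolding poisson_def by (intro sum.cong) (use ij in auto)
    then show ?thesis using ij by (simp add: sum.delta)
  qed
  show "1 \<le> i \<Longrightarrow> i \<le> n \<Longrightarrow> 1 \<le> j \<Longrightarrow> j \<le> n + 1 \<Longrightarrow> poisson n (qv n j) (pv i) = (if i = j then - 1 else 0 :: 'k ratfun)"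
    using pq[of i j] poisson_antisym[of n "qv n j" "pv i :: 'k ratfun"] by simp
qed

definition central :: "nat \<Rightarrow> 'k::field_char_0 ratfun \<Rightarrow> bool" where
  "central n c \<longleftrightarrow> (\<forall>i\<in>{1..n}. partial_deriv n (VP i) c = 0 \<and> partial_deriv n (VQ i) c = 0)"

lemma poisson_central: "central n c \<Longrightarrow> poisson n c g = 0" "central n c \<Longrightarrow> poisson n g c = 0"
  unfolding poisson_def central_def by (auto intro!: sum.neutral)

lemma central_coords:
  "central n (tv :: 'k::field_char_0 ratfun)" "central n (etav :: 'k ratfun)" "j \<le> 2*n+1 \<Longrightarrow> central n (al n j :: 'k ratfun)"
  by (auto simp: central_def)

lemmas poisson_coords_central [simp] = poisson_central[OF central_coords(1)] poisson_central[OF central_coords(2)]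
  poisson_central[OF central_coords(3)]

text \<open>With \<open>f\<close> fixed, both sides are derivations along \<phi> in the second
  argument, so the variables decide. Antisymmetry later does the same for the first
  argument.\<close>

lemma commutes_poisson_right:
  fixes \<phi> :: "'k::field_char_0 ratfun \<Rightarrow> 'k ratfun"
  assumes \<phi>: "kend n \<phi>" and f: "f \<in> ratfield n"
    and V: "\<And>y. y \<in> vars n \<Longrightarrow> \<phi> (poisson n f (Var y)) = poisson n (\<phi> f) (\<phi> (Var y))"
    and g: "g \<in> ratfield n"
  shows "\<phi> (poisson n f g) = poisson n (\<phi> f) (\<phi> g)"
proof -
  note ph = kend_simps[OF \<phi>] and d1 = derivation_simps[OF derivation_poisson[OF f]]
    and d2 = derivation_simps[OF derivation_poisson[OF kend_in[OF \<phi> f]]]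
  show ?thesis using g
  proof (induction rule: ratfield_induct)
    case (inverse g)
    moreover have "\<phi> g \<noteq> 0" using inverse by (simp add: ph)
    ultimately show ?case
      using f by (simp add: derivation_inverse[OF derivation_poisson] ph)
  qed (use f in \<open>simp_all add: ph d1 d2 V\<close>)
qed

lemma commutes_poisson:
  fixes \<phi> :: "'k::field_char_0 ratfun \<Rightarrow> 'k ratfun"
  assumes \<phi>: "kend n \<phi>"
    and c: "central n (\<phi> tv)" "central n (\<phi> etav)" "\<And>j. 1 \<le> j \<Longrightarrow> j \<le> 2*n+1 \<Longrightarrow> central n (\<phi> (al n j))"
    and qq: "\<And>i j. 1 \<le> i \<Longrightarrow> i \<le> n \<Longrightarrow> 1 \<le> j \<Longrightarrow> j \<le> n \<Longrightarrow> poisson n (\<phi> (qv n i)) (\<phi> (qv n j)) = 0"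
    and pp: "\<And>i j. 1 \<le> i \<Longrightarrow> i \<le> n \<Longrightarrow> 1 \<le> j \<Longrightarrow> j \<le> n \<Longrightarrow> poisson n (\<phi> (pv i)) (\<phi> (pv j)) = 0"
    and pq: "\<And>i j. 1 \<le> i \<Longrightarrow> i \<le> n \<Longrightarrow> 1 \<le> j \<Longrightarrow> j \<le> n \<Longrightarrow>
      poisson n (\<phi> (pv i)) (\<phi> (qv n j)) = (if i = j then 1 else 0)"
    and f: "f \<in> ratfield n" and g: "g \<in> ratfield n"
  shows "\<phi> (poisson n f g) = poisson n (\<phi> f) (\<phi> g)"
proof -
  note ph = kend_simps[OF \<phi>] and cen = poisson_central
  have qp: "poisson n (\<phi> (qv n i)) (\<phi> (pv j)) = (if j = i then - 1 else 0)" if "1 \<le> i" "i \<le> n" "1 \<le> j" "j \<le> n" for i j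
    using pq[of j i] that poisson_antisym[of n "\<phi> (qv n i)" "\<phi> (pv j)"] by simp
  have VV: "\<phi> (poisson n (Var x) (Var y)) = poisson n (\<phi> (Var x)) (\<phi> (Var y))"
    if x: "x \<in> vars n" and y: "y \<in> vars n" for x y
  proof -
    have cc: "\<phi> (poisson n (Var x) (Var y)) = poisson n (\<phi> (Var x)) (\<phi> (Var y))"
      if "(central n (Var x :: 'k ratfun) \<and> central n (\<phi> (Var x))) \<or> (central n (Var y :: 'k ratfun) \<and> central n (\<phi> (Var y)))"
      using that by (auto simp: cen ph)
    have al': "central n (Var (VAlpha j) :: 'k ratfun) \<and> central n (\<phi> (Var (VAlpha j)))" if "1 \<le> j" "j \<le> 2*n+1" for j
      using c(3)[OF that] central_coords(3)[of j n, where ?'k = 'k] that by (simp add: al_Var)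
    show ?thesis using x
    proof (cases rule: vars_cases)
      case VT
      then show ?thesis using cc c(1) central_coords(1) by blast
    next
      case VEta
      then show ?thesis using cc c(2) central_coords(2) by blast
    next
      case (VAlpha j)
      then show ?thesis using cc al' by blast
    next
      case x: (VQ i)
      show ?thesis using y
      proof (cases rule: vars_cases)
        case VT
        then show ?thesis using cc c(1) central_coords(1) by blast
      next
        case VEta
        then show ?thesis using cc c(2) central_coords(2) by blast
      next
        case (VAlpha j)
        then show ?thesis using cc al' by blast
      next
        case (VQ j)
        then show ?thesis using x qq[of i j] by (simp add: qv_Var[symmetric] ph)
      next
        case (VP j)
        then show ?thesis using x qp[of i j] by (simp add: qv_Var[symmetric] ph)
      qed
    next
      case x: (VP i)
      show ?thesis using y
      proof (cases rule: vars_cases)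
        case VT
        then show ?thesis using cc c(1) central_coords(1) by blast
      next
        case VEta
        then show ?thesis using cc c(2) central_coords(2) by blast
      next
        case (VAlpha j)
        then show ?thesis using cc al' by blast
      next
        case (VQ j)
        then show ?thesis using x pq[of i j] by (simp add: qv_Var[symmetric] ph)
      next
        case (VP j)
        then show ?thesis using x pp[of i j] by (simp add: ph)
      qed
    qed
  qed
  have Vg: "\<phi> (poisson n (Var x) g) = poisson n (\<phi> (Var x)) (\<phi> g)" if "x \<in> vars n" "g \<in> ratfield n" for x g
    by (rule commutes_poisson_right[OF \<phi> Var_in[OF that(1)] VV[OF that(1)] that(2)])
  show ?thesis
  proof (rule commutes_poisson_right[OF \<phi> f _ g])
    fix y assume y: "y \<in> vars n"
    have "\<phi> (poisson n f (Var y)) = - \<phi> (poisson n (Var y) f)"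
      unfolding poisson_antisym[of n f] using f y by (simp add: ph Var_in)
    then show "\<phi> (poisson n f (Var y)) = poisson n (\<phi> f) (\<phi> (Var y))"
      unfolding poisson_antisym[of n "\<phi> f"] Vg[OF y f] .
  qed
qed

lemma reflection_0_poisson:
  assumes n: "1 \<le> n" and fg: "f \<in> ratfield n" "g \<in> ratfield n"
  shows "reflection n 0 (poisson n f g) = (poisson n (reflection n 0 f) (reflection n 0 g) :: 'k::field_char_0 ratfun)"
proof (rule commutes_poisson[OF kend_reflection_0[OF n] _ _ _ _ _ _ fg])
  note pd = derivation_simps[OF derivation_partial]
  define X :: "'k ratfun" where "X = al n 0 / (qv n 1 - 1)"
  have q1: "qv n 1 - 1 \<noteq> (0 :: 'k ratfun)" by (rule q1_neq_1[OF n])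
  have X_in: "X \<in> ratfield n" using n by (simp add: X_def)
  note pr = derivation_simps[OF derivation_poisson] and pl = derivation_simps[OF derivation_poisson_left]
  have pX: "poisson n (pv i) X = (if i = 1 then - al n 0 / (qv n 1 - 1)^2 else 0)" if "1 \<le> i" "i \<le> n" for i
    unfolding X_def using that n q1 by (subst derivation_divide[OF derivation_poisson]) (simp_all add: pr)
  have qX: "poisson n (qv n i) X = 0" if "1 \<le> i" "i \<le> n" for i
    unfolding X_def using that n q1 by (subst derivation_divide[OF derivation_poisson]) (simp_all add: pr)
  have XX: "poisson n X X = 0"
    unfolding poisson_def by (simp add: mult.commute)
  have Xp: "poisson n X (pv i) = (if i = 1 then al n 0 / (qv n 1 - 1)^2 else 0)" if "1 \<le> i" "i \<le> n" for i
    unfolding poisson_antisym[of n X] pX[OF that] by simp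
  have Xq: "poisson n X (qv n i) = 0" if "1 \<le> i" "i \<le> n" for i
    unfolding poisson_antisym[of n X] qX[OF that] by simp
  have rp: "reflection n 0 (pv i) = pv i - (if i = 1 then X else 0)" if "1 \<le> i" "i \<le> n" for i
    using that n by (simp add: reflection_0_simps X_def)
  show "central n (reflection n 0 tv :: 'k ratfun)" using n by (simp add: reflection_0_simps central_coords)
  show "central n (reflection n 0 etav :: 'k ratfun)" using n by (simp add: reflection_0_simps central_def pd)
  show "central n (reflection n 0 (al n j) :: 'k ratfun)" if "1 \<le> j" "j \<le> 2*n+1" for j
    using that n derivation_of_int[OF derivation_partial, where ?'k = 'k]
    by (simp add: reflection_0_al central_def pd)
  fix i j assume ij: "1 \<le> i" "i \<le> n" "1 \<le> j" "j \<le> n"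
  show "poisson n (reflection n 0 (qv n i)) (reflection n 0 (qv n j)) = (0 :: 'k ratfun)"
    using ij n by (simp add: reflection_0_simps)
  show "poisson n (reflection n 0 (pv i)) (reflection n 0 (pv j)) = (0 :: 'k ratfun)"
    unfolding rp[OF ij(1,2)] rp[OF ij(3,4)] using ij X_in by (simp add: pl pr pX Xp XX)
  show "poisson n (reflection n 0 (pv i)) (reflection n 0 (qv n j)) = (if i = j then 1 else 0 :: 'k ratfun)"
    unfolding rp[OF ij(1,2)] using ij X_in n by (simp add: reflection_0_simps pl pr Xq)
qed

text \<open>\<open>Phi n\<close> generates a scaling, with weight 1 on q_j - t and weight -1 on
  p_j.\<close>

lemma poisson_Phi:
  "1 \<le> j \<Longrightarrow> j \<le> n + 1 \<Longrightarrow> poisson n (Phi n) (qv n j) = (qv n j - tv :: 'k::field_char_0 ratfun)"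
  "1 \<le> j \<Longrightarrow> j \<le> n \<Longrightarrow> poisson n (Phi n) (pv j) = (- pv j :: 'k::field_char_0 ratfun)"
proof -
  note pl = derivation_simps[OF derivation_poisson_left]
  show "poisson n (Phi n) (qv n j) = (qv n j - tv :: 'k ratfun)" if j: "1 \<le> j" "j \<le> n + 1"
  proof -
    have "poisson n (Phi n) (qv n j) = (\<Sum>k=1..n. poisson n ((qv n k - tv) * pv k) (qv n j :: 'k ratfun))"
      using j by (simp add: Phi_def pl)
    also have "\<dots> = (\<Sum>k=1..n. if k = j then qv n j - tv else 0)"
      using j by (intro sum.cong) (auto simp: pl)
    also have "\<dots> = qv n j - tv" using j by (cases "j = n + 1") (simp_all add: qv_def)
    finally show ?thesis .
  qed
  show "poisson n (Phi n) (pv j) = (- pv j :: 'k ratfun)" if j: "1 \<le> j" "j \<le> n"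
  proof -
    have "poisson n (Phi n) (pv j) = (\<Sum>k=1..n. poisson n ((qv n k - tv) * pv k) (pv j :: 'k ratfun))"
      using j by (simp add: Phi_def pl)
    also have "\<dots> = (\<Sum>k=1..n. if k = j then - pv j else 0)"
      using j by (intro sum.cong) (auto simp: pl)
    also have "\<dots> = - pv j" using j by simp
    finally show ?thesis .
  qed
qed

text \<open>The differences d_i of the q_i and the partial sums B_j of the p_j satisfy {d_i, B_j} =
  \<delta>_{i,j}. They have weights 1 and -1 under the scaling generated by F =
  \<open>Phi n\<close>, so the contributions of F to the brackets of d_i F and B_j/F cancel.\<close>

lemma rotation_poisson:
  assumes n: "1 \<le> n" and fg: "f \<in> ratfield n" "g \<in> ratfield n"
  shows "rotation n (poisson n f g) = (poisson n (rotation n f) (rotation n g) :: 'k::field_char_0 ratfun)"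
proof (rule commutes_poisson[OF kend_rotation _ _ _ _ _ _ fg])
  note pd = derivation_simps[OF derivation_partial]
  note pr = derivation_simps[OF derivation_poisson] and pl = derivation_simps[OF derivation_poisson_left]
  define B d :: "nat \<Rightarrow> 'k ratfun" where "B i = (\<Sum>j=1..i. pv j)" and "d i = qv n (i + 1) - qv n i" for i
  define F c :: "'k ratfun" where "F = Phi n" and "c = tv - 1"
  have F: "F \<noteq> 0" "F \<in> ratfield n" and c: "c \<noteq> 0" "c \<in> ratfield n" "central n c"
    by (simp_all add: F_def c_def central_def pd)
  have B_in: "B i \<in> ratfield n" if "i \<le> n" for i using that by (simp add: B_def)
  have d_in: "d i \<in> ratfield n" if "1 \<le> i" "i \<le> n" for i using that by (simp add: d_def)
  have cc: "poisson n c f = 0" "poisson n f c = 0" for f using poisson_central[OF c(3)] .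
  have FF: "poisson n F F = 0" unfolding poisson_def by (simp add: mult.commute)
  have FB: "poisson n F (B i) = - B i" "poisson n (B i) F = B i" if "i \<le> n" for i
  proof -
    have "poisson n F (B i) = (\<Sum>j=1..i. poisson n F (pv j))" unfolding B_def using that F by (simp add: pr)
    also have "\<dots> = (\<Sum>j=1..i. - pv j)" using that by (intro sum.cong) (auto simp: F_def poisson_Phi)
    finally show "poisson n F (B i) = - B i" by (simp add: B_def sum_negf)
    then show "poisson n (B i) F = B i" using poisson_antisym[of n "B i" F] by simp
  qed
  have Fd: "poisson n F (d i) = d i" "poisson n (d i) F = - d i" if "1 \<le> i" "i \<le> n" for i
  proof -
    show "poisson n F (d i) = d i" unfolding d_def using that F
      by (subst derivation_diff[OF derivation_poisson]) (simp_all add: F_def poisson_Phi)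
    then show "poisson n (d i) F = - d i" using poisson_antisym[of n "d i" F] by simp
  qed
  have BB: "poisson n (B i) (B j) = 0" if "i \<le> n" "j \<le> n" for i j
    unfolding B_def using that by (simp add: pl pr)
  have dd: "poisson n (d i) (d j) = 0" if "1 \<le> i" "i \<le> n" "1 \<le> j" "j \<le> n" for i j
    unfolding d_def using that by (simp add: pl pr)
  have qB: "poisson n (qv n i) (B j) = (if i \<le> j then - 1 else 0)" if "1 \<le> i" "i \<le> n + 1" "j \<le> n" for i j
  proof -
    have "poisson n (qv n i) (B j) = (\<Sum>k=1..j. poisson n (qv n i) (pv k :: 'k ratfun))" unfolding B_def using that by (simp add: pr)
    also have "\<dots> = (\<Sum>k=1..j. if k = i then - 1 else 0)" using that by (intro sum.cong) auto
    also have "\<dots> = (if i \<le> j then - 1 else 0)" using that by (simp add: sum.delta)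
    finally show ?thesis .
  qed
  have dB: "poisson n (d i) (B j) = (if i = j then 1 else 0)" if "1 \<le> i" "i \<le> n" "j \<le> n" for i j
  proof -
    have "poisson n (d i) (B j) = poisson n (qv n (i + 1)) (B j) - poisson n (qv n i) (B j)"
      unfolding d_def using that B_in[of j] by (subst derivation_diff[OF derivation_poisson_left]) simp_all
    then show ?thesis using that by (simp add: qB)
  qed
  have rp: "rotation n (pv i) = d i * F / c" if "1 \<le> i" "i \<le> n" for i
    using that by (simp add: rotation_simps d_def F_def c_def)
  have rq: "rotation n (qv n i) = 1 + c * B i / F" if "1 \<le> i" "i \<le> n" for i
    using that by (simp add: qv_Var rotation_simps B_def F_def c_def)
  show "central n (rotation n tv :: 'k ratfun)" by (simp add: rotation_simps central_def pd)
  show "central n (rotation n etav :: 'k ratfun)" by (simp add: rotation_simps central_def pd)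
  show "central n (rotation n (al n j) :: 'k ratfun)" if "1 \<le> j" "j \<le> 2*n+1" for j
    using that by (simp add: al_Var rotation_simps central_coords)
  fix i j assume ij: "1 \<le> i" "i \<le> n" "1 \<le> j" "j \<le> n"
  note ins = B_in[OF ij(2)] B_in[OF ij(4)] d_in[OF ij(1,2)] d_in[OF ij(3,4)] F c(1,2)
  show "poisson n (rotation n (qv n i)) (rotation n (qv n j)) = (0 :: 'k ratfun)"
    unfolding rq[OF ij(1,2)] rq[OF ij(3,4)] using ins ij
    by (simp add: pl pr cc FF FB BB; simp add: field_simps power2_eq_square)
  show "poisson n (rotation n (pv i)) (rotation n (pv j)) = (0 :: 'k ratfun)"
    unfolding rp[OF ij(1,2)] rp[OF ij(3,4)] using ins ij
    by (simp add: pl pr cc FF Fd dd; simp add: field_simps power2_eq_square)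
  show "poisson n (rotation n (pv i)) (rotation n (qv n j)) = (if i = j then 1 else 0 :: 'k ratfun)"
    unfolding rp[OF ij(1,2)] rq[OF ij(3,4)] using ins ij
    by (simp add: pl pr cc FF Fd FB dB; simp add: field_simps power2_eq_square)
qed

section \<open>Invariance under all generators\<close>

lemma rotation_surj:
  assumes "1 \<le> n" "f \<in> ratfield n"
  obtains a where "a \<in> ratfield n" "f = rotation n a"
proof
  show "(rotation n ^^ (2*n+1)) f \<in> ratfield n"
    by (rule kend_in[OF kend_funpow[OF kend_rotation] assms(2)])
  have "(rotation n ^^ Suc (2*n+1)) f = f" using rotation_order[OF assms] by simp
  then show "f = rotation n ((rotation n ^^ (2*n+1)) f)" by simp
qed

lemma conj_refl_0: "conj_refl n 0 = reflection n 0"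
  by (simp add: conj_refl_def comp_def)

text \<open>Moving the rotation from one side of a reflection to the other raises the index by 1.
  Every argument is the image of something under the rotation, so the property passes from i to
  i+1.\<close>

lemma conj_refl_poisson:
  assumes n: "1 \<le> n" and fg: "f \<in> ratfield n" "g \<in> ratfield n"
  shows "conj_refl n i (poisson n f g) = (poisson n (conj_refl n i f) (conj_refl n i g) :: 'k::field_char_0 ratfun)"
  using fg
proof (induction i arbitrary: f g)
  case 0
  then show ?case using reflection_0_poisson[OF n] by (simp add: conj_refl_0)
next
  case (Suc i)
  obtain a where a: "a \<in> ratfield n" "f = rotation n a" using rotation_surj[OF n Suc.prems(1)] .
  obtain b where b: "b \<in> ratfield n" "g = rotation n b" using rotation_surj[OF n Suc.prems(2)] .
  note c = conj_refl_rotation[OF n, of _ i, simplified, symmetric]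
  note E = kend_in[OF kend_conj_refl[OF n]]
  show ?case
    using a b by (simp add: c rotation_poisson[OF n, symmetric] Suc.IH E)
qed

text \<open>The same induction. The rotation contributes the factor -t^2 on both sides, and it
  cancels because reflections fix t.\<close>

lemma conj_refl_ddt:
  assumes n: "1 \<le> n" and f: "f \<in> ratfield n"
  shows "conj_refl n i (ddt n f) = (ddt n (conj_refl n i f) :: 'k::field_char_0 ratfun)"
  using f
proof (induction i arbitrary: f)
  case 0
  then show ?case using reflection_0_ddt[OF n] by (simp add: conj_refl_0)
next
  case (Suc i)
  obtain a where a: "a \<in> ratfield n" "f = rotation n a" using rotation_surj[OF n Suc.prems] .
  note c = conj_refl_rotation[OF n, of _ i, simplified, symmetric]
  note E = kend_simps[OF kend_conj_refl[OF n, of "Suc i"]]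
  have t: "conj_refl n (Suc i) (tv :: 'k ratfun) = tv" by (rule conj_refl_tv[OF n])
  have "conj_refl n (Suc i) (rotation n (ddt n a)) = rotation n (ddt n (conj_refl n i a))"
    using a by (simp add: c Suc.IH)
  also have "\<dots> = - (tv ^ 2) * ddt n (rotation n (conj_refl n i a))"
    by (rule rotation_ddt[OF n kend_in[OF kend_conj_refl[OF n] a(1)]])
  also have "rotation n (conj_refl n i a) = conj_refl n (Suc i) f" using a by (simp add: c)
  finally have "conj_refl n (Suc i) (- (tv ^ 2) * ddt n f) = - (tv ^ 2) * ddt n (conj_refl n (Suc i) f)"
    using rotation_ddt[OF n a(1)] a(2) by simp
  moreover have "conj_refl n (Suc i) (- (tv ^ 2) * ddt n f) = - (tv ^ 2) * conj_refl n (Suc i) (ddt n f)"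
    using Suc.prems t by (simp add: E)
  ultimately have "tv ^ 2 * conj_refl n (Suc i) (ddt n f) = tv ^ 2 * ddt n (conj_refl n (Suc i) f)" by simp
  then show ?case by simp
qed

lemma reflection_ddt:
  assumes "1 \<le> n" "i \<le> 2*n+1" "f \<in> ratfield n"
  shows "reflection n i (ddt n f) = (ddt n (reflection n i f) :: 'k::field_char_0 ratfun)"
  using assms by (simp add: reflection_eq conj_refl_ddt)

lemma ring_iso_kend:
  assumes "kend n \<phi>" "bij_betw \<phi> (ratfield n) (ratfield n)"
  shows "\<phi> \<in> ring_iso (ratfield_ring n) (ratfield_ring n)"
  unfolding ring_iso_def using assms
  by (auto intro!: ring_hom_memI simp: ratfield_ring_def kend_simps[OF assms(1)])

lemma bij_rotation:
  assumes "1 \<le> n"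
  shows "bij_betw (rotation n) (ratfield n) (ratfield n :: 'a::field_char_0 ratfun set)"
proof -
  have "inj_on (rotation n) (ratfield n :: 'a ratfun set)" by (rule inj_onI) (rule kend_inj[OF kend_rotation])
  moreover have "ratfield n \<subseteq> rotation n ` (ratfield n :: 'a ratfun set)"
  proof
    fix f :: "'a ratfun"
    assume "f \<in> ratfield n"
    then obtain a where "a \<in> ratfield n" "f = rotation n a" by (rule rotation_surj[OF assms])
    then show "f \<in> rotation n ` ratfield n" by (intro image_eqI)
  qed
  then have "rotation n ` ratfield n = (ratfield n :: 'a ratfun set)" using kend_in[OF kend_rotation] by (intro subset_antisym) auto
  ultimately show ?thesis by (simp add: bij_betw_def)
qed

lemma reflection_in: "1 \<le> n \<Longrightarrow> i \<le> 2*n+1 \<Longrightarrow> f \<in> ratfield n \<Longrightarrow> reflection n i f \<in> ratfield n"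
  by (simp add: reflection_eq kend_in[OF kend_conj_refl])

lemma kend_reflection:
  assumes "1 \<le> n" "i \<le> 2*n+1"
  shows "kend n (reflection n i)"
  using kend_conj_refl[OF assms(1), of i] unfolding kend_def by (simp add: reflection_eq[OF assms])

lemma bij_reflection:
  assumes "1 \<le> n" "i \<le> 2*n+1"
  shows "bij_betw (reflection n i) (ratfield n) (ratfield n)"
  by (rule bij_betw_byWitness[where f' = "reflection n i"])
    (auto simp: reflection_in[OF assms] reflection_eq[OF assms] kend_in[OF kend_conj_refl[OF assms(1)]] conj_refl_twice[OF assms(1)])

lemma birational_canonical_rotation: "1 \<le> n \<Longrightarrow> birational_canonical n (rotation n)"
  unfolding birational_canonical_def
  using ring_iso_kend[OF kend_rotation bij_rotation] rotation_poisson by blast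

lemma birational_canonical_reflection:
  assumes "1 \<le> n" "i \<le> 2*n+1"
  shows "birational_canonical n (reflection n i)"
  unfolding birational_canonical_def
  using ring_iso_kend[OF kend_reflection[OF assms] bij_reflection[OF assms]]
  by (simp add: reflection_eq[OF assms] conj_refl_poisson[OF assms(1)])

section \<open>The group of symmetries\<close>

definition symmetry :: "nat \<Rightarrow> weyl_gen \<Rightarrow> 'k::field_char_0 ratfun \<Rightarrow> 'k ratfun" where
  "symmetry n g = (case g of Rot \<Rightarrow> rotation n | Refl i \<Rightarrow> reflection n i)"

lemma symmetry_simps [simp]: "symmetry n Rot = rotation n" "symmetry n (Refl i) = reflection n i"
  by (simp_all add: symmetry_def)

lemma weyl_gens_cases:
  assumes "g \<in> weyl_gens n"
  obtains "g = Rot" | i where "g = Refl i" "i \<le> 2*n+1"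
  using assms by (auto simp: weyl_gens_def)

section \<open>Action on the partial sums of the parameters\<close>

lemma cumul_pred: "cumul n (k - 1) = (cumul n k - par n (k - 1) :: 'k::field_char_0 ratfun)"
proof -
  have "cumul n (k - 1 + 1) = (cumul n (k - 1) + par n (k - 1) :: 'k ratfun)" by (rule cumul_step)
  then show ?thesis by simp
qed

text \<open>The normalization at 0 is not preserved by the permutation, so only differences of
  partial sums are permuted exactly.\<close>

lemma kend_cumul_diff:
  fixes \<phi> :: "'k::field_char_0 ratfun \<Rightarrow> 'k ratfun"
  assumes \<phi>: "kend n \<phi>" and \<sigma>: "\<And>k. \<phi> (par n k) = cumul n (\<sigma> (k + 1)) - cumul n (\<sigma> k)"
  shows "\<phi> (cumul n a - cumul n b) = cumul n (\<sigma> a) - cumul n (\<sigma> b)"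
proof -
  note ph = kend_simps[OF \<phi>]
  have "\<phi> (cumul n k) = cumul n (\<sigma> k) - cumul n (\<sigma> 0)" for k
  proof (induction k rule: int_induct[where k = 0])
    case base
    then show ?case by (simp add: ph)
  next
    case (step1 k)
    then show ?case by (simp add: ph cumul_step \<sigma>)
  next
    case (step2 k)
    then show ?case by (simp add: ph cumul_pred \<sigma>)
  qed
  then show ?thesis by (simp add: ph)
qed

lemma par_cong: "per n dvd k - l \<Longrightarrow> par n k = (par n l :: 'k::field_char_0 ratfun)"
  unfolding par_def by (simp only: mod_eq_dvd_iff[symmetric])

text \<open>A parameter is the difference of two consecutive partial sums, as a simple root is of
  two unit vectors. The action through the Cartan matrix is then a transposition of neighbours,
  repeated periodically.\<close>

lemma refl_par_swap:
  assumes n: "1 \<le> n"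
  shows "refl_par (per n) i (par n) k =
    (cumul n (swap_at (per n) i (k + 1)) - cumul n (swap_at (per n) i k) :: 'k::field_char_0 ratfun)"
proof -
  have N: "4 \<le> per n" using n by simp
  note small = not_dvd_small[OF N] and shift = dvd_shift[OF N]
  have two: "cumul n (k + 2) = (cumul n k + par n k + par n (k + 1) :: 'k ratfun)"
  proof -
    have "cumul n (k + 1 + 1) = (cumul n k + par n k + par n (k + 1) :: 'k ratfun)" by (simp only: cumul_step)
    then show ?thesis by (simp add: add.assoc)
  qed
  have one: "cumul n (1 + k) = (cumul n k + par n k :: 'k ratfun)" using cumul_step[of n k] by (simp only: add.commute)
  have e: "k + 1 - (i + 1) = k - i" "k - (i + 1) = k - i - 1" by simp_all
  consider "per n dvd k - i" | "per n dvd k - i - 1" | "per n dvd k - i + 1"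
    | "\<not> per n dvd k - i" "\<not> per n dvd k - i - 1" "\<not> per n dvd k - i + 1" by blast
  then show ?thesis
  proof cases
    case 1
    then have "\<not> per n dvd k + 1 - i" "\<not> per n dvd k + - 1 - i" using small by (simp_all only: shift) simp_all
    then show ?thesis using 1 par_cong[of n k i, where ?'k = 'k]
      by (simp add: refl_par_def coupling_def swap_at_def e cumul_step)
  next
    case 2
    then have d: "per n dvd k - (i + 1)" by (simp add: e)
    have "\<not> per n dvd k - i" "\<not> per n dvd k + 1 - i"
      using shift[OF d, of 1] shift[OF d, of 2] small by (simp_all add: algebra_simps)
    moreover have "par n (k - 1) = (par n i :: 'k ratfun)" using d by (intro par_cong) (simp add: algebra_simps)
    ultimately show ?thesis using 2
      by (simp add: refl_par_def coupling_def swap_at_def e cumul_step cumul_pred one algebra_simps)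
  next
    case 3
    then have d: "per n dvd k + 1 - i" by (simp add: algebra_simps)
    have "\<not> per n dvd k - i" "\<not> per n dvd k - i - 1"
      using shift[OF d, of "- 1"] shift[OF d, of "- 2"] small by (simp_all add: algebra_simps)
    moreover have "par n (k + 1) = (par n i :: 'k ratfun)" using d by (intro par_cong) simp
    ultimately show ?thesis using 3 d two[unfolded add.commute[of k 2]]
      by (simp add: refl_par_def coupling_def swap_at_def e cumul_step)
  next
    case 4
    moreover have "\<not> per n dvd k + 1 - i" using 4(3) by (simp only: diff_add_eq not_False_eq_True)
    ultimately show ?thesis
      by (simp add: refl_par_def coupling_def swap_at_def e cumul_step)
  qed
qed

text \<open>The uniform specialization to 1/(2n+2) is compatible with the eliminated \<alpha>_0 and
  makes the partial sums linear in the index.\<close>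

lemma par_homogeneous: "local_subst (\<lambda>_. 1 / of_int (per n)) (par n k) (1 / of_int (per n) :: 'k::field_char_0 ratfun)"
proof -
  let ?\<sigma> = "\<lambda>_. 1 / of_int (per n) :: 'k ratfun"
  have N: "(of_int (per n) :: 'k ratfun) \<noteq> 0" unfolding of_int_ratfun_eq_0_iff by simp
  have "local_subst ?\<sigma> (1 - (\<Sum>k=1..2*n+1. Var (VAlpha k))) (1 - (\<Sum>k=1..2*n+1. 1 / of_int (per n)))"
    by (intro local_subst_diff local_subst_1 local_subst_sum local_subst_Var' HOL.refl)
  moreover have "1 - (\<Sum>k=1..2*n+1. 1 / of_int (per n) :: 'k ratfun) = 1 / of_int (per n)"
    using N by (simp add: field_simps del: sum.cl_ivl_Suc)
  ultimately show ?thesis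
    by (simp add: par_def al_def local_subst_Var' del: sum.cl_ivl_Suc)
qed

lemma cumul_homogeneous: "local_subst (\<lambda>_. 1 / of_int (per n)) (cumul n k) (of_int k / of_int (per n) :: 'k::field_char_0 ratfun)"
proof (induction k rule: int_induct[where k = 0])
  case base
  show ?case using local_subst_Const[of _ "0 :: 'k"] by (simp add: cumul_0)
next
  case (step1 k)
  have "of_int (k + 1) / of_int (per n) = of_int k / of_int (per n) + (1 / of_int (per n) :: 'k ratfun)"
    by (simp only: of_int_add of_int_1 add_divide_distrib)
  then show ?case unfolding cumul_step using local_subst_add[OF step1(2) par_homogeneous] by (simp only:)
next
  case (step2 k)
  have "of_int (k - 1) / of_int (per n) = of_int k / of_int (per n) - (1 / of_int (per n) :: 'k ratfun)"
    by (simp only: of_int_diff of_int_1 diff_divide_distrib)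
  then show ?case unfolding cumul_pred using local_subst_diff[OF step2(2) par_homogeneous] by (simp only:)
qed

text \<open>The uniform specialization shows that the map is a shift. For the second claim,
  comparing indices 0 and 1 gives an equality of \<alpha>_0 with the parameter at \<sigma>(0);
  setting one \<alpha>_r to 1 and all other variables to 0 refutes it unless the shift is a multiple
  of the period.\<close>

lemma cumul_diff_eq:
  assumes eq: "\<And>a b. cumul n (\<sigma> a) - cumul n (\<sigma> b) = (cumul n a - cumul n b :: 'k::field_char_0 ratfun)"
  shows "\<sigma> = (\<lambda>k. k + \<sigma> 0)" "per n dvd \<sigma> 0"
proof -
  have N: "(of_int (per n) :: 'k ratfun) \<noteq> 0" unfolding of_int_ratfun_eq_0_iff by simp
  show *: "\<sigma> = (\<lambda>k. k + \<sigma> 0)"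
  proof
    fix k
    let ?c = "\<lambda>k. of_int k / of_int (per n) :: 'k ratfun"
    have "local_subst (\<lambda>_. 1 / of_int (per n)) (cumul n (\<sigma> k) - cumul n (\<sigma> 0) - (cumul n k - cumul n 0))
      ((?c (\<sigma> k) - ?c (\<sigma> 0)) - (?c k - ?c 0))"
      by (intro local_subst_diff cumul_homogeneous)
    then have "(?c (\<sigma> k) - ?c (\<sigma> 0)) - (?c k - ?c 0) = 0" unfolding eq diff_self by (rule local_subst_0)
    then have "of_int (\<sigma> k - \<sigma> 0 - k) = (0 :: 'k ratfun)"
      using N by (simp add: diff_divide_distrib[symmetric])
    then show "\<sigma> k = k + \<sigma> 0" unfolding of_int_ratfun_eq_0_iff by simp
  qed
  show "per n dvd \<sigma> 0"
  proof (rule ccontr)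
    assume d: "\<not> per n dvd \<sigma> 0"
    define r where "r = nat (\<sigma> 0 mod per n)"
    have r: "\<sigma> 0 mod per n = int r" "r \<le> 2*n+1" by (simp_all only: r_def nat_mod_per) simp
    then have r0: "r \<noteq> 0" using d by (auto simp: dvd_eq_mod_eq_0)
    let ?\<sigma> = "\<lambda>x. if x = VAlpha r then 1 else 0 :: 'k ratfun"
    have "\<sigma> 1 = \<sigma> 0 + 1" by (subst *) simp
    then have "par n (\<sigma> 0) = (par n 0 :: 'k ratfun)"
      using eq[of 1 0] by (simp add: cumul_step cumul_1)
    then have "Var (VAlpha r) = 1 - (\<Sum>k=1..2*n+1. Var (VAlpha k) :: 'k ratfun)"
      using r r0 by (simp add: par_def al_def del: sum.cl_ivl_Suc)
    then have "Var (VAlpha r) - (1 - (\<Sum>k=1..2*n+1. Var (VAlpha k) :: 'k ratfun)) = 0" by (simp only: diff_self)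
    moreover have "local_subst ?\<sigma> (Var (VAlpha r) - (1 - (\<Sum>k=1..2*n+1. Var (VAlpha k))))
        (?\<sigma> (VAlpha r) - (1 - (\<Sum>k=1..2*n+1. ?\<sigma> (VAlpha k))))"
      by (intro local_subst_diff local_subst_sum local_subst_1 local_subst_Var)
    ultimately have "?\<sigma> (VAlpha r) - (1 - (\<Sum>k=1..2*n+1. ?\<sigma> (VAlpha k))) = 0"
      by (simp only: local_subst_0)
    then show False using r r0 by (simp del: sum.cl_ivl_Suc)
  qed
qed

context
  fixes n :: nat
  assumes n: "1 \<le> n"
begin

section \<open>Evaluation of words in the group of bijections of the field\<close>

abbreviation "KG \<equiv> BijGroup (ratfield n :: 'k::field_char_0 ratfun set)"

lemma symmetry_Bij:
  assumes "g \<in> weyl_gens n"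
  shows "(symmetry n g :: 'k::field_char_0 ratfun \<Rightarrow> 'k ratfun) \<in> Bij (ratfield n)"
  using assms
proof (cases rule: weyl_gens_cases)
  case 1
  then show ?thesis using bij_rotation[OF n] by (simp add: Bij_def) (simp add: rotation_def ratfun_subst_def)
next
  case (2 i)
  then show ?thesis using bij_reflection[OF n 2(2)] by (simp add: Bij_def) (simp add: reflection_def ratfun_subst_def)
qed

lemma symmetry_gens: "symmetry n ` weyl_gens n \<subseteq> carrier (KG :: ('k::field_char_0 ratfun \<Rightarrow> 'k ratfun) monoid)"
  using symmetry_Bij by (auto simp: BijGroup_def)

lemmas word_eval_symmetry_closed = group.word_eval_closed[OF group_BijGroup symmetry_gens]

lemma word_eval_Bij:
  "w \<in> words (weyl_gens n) \<Longrightarrow> word_eval KG (symmetry n) w \<in> Bij (ratfield n)"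
  using word_eval_symmetry_closed[of w] by (simp add: BijGroup_def)

lemma mult_KG: "f \<in> Bij (ratfield n) \<Longrightarrow> g \<in> Bij (ratfield n) \<Longrightarrow> x \<in> ratfield n \<Longrightarrow> (f \<otimes>\<^bsub>KG\<^esub> g) x = f (g x)"
  by (simp add: BijGroup_def compose_def)

lemma one_KG: "x \<in> ratfield n \<Longrightarrow> \<one>\<^bsub>KG\<^esub> x = x"
  by (simp add: BijGroup_def)

lemma word_eval_symmetry_Cons:
  fixes f :: "'k::field_char_0 ratfun"
  assumes "g \<in> weyl_gens n" "w \<in> words (weyl_gens n)" "f \<in> ratfield n"
  shows "word_eval KG (symmetry n) ((g, True) # w) f = symmetry n g (word_eval KG (symmetry n) w f)"
  using assms by (simp add: mult_KG symmetry_Bij word_eval_Bij)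

lemma word_eval_symmetry_eqI:
  assumes "u \<in> words (weyl_gens n)" "v \<in> words (weyl_gens n)"
    "\<And>f. f \<in> ratfield n \<Longrightarrow> word_eval KG (symmetry n) u f = (word_eval KG (symmetry n) v f :: 'k::field_char_0 ratfun)"
  shows "word_eval KG (symmetry n) u = (word_eval KG (symmetry n) v :: 'k ratfun \<Rightarrow> 'k ratfun)"
  using word_eval_Bij[OF assms(1)] word_eval_Bij[OF assms(2)] assms(3)
  by (intro extensionalityI[where A = "ratfield n"]) (auto simp: Bij_def)

lemma rotation_inv:
  fixes g :: "'k::field_char_0 ratfun"
  assumes "g \<in> ratfield n"
  shows "(inv\<^bsub>KG\<^esub> rotation n) (rotation n g) = g"
proof -
  interpret group "KG :: ('k ratfun \<Rightarrow> 'k ratfun) monoid" by (rule group_BijGroup)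
  have r: "rotation n \<in> Bij (ratfield n :: 'k ratfun set)" using symmetry_Bij[of Rot, where ?'k = 'k] by (simp add: weyl_gens_def)
  then have c: "rotation n \<in> carrier (KG :: ('k ratfun \<Rightarrow> 'k ratfun) monoid)" by (simp add: BijGroup_def)
  then have "inv\<^bsub>KG\<^esub> rotation n \<in> Bij (ratfield n :: 'k ratfun set)" using inv_closed by (simp add: BijGroup_def)
  from mult_KG[OF this r assms] show ?thesis using c assms by (simp add: one_KG)
qed

lemma reflection_inv:
  assumes "i \<le> 2*n+1"
  shows "inv\<^bsub>KG\<^esub> reflection n i = (reflection n i :: 'k::field_char_0 ratfun \<Rightarrow> 'k ratfun)"
proof -
  interpret group "KG :: ('k ratfun \<Rightarrow> 'k ratfun) monoid" by (rule group_BijGroup)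
  let ?r = "reflection n i :: 'k ratfun \<Rightarrow> 'k ratfun"
  have r: "?r \<in> Bij (ratfield n)"
    using symmetry_Bij[of "Refl i", where ?'k = 'k] assms by (simp add: weyl_gens_def)
  have c: "?r \<in> carrier KG" using r by (simp add: BijGroup_def)
  have "?r \<otimes>\<^bsub>KG\<^esub> ?r = \<one>\<^bsub>KG\<^esub>"
  proof (rule extensionalityI[where A = "ratfield n"])
    show "?r \<otimes>\<^bsub>KG\<^esub> ?r \<in> extensional (ratfield n)" "\<one>\<^bsub>KG\<^esub> \<in> extensional (ratfield n)"
      using r by (simp_all add: BijGroup_def)
    fix f :: "'k ratfun" assume "f \<in> ratfield n"
    then show "(?r \<otimes>\<^bsub>KG\<^esub> ?r) f = \<one>\<^bsub>KG\<^esub> f"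
      using reflection_in[OF n assms, of f] reflection_eq[OF n assms, where ?'a = 'k] conj_refl_twice[OF n, where ?'k = 'k]
      by (simp add: mult_KG[OF r r] one_KG)
  qed
  then show ?thesis using inv_equality[OF _ c c] by simp
qed

text \<open>Each letter sends differences of partial sums to such differences, so a further letter
  on the left only moves the indices. Automorphisms and permutations thus compose in the same
  order.\<close>

lemma word_eval_cumul_diff:
  assumes "w \<in> words (weyl_gens n)"
  shows "word_eval KG (symmetry n) w (cumul n a - cumul n b) =
    (cumul n (word_perm n w a) - cumul n (word_perm n w b) :: 'k::field_char_0 ratfun)"
  using assms
proof (induction w)
  case Nil
  then show ?case by (simp add: one_KG)
next
  case (Cons l w)
  obtain g e where l: "l = (g, e)" by fastforce
  interpret group "KG :: ('k ratfun \<Rightarrow> 'k ratfun) monoid" by (rule group_BijGroup)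
  have g: "g \<in> weyl_gens n" and w: "w \<in> words (weyl_gens n)" using Cons.prems by (simp_all add: l)
  define \<phi> :: "'k ratfun \<Rightarrow> 'k ratfun" where
    "\<phi> = (if e then symmetry n g else inv\<^bsub>KG\<^esub> symmetry n g)"
  have "\<phi> \<in> carrier KG" using g symmetry_gens by (auto simp: \<phi>_def)
  then have \<phi>: "\<phi> \<in> Bij (ratfield n)" by (simp add: BijGroup_def)
  have "\<phi> (cumul n a - cumul n b) = cumul n (letter_perm n l a) - cumul n (letter_perm n l b)" for a b
    using g
  proof (cases rule: weyl_gens_cases)
    case 1
    have "rotation n (par n k) = (cumul n (k + 1 + 1) - cumul n (k + 1) :: 'k ratfun)" for k
      unfolding rotation_par by (simp only: cumul_step) simp
    from kend_cumul_diff[OF kend_rotation this]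
    have rot: "rotation n (cumul n a - cumul n b) = (cumul n (a + 1) - cumul n (b + 1) :: 'k ratfun)" for a b .
    show ?thesis using rot rotation_inv[of "cumul n (a - 1) - cumul n (b - 1) :: 'k ratfun"]
      by (cases e) (simp_all add: \<phi>_def 1 l)
  next
    case (2 i)
    have "\<phi> = reflection n i" using 2 reflection_inv[where ?'k = 'k] by (simp add: \<phi>_def)
    moreover have "kend n (reflection n i :: 'k ratfun \<Rightarrow> 'k ratfun)" by (rule kend_reflection[OF n 2(2)])
    moreover have "reflection n i (par n k) = cumul n (swap_at (per n) (int i) (k + 1)) - (cumul n (swap_at (per n) (int i) k) :: 'k ratfun)" for k
      unfolding refl_par_swap[OF n, symmetric] using conj_refl_par[OF n] by (simp add: reflection_eq[OF n 2(2)])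
    ultimately show ?thesis using kend_cumul_diff[of n \<phi> "swap_at (per n) (int i)"] by (simp add: l 2)
  qed
  moreover have "word_eval KG (symmetry n) (l # w) (cumul n a - cumul n b) = \<phi> (word_eval KG (symmetry n) w (cumul n a - cumul n b))"
    using \<phi> w by (simp add: l \<phi>_def mult_KG word_eval_Bij)
  ultimately show ?case using Cons.IH[OF w] by simp
qed

lemma word_eval_faithful:
  assumes "w \<in> words (weyl_gens n)"
    and "word_eval KG (symmetry n) w = (\<one>\<^bsub>KG\<^esub> :: 'k::field_char_0 ratfun \<Rightarrow> 'k ratfun)"
  shows "wcong n w []"
proof -
  have "cumul n (word_perm n w a) - cumul n (word_perm n w b) = (cumul n a - cumul n b :: 'k ratfun)" for a b
    using word_eval_cumul_diff[OF assms(1), of a b, where ?'k = 'k] assms(2) by (simp add: one_KG)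
  from cumul_diff_eq[of n "word_perm n w", OF this] show ?thesis
    by (rule word_perm_trivial[OF n assms(1)])
qed

lemma word_eval_rot_power:
  assumes "f \<in> ratfield n"
  shows "concat (replicate m pi_word) \<in> words (weyl_gens n) \<and>
    word_eval KG (symmetry n) (concat (replicate m pi_word)) f = ((rotation n ^^ m) f :: 'k::field_char_0 ratfun)"
proof (induction m)
  case 0
  then show ?case using assms by (simp add: one_KG)
next
  case (Suc m)
  then show ?case using assms word_eval_symmetry_Cons[of Rot "concat (replicate m pi_word)" f]
    by (simp add: weyl_gens_def del: word_eval_simps)
qed

lemma reflection_coxeter:
  fixes f :: "'k::field_char_0 ratfun"
  assumes ij: "i \<le> 2*n+1" "j \<le> 2*n+1" "i \<noteq> j" and f: "f \<in> ratfield n"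
  defines "r \<equiv> \<lambda>f. reflection n i (reflection n j f)"
  shows "nat (2 - cartan n i j) = 2 \<Longrightarrow> r (r f) = f" "nat (2 - cartan n i j) = 3 \<Longrightarrow> r (r (r f)) = f"
proof -
  note E = kend_in[OF kend_conj_refl[OF n]] and eq = reflection_eq[OF n ij(1)] reflection_eq[OF n ij(2)]
    and tw = conj_refl_twice[OF n, where ?'k = 'k]
  show "r (r f) = f" if "nat (2 - cartan n i j) = 2"
  proof -
    have "cartan n i j = 0" "cartan n j i = 0" using that ij(3) by (auto simp: cartan_def split: if_splits)
    then have "coupling (per n) (int i - int j) = 0" "coupling (per n) (int j - int i) = 0"
      using coupling_cartan[OF n] ij by simp_all
    from conj_refl_commute[OF n this, of "conj_refl n i (conj_refl n j f)"] show ?thesis using f by (simp add: r_def eq E tw)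
  qed
  have braid: "conj_refl n a (conj_refl n b (conj_refl n a g)) = conj_refl n b (conj_refl n a (conj_refl n b g))"
    if "b = a + 1 \<or> (a = 2*n+1 \<and> b = 0)" "g \<in> ratfield n" for a b and g :: "'k ratfun"
    using that(1)
  proof
    assume "b = a + 1"
    then show ?thesis using conj_refl_braid[OF n that(2)] by simp
  next
    \<comment> \<open>The braid relation for 2n+1 and 2n+2, with index 2n+2 identified with
      0.\<close>
    assume ab: "a = 2*n+1 \<and> b = 0"
    show ?thesis using conj_refl_braid[OF n that(2), of "2*n+1"] conj_refl_period[OF n, where ?'k = 'k] that(2) ab
      by (simp add: E)
  qed
  show "r (r (r f)) = f" if "nat (2 - cartan n i j) = 3"
  proof -
    have "j = i + 1 \<or> (i = 2*n+1 \<and> j = 0) \<or> i = j + 1 \<or> (j = 2*n+1 \<and> i = 0)"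
      using that ij(3) by (auto simp: cartan_def split: if_splits)
    then have "conj_refl n i (conj_refl n j (conj_refl n i g)) = conj_refl n j (conj_refl n i (conj_refl n j g))"
      if "g \<in> ratfield n" for g :: "'k ratfun" using braid[of j i g] braid[of i j g] that by argo
    from this[of "conj_refl n j (conj_refl n i (conj_refl n j f))"] show ?thesis using f
      by (simp add: r_def eq E tw)
  qed
qed

lemma symmetry_relations:
  assumes "(a, b) \<in> weyl_rels n"
  shows "a \<in> words (weyl_gens n) \<and> b \<in> words (weyl_gens n) \<and>
    word_eval KG (symmetry n) a = (word_eval KG (symmetry n) b :: 'k::field_char_0 ratfun \<Rightarrow> 'k ratfun)"
proof -
  have "a \<in> words (weyl_gens n) \<and> b \<in> words (weyl_gens n) \<and>
    (\<forall>f\<in>ratfield n. word_eval KG (symmetry n) a f = (word_eval KG (symmetry n) b f :: 'k ratfun))"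
  proof -
    have g: "Rot \<in> weyl_gens n" "\<And>i. Refl i \<in> weyl_gens n \<longleftrightarrow> i \<le> 2*n+1" by (auto simp: weyl_gens_def)
    note ev = word_eval_symmetry_Cons word_eval_simps(1) one_KG g
    note E = kend_in[OF kend_conj_refl[OF n]] and E' = kend_in[OF kend_rotation]
    consider (sq) i where "i \<le> 2*n+1" "a = s_word i @ s_word i" "b = []"
      | (cox) i j where "i \<le> 2*n+1" "j \<le> 2*n+1" "i \<noteq> j"
          "a = concat (replicate (nat (2 - cartan n i j)) (s_word i @ s_word j))" "b = []"
      | (ord) "a = concat (replicate (2*n+2) pi_word)" "b = []"
      | (rot) i where "i \<le> 2*n" "a = pi_word @ s_word i" "b = s_word (i+1) @ pi_word"
      | (rot') "a = pi_word @ s_word (2*n+1)" "b = s_word 0 @ pi_word"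
      using assms by (auto simp: weyl_rels_def)
    then show ?thesis
    proof cases
      case sq
      then show ?thesis by (simp add: ev reflection_eq[OF n] E conj_refl_twice[OF n] del: word_eval_simps(2))
    next
      case cox
      have "nat (2 - cartan n i j) = 2 \<or> nat (2 - cartan n i j) = 3" using cox(3) by (simp add: cartan_def)
      then show ?thesis
      proof
        assume m: "nat (2 - cartan n i j) = 2"
        have "a = [(Refl i, True), (Refl j, True), (Refl i, True), (Refl j, True)]"
          unfolding cox(4) m by (simp add: numeral_2_eq_2)
        then show ?thesis using cox(1,2,5) reflection_coxeter(1)[OF cox(1-3) _ m, where ?'k = 'k]
          by (simp add: ev del: word_eval_simps(2))
      next
        assume m: "nat (2 - cartan n i j) = 3"
        have "a = [(Refl i, True), (Refl j, True), (Refl i, True), (Refl j, True), (Refl i, True), (Refl j, True)]"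
          unfolding cox(4) m by (simp add: numeral_3_eq_3)
        then show ?thesis using cox(1,2,5) reflection_coxeter(2)[OF cox(1-3) _ m, where ?'k = 'k]
          by (simp add: ev del: word_eval_simps(2))
      qed
    next
      case ord
      have "a \<in> words (weyl_gens n)" using word_eval_rot_power[of "0 :: 'k ratfun" "2*n+2"] ord(1) by simp
      moreover have "word_eval KG (symmetry n) a f = (word_eval KG (symmetry n) b f :: 'k ratfun)" if "f \<in> ratfield n" for f
        using word_eval_rot_power[OF that, of "2*n+2"] rotation_order[OF n that] that unfolding ord
        by (simp add: one_KG del: replicate.simps replicate_Suc funpow.simps)
      ultimately show ?thesis using ord(2) by simp
    next
      case rot
      have c: "rotation n (conj_refl n i f) = conj_refl n (i + 1) (rotation n f)" if "f \<in> ratfield n" for f :: "'k ratfun"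
        by (rule conj_refl_rotation[OF n that])
      show ?thesis using rot c
        by (simp add: ev reflection_eq[OF n] E E' del: word_eval_simps(2))
    next
      case rot'
      have c: "rotation n (conj_refl n (2*n+1) f) = conj_refl n 0 (rotation n f)" if "f \<in> ratfield n" for f :: "'k ratfun"
        using conj_refl_rotation[OF n that, of "2*n+1"] conj_refl_period[OF n kend_in[OF kend_rotation that]] by simp
      show ?thesis using rot' c
        by (simp add: ev reflection_eq[OF n] E E' del: word_eval_simps(2))
    qed
  qed
  then show ?thesis using word_eval_symmetry_eqI[of a b] by blast
qed

lemma symmetry_group_iso:
  "(symmetry_group n :: ('k::field_char_0 ratfun \<Rightarrow> 'k ratfun) monoid) \<cong> ext_affine_weyl n"
proof -
  have "symmetry n ` weyl_gens n = insert (rotation n) (reflection n ` {0..2*n+1} :: ('k ratfun \<Rightarrow> 'k ratfun) set)"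
    by (simp add: weyl_gens_def image_image del: atLeastAtMost_iff)
  then have "symmetry_group n = subgroup_generated KG (symmetry n ` weyl_gens n :: ('k ratfun \<Rightarrow> 'k ratfun) set)"
    by (simp only: symmetry_group_def)
  moreover have "subgroup_generated KG (symmetry n ` weyl_gens n :: ('k ratfun \<Rightarrow> 'k ratfun) set) \<cong>
      presented_group (weyl_gens n) (weyl_rels n)"
    by (rule group.presented_group_iso[OF group_BijGroup symmetry_gens symmetry_relations word_eval_faithful])
  ultimately show ?thesis by (simp only: ext_affine_weyl_def)
qed

end

theorem theorem4p2:
  fixes n :: nat
  assumes "1 \<le> n"
  shows
    "(\<forall>i\<le>2*n+1.
        birational_canonical n (reflection n i :: 'k::field_char_0 ratfun \<Rightarrow> 'k ratfun) \<and>
        (\<forall>f\<in>(ratfield n :: 'k ratfun set). reflection n i (ddt n f) = ddt n (reflection n i f))) \<and>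
     birational_canonical n (rotation n :: 'k ratfun \<Rightarrow> 'k ratfun) \<and>
     (\<forall>f\<in>(ratfield n :: 'k ratfun set). rotation n (ddt n f) = - (tv^2) * ddt n (rotation n f)) \<and>
     (symmetry_group n :: ('k ratfun \<Rightarrow> 'k ratfun) monoid) \<cong> ext_affine_weyl n"
  using birational_canonical_reflection[OF assms] reflection_ddt[OF assms]
    birational_canonical_rotation[OF assms] rotation_ddt[OF assms] symmetry_group_iso[OF assms]
  by blast

end
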